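(* Let $\mathbb V$ be a VOA, let $\mathfrak X=(\pi:\mathcal C\to\mathcal B)$ be a family of compact Riemann surfaces, and let $W\subset\mathcal C$ be open and such that there are a function $\eta\in\mathcal O(W)$ injective on each fiber of $W$ over $\mathcal B$ and holomorphic coordinates $\tau_\bullet=(\tau_1,\dots,\tau_m)$ of $\pi(W)$ (write $\tau_\bullet$ also for $\tau_\bullet\circ\pi$). Let $\mathfrak x$ be a holomorphic vector field on $W$ of the form $$\mathfrak x=h(\eta,\tau_\bullet)\partial_\eta+\sum_{j=1}^m g_j(\tau_\bullet)\partial_{\tau_j}$$ with $h$ holomorphic on $(\eta,\tau_\bullet)(W)$ and $g_1,\dots,g_m$ holomorphic on $\tau_\bullet(\pi(W))$. Let $n\in\mathbb N$ and let $v\in\mathscr V_{\mathfrak X}^{\le n}(W)$ be equal to $u\in\mathbb V^{\le n}\otimes_{\mathbb C}\mathcal O(W)$ in the $\eta$-coordinate, i.e. $v=\mathcal U_\varrho(\eta)^{-1}u$. Then, in the $\eta$-coordinate, the Lie derivative $\mathcal L_{\mathfrak x}v$ equals $$h(\eta,\tau_\bullet)\partial_\eta u+\sum_{j=1}^m g_j(\tau_\bullet)\partial_{\tau_j}u-\sum_{k\ge1}\frac1{k!}\,\partial_\eta^kh(\eta,\tau_\bullet)\,L_{k-1}u .$$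
   Context: VOA: a vertex operator algebra $\mathbb V=\bigoplus_{n\in\mathbb N}\mathbb V(n)$ over $\mathbb C$ with $\dim\mathbb V(n)<\infty$, $\dim\mathbb V(0)=1$, conformal vector $\mathbf c$, Virasoro operators $L_n=Y(\mathbf c)_{n+1}$, and $L_0=n$ on $\mathbb V(n)$; $\mathbb V^{\le n}=\bigoplus_{k\le n}\mathbb V(k)$. Family of compact Riemann surfaces: a proper surjective holomorphic submersion $\pi:\mathcal C\to\mathcal B$ of complex manifolds whose fibers are compact Riemann surfaces. Change of coordinates: $\mathbb G$ is the group of germs at $0\in\mathbb C$ of holomorphic $\rho$ with $\rho(0)=0$, $\rho'(0)\ne0$. Writing $\rho(z)=\rho'(0)\exp(\sum_{n>0}c_nz^{n+1}\partial_z)z$ with unique $c_n\in\mathbb C$, put $\mathcal U(\rho)=\rho'(0)^{L_0}\exp(\sum_{n>0}c_nL_n)$ on $\mathbb V$. Sheaf of VOAs: $\mathscr V^{\le n}_{\mathfrak X}$ is the holomorphic vector bundle on $\mathcal C$ with a trivialization $\mathcal U_\varrho(\eta):\mathscr V^{\le n}_{\mathfrak X}|_U\xrightarrow{\simeq}\mathbb V^{\le n}\otimes_{\mathbb C}\mathcal O_U$ for every open $U\subset\mathcal C$ and every $\eta\in\mathcal O(U)$ injective on each fiber of $U$, with transition functions $\mathcal U_\varrho(\eta)\mathcal U_\varrho(\mu)^{-1}=\mathcal U(\varrho(\eta|\mu))$, where $\varrho(\eta|\mu)_p\in\mathbb G$ is $z\mapsto\eta\circ(\mu,\pi)^{-1}(z+\mu(p),\pi(p))-\eta(p)$.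 Transport: a biholomorphism $\varphi:U\to V$ between open subsets of $\mathcal C$ is fiber-preserving if $\varphi(U\cap\pi^{-1}(\pi(p)))=V\cap\pi^{-1}(\pi(\varphi(p)))$ for each $p\in U$. Let $\varphi_*f=f\circ\varphi^{-1}$. There is an isomorphism $\mathcal V_\varrho(\varphi):\mathscr V^{\le n}_{\mathfrak X}|_U\to\mathscr V^{\le n}_{\mathfrak X}|_V$ determined, independently of $\eta$, by $\mathcal U_\varrho(\eta)\mathcal V_\varrho(\varphi)=\varphi_*\,\mathcal U_\varrho(\eta\circ\varphi)$ for $\eta$ (locally defined) on $V$ injective on fibers. Lie derivative: for each precompact open $V$ with closure in $W$, choose an open $T\subset\mathbb C$ containing $0$ and a holomorphic map $(\zeta,p)\in T\times V\mapsto\varphi^{\mathfrak x}_\zeta(p)$ such that each $\varphi^{\mathfrak x}_\zeta$ is a fiber-preserving biholomorphism of $V$ onto an open subset of $W$, $\varphi^{\mathfrak x}_0(p)=p$, and $\partial_\zeta\varphi^{\mathfrak x}_\zeta(p)|_{\zeta=0}=\mathfrak x(p)$. Then $$\mathcal L_{\mathfrak x}v|_V=\lim_{\zeta\to0}\frac{\mathcal V_\varrho(\varphi^{\mathfrak x}_\zeta)^{-1}\big(v|_{\varphi^{\mathfrak x}_\zeta(V)}\big)-v|_V}{\zeta}.$$ "Equals $u'$ in the $\eta$-coordinate" means equals $\mathcal U_\varrho(\eta)^{-1}u'$. *)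

theory Defs
  imports "HOL-Complex_Analysis.Complex_Analysis" "HOL-Library.Groups_Big_Fun"
begin

section \<open>Vertex operator algebras\<close>

record 'v voa_data =
  scl :: "complex \<Rightarrow> 'v \<Rightarrow> 'v"
  gr :: "nat \<Rightarrow> 'v set"
  Y :: "'v \<Rightarrow> int \<Rightarrow> 'v \<Rightarrow> 'v"
  vac :: 'v
  conf :: 'v

text \<open>\<open>Y V u n w\<close> is the mode \<open>Y(u)\<^sub>n w\<close>, where \<open>Y(u,z) = \<Sum>\<^sub>n Y(u)\<^sub>n z\<^sup>-\<^sup>n\<^sup>-\<^sup>1\<close>.\<close>

definition vir :: "'v voa_data \<Rightarrow> int \<Rightarrow> 'v \<Rightarrow> 'v" where
  "vir V n = Y V (conf V) (n + 1)"

definition is_decomp :: "'v::ab_group_add voa_data \<Rightarrow> 'v \<Rightarrow> (nat \<Rightarrow> 'v) \<Rightarrow> bool" where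
  "is_decomp V v f \<longleftrightarrow> (\<forall>n. f n \<in> gr V n) \<and> finite {n. f n \<noteq> 0} \<and> v = Sum_any f"

definition hcomp :: "'v::ab_group_add voa_data \<Rightarrow> nat \<Rightarrow> 'v \<Rightarrow> 'v" where
  "hcomp V n v = (THE f. is_decomp V v f) n"

text \<open>In the Jacobi identity below (in Borcherds' form) all sums have finite support by truncation.\<close>

locale voa =
  fixes V :: "'v::ab_group_add voa_data"
  assumes vector_space: "vector_space (scl V)"
    and linear_left: "Vector_Spaces.linear (scl V) (scl V) (\<lambda>u. Y V u n w)"
    and linear_right: "Vector_Spaces.linear (scl V) (scl V) (Y V u n)"
    and graded_subspace: "module.subspace (scl V) (gr V k)"
    and graded_sum: "\<exists>!f. is_decomp V v f"
    and graded_finite_dim: "\<exists>B. finite B \<and> module.span (scl V) B = gr V k"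
    and dim_0: "vector_space.dim (scl V) (gr V 0) = 1"
    and truncation: "\<exists>N. \<forall>n\<ge>N. Y V u n w = 0"
    and vac_grade: "vac V \<in> gr V 0"
    and vacuum: "Y V (vac V) n w = (if n = -1 then w else 0)"
    and creation: "Y V u (-1) (vac V) = u" "n \<ge> 0 \<Longrightarrow> Y V u n (vac V) = 0"
    and jacobi:
      "Sum_any (\<lambda>l. scl V (of_int m gchoose l) (Y V (Y V u (n + int l) v) (m + k - int l) w)) =
       Sum_any (\<lambda>l. scl V ((-1) ^ l * (of_int n gchoose l))
                      (Y V u (m + n - int l) (Y V v (k + int l) w)))
     - Sum_any (\<lambda>l. scl V ((-1) powi n * (-1) ^ l * (of_int n gchoose l))
                      (Y V v (n + k - int l) (Y V u (m + int l) w)))"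
    and conf_grade: "conf V \<in> gr V 2"
    and virasoro: "\<exists>c::complex. \<forall>m n w. vir V m (vir V n w) - vir V n (vir V m w) =
       scl V (of_int (m - n)) (vir V (m + n) w)
       + (if m + n = 0 then scl V (of_int (m ^ 3 - m) / 12 * c) w else 0)"
    and L0_grading: "v \<in> gr V k \<Longrightarrow> vir V 0 v = scl V (of_nat k) v"
    and translation: "Y V (vir V (-1) u) n w = scl V (- of_int n) (Y V u (n - 1) w)"

definition gr_le :: "'v::ab_group_add voa_data \<Rightarrow> nat \<Rightarrow> 'v set" where
  "gr_le V n = {\<Sum>k\<le>n. f k | f. \<forall>k. f k \<in> gr V k}"

text \<open>
  Convergence tested on all linear functionals. For functions with values in a finite-dimensional
  subspace, such as \<open>gr_le V n\<close>, it is convergence in the usual topology of that subspace.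
\<close>
definition vtendsto :: "'v::ab_group_add voa_data \<Rightarrow> ('a \<Rightarrow> 'v) \<Rightarrow> 'v \<Rightarrow> 'a filter \<Rightarrow> bool" where
  "vtendsto V f l F \<longleftrightarrow>
     (\<forall>\<alpha>. Vector_Spaces.linear (scl V) (*) \<alpha> \<longrightarrow> ((\<lambda>x. \<alpha> (f x) :: complex) \<longlongrightarrow> \<alpha> l) F)"

section \<open>The action of changes of coordinates\<close>

text \<open>
  The operator \<open>\<Sum>\<^sub>n\<^sub>>\<^sub>0 c\<^sub>n z\<^sup>n\<^sup>+\<^sup>1 \<partial>\<^sub>z\<close> on formal power series, and its exponential applied to \<open>z\<close>.
  The \<open>k\<close>-th power applied to \<open>z\<close> is divisible by \<open>z\<^sup>k\<^sup>+\<^sup>1\<close>, hence the terms with \<open>k > N\<close> do not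
  contribute to the coefficient of \<open>z\<^sup>N\<close>.
\<close>
definition vf :: "(nat \<Rightarrow> complex) \<Rightarrow> complex fps \<Rightarrow> complex fps" where
  "vf c f = Abs_fps (\<lambda>k. if k \<ge> 2 then c (k - 1) else 0) * fps_deriv f"

definition exp_vf :: "(nat \<Rightarrow> complex) \<Rightarrow> complex fps" where
  "exp_vf c = Abs_fps (\<lambda>N. \<Sum>k\<le>N. fps_nth ((vf c ^^ k) fps_X) N / fact k)"

text \<open>The value at \<open>0\<close> is not used by \<open>exp_vf\<close>; it is set to \<open>0\<close> to make the sequence unique.\<close>
definition germ_coeffs :: "(complex \<Rightarrow> complex) \<Rightarrow> nat \<Rightarrow> complex" where
  "germ_coeffs \<rho> =
     (THE c. c 0 = 0 \<and> fps_expansion \<rho> 0 = fps_const (deriv \<rho> 0) * exp_vf c)"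

definition sum_vir :: "'v::ab_group_add voa_data \<Rightarrow> (nat \<Rightarrow> complex) \<Rightarrow> 'v \<Rightarrow> 'v" where
  "sum_vir V c v = Sum_any (\<lambda>n. if n > 0 then scl V (c n) (vir V (int n) v) else 0)"

text \<open>The operators \<open>\<U>(\<rho>) = \<rho>'(0)\<^bsup>L_0\<^esup> exp(\<Sum>\<^sub>n\<^sub>>\<^sub>0 c\<^sub>n L\<^sub>n)\<close>; the exponential is locally finite because
  \<open>L\<^sub>n\<close> lowers the degree by \<open>n\<close>.\<close>
definition pow_L0 :: "'v::ab_group_add voa_data \<Rightarrow> complex \<Rightarrow> 'v \<Rightarrow> 'v" where
  "pow_L0 V a v = Sum_any (\<lambda>k. scl V (a ^ k) (hcomp V k v))"

definition coord_op :: "'v::ab_group_add voa_data \<Rightarrow> (complex \<Rightarrow> complex) \<Rightarrow> 'v \<Rightarrow> 'v" where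
  "coord_op V \<rho> v = pow_L0 V (deriv \<rho> 0)
     (Sum_any (\<lambda>k. scl V (1 / fact k) ((sum_vir V (germ_coeffs \<rho>) ^^ k) v)))"

section \<open>Complex manifolds\<close>

text \<open>
  The space \<open>\<complex>\<^sup>d\<close> is realized as a subspace of \<open>nat \<Rightarrow> complex\<close> with the product topology, so that
  the dimension is an arbitrary natural number, possibly \<open>0\<close>.
\<close>
type_synonym cvec = "nat \<Rightarrow> complex"

definition Cn :: "nat \<Rightarrow> cvec set" where
  "Cn d = {x. \<forall>i\<ge>d. x i = 0}"

text \<open>Complex differentiability at each point of \<open>S\<close>, an open subset of \<open>\<complex>\<^sup>d\<close>.\<close>
definition holo :: "nat \<Rightarrow> cvec set \<Rightarrow> (cvec \<Rightarrow> complex) \<Rightarrow> bool" where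
  "holo d S f \<longleftrightarrow> (\<forall>x\<in>S. \<exists>a.
     ((\<lambda>y. (f y - f x - (\<Sum>i<d. a i * (y i - x i))) / of_real (\<Sum>i<d. cmod (y i - x i)))
        \<longlongrightarrow> 0) (at x within S))"

definition pd :: "nat \<Rightarrow> (cvec \<Rightarrow> complex) \<Rightarrow> cvec \<Rightarrow> complex" where
  "pd i f x = deriv (\<lambda>z. f (x(i := z))) (x i)"

definition vpd :: "'v::ab_group_add voa_data \<Rightarrow> nat \<Rightarrow> (cvec \<Rightarrow> 'v) \<Rightarrow> cvec \<Rightarrow> 'v" where
  "vpd V i f x =
     (THE D. vtendsto V (\<lambda>t. scl V (1 / t) (f (x(i := x i + t)) - f x)) D (at 0))"

text \<open>A chart \<open>(U, d, \<phi>)\<close> is a homeomorphism \<open>\<phi>\<close> of an open set \<open>U\<close> onto an open subset of \<open>\<complex>\<^sup>d\<close>.\<close>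
type_synonym 'a chart = "'a set \<times> nat \<times> ('a \<Rightarrow> cvec)"

definition is_chart :: "'a::topological_space chart \<Rightarrow> bool" where
  "is_chart = (\<lambda>(U, d, \<phi>). open U \<and> openin (top_of_set (Cn d)) (\<phi> ` U) \<and>
     homeomorphism U (\<phi> ` U) \<phi> (inv_into U \<phi>))"

definition holo_transition :: "'a chart \<Rightarrow> 'a chart \<Rightarrow> bool" where
  "holo_transition = (\<lambda>(U, d, \<phi>) (V, e, \<psi>).
     \<forall>i<e. holo d (\<phi> ` (U \<inter> V)) (\<lambda>x. \<psi> (inv_into U \<phi> x) i))"

definition complex_atlas :: "'a::topological_space chart set \<Rightarrow> bool" where
  "complex_atlas A \<longleftrightarrow> (\<forall>c\<in>A. is_chart c) \<and> (\<forall>c\<in>A. \<forall>c'\<in>A. holo_transition c c') \<and>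
     (\<Union>(U, d, \<phi>)\<in>A. U) = UNIV"

definition holo_coords :: "'a::topological_space chart set \<Rightarrow> 'a set \<Rightarrow> nat \<Rightarrow> ('a \<Rightarrow> cvec) \<Rightarrow> bool"
  where "holo_coords A U d \<phi> \<longleftrightarrow> is_chart (U, d, \<phi>) \<and>
    (\<forall>c\<in>A. holo_transition (U, d, \<phi>) c \<and> holo_transition c (U, d, \<phi>))"

text \<open>The following two notions are used for open \<open>U\<close> and \<open>S\<close>.\<close>
definition holo_fun :: "'a chart set \<Rightarrow> 'a set \<Rightarrow> ('a \<Rightarrow> complex) \<Rightarrow> bool" where
  "holo_fun A U f \<longleftrightarrow> (\<forall>(V, d, \<phi>)\<in>A. holo d (\<phi> ` (U \<inter> V)) (f \<circ> inv_into V \<phi>))"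

definition holo_map :: "'a::topological_space chart set \<Rightarrow> 'b::topological_space chart set \<Rightarrow>
    'a set \<Rightarrow> ('a \<Rightarrow> 'b) \<Rightarrow> bool" where
  "holo_map A A' S F \<longleftrightarrow> continuous_on S F \<and>
     (\<forall>(V, e, \<psi>)\<in>A'. \<forall>i<e. holo_fun A (S \<inter> F -` V) (\<lambda>p. \<psi> (F p) i))"

definition times_C :: "'a chart set \<Rightarrow> (complex \<times> 'a) chart set" where
  "times_C A = (\<lambda>(U, d, \<phi>). (UNIV \<times> U, Suc d, \<lambda>(z, p). case_nat z (\<phi> p))) ` A"

section \<open>Families of compact Riemann surfaces\<close>

record ('c, 'b) family_data =
  tot :: "'c chart set"
  base :: "'b chart set"
  proj :: "'c \<Rightarrow> 'b"

text \<open>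
  The last clause says that the differential of the projection (in charts, a Jacobian matrix)
  is surjective and that the relative dimension is \<open>1\<close>. With properness and surjectivity, this makes
  every fiber a compact Riemann surface (not required to be connected).
\<close>
definition RS_family ::
  "('c::{t2_space,second_countable_topology}, 'b::{t2_space,second_countable_topology}) family_data
     \<Rightarrow> bool" where
  "RS_family X \<longleftrightarrow> complex_atlas (tot X) \<and> complex_atlas (base X) \<and>
     holo_map (tot X) (base X) UNIV (proj X) \<and> surj (proj X) \<and>
     (\<forall>K. compact K \<longrightarrow> compact (proj X -` K)) \<and>
     (\<forall>(U, d, \<phi>)\<in>tot X. \<forall>(V, e, \<psi>)\<in>base X. \<forall>p\<in>U \<inter> proj X -` V.
        d = Suc e \<and>
        (\<forall>y. \<exists>x. \<forall>i<e.
           (\<Sum>j<d. pd j (\<lambda>z. \<psi> (proj X (inv_into U \<phi> z)) i) (\<phi> p) * x j) = y i))"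

definition fiber_coord :: "('c::topological_space, 'b) family_data \<Rightarrow> 'c set \<Rightarrow> ('c \<Rightarrow> complex) \<Rightarrow> bool"
  where "fiber_coord X U \<eta> \<longleftrightarrow>
    open U \<and> holo_fun (tot X) U \<eta> \<and> (\<forall>b. inj_on \<eta> (U \<inter> proj X -` {b}))"

type_synonym 'c loc = "'c set \<times> ('c \<Rightarrow> complex)"

definition loc_coords :: "('c::topological_space, 'b) family_data \<Rightarrow> 'c \<Rightarrow> 'c loc set" where
  "loc_coords X p = {(U, \<eta>). fiber_coord X U \<eta> \<and> p \<in> U}"

text \<open>A representative of the germ \<open>\<rho>(\<eta>|\<mu>)\<^sub>p\<close>, for \<open>\<eta>\<close> and \<open>\<mu>\<close> defined on \<open>U\<close>.\<close>
definition coord_change ::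
  "('c, 'b) family_data \<Rightarrow> 'c set \<Rightarrow> ('c \<Rightarrow> complex) \<Rightarrow> ('c \<Rightarrow> complex) \<Rightarrow> 'c \<Rightarrow> complex \<Rightarrow> complex" where
  "coord_change X U \<eta> \<mu> p =
     (\<lambda>z. \<eta> (inv_into U (\<lambda>q. (\<mu> q, proj X q)) (z + \<mu> p, proj X p)) - \<eta> p)"

section \<open>The sheaf of vertex operator algebras\<close>

text \<open>
  The bundle is glued from its transition functions: an element of its fiber at \<open>p\<close> assigns to every
  local coordinate \<open>(U, \<eta>)\<close> at \<open>p\<close> its image under the trivialization \<open>\<U>(\<eta>)\<close> over \<open>U\<close>, so
  this trivialization is \<open>a \<mapsto> a (U, \<eta>)\<close>.
\<close>
definition voa_fiber :: "'v::ab_group_add voa_data \<Rightarrow> ('c::topological_space, 'b) family_data \<Rightarrow>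
    nat \<Rightarrow> 'c \<Rightarrow> ('c loc \<Rightarrow> 'v) set" where
  "voa_fiber V X n p = {a \<in> loc_coords X p \<rightarrow>\<^sub>E gr_le V n.
     \<forall>(U, \<eta>)\<in>loc_coords X p. \<forall>(U', \<mu>)\<in>loc_coords X p.
       a (U, \<eta>) = coord_op V (coord_change X (U \<inter> U') \<eta> \<mu> p) (a (U', \<mu>))}"

text \<open>The space \<open>V\<^sup>\<le>\<^sup>n \<otimes> \<O>(U)\<close>, as a space of functions.\<close>
definition gr_le_O :: "'v::ab_group_add voa_data \<Rightarrow> 'c chart set \<Rightarrow> nat \<Rightarrow> 'c set \<Rightarrow> ('c \<Rightarrow> 'v) set" where
  "gr_le_O V A n U = {u. \<exists>B f. finite B \<and> B \<subseteq> gr_le V n \<and> (\<forall>b\<in>B. holo_fun A U (f b)) \<and>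
     (\<forall>p\<in>U. u p = (\<Sum>b\<in>B. scl V (f b p) b))}"

definition voa_sections :: "'v::ab_group_add voa_data \<Rightarrow> ('c::topological_space, 'b) family_data \<Rightarrow>
    nat \<Rightarrow> 'c set \<Rightarrow> ('c \<Rightarrow> 'c loc \<Rightarrow> 'v) set" where
  "voa_sections V X n W = {s. (\<forall>p\<in>W. s p \<in> voa_fiber V X n p) \<and>
     (\<forall>U \<eta>. fiber_coord X U \<eta> \<longrightarrow> (\<lambda>p. s p (U, \<eta>)) \<in> gr_le_O V (tot X) n (W \<inter> U))}"

definition equals_in_coord ::
  "('c \<Rightarrow> 'c loc \<Rightarrow> 'v) \<Rightarrow> 'c set \<Rightarrow> ('c \<Rightarrow> complex) \<Rightarrow> ('c \<Rightarrow> 'v) \<Rightarrow> bool" where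
  "equals_in_coord s W \<eta> u \<longleftrightarrow> (\<forall>p\<in>W. s p (W, \<eta>) = u p)"

section \<open>Transport and Lie derivative\<close>

definition fiber_biholo :: "('c::topological_space, 'b) family_data \<Rightarrow> 'c set \<Rightarrow> 'c set \<Rightarrow>
    ('c \<Rightarrow> 'c) \<Rightarrow> bool" where
  "fiber_biholo X U V \<phi> \<longleftrightarrow> open U \<and> open V \<and> bij_betw \<phi> U V \<and>
     holo_map (tot X) (tot X) U \<phi> \<and> holo_map (tot X) (tot X) V (inv_into U \<phi>) \<and>
     (\<forall>p\<in>U. \<phi> ` (U \<inter> proj X -` {proj X p}) = V \<inter> proj X -` {proj X (\<phi> p)})"

text \<open>
  The bundle isomorphism \<open>\<V>(\<phi>)\<close> from the fiber at \<open>p \<in> U\<close> to the fiber at \<open>\<phi> p\<close>, for \<open>\<phi>\<close> defined on \<open>U\<close>: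
  its value in the coordinate \<open>\<eta>\<close> is the value of the argument in the coordinate \<open>\<eta> \<circ> \<phi>\<close>.
\<close>
definition transport :: "('c::topological_space, 'b) family_data \<Rightarrow> 'c set \<Rightarrow> ('c \<Rightarrow> 'c) \<Rightarrow> 'c \<Rightarrow>
    ('c loc \<Rightarrow> 'v) \<Rightarrow> 'c loc \<Rightarrow> 'v" where
  "transport X U \<phi> p a =
     restrict (\<lambda>(U', \<eta>). a (U \<inter> \<phi> -` U', \<eta> \<circ> \<phi>)) (loc_coords X (\<phi> p))"

definition transport_inv :: "'v::ab_group_add voa_data \<Rightarrow> ('c::topological_space, 'b) family_data \<Rightarrow>
    nat \<Rightarrow> 'c set \<Rightarrow> ('c \<Rightarrow> 'c) \<Rightarrow> ('c \<Rightarrow> 'c loc \<Rightarrow> 'v) \<Rightarrow> 'c \<Rightarrow> 'c loc \<Rightarrow> 'v" where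
  "transport_inv V X n U \<phi> s p = inv_into (voa_fiber V X n p) (transport X U \<phi> p) (s (\<phi> p))"

text \<open>Vector fields act as derivations on (locally defined) holomorphic functions.\<close>
type_synonym 'c vfield = "('c \<Rightarrow> complex) \<Rightarrow> 'c \<Rightarrow> complex"

text \<open>\<open>coord_deriv W c i\<close> is \<open>\<partial>/\<partial>c\<^sub>i\<close> for a coordinate system \<open>c\<close> on \<open>W\<close>; \<open>coord_vderiv\<close> is \<open>id \<otimes> \<partial>/\<partial>c\<^sub>i\<close>
  on vector-valued functions.\<close>
definition coord_deriv :: "'c set \<Rightarrow> ('c \<Rightarrow> cvec) \<Rightarrow> nat \<Rightarrow> 'c vfield" where
  "coord_deriv W c i f p = pd i (f \<circ> inv_into W c) (c p)"

definition coord_vderiv :: "'v::ab_group_add voa_data \<Rightarrow> 'c set \<Rightarrow> ('c \<Rightarrow> cvec) \<Rightarrow> nat \<Rightarrow>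
    ('c \<Rightarrow> 'v) \<Rightarrow> 'c \<Rightarrow> 'v" where
  "coord_vderiv V W c i u p = vpd V i (u \<circ> inv_into W c) (c p)"

text \<open>The last clause is \<open>\<partial>\<^sub>\<zeta> \<phi>\<^sub>\<zeta>(p)|\<^sub>\<zeta>\<^sub>=\<^sub>0 = x(p)\<close>, an equality of tangent vectors.\<close>
definition local_flow :: "('c::topological_space, 'b) family_data \<Rightarrow> 'c set \<Rightarrow> 'c vfield \<Rightarrow> 'c set \<Rightarrow>
    complex set \<Rightarrow> (complex \<Rightarrow> 'c \<Rightarrow> 'c) \<Rightarrow> bool" where
  "local_flow X W x U T \<phi> \<longleftrightarrow> open T \<and> 0 \<in> T \<and>
     holo_map (times_C (tot X)) (tot X) (T \<times> U) (\<lambda>(\<zeta>, p). \<phi> \<zeta> p) \<and>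
     (\<forall>\<zeta>\<in>T. \<phi> \<zeta> ` U \<subseteq> W \<and> fiber_biholo X U (\<phi> \<zeta> ` U) (\<phi> \<zeta>)) \<and>
     (\<forall>p\<in>U. \<phi> 0 p = p) \<and>
     (\<forall>p\<in>U. \<forall>N f. open N \<and> p \<in> N \<and> holo_fun (tot X) N f \<longrightarrow>
        ((\<lambda>\<zeta>. f (\<phi> \<zeta> p)) has_field_derivative x f p) (at 0))"

text \<open>
  The section \<open>w\<close> is the Lie derivative of \<open>v\<close>: on every precompact \<open>U\<close> with closure in \<open>W\<close>,
  an admissible \<open>\<phi>\<close> exists, and the limit (in the fiber at each point, expressed in
  local coordinates) is \<open>w\<close> whatever the choice of \<open>\<phi>\<close>.
\<close>
definition has_lie_derivative :: "'v::ab_group_add voa_data \<Rightarrow> ('c::topological_space, 'b) family_data \<Rightarrow>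
    nat \<Rightarrow> 'c set \<Rightarrow> 'c vfield \<Rightarrow> ('c \<Rightarrow> 'c loc \<Rightarrow> 'v) \<Rightarrow> ('c \<Rightarrow> 'c loc \<Rightarrow> 'v) \<Rightarrow> bool" where
  "has_lie_derivative V X n W x v w \<longleftrightarrow> w \<in> voa_sections V X n W \<and>
     (\<forall>U. open U \<and> compact (closure U) \<and> closure U \<subseteq> W \<longrightarrow>
        (\<exists>T \<phi>. local_flow X W x U T \<phi>) \<and>
        (\<forall>T \<phi>. local_flow X W x U T \<phi> \<longrightarrow>
           (\<forall>p\<in>U. \<forall>l\<in>loc_coords X p.
              vtendsto V
                (\<lambda>\<zeta>. scl V (1 / \<zeta>) (transport_inv V X n U (\<phi> \<zeta>) v p l - v p l))
                (w p l) (at 0))))"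

end

theory Submission
  imports Defs "HOL-Homology.Invariance_of_Domain"
begin

text \<open>
  Let \<open>\<phi>\<close> be a local flow of \<open>x\<close> and \<open>p\<close> a point. The transport of the fibers identifies the value of
  the section at \<open>\<phi> \<zeta> p\<close> in the coordinate \<open>\<eta>\<close> with a vector at \<open>p\<close> in the coordinate \<open>\<eta> \<circ> \<phi> \<zeta>\<close>. In the
  coordinate \<open>\<eta>\<close>, the transported vector is therefore \<open>\<U>(\<rho>\<^sub>\<zeta>) u(\<phi> \<zeta> p)\<close>, where \<open>\<rho>\<^sub>\<zeta>\<close> is the germ at
  \<open>p\<close> of the change from \<open>\<eta> \<circ> \<phi> \<zeta>\<close> to \<open>\<eta>\<close> (\<open>transport_inv_value\<close>). The Lie derivative is the
  derivative of this product at \<open>\<zeta> = 0\<close>, where \<open>\<rho>\<^sub>0 = id\<close>. The factor \<open>u(\<phi> \<zeta> p)\<close> contributes the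
  derivative of \<open>u\<close> in the direction \<open>x\<close>, which is the first part of the formula.

  For the other factor, the inverse germ of \<open>\<rho>\<^sub>\<zeta>\<close> is \<open>z \<mapsto> \<eta>(\<phi> \<zeta> (q z)) - \<eta>(\<phi> \<zeta> p)\<close>, where \<open>q\<close> is the curve
  in the fiber of \<open>p\<close> parametrized by \<open>\<eta>\<close>. Its \<open>\<zeta>\<close>-derivative at \<open>0\<close> is \<open>h(\<eta>(p) + z) - h(\<eta>(p))\<close>,
  with the base coordinates held fixed. Inverting changes the sign at first order, so the \<open>k\<close>-th
  Taylor coefficient of \<open>\<rho>\<^sub>\<zeta>\<close> has derivative \<open>- \<partial>\<^sup>k h / k!\<close> (\<open>flow_germ_deriv\<close>). To first order at the
  identity, the coefficients \<open>c\<^sub>n\<close> in the exponential form of a germ are its Taylor coefficients of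
  order \<open>n + 1\<close>, because the remaining terms of the exponential are at least quadratic in the
  \<open>c\<^sub>n\<close> (\<open>germ_coeffs_deriv_at_id\<close>). So \<open>\<U>(\<rho>\<^sub>\<zeta>)\<close> has derivative \<open>- \<Sum>\<^sub>k \<partial>\<^sup>k h / k! L\<^sub>k\<^sub>-\<^sub>1\<close>
  (\<open>weak_deriv_coord_op\<close>).

  The difference quotients lie in the fiber at \<open>p\<close>, and the changes of coordinates are linear and
  independent of \<open>\<zeta>\<close>. Hence convergence in the coordinate \<open>\<eta>\<close> implies convergence in every other
  coordinate, and the limits are again compatible. This shows that the formula defines an element
  of the fiber (\<open>lie_section_fiber\<close>). Its holomorphy in an arbitrary coordinate follows from that of the
  Taylor coefficients of the changes of coordinates (\<open>lie_section_holo\<close>).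

  All of this rests on two facts about the family. First, a fiber coordinate together
  with coordinates of the base is a coordinate system of the total space (\<open>fiber_chart\<close>): its
  differential is injective because an injective holomorphic function of one variable has nonzero
  derivative, and invariance of domain together with the differentiability of inverse maps
  (\<open>holo_inverse\<close>) does the rest. Second, a flow is only asked to be tangent to \<open>x\<close> at
  \<open>\<zeta> = 0\<close>, so a single Euler step in these coordinates provides one (\<open>local_flow_exists\<close>).
\<close>

section \<open>The spaces \<open>\<complex>\<^sup>d\<close>\<close>

text \<open>The distance that appears as the denominator in the definition of \<open>holo\<close>; on \<open>Cn d\<close> it induces the product topology.\<close>
definition cdist :: "nat \<Rightarrow> cvec \<Rightarrow> cvec \<Rightarrow> real" where
  "cdist d x y = (\<Sum>i<d. cmod (y i - x i))"

lemma cdist_ge_0 [simp]: "0 \<le> cdist d x y"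
  by (simp add: cdist_def sum_nonneg)

lemma cdist_self [simp]: "cdist d x x = 0"
  by (simp add: cdist_def)

lemma cdist_commute: "cdist d x y = cdist d y x"
  by (simp add: cdist_def norm_minus_commute)

lemma cdist_triangle: "cdist d x z \<le> cdist d x y + cdist d y z"
  unfolding cdist_def sum.distrib[symmetric]
  by (rule sum_mono, rule order_trans[OF _ norm_triangle_ineq]) simp

lemma coordinate_le_cdist: "i < d \<Longrightarrow> cmod (y i - x i) \<le> cdist d x y"
  unfolding cdist_def by (rule member_le_sum) auto

lemma cdist_eq_0_iff:
  assumes "x \<in> Cn d" "y \<in> Cn d"
  shows "cdist d x y = 0 \<longleftrightarrow> x = y"
proof
  assume "cdist d x y = 0"
  then have *: "\<forall>i<d. y i = x i"
    by (auto simp: cdist_def sum_nonneg_eq_0_iff)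
  show "x = y"
  proof
    fix i show "x i = y i" using * assms by (cases "i < d") (auto simp: Cn_def)
  qed
qed auto

lemma continuous_on_coordinate:
  "continuous_on S f \<Longrightarrow> continuous_on S (\<lambda>x. (f x :: cvec) i)"
  by (rule continuous_on_product_then_coordinatewise)

lemma continuous_on_fun_upd [continuous_intros]:
  assumes "continuous_on S f" "continuous_on S g"
  shows "continuous_on S (\<lambda>x. (f x :: cvec)(i := g x))"
proof (rule continuous_on_coordinatewise_then_product)
  fix j show "continuous_on S (\<lambda>x. ((f x)(i := g x)) j)"
    by (cases "j = i") (simp_all add: assms continuous_on_coordinate)
qed

lemma continuous_on_case_nat [continuous_intros]:
  assumes "continuous_on S f" "continuous_on S g"
  shows "continuous_on S (\<lambda>x. case_nat (f x) (g x) :: cvec)"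
proof (rule continuous_on_coordinatewise_then_product)
  fix i show "continuous_on S (\<lambda>x. case i of 0 \<Rightarrow> f x | Suc j \<Rightarrow> g x j)"
    by (cases i) (simp_all add: assms continuous_on_coordinate)
qed

lemma continuous_on_cdist [continuous_intros]:
  "continuous_on S f \<Longrightarrow> continuous_on S g \<Longrightarrow> continuous_on S (\<lambda>x. cdist d (f x) (g x))"
  unfolding cdist_def
  by (intro continuous_on_sum continuous_on_norm continuous_on_diff continuous_on_coordinate)

lemma open_cdist_ball: "open {y. cdist d x y < r}"
  by (intro open_Collect_less continuous_on_cdist continuous_on_const continuous_on_id)

lemma open_contains_cdist_ball:
  assumes "open U" "x \<in> U" "x \<in> Cn d"
  shows "\<exists>e>0. \<forall>y\<in>Cn d. cdist d x y < e \<longrightarrow> y \<in> U"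
proof -
  have "openin (product_topology (\<lambda>_. euclidean) UNIV) U"
    using assms(1) by (simp add: open_fun_def)
  from product_topology_open_contains_basis[OF this assms(2)]
  obtain X where X: "x \<in> Pi\<^sub>E UNIV X" "\<And>i. openin euclidean (X i)" "Pi\<^sub>E UNIV X \<subseteq> U"
    by blast
  have "\<forall>i. \<exists>e>0. ball (x i) e \<subseteq> X i"
    using X(1,2) open_contains_ball by (metis PiE_mem UNIV_I open_openin)
  then obtain e where e: "\<And>i. e i > 0" "\<And>i. ball (x i) (e i) \<subseteq> X i" by metis
  define \<epsilon> where "\<epsilon> = Min (insert 1 (e ` {..<d}))"
  have \<epsilon>: "\<epsilon> > 0" "\<And>i. i < d \<Longrightarrow> \<epsilon> \<le> e i"
    by (auto simp: \<epsilon>_def e(1))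
  have "y \<in> U" if "y \<in> Cn d" "cdist d x y < \<epsilon>" for y
  proof -
    have "y i \<in> X i" for i
    proof (cases "i < d")
      case True
      have "cmod (y i - x i) < e i"
        using coordinate_le_cdist[OF True, of y x] \<epsilon>(2)[OF True] that by linarith
      then show ?thesis using e(2)[of i]
        by (auto simp: dist_norm norm_minus_commute)
    next
      case False
      then have "y i = x i" using that assms by (auto simp: Cn_def)
      then show ?thesis using e(1)[of i] e(2)[of i] by auto
    qed
    then show ?thesis using X(3) by auto
  qed
  then show ?thesis using \<epsilon>(1) by blast
qed

lemma openin_Cn_iff:
  "openin (top_of_set (Cn d)) S \<longleftrightarrow>
     S \<subseteq> Cn d \<and> (\<forall>x\<in>S. \<exists>e>0. \<forall>y\<in>Cn d. cdist d x y < e \<longrightarrow> y \<in> S)"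
proof
  assume "openin (top_of_set (Cn d)) S"
  then obtain U where "open U" "S = Cn d \<inter> U" by (auto simp: openin_open)
  then show "S \<subseteq> Cn d \<and> (\<forall>x\<in>S. \<exists>e>0. \<forall>y\<in>Cn d. cdist d x y < e \<longrightarrow> y \<in> S)"
    using open_contains_cdist_ball[of U _ d] by fastforce
next
  assume *: "S \<subseteq> Cn d \<and> (\<forall>x\<in>S. \<exists>e>0. \<forall>y\<in>Cn d. cdist d x y < e \<longrightarrow> y \<in> S)"
  define U where "U = \<Union>{{y. cdist d x y < e} |x e. x \<in> S \<and> (\<forall>y\<in>Cn d. cdist d x y < e \<longrightarrow> y \<in> S)}"
  have "open U" unfolding U_def by (rule open_Union) (auto intro: open_cdist_ball)
  moreover have "S \<subseteq> U"
  proof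
    fix x assume "x \<in> S"
    moreover obtain e where "e > 0" "\<forall>y\<in>Cn d. cdist d x y < e \<longrightarrow> y \<in> S" using * \<open>x \<in> S\<close> by blast
    ultimately show "x \<in> U" unfolding U_def
      by (intro UnionI[of "{y. cdist d x y < e}"]) auto
  qed
  moreover have "Cn d \<inter> U \<subseteq> S" unfolding U_def by blast
  ultimately have "S = Cn d \<inter> U" using * by blast
  with \<open>open U\<close> show "openin (top_of_set (Cn d)) S" unfolding openin_open by blast
qed

lemma openin_cdist_ball:
  "x \<in> Cn d \<Longrightarrow> openin (top_of_set (Cn d)) {y\<in>Cn d. cdist d x y < r}"
  unfolding openin_open
  by (rule exI[of _ "{y. cdist d x y < r}"])
     (auto intro: open_cdist_ball)

lemma eventually_at_within_Cn:
  assumes "S \<subseteq> Cn d" "x \<in> S"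
  shows "eventually P (at x within S) \<longleftrightarrow>
    (\<exists>e>0. \<forall>y\<in>S. y \<noteq> x \<and> cdist d x y < e \<longrightarrow> P y)"
proof
  assume "eventually P (at x within S)"
  then obtain U where "open U" "x \<in> U" "\<forall>y\<in>U. y \<noteq> x \<longrightarrow> y \<in> S \<longrightarrow> P y"
    by (auto simp: eventually_at_topological)
  then show "\<exists>e>0. \<forall>y\<in>S. y \<noteq> x \<and> cdist d x y < e \<longrightarrow> P y"
    using open_contains_cdist_ball[of U x d] assms by blast
next
  assume "\<exists>e>0. \<forall>y\<in>S. y \<noteq> x \<and> cdist d x y < e \<longrightarrow> P y"
  then obtain e where e: "e > 0" "\<forall>y\<in>S. y \<noteq> x \<and> cdist d x y < e \<longrightarrow> P y" by blast
  show "eventually P (at x within S)"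
    using e open_cdist_ball[of d x e] unfolding eventually_at_topological by (intro exI[of _ "{y. cdist d x y < e}"]) auto
qed

lemma continuous_on_Cn_iff:
  fixes f :: "cvec \<Rightarrow> 'a::metric_space"
  assumes "S \<subseteq> Cn d"
  shows "continuous_on S f \<longleftrightarrow>
    (\<forall>x\<in>S. \<forall>e>0. \<exists>\<delta>>0. \<forall>y\<in>S. cdist d x y < \<delta> \<longrightarrow> dist (f y) (f x) < e)"
proof -
  have "(f \<longlongrightarrow> f x) (at x within S) \<longleftrightarrow>
     (\<forall>e>0. \<exists>\<delta>>0. \<forall>y\<in>S. cdist d x y < \<delta> \<longrightarrow> dist (f y) (f x) < e)" if "x \<in> S" for x
    unfolding tendsto_iff eventually_at_within_Cn[OF assms that]
    by (metis dist_self)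
  then show ?thesis unfolding continuous_on_def by blast
qed

lemma Cn_fun_upd [intro]: "x \<in> Cn d \<Longrightarrow> i < d \<Longrightarrow> x(i := z) \<in> Cn d"
  by (auto simp: Cn_def)

lemma cdist_fun_upd: "i < d \<Longrightarrow> cdist d x (x(i := z)) = cmod (z - x i)"
  unfolding cdist_def
  by (subst sum.remove[of _ i]) (auto intro!: sum.neutral)

lemma cdist_fun_upd2: "i < d \<Longrightarrow> cdist d x (y(i := z)) \<le> cdist d x y + cmod (z - x i)"
  unfolding cdist_def
  by (subst sum.remove[of _ i], simp, simp, subst (2) sum.remove[of _ i], auto)

section \<open>Holomorphic functions on open subsets of \<open>\<complex>\<^sup>d\<close>\<close>

text \<open>Both \<open>y\<close> and \<open>z\<close> vary near \<open>x\<close>. This uniformity is what makes maps with injective derivative locally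
  expansive and holomorphic functions locally Lipschitz.\<close>
definition strict_deriv :: "nat \<Rightarrow> (cvec \<Rightarrow> complex) \<Rightarrow> (nat \<Rightarrow> complex) \<Rightarrow> cvec \<Rightarrow> bool" where
  "strict_deriv d f a x \<longleftrightarrow> (\<forall>e>0. \<exists>\<delta>>0. \<forall>y\<in>Cn d. \<forall>z\<in>Cn d. cdist d x y < \<delta> \<longrightarrow> cdist d x z < \<delta> \<longrightarrow>
     cmod (f z - f y - (\<Sum>i<d. a i * (z i - y i))) \<le> e * cdist d y z)"

lemma strict_iff_weak_bound:
  fixes R c :: "'a \<Rightarrow> real"
  assumes pos: "\<And>y. y \<in> S \<Longrightarrow> y \<noteq> x \<Longrightarrow> c y > 0" and "c x = 0" "R x = 0"
  shows "(\<forall>e>0. \<exists>\<delta>>0. \<forall>y\<in>S. y \<noteq> x \<and> c y < \<delta> \<longrightarrow> R y < e * c y) \<longleftrightarrow>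
         (\<forall>e>0. \<exists>\<delta>>0. \<forall>y\<in>S. c y < \<delta> \<longrightarrow> R y \<le> e * c y)" (is "?L \<longleftrightarrow> ?R")
proof
  assume L: ?L
  show ?R
  proof (intro allI impI)
    fix e :: real assume "e > 0"
    with L obtain \<delta> where \<delta>: "\<delta> > 0" "\<forall>y\<in>S. y \<noteq> x \<and> c y < \<delta> \<longrightarrow> R y < e * c y" by blast
    have "R y \<le> e * c y" if "y \<in> S" "c y < \<delta>" for y
      using \<delta>(2) that assms(2,3) by (cases "y = x") (auto intro: less_imp_le)
    with \<delta>(1) show "\<exists>\<delta>>0. \<forall>y\<in>S. c y < \<delta> \<longrightarrow> R y \<le> e * c y" by blast
  qed
next
  assume R: ?R
  show ?L
  proof (intro allI impI)
    fix e :: real assume "e > 0"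
    then have "e / 2 > 0" by simp
    with R obtain \<delta> where \<delta>: "\<delta> > 0" "\<forall>y\<in>S. c y < \<delta> \<longrightarrow> R y \<le> e/2 * c y" by blast
    have "R y < e * c y" if "y \<in> S" "y \<noteq> x" "c y < \<delta>" for y
    proof -
      have "R y \<le> e/2 * c y" using \<delta>(2) that by blast
      also have "\<dots> < e * c y" using pos[OF that(1,2)] \<open>e > 0\<close> by simp
      finally show ?thesis .
    qed
    with \<delta>(1) show "\<exists>\<delta>>0. \<forall>y\<in>S. y \<noteq> x \<and> c y < \<delta> \<longrightarrow> R y < e * c y" by blast
  qed
qed

lemma holo_eps_delta:
  assumes "S \<subseteq> Cn d"
  shows "holo d S f \<longleftrightarrow> (\<forall>x\<in>S. \<exists>a. \<forall>e>0. \<exists>\<delta>>0. \<forall>y\<in>S. cdist d x y < \<delta> \<longrightarrow>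
     cmod (f y - f x - (\<Sum>i<d. a i * (y i - x i))) \<le> e * cdist d x y)"
proof -
  have "((\<lambda>y. (f y - f x - (\<Sum>i<d. a i * (y i - x i))) / of_real (\<Sum>i<d. cmod (y i - x i)))
        \<longlongrightarrow> 0) (at x within S) \<longleftrightarrow> (\<forall>e>0. \<exists>\<delta>>0. \<forall>y\<in>S. cdist d x y < \<delta> \<longrightarrow>
     cmod (f y - f x - (\<Sum>i<d. a i * (y i - x i))) \<le> e * cdist d x y)" (is "?L = ?R") if "x \<in> S" for x a
  proof -
    have *: "cdist d x y > 0" if "y \<in> S" "y \<noteq> x" for y
      using cdist_eq_0_iff[of x d y] that \<open>x \<in> S\<close> assms cdist_ge_0[of d x y]
      by (metis less_eq_real_def subsetD)
    have L: "?L = (\<forall>e>0. \<exists>\<delta>>0. \<forall>y\<in>S. y \<noteq> x \<and> cdist d x y < \<delta> \<longrightarrow>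
       cmod (f y - f x - (\<Sum>i<d. a i * (y i - x i))) < e * cdist d x y)"
    proof -
      have "dist ((f y - f x - (\<Sum>i<d. a i * (y i - x i))) / of_real (\<Sum>i<d. cmod (y i - x i))) 0 < e
        \<longleftrightarrow> cmod (f y - f x - (\<Sum>i<d. a i * (y i - x i))) < e * cdist d x y"
        if "y \<in> S" "y \<noteq> x" for y e
      proof -
        have "dist (A / complex_of_real B) 0 < e \<longleftrightarrow> cmod A < e * B" if "B > 0" for A B
          using that by (simp add: norm_divide pos_divide_less_eq)
        from this[OF *[OF that]] show ?thesis unfolding cdist_def .
      qed
      then show ?thesis
        unfolding tendsto_iff eventually_at_within_Cn[OF assms \<open>x \<in> S\<close>]
        by (intro all_cong ex_cong1 conj_cong ball_cong refl imp_cong) auto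
    qed
    show ?thesis unfolding L
      by (rule strict_iff_weak_bound) (use * in auto)
  qed
  note * = this
  show ?thesis unfolding holo_def by (rule ball_cong[OF refl], rule ex_cong1, erule *)
qed

lemma openin_Cn_line:
  assumes "openin (top_of_set (Cn d)) S" "x \<in> S" "i < d"
  shows "open {z. x(i := z) \<in> S}"
proof -
  obtain U where U: "open U" "S = Cn d \<inter> U" using assms(1) by (auto simp: openin_open)
  have "{z. x(i := z) \<in> S} = (\<lambda>z. x(i := z)) -` U" using U assms by auto
  then show ?thesis
    by (simp add: U(1) continuous_intros open_vimage)
qed

lemma strict_deriv_line:
  assumes "strict_deriv d f a x" "x \<in> Cn d" "i < d"
  shows "((\<lambda>z. f (x(i := z))) has_field_derivative a i) (at (x i))"
  unfolding has_field_derivative_def has_derivative_at_alt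
proof (intro conjI allI impI bounded_linear_mult_right)
  fix e :: real assume "e > 0"
  then obtain \<delta> where \<delta>: "\<delta> > 0" "\<And>y z. y \<in> Cn d \<Longrightarrow> z \<in> Cn d \<Longrightarrow> cdist d x y < \<delta> \<Longrightarrow> cdist d x z < \<delta> \<Longrightarrow>
     cmod (f z - f y - (\<Sum>i<d. a i * (z i - y i))) \<le> e * cdist d y z"
    using assms(1) unfolding strict_deriv_def by meson
  have "cmod (f (x(i := w)) - f (x(i := x i)) - a i * (w - x i)) \<le> e * cmod (w - x i)"
    if "cmod (w - x i) < \<delta>" for w
  proof -
    have "(\<Sum>j<d. a j * ((x(i := w)) j - x j)) = a i * (w - x i)"
      by (subst sum.remove[of _ i]) (auto simp: assms(3) intro!: sum.neutral)
    then show ?thesis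
      using \<delta>(2)[of x "x(i := w)"] that assms \<delta>(1) by (simp add: cdist_fun_upd Cn_fun_upd)
  qed
  then show "\<exists>\<delta>>0. \<forall>y. cmod (y - x i) < \<delta> \<longrightarrow>
      cmod (f (x(i := y)) - f (x(i := x i)) - a i * (y - x i)) \<le> e * cmod (y - x i)"
    using \<delta>(1) by blast
qed

lemma strict_deriv_chain:
  fixes \<gamma> :: "complex \<Rightarrow> cvec"
  assumes f: "strict_deriv d f a (\<gamma> t)"
    and \<gamma>: "eventually (\<lambda>s. \<gamma> s \<in> Cn d) (nhds t)"
    and d\<gamma>: "\<And>i. i < d \<Longrightarrow> ((\<lambda>s. \<gamma> s i) has_field_derivative \<gamma>' i) (at t)"
  shows "((\<lambda>s. f (\<gamma> s)) has_field_derivative (\<Sum>i<d. a i * \<gamma>' i)) (at t)"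
proof -
  have \<gamma>t: "\<gamma> t \<in> Cn d" using \<gamma> by (rule eventually_nhds_x_imp_x)
  have q: "((\<lambda>s. (\<gamma> s i - \<gamma> t i) / (s - t)) \<longlongrightarrow> \<gamma>' i) (at t)" if "i < d" for i
    using d\<gamma>[OF that] unfolding has_field_derivative_iff .
  have q0: "((\<lambda>s. \<gamma> s i) \<longlongrightarrow> \<gamma> t i) (at t)" if "i < d" for i
    using DERIV_isCont[OF d\<gamma>[OF that]] unfolding isCont_def .
  define Q where "Q s = (\<Sum>i<d. cmod ((\<gamma> s i - \<gamma> t i) / (s - t)))" for s
  have Q: "(Q \<longlongrightarrow> (\<Sum>i<d. cmod (\<gamma>' i))) (at t)"
    unfolding Q_def by (intro tendsto_sum tendsto_norm) (use q in auto)
  have cd: "cdist d (\<gamma> t) (\<gamma> s) = Q s * cmod (s - t)" if "s \<noteq> t" for s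
    using that by (simp add: cdist_def Q_def norm_divide sum_divide_distrib[symmetric])
  have "((\<lambda>s. cdist d (\<gamma> t) (\<gamma> s)) \<longlongrightarrow> (\<Sum>i<d. cmod (\<gamma> t i - \<gamma> t i))) (at t)"
    unfolding cdist_def
    by (intro tendsto_sum tendsto_norm tendsto_diff tendsto_const) (use q0 in auto)
  then have cd0: "((\<lambda>s. cdist d (\<gamma> t) (\<gamma> s)) \<longlongrightarrow> 0) (at t)" by simp
  have lin: "((\<lambda>s. (\<Sum>i<d. a i * ((\<gamma> s i - \<gamma> t i) / (s - t)))) \<longlongrightarrow> (\<Sum>i<d. a i * \<gamma>' i)) (at t)"
    by (intro tendsto_sum tendsto_mult tendsto_const) (use q in auto)
  have rem: "((\<lambda>s. (f (\<gamma> s) - f (\<gamma> t) - (\<Sum>i<d. a i * (\<gamma> s i - \<gamma> t i))) / (s - t)) \<longlongrightarrow> 0) (at t)"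
    unfolding tendsto_iff
  proof (intro allI impI)
    fix e :: real assume "e > 0"
    define M where "M = (\<Sum>i<d. cmod (\<gamma>' i)) + 1"
    have "M > 0" unfolding M_def by (simp add: add_nonneg_pos sum_nonneg)
    have "e / (2 * M) > 0" using \<open>M > 0\<close> \<open>e > 0\<close> by simp
    then obtain \<delta> where \<delta>: "\<delta> > 0" "\<And>y z. y \<in> Cn d \<Longrightarrow> z \<in> Cn d \<Longrightarrow> cdist d (\<gamma> t) y < \<delta> \<Longrightarrow>
        cdist d (\<gamma> t) z < \<delta> \<Longrightarrow>
        cmod (f z - f y - (\<Sum>i<d. a i * (z i - y i))) \<le> e / (2 * M) * cdist d y z"
      using f unfolding strict_deriv_def by meson
    have e1: "eventually (\<lambda>s. cdist d (\<gamma> t) (\<gamma> s) < \<delta>) (at t)"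
      using cd0 \<delta>(1) by (rule order_tendstoD)
    have e2: "eventually (\<lambda>s. Q s < M) (at t)"
      by (rule order_tendstoD[OF Q]) (simp add: M_def)
    have e3: "eventually (\<lambda>s. \<gamma> s \<in> Cn d) (at t)" 
      using \<gamma> by (simp add: eventually_nhds_conv_at)
    have e4: "eventually (\<lambda>s. s \<noteq> t) (at t)" by (simp add: eventually_neq_at_within)
    show "eventually (\<lambda>s. dist ((f (\<gamma> s) - f (\<gamma> t) - (\<Sum>i<d. a i * (\<gamma> s i - \<gamma> t i))) / (s - t)) 0 < e) (at t)"
      using e1 e2 e3 e4
    proof eventually_elim
      case (elim s)
      have "cmod (f (\<gamma> s) - f (\<gamma> t) - (\<Sum>i<d. a i * (\<gamma> s i - \<gamma> t i))) \<le> e / (2 * M) * (Q s * cmod (s - t))"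
        using \<delta>(2)[of "\<gamma> t" "\<gamma> s"] elim \<gamma>t \<delta>(1) cd[of s] by simp
      also have "\<dots> \<le> e / (2 * M) * (M * cmod (s - t))"
        using elim \<open>e > 0\<close> \<open>M > 0\<close> by (intro mult_left_mono mult_right_mono) auto
      also have "\<dots> = e/2 * cmod (s - t)" using \<open>M > 0\<close> by simp
      also have "\<dots> < e * cmod (s - t)" using \<open>e > 0\<close> elim by simp
      finally show ?case using elim by (simp add: norm_divide divide_simps)
    qed
  qed
  have "((\<lambda>s. (\<Sum>i<d. a i * ((\<gamma> s i - \<gamma> t i) / (s - t))) +
     (f (\<gamma> s) - f (\<gamma> t) - (\<Sum>i<d. a i * (\<gamma> s i - \<gamma> t i))) / (s - t)) \<longlongrightarrow> (\<Sum>i<d. a i * \<gamma>' i) + 0) (at t)"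
    by (intro tendsto_add lin rem)
  moreover have "(\<Sum>i<d. a i * ((\<gamma> s i - \<gamma> t i) / (s - t))) +
     (f (\<gamma> s) - f (\<gamma> t) - (\<Sum>i<d. a i * (\<gamma> s i - \<gamma> t i))) / (s - t) = (f (\<gamma> s) - f (\<gamma> t)) / (s - t)" for s
  proof -
    have "(\<Sum>i<d. a i * ((\<gamma> s i - \<gamma> t i) / (s - t))) = (\<Sum>i<d. a i * (\<gamma> s i - \<gamma> t i)) / (s - t)"
      unfolding sum_divide_distrib by (intro sum.cong refl) (rule times_divide_eq_right)
    then show ?thesis by (simp only: add_divide_distrib[symmetric]) simp
  qed
  ultimately show ?thesis
    unfolding has_field_derivative_iff by simp
qed

definition sep_holo :: "nat \<Rightarrow> cvec set \<Rightarrow> (cvec \<Rightarrow> complex) \<Rightarrow> bool" where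
  "sep_holo d S f \<longleftrightarrow> (\<forall>x\<in>S. \<forall>i<d. (\<lambda>z. f (x(i := z))) field_differentiable at (x i))"

lemma sep_holo_line:
  assumes "sep_holo d S f" "i < d"
  shows "(\<lambda>z. f (x(i := z))) holomorphic_on {z. x(i := z) \<in> S}"
  unfolding holomorphic_on_def
proof
  fix z assume "z \<in> {z. x(i := z) \<in> S}"
  then have "(\<lambda>w. f ((x(i := z))(i := w))) field_differentiable at ((x(i := z)) i)"
    using assms unfolding sep_holo_def by blast
  then show "(\<lambda>z. f (x(i := z))) field_differentiable at z within {z. x(i := z) \<in> S}"
    by (simp add: field_differentiable_at_within)
qed

lemma openin_Cn_ball:
  assumes "openin (top_of_set (Cn d)) S" "x \<in> S"
  obtains r where "r > 0" "\<And>y. y \<in> Cn d \<Longrightarrow> cdist d x y < r \<Longrightarrow> y \<in> S"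
  using assms unfolding openin_Cn_iff by blast

lemma openin_CnD: "openin (top_of_set (Cn d)) S \<Longrightarrow> x \<in> S \<Longrightarrow> x \<in> Cn d"
  using openin_imp_subset by blast

text \<open>Uniformity over a closed disc around each point of a line comes from the compactness of the disc.
  It feeds Cauchy's estimate in \<open>continuous_on_pd\<close>.\<close>
lemma line_uniform:
  fixes f :: "cvec \<Rightarrow> complex"
  assumes S: "openin (top_of_set (Cn d)) S" and f: "continuous_on S f" and x: "x \<in> S" and i: "i < d"
    and r: "r > 0" "\<And>y. y \<in> Cn d \<Longrightarrow> cdist d x y < 4 * r \<Longrightarrow> y \<in> S" and e: "e > 0"
  shows "\<exists>\<delta>>0. \<forall>y\<in>Cn d. cdist d x y < \<delta> \<longrightarrow>
    (\<forall>w\<in>cball 0 r. cmod (f (y(i := y i + w)) - f (x(i := x i + w))) \<le> e)"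
proof -
  define U where "U = {y\<in>Cn d. cdist d x y < r}"
  have xC: "x \<in> Cn d" using openin_CnD[OF S x] .
  have inS: "y(i := y i + w) \<in> S" if "y \<in> U" "w \<in> cball 0 r" for y w
  proof (rule r(2))
    have "cmod (y i + w - x i) \<le> cmod (y i - x i) + cmod w"
      by (metis add_diff_eq diff_add_eq norm_triangle_ineq)
    then show "cdist d x (y(i := y i + w)) < 4 * r"
      using that cdist_fun_upd2[OF i, of x y "y i + w"] coordinate_le_cdist[OF i, of y x] r(1)
      by (auto simp: U_def)
  qed (use that i in \<open>auto simp: U_def\<close>)
  have "continuous_on (U \<times> cball 0 r) (\<lambda>p. f ((fst p)(i := fst p i + snd p)))"
    by (rule continuous_on_compose2[OF f continuous_on_fun_upd[OF continuous_on_fst[OF continuous_on_id]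
         continuous_on_add[OF continuous_on_coordinate[OF continuous_on_fst[OF continuous_on_id]]
           continuous_on_snd[OF continuous_on_id]]]]) (use inS in auto)
  from continuous_on_prod_compactE[OF this compact_cball _ e, of x]
  obtain X0 where X0: "x \<in> X0" "open X0"
    "\<forall>y\<in>X0 \<inter> U. \<forall>t\<in>cball 0 r. dist (f (y(i := y i + t))) (f (x(i := x i + t))) \<le> e"
    using xC r(1) by (auto simp: U_def)
  from open_contains_cdist_ball[OF X0(2,1) xC] obtain \<delta> where
    "\<delta> > 0" "\<forall>y\<in>Cn d. cdist d x y < \<delta> \<longrightarrow> y \<in> X0" by blast
  then show ?thesis using X0(3) r(1)
    by (intro exI[of _ "min \<delta> r"]) (auto simp: U_def dist_norm)
qed

text \<open>Cauchy's estimate on a small disc bounds the difference of two partial derivatives by the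
  difference of the functions on the disc.\<close>
lemma continuous_on_pd:
  assumes S: "openin (top_of_set (Cn d)) S" and f: "continuous_on S f" "sep_holo d S f" and i: "i < d"
  shows "continuous_on S (pd i f)"
  unfolding continuous_on_Cn_iff[OF openin_imp_subset[OF S]]
proof (intro ballI allI impI)
  fix x and e :: real assume x: "x \<in> S" and e: "e > 0"
  obtain r0 where r0: "r0 > 0" "\<And>y. y \<in> Cn d \<Longrightarrow> cdist d x y < r0 \<Longrightarrow> y \<in> S"
    using openin_Cn_ball[OF S x] by blast
  define r where "r = r0 / 4"
  have r: "r > 0" "\<And>y. y \<in> Cn d \<Longrightarrow> cdist d x y < 4 * r \<Longrightarrow> y \<in> S"
    using r0 by (auto simp: r_def)
  have "e * r / 2 > 0" using r e by simp
  from line_uniform[OF S f(1) x i r this] obtain \<delta> where \<delta>: "\<delta> > 0"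
    "\<forall>y\<in>Cn d. cdist d x y < \<delta> \<longrightarrow>
      (\<forall>w\<in>cball 0 r. cmod (f (y(i := y i + w)) - f (x(i := x i + w))) \<le> e * r / 2)"
    by blast
  have hol: "(\<lambda>w. f (y(i := y i + w))) holomorphic_on ball 0 (2 * r)"
    if yC: "y \<in> Cn d" and yr: "cdist d x y < r" for y
  proof -
    have inS: "y(i := y i + w) \<in> S" if w: "w \<in> ball 0 (2 * r)" for w
    proof (rule r(2))
      have "cmod (y i + w - x i) \<le> cmod (y i - x i) + cmod w"
        by (metis add_diff_eq diff_add_eq norm_triangle_ineq)
      then show "cdist d x (y(i := y i + w)) < 4 * r"
        using yC yr w cdist_fun_upd2[OF i, of x y "y i + w"] coordinate_le_cdist[OF i, of y x]
        by auto
    qed (use yC i in auto)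
    have "(\<lambda>w. y i + w) ` ball 0 (2 * r) \<subseteq> {z. y(i := z) \<in> S}"
      using inS by blast
    then have "((\<lambda>z. f (y(i := z))) \<circ> (\<lambda>w. y i + w)) holomorphic_on ball 0 (2 * r)"
      by (intro holomorphic_on_compose_gen[OF _ sep_holo_line[OF f(2) i]] holomorphic_intros)
    then show ?thesis by (simp add: o_def)
  qed
  have dv: "deriv (\<lambda>w. f (y(i := y i + w))) 0 = pd i f y" for y
    unfolding pd_def by (subst (2) deriv_shift_0) (simp add: o_def)
  have "dist (pd i f y) (pd i f x) < e" if y: "y \<in> S" "cdist d x y < min \<delta> r" for y
  proof -
    have yC: "y \<in> Cn d" using openin_CnD[OF S y(1)] .
    define g where "g = (\<lambda>w. f (y(i := y i + w)) - f (x(i := x i + w)))"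
    have h1: "(\<lambda>w. f (y(i := y i + w))) holomorphic_on ball 0 (2 * r)"
      and h2: "(\<lambda>w. f (x(i := x i + w))) holomorphic_on ball 0 (2 * r)"
      using hol[OF yC] hol[of x] openin_CnD[OF S x] y r(1) by auto
    have gh: "g holomorphic_on ball 0 (2 * r)"
      unfolding g_def using h1 h2 by (rule holomorphic_on_diff)
    have "cmod ((deriv ^^ 1) g 0) \<le> fact 1 * (e * r / 2) / r ^ 1"
    proof (rule Cauchy_inequality)
      show "g holomorphic_on ball 0 r" by (rule holomorphic_on_subset[OF gh]) (use r in auto)
      show "continuous_on (cball 0 r) g"
        by (rule continuous_on_subset[OF holomorphic_on_imp_continuous_on[OF gh]]) (use r in auto)
      show "cmod (g w) \<le> e * r / 2" if "cmod (0 - w) = r" for w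
        unfolding g_def using \<delta>(2) yC y that by (auto simp: dist_norm)
    qed (rule r(1))
    then have "cmod (deriv g 0) \<le> e / 2" using r by simp
    moreover have "deriv g 0 = pd i f y - pd i f x"
    proof -
      have "0 \<in> ball 0 (2 * r)" using r by simp
      then have "(\<lambda>w. f (y(i := y i + w))) field_differentiable at 0"
        "(\<lambda>w. f (x(i := x i + w))) field_differentiable at 0"
        using h1 h2 by (auto intro: holomorphic_on_imp_differentiable_at)
      then show ?thesis unfolding g_def by (simp add: deriv_diff dv)
    qed
    ultimately show ?thesis using e by (simp add: dist_norm)
  qed
  then show "\<exists>\<delta>>0. \<forall>y\<in>S. cdist d x y < \<delta> \<longrightarrow> dist (pd i f y) (pd i f x) < e"
    using \<delta>(1) r(1) by (intro exI[of _ "min \<delta> r"]) auto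
qed

text \<open>Between two points one moves along the coordinate axes, and on each segment the mean value
  inequality applies, since the partial derivative is close to its value at \<open>x\<close>.\<close>
lemma sep_holo_imp_strict:
  assumes S: "openin (top_of_set (Cn d)) S" and f: "continuous_on S f" "sep_holo d S f" and x: "x \<in> S"
  shows "strict_deriv d f (\<lambda>i. pd i f x) x"
  unfolding strict_deriv_def
proof (intro allI impI)
  fix e :: real assume e: "e > 0"
  obtain r where r: "r > 0" "\<And>y. y \<in> Cn d \<Longrightarrow> cdist d x y < r \<Longrightarrow> y \<in> S"
    using openin_Cn_ball[OF S x] by blast
  have "\<exists>\<delta>>0. \<forall>y\<in>S. cdist d x y < \<delta> \<longrightarrow> dist (pd i f y) (pd i f x) < e" if "i < d" for i
    using continuous_on_pd[OF S f that] x e unfolding continuous_on_Cn_iff[OF openin_imp_subset[OF S]]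
    by blast
  then have "\<forall>i\<in>{..<d}. \<exists>\<delta>>0. \<forall>y\<in>S. cdist d x y < \<delta> \<longrightarrow> dist (pd i f y) (pd i f x) < e" by blast
  then obtain \<delta>i where \<delta>i: "\<forall>i\<in>{..<d}. \<delta>i i > 0 \<and> (\<forall>y\<in>S. cdist d x y < \<delta>i i \<longrightarrow> dist (pd i f y) (pd i f x) < e)"
    unfolding bchoice_iff by blast
  define \<delta>0 where "\<delta>0 = Min (insert r (\<delta>i ` {..<d}))"
  have \<delta>0: "\<delta>0 > 0" "\<delta>0 \<le> r" "\<And>i. i < d \<Longrightarrow> \<delta>0 \<le> \<delta>i i"
    using \<delta>i r by (auto simp: \<delta>0_def)
  define \<delta> where "\<delta> = \<delta>0 / 3"
  have "cmod (f z - f y - (\<Sum>i<d. pd i f x * (z i - y i))) \<le> e * cdist d y z"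
    if y: "y \<in> Cn d" "cdist d x y < \<delta>" and z: "z \<in> Cn d" "cdist d x z < \<delta>" for y z
  proof -
    \<comment> \<open>move from \<open>y\<close> to \<open>z\<close> along one coordinate axis after the other\<close>
    define p where "p k = (\<lambda>i. if i < k then z i else y i)" for k
    have pC: "p k \<in> Cn d" for k using y z by (auto simp: p_def Cn_def)
    have pd: "cdist d x (p k) \<le> cdist d x y + cdist d x z" for k
      unfolding cdist_def sum.distrib[symmetric] by (rule sum_mono) (auto simp: p_def)
    have p0: "p 0 = y" by (simp add: p_def)
    have pz: "p d = z"
    proof
      fix i show "p d i = z i" using y z by (cases "i < d") (auto simp: p_def Cn_def)
    qed
    have step: "cmod ((f (p (Suc k)) - f (p k)) - pd k f x * (z k - y k)) \<le> e * cmod (z k - y k)"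
      if k: "k < d" for k
    proof -
      have in_ball: "cdist d x ((p k)(k := t)) < \<delta>0" if "t \<in> ball (x k) \<delta>" for t
        using cdist_fun_upd2[OF k, of x "p k" t] pd[of k] y z that
        by (auto simp: \<delta>_def dist_norm norm_minus_commute)
      have inS: "(p k)(k := t) \<in> S" if "t \<in> ball (x k) \<delta>" for t
        using r(2)[OF Cn_fun_upd[OF pC k]] in_ball[OF that] \<delta>0(2) by auto
      define G where "G t = f ((p k)(k := t)) - pd k f x * t" for t
      have "cmod (G (z k) - G (y k)) \<le> e * cmod (z k - y k)"
      proof (rule field_differentiable_bound[where S = "ball (x k) \<delta>"])
        fix t assume t: "t \<in> ball (x k) \<delta>"
        have "(\<lambda>w. f (((p k)(k := t))(k := w))) field_differentiable at (((p k)(k := t)) k)"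
          using f(2) inS[OF t] k unfolding sep_holo_def by blast
        then have "((\<lambda>w. f ((p k)(k := w))) has_field_derivative pd k f ((p k)(k := t))) (at t)"
          unfolding pd_def by (simp add: DERIV_deriv_iff_field_differentiable)
        then have "(G has_field_derivative pd k f ((p k)(k := t)) - pd k f x) (at t)"
          unfolding G_def by (auto intro!: derivative_eq_intros)
        then show "(G has_field_derivative pd k f ((p k)(k := t)) - pd k f x) (at t within ball (x k) \<delta>)"
          by (rule has_field_derivative_at_within)
        show "cmod (pd k f ((p k)(k := t)) - pd k f x) \<le> e"
        proof -
          have *: "\<forall>y\<in>S. cdist d x y < \<delta>i k \<longrightarrow> dist (pd k f y) (pd k f x) < e" using \<delta>i k by simp
          show ?thesis
            using *[rule_format, OF inS[OF t]] in_ball[OF t] \<delta>0(3)[OF k] by (simp add: dist_norm)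
        qed
      next
        show "z k \<in> ball (x k) \<delta>" "y k \<in> ball (x k) \<delta>"
          using coordinate_le_cdist[OF k, of z x] coordinate_le_cdist[OF k, of y x] y z
          by (auto simp: dist_norm norm_minus_commute)
      qed (rule convex_ball)
      moreover have "(p k)(k := z k) = p (Suc k)" "(p k)(k := y k) = p k"
        by (auto simp: p_def fun_eq_iff)
      ultimately show ?thesis by (simp add: G_def algebra_simps)
    qed
    have "f z - f y = (\<Sum>k<d. f (p (Suc k)) - f (p k))"
      using sum_lessThan_telescope[of "\<lambda>k. f (p k)" d] by (simp add: p0 pz)
    then have "f z - f y - (\<Sum>k<d. pd k f x * (z k - y k)) =
      (\<Sum>k<d. (f (p (Suc k)) - f (p k)) - pd k f x * (z k - y k))"
      by (simp add: sum_subtractf)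
    then have "cmod (f z - f y - (\<Sum>k<d. pd k f x * (z k - y k))) \<le> (\<Sum>k<d. e * cmod (z k - y k))"
      by (simp only:) (intro sum_norm_le step, simp)
    then show ?thesis by (simp add: cdist_def sum_distrib_left)
  qed
  then show "\<exists>\<delta>>0. \<forall>y\<in>Cn d. \<forall>z\<in>Cn d. cdist d x y < \<delta> \<longrightarrow> cdist d x z < \<delta> \<longrightarrow>
     cmod (f z - f y - (\<Sum>i<d. pd i f x * (z i - y i))) \<le> e * cdist d y z"
    using \<delta>0(1) by (intro exI[of _ \<delta>]) (auto simp: \<delta>_def)
qed

lemma strict_deriv_imp_holo:
  assumes S: "S \<subseteq> Cn d" and "\<And>x. x \<in> S \<Longrightarrow> \<exists>a. strict_deriv d f a x"
  shows "holo d S f"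
  unfolding holo_eps_delta[OF S]
proof
  fix x assume x: "x \<in> S"
  then obtain a where a: "strict_deriv d f a x" using assms(2) by blast
  have "\<exists>\<delta>>0. \<forall>y\<in>S. cdist d x y < \<delta> \<longrightarrow>
     cmod (f y - f x - (\<Sum>i<d. a i * (y i - x i))) \<le> e * cdist d x y" if "e > 0" for e
  proof -
    from a \<open>e > 0\<close> obtain \<delta> where \<delta>: "\<delta> > 0" "\<forall>y\<in>Cn d. \<forall>z\<in>Cn d. cdist d x y < \<delta> \<longrightarrow> cdist d x z < \<delta> \<longrightarrow>
     cmod (f z - f y - (\<Sum>i<d. a i * (z i - y i))) \<le> e * cdist d y z"
      unfolding strict_deriv_def by blast
    have xC: "x \<in> Cn d" using S x by blast
    have "cmod (f y - f x - (\<Sum>i<d. a i * (y i - x i))) \<le> e * cdist d x y"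
      if "y \<in> S" "cdist d x y < \<delta>" for y
      using \<delta>(2)[rule_format, OF xC, of y] \<delta>(1) that S by auto
    then show ?thesis using \<delta>(1) by blast
  qed
  then show "\<exists>a. \<forall>e>0. \<exists>\<delta>>0. \<forall>y\<in>S. cdist d x y < \<delta> \<longrightarrow>
     cmod (f y - f x - (\<Sum>i<d. a i * (y i - x i))) \<le> e * cdist d x y" by blast
qed

lemma holo_imp_sep:
  assumes S: "openin (top_of_set (Cn d)) S" and f: "holo d S f"
  shows "continuous_on S f" "sep_holo d S f"
proof -
  have SC: "S \<subseteq> Cn d" using openin_imp_subset[OF S] .
  have "\<exists>a. \<forall>e>0. \<exists>\<delta>>0. \<forall>y\<in>S. cdist d x y < \<delta> \<longrightarrow>
     cmod (f y - f x - (\<Sum>i<d. a i * (y i - x i))) \<le> e * cdist d x y" if "x \<in> S" for x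
    using f that unfolding holo_eps_delta[OF SC] by blast
  then have ex: thesis if "x \<in> S" "\<And>a. (\<And>e. e > 0 \<Longrightarrow> \<exists>\<delta>>0. \<forall>y\<in>S. cdist d x y < \<delta> \<longrightarrow>
     cmod (f y - f x - (\<Sum>i<d. a i * (y i - x i))) \<le> e * cdist d x y) \<Longrightarrow> thesis" for x thesis
    using that by meson
  show "continuous_on S f"
    unfolding continuous_on_Cn_iff[OF SC]
  proof (intro ballI allI impI)
    fix x and e :: real assume x: "x \<in> S" and e: "e > 0"
    obtain a where a: "\<And>e. e > 0 \<Longrightarrow> \<exists>\<delta>>0. \<forall>y\<in>S. cdist d x y < \<delta> \<longrightarrow>
       cmod (f y - f x - (\<Sum>i<d. a i * (y i - x i))) \<le> e * cdist d x y"
      using ex[OF x] by blast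
    obtain \<delta> where \<delta>: "\<delta> > 0" "\<And>y. y \<in> S \<Longrightarrow> cdist d x y < \<delta> \<Longrightarrow>
       cmod (f y - f x - (\<Sum>i<d. a i * (y i - x i))) \<le> 1 * cdist d x y"
      using a[of 1] by auto
    define M where "M = 1 + (\<Sum>i<d. cmod (a i))"
    have M: "M > 0" unfolding M_def by (simp add: add_pos_nonneg sum_nonneg)
    have "dist (f y) (f x) < e" if y: "y \<in> S" "cdist d x y < min \<delta> (e / M)" for y
    proof -
      have "cmod (\<Sum>i<d. a i * (y i - x i)) \<le> (\<Sum>i<d. cmod (a i) * cdist d x y)"
        by (intro sum_norm_le) (auto simp: norm_mult intro!: mult_left_mono coordinate_le_cdist)
      moreover have "cmod (f y - f x - (\<Sum>i<d. a i * (y i - x i))) \<le> 1 * cdist d x y"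
        using \<delta>(2)[of y] y by simp
      ultimately have "cmod (f y - f x) \<le> 1 * cdist d x y + (\<Sum>i<d. cmod (a i) * cdist d x y)"
        using norm_triangle_sub[of "f y - f x" "\<Sum>i<d. a i * (y i - x i)"] by linarith
      also have "\<dots> = M * cdist d x y"
        by (simp add: M_def sum_distrib_right distrib_right)
      also have "\<dots> < e" using y M by (simp add: pos_less_divide_eq mult.commute)
      finally show ?thesis by (simp add: dist_norm)
    qed
    then show "\<exists>\<delta>>0. \<forall>y\<in>S. cdist d x y < \<delta> \<longrightarrow> dist (f y) (f x) < e"
      using \<delta>(1) M e by (intro exI[of _ "min \<delta> (e / M)"]) auto
  qed
  show "sep_holo d S f"
    unfolding sep_holo_def
  proof (intro ballI allI impI)
    fix x i assume x: "x \<in> S" and i: "i < d"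
    obtain a where a: "\<And>e. e > 0 \<Longrightarrow> \<exists>\<delta>>0. \<forall>y\<in>S. cdist d x y < \<delta> \<longrightarrow>
       cmod (f y - f x - (\<Sum>i<d. a i * (y i - x i))) \<le> e * cdist d x y"
      using ex[OF x] by blast
    obtain r where r: "r > 0" "\<And>y. y \<in> Cn d \<Longrightarrow> cdist d x y < r \<Longrightarrow> y \<in> S"
      using openin_Cn_ball[OF S x] by blast
    have "((\<lambda>z. f (x(i := z))) has_field_derivative a i) (at (x i))"
      unfolding has_field_derivative_def has_derivative_at_alt
    proof (intro conjI allI impI bounded_linear_mult_right)
      fix e :: real assume "e > 0"
      then obtain \<delta> where \<delta>: "\<delta> > 0" "\<And>y. y \<in> S \<Longrightarrow> cdist d x y < \<delta> \<Longrightarrow>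
        cmod (f y - f x - (\<Sum>i<d. a i * (y i - x i))) \<le> e * cdist d x y"
        using a[of e] by auto
      have "cmod (f (x(i := w)) - f (x(i := x i)) - a i * (w - x i)) \<le> e * cmod (w - x i)"
        if "cmod (w - x i) < min \<delta> r" for w
      proof -
        have "x(i := w) \<in> S"
          using that SC x i by (intro r(2)) (auto simp: cdist_fun_upd)
        moreover have "(\<Sum>j<d. a j * ((x(i := w)) j - x j)) = a i * (w - x i)"
          by (subst sum.remove[of _ i]) (auto simp: i intro!: sum.neutral)
        ultimately show ?thesis
          using \<delta>(2)[of "x(i := w)"] that i by (simp add: cdist_fun_upd)
      qed
      then show "\<exists>\<delta>>0. \<forall>y. cmod (y - x i) < \<delta> \<longrightarrow>
          cmod (f (x(i := y)) - f (x(i := x i)) - a i * (y - x i)) \<le> e * cmod (y - x i)"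
        using \<delta>(1) r(1) by (intro exI[of _ "min \<delta> r"]) auto
    qed
    then show "(\<lambda>z. f (x(i := z))) field_differentiable at (x i)"
      unfolding field_differentiable_def by blast
  qed
qed

text \<open>
  Osgood's lemma. It reduces products, partial derivatives and limits to functions of one variable.
\<close>
theorem holo_iff:
  assumes "openin (top_of_set (Cn d)) S"
  shows "holo d S f \<longleftrightarrow> continuous_on S f \<and> sep_holo d S f"
proof safe
  assume "continuous_on S f" "sep_holo d S f"
  from sep_holo_imp_strict[OF assms this] show "holo d S f"
    by (intro strict_deriv_imp_holo[OF openin_imp_subset[OF assms]] exI)
qed (use holo_imp_sep[OF assms] in simp_all)

theorem holo_imp_strict:
  assumes "openin (top_of_set (Cn d)) S" "holo d S f" "x \<in> S"
  shows "strict_deriv d f (\<lambda>i. pd i f x) x"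
  by (rule sep_holo_imp_strict[OF assms(1) holo_imp_sep[OF assms(1,2)] assms(3)])

lemma holo_line_deriv:
  assumes "openin (top_of_set (Cn d)) S" "holo d S f" "x \<in> S" "i < d"
  shows "((\<lambda>z. f (x(i := z))) has_field_derivative pd i f x) (at (x i))"
  by (rule strict_deriv_line[OF holo_imp_strict[OF assms(1-3)] openin_CnD[OF assms(1,3)] assms(4)])

lemma holo_chain:
  fixes \<gamma> :: "complex \<Rightarrow> cvec"
  assumes "openin (top_of_set (Cn d)) S" "holo d S f" "\<gamma> t \<in> S" "eventually (\<lambda>s. \<gamma> s \<in> Cn d) (nhds t)"
    "\<And>i. i < d \<Longrightarrow> ((\<lambda>s. \<gamma> s i) has_field_derivative \<gamma>' i) (at t)"
  shows "((\<lambda>s. f (\<gamma> s)) has_field_derivative (\<Sum>i<d. pd i f (\<gamma> t) * \<gamma>' i)) (at t)"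
  using strict_deriv_chain[OF holo_imp_strict[OF assms(1-3)] assms(4,5)] .

lemma holo_cong:
  assumes "S \<subseteq> Cn d" "\<And>x. x \<in> S \<Longrightarrow> f x = g x"
  shows "holo d S f \<longleftrightarrow> holo d S g"
  unfolding holo_eps_delta[OF assms(1)] using assms(2) by (simp cong: ball_cong)

lemma sep_holo_subset: "sep_holo d S f \<Longrightarrow> S' \<subseteq> S \<Longrightarrow> sep_holo d S' f"
  unfolding sep_holo_def by blast

lemma holo_subset:
  assumes "openin (top_of_set (Cn d)) S" "openin (top_of_set (Cn d)) S'" "S' \<subseteq> S" "holo d S f"
  shows "holo d S' f"
  using assms(3) holo_imp_sep[OF assms(1,4)] unfolding holo_iff[OF assms(2)]
  by (auto intro: continuous_on_subset sep_holo_subset)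

lemma holo_local:
  assumes "\<And>x. x \<in> S \<Longrightarrow> \<exists>S'. openin (top_of_set (Cn d)) S' \<and> x \<in> S' \<and> holo d S' f"
    and "S \<subseteq> Cn d"
  shows "holo d S f"
proof (rule strict_deriv_imp_holo[OF assms(2)])
  fix x assume "x \<in> S"
  from assms(1)[OF this] obtain S' where "openin (top_of_set (Cn d)) S'" "holo d S' f" "x \<in> S'" by blast
  then show "\<exists>a. strict_deriv d f a x" by (intro exI) (rule holo_imp_strict)
qed

lemma holo_const [simp]: "holo d S (\<lambda>_. c)"
  unfolding holo_def by (intro ballI exI[of _ "\<lambda>_. 0"]) simp

lemma holo_coordinate:
  assumes "i < d" "S \<subseteq> Cn d"
  shows "holo d S (\<lambda>x. x i)"
proof (rule strict_deriv_imp_holo[OF assms(2)])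
  fix x
  have "(\<Sum>j<d. (if j = i then 1 else 0) * (z j - y j)) = z i - y i" for y z :: cvec
    by (subst sum.remove[of _ i]) (auto simp: assms(1) intro!: sum.neutral)
  then show "\<exists>a. strict_deriv d (\<lambda>x. x i) a x"
    unfolding strict_deriv_def by (intro exI[of _ "\<lambda>j. if j = i then 1 else 0"] allI impI exI[of _ 1]) auto
qed

context
  fixes d S assumes S: "openin (top_of_set (Cn d)) S"
begin

lemma holo_add: "holo d S f \<Longrightarrow> holo d S g \<Longrightarrow> holo d S (\<lambda>x. f x + g x)"
  unfolding holo_iff[OF S] sep_holo_def by (auto intro!: continuous_on_add field_differentiable_add)

lemma holo_diff: "holo d S f \<Longrightarrow> holo d S g \<Longrightarrow> holo d S (\<lambda>x. f x - g x)"
  unfolding holo_iff[OF S] sep_holo_def by (auto intro!: continuous_on_diff field_differentiable_diff)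

lemma holo_mult: "holo d S f \<Longrightarrow> holo d S g \<Longrightarrow> holo d S (\<lambda>x. f x * g x)"
  unfolding holo_iff[OF S] sep_holo_def by (auto intro!: continuous_on_mult field_differentiable_mult)

lemma holo_divide:
  "holo d S f \<Longrightarrow> holo d S g \<Longrightarrow> (\<And>x. x \<in> S \<Longrightarrow> g x \<noteq> 0) \<Longrightarrow> holo d S (\<lambda>x. f x / g x)"
  unfolding holo_iff[OF S] sep_holo_def by (auto intro!: continuous_on_divide field_differentiable_divide)

lemma holo_sum: "(\<And>i. i \<in> I \<Longrightarrow> holo d S (f i)) \<Longrightarrow> holo d S (\<lambda>x. \<Sum>i\<in>I. f i x)"
  by (induction I rule: infinite_finite_induct) (auto intro: holo_add)

end

lemma continuous_on_into_Cn:
  fixes F :: "'a::topological_space \<Rightarrow> cvec"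
  assumes "\<And>x. x \<in> S \<Longrightarrow> F x \<in> Cn e" "\<And>i. i < e \<Longrightarrow> continuous_on S (\<lambda>x. F x i)"
  shows "continuous_on S F"
proof (rule continuous_on_coordinatewise_then_product)
  fix i show "continuous_on S (\<lambda>x. F x i)"
  proof (cases "i < e")
    case False
    then have "continuous_on S (\<lambda>x. F x i) \<longleftrightarrow> continuous_on S (\<lambda>_. 0::complex)"
      using assms(1) by (intro continuous_on_cong) (auto simp: Cn_def)
    then show ?thesis by simp
  qed (rule assms(2))
qed

lemma eventually_line_in:
  assumes "openin (top_of_set (Cn d)) S" "x \<in> S" "i < d"
  shows "eventually (\<lambda>z. x(i := z) \<in> S) (nhds (x i))"
  using eventually_nhds_in_open[OF openin_Cn_line[OF assms]] assms(2) by simp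

lemma
  fixes F :: "cvec \<Rightarrow> cvec"
  assumes S: "openin (top_of_set (Cn d)) S" and S': "openin (top_of_set (Cn e)) S'"
    and FS: "\<And>x. x \<in> S \<Longrightarrow> F x \<in> S'" and F: "\<And>i. i < e \<Longrightarrow> holo d S (\<lambda>x. F x i)"
    and g: "holo e S' g"
  shows holo_compose: "holo d S (\<lambda>x. g (F x))"
    and pd_compose: "x \<in> S \<Longrightarrow> j < d \<Longrightarrow>
      pd j (\<lambda>x. g (F x)) x = (\<Sum>i<e. pd i g (F x) * pd j (\<lambda>x. F x i) x)"
proof -
  have deriv: "((\<lambda>z. g (F (x(j := z)))) has_field_derivative
      (\<Sum>i<e. pd i g (F x) * pd j (\<lambda>x. F x i) x)) (at (x j))" if x: "x \<in> S" "j < d" for x j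
  proof -
    have "((\<lambda>z. g (F (x(j := z)))) has_field_derivative
      (\<Sum>i<e. pd i g (F (x(j := x j))) * pd j (\<lambda>x. F x i) x)) (at (x j))"
    proof (rule holo_chain[OF S' g])
      show "F (x(j := x j)) \<in> S'" using FS x by simp
      show "eventually (\<lambda>s. F (x(j := s)) \<in> Cn e) (nhds (x j))"
        using eventually_line_in[OF S x] by eventually_elim (use FS openin_imp_subset[OF S'] in blast)
    qed (rule holo_line_deriv[OF S F x])
    then show ?thesis by simp
  qed
  have FC: "F x \<in> Cn e" if "x \<in> S" for x using openin_CnD[OF S' FS[OF that]] .
  have "continuous_on S F"
    by (rule continuous_on_into_Cn[OF FC]) (use holo_imp_sep[OF S F] in auto)
  then have "continuous_on S (\<lambda>x. g (F x))"
    by (rule continuous_on_compose2[OF holo_imp_sep(1)[OF S' g]]) (use FS in auto)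
  moreover have "sep_holo d S (\<lambda>x. g (F x))"
    unfolding sep_holo_def field_differentiable_def using deriv by blast
  ultimately show "holo d S (\<lambda>x. g (F x))" unfolding holo_iff[OF S] by blast
  show "pd j (\<lambda>x. g (F x)) x = (\<Sum>i<e. pd i g (F x) * pd j (\<lambda>x. F x i) x)" if "x \<in> S" "j < d"
    unfolding pd_def[of j "\<lambda>x. g (F x)"] using deriv[OF that] by (rule DERIV_imp_deriv)
qed

text \<open>Passes from local to uniform positive constants; used for Lipschitz constants, for the speed of
  convergence of difference quotients, and for the time during which a flow exists.\<close>
lemma compact_locally_uniform:
  fixes P :: "real \<Rightarrow> 'a::topological_space \<Rightarrow> bool"
  assumes "compact C" and mono: "\<And>e e' c. P e c \<Longrightarrow> 0 < e' \<Longrightarrow> e' \<le> e \<Longrightarrow> P e' c"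
    and loc: "\<And>c. c \<in> C \<Longrightarrow> \<exists>U. open U \<and> c \<in> U \<and> (\<exists>e>0. \<forall>c'\<in>U \<inter> C. P e c')"
  shows "\<exists>e>0. \<forall>c\<in>C. P e c"
proof -
  define \<C> where "\<C> = {U. open U \<and> (\<exists>e>0. \<forall>c'\<in>U \<inter> C. P e c')}"
  have "C \<subseteq> \<Union>\<C>" using loc unfolding \<C>_def by blast
  moreover have "\<forall>U\<in>\<C>. open U" by (auto simp: \<C>_def)
  ultimately obtain D where D: "D \<subseteq> \<C>" "finite D" "C \<subseteq> \<Union>D"
    using \<open>compact C\<close> by (meson compactE)
  from D(2,1) have "\<exists>e>0. \<forall>U\<in>D. \<forall>c'\<in>U \<inter> C. P e c'"
  proof (induction D)
    case (insert U D)
    then obtain e1 where e1: "e1 > 0" "\<forall>U\<in>D. \<forall>c'\<in>U \<inter> C. P e1 c'" by blast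
    from insert.prems obtain e2 where e2: "e2 > 0" "\<forall>c'\<in>U \<inter> C. P e2 c'" by (auto simp: \<C>_def)
    have "\<forall>U'\<in>insert U D. \<forall>c'\<in>U' \<inter> C. P (min e1 e2) c'"
      using e1 e2 mono[of e1 _ "min e1 e2"] mono[of e2 _ "min e1 e2"] by auto
    then show ?case using e1(1) e2(1) by (intro exI[of _ "min e1 e2"]) auto
  qed (auto intro: exI[of _ 1])
  then show ?thesis using D(3) by blast
qed

lemma diff_quot_uniform:
  fixes \<gamma> :: "'a::topological_space \<Rightarrow> cvec"
  assumes S: "openin (top_of_set (Cn d)) S" and f: "holo d S f" and i: "i < d"
    and C: "compact C" and \<gamma>: "continuous_on C \<gamma>" "\<gamma> ` C \<subseteq> S" and e: "e > 0"
  shows "\<exists>\<delta>>0. \<forall>c\<in>C. \<forall>t. t \<noteq> 0 \<and> cmod t < \<delta> \<longrightarrow> (\<gamma> c)(i := \<gamma> c i + t) \<in> S \<and>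
    cmod ((f ((\<gamma> c)(i := \<gamma> c i + t)) - f (\<gamma> c)) / t - pd i f (\<gamma> c)) \<le> e"
proof (rule compact_locally_uniform[OF C])
  fix c0 assume c0: "c0 \<in> C"
  then have x0: "\<gamma> c0 \<in> S" using \<gamma>(2) by blast
  then have x0C: "\<gamma> c0 \<in> Cn d" using openin_CnD[OF S] by blast
  obtain r where r: "r > 0" "\<And>y. y \<in> Cn d \<Longrightarrow> cdist d (\<gamma> c0) y < r \<Longrightarrow> y \<in> S"
    using openin_Cn_ball[OF S x0] by blast
  have e2: "e / 2 > 0" using e by simp
  obtain \<delta>1 where \<delta>1: "\<delta>1 > 0" "\<forall>y\<in>Cn d. \<forall>z\<in>Cn d. cdist d (\<gamma> c0) y < \<delta>1 \<longrightarrow> cdist d (\<gamma> c0) z < \<delta>1 \<longrightarrow>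
     cmod (f z - f y - (\<Sum>j<d. pd j f (\<gamma> c0) * (z j - y j))) \<le> e / 2 * cdist d y z"
    using holo_imp_strict[OF S f x0] e2 unfolding strict_deriv_def by blast
  have "continuous_on S (pd i f)" using continuous_on_pd[OF S holo_imp_sep[OF S f] i] .
  then obtain \<delta>2 where \<delta>2: "\<delta>2 > 0"
    "\<forall>y\<in>S. cdist d (\<gamma> c0) y < \<delta>2 \<longrightarrow> dist (pd i f y) (pd i f (\<gamma> c0)) < e / 2"
    using x0 e2 unfolding continuous_on_Cn_iff[OF openin_imp_subset[OF S]] by blast
  define \<delta> where "\<delta> = min r (min \<delta>1 \<delta>2) / 2"
  have \<delta>: "\<delta> > 0" using r \<delta>1 \<delta>2 by (simp add: \<delta>_def)
  have "continuous_on C (\<lambda>c. cdist d (\<gamma> c0) (\<gamma> c))"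
    by (intro continuous_on_cdist continuous_on_const \<gamma>(1))
  moreover have "cdist d (\<gamma> c0) (\<gamma> c0) \<in> {..<\<delta>}" using \<delta> by simp
  ultimately obtain U where U: "open U" "c0 \<in> U" "\<forall>c\<in>C. c \<in> U \<longrightarrow> cdist d (\<gamma> c0) (\<gamma> c) \<in> {..<\<delta>}"
    using c0 unfolding continuous_on_topological by (meson open_lessThan)
  have "(\<gamma> c)(i := \<gamma> c i + t) \<in> S \<and>
    cmod ((f ((\<gamma> c)(i := \<gamma> c i + t)) - f (\<gamma> c)) / t - pd i f (\<gamma> c)) \<le> e"
    if c: "c \<in> U" "c \<in> C" and t: "t \<noteq> 0" "cmod t < \<delta>" for c t
  proof -
    define y where "y = \<gamma> c"
    define z where "z = y(i := y i + t)"
    have yS: "y \<in> S" using c \<gamma>(2) by (auto simp: y_def)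
    have yC: "y \<in> Cn d" using openin_CnD[OF S yS] .
    have zC: "z \<in> Cn d" using yC i by (auto simp: z_def)
    have yd: "cdist d (\<gamma> c0) y < \<delta>" using U(3) c by (simp add: y_def)
    have yz: "cdist d y z = cmod t" by (simp add: z_def cdist_fun_upd[OF i])
    have zd: "cdist d (\<gamma> c0) z < 2 * \<delta>" using cdist_triangle[of d "\<gamma> c0" z y] yd yz t by simp
    have "z \<in> S" using zd by (intro r(2)[OF zC]) (simp add: \<delta>_def)
    have "(\<Sum>j<d. pd j f (\<gamma> c0) * (z j - y j)) = pd i f (\<gamma> c0) * t"
      by (subst sum.remove[of _ i]) (auto simp: z_def i intro!: sum.neutral)
    then have "cmod (f z - f y - pd i f (\<gamma> c0) * t) \<le> e / 2 * cmod t"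
      using \<delta>1(2)[rule_format, OF yC zC] yd zd \<delta> yz by (simp add: \<delta>_def)
    moreover have "(f z - f y) / t - pd i f (\<gamma> c0) = (f z - f y - pd i f (\<gamma> c0) * t) / t"
      using t by (simp add: field_simps)
    ultimately have "cmod ((f z - f y) / t - pd i f (\<gamma> c0)) \<le> e / 2"
      using t by (simp add: norm_divide pos_divide_le_eq)
    moreover have "cmod (pd i f (\<gamma> c0) - pd i f y) < e / 2"
      using \<delta>2(2)[rule_format, OF yS] yd \<delta> by (simp add: \<delta>_def dist_norm norm_minus_commute)
    moreover have "(f z - f y) / t - pd i f y =
        ((f z - f y) / t - pd i f (\<gamma> c0)) + (pd i f (\<gamma> c0) - pd i f y)" by simp
    ultimately have "cmod ((f z - f y) / t - pd i f y) \<le> e"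
      using norm_triangle_ineq[of "(f z - f y) / t - pd i f (\<gamma> c0)" "pd i f (\<gamma> c0) - pd i f y"] by simp
    then show ?thesis using \<open>z \<in> S\<close> by (simp add: y_def z_def)
  qed
  then show "\<exists>U. open U \<and> c0 \<in> U \<and> (\<exists>\<delta>>0. \<forall>c\<in>U \<inter> C. \<forall>t. t \<noteq> 0 \<and> cmod t < \<delta> \<longrightarrow>
    (\<gamma> c)(i := \<gamma> c i + t) \<in> S \<and> cmod ((f ((\<gamma> c)(i := \<gamma> c i + t)) - f (\<gamma> c)) / t - pd i f (\<gamma> c)) \<le> e)"
    using U \<delta> by blast
qed auto

lemma diff_quot_uniform_limit:
  fixes \<gamma> :: "'a::topological_space \<Rightarrow> cvec"
  assumes "openin (top_of_set (Cn d)) S" "holo d S f" "i < d"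
    "compact C" "continuous_on C \<gamma>" "\<gamma> ` C \<subseteq> S"
  shows "uniform_limit C (\<lambda>t c. (f ((\<gamma> c)(i := \<gamma> c i + t)) - f (\<gamma> c)) / t) (\<lambda>c. pd i f (\<gamma> c)) (at 0)"
    and "eventually (\<lambda>t. \<forall>c\<in>C. (\<gamma> c)(i := \<gamma> c i + t) \<in> S) (at 0)"
proof -
  show "uniform_limit C (\<lambda>t c. (f ((\<gamma> c)(i := \<gamma> c i + t)) - f (\<gamma> c)) / t) (\<lambda>c. pd i f (\<gamma> c)) (at 0)"
    unfolding uniform_limit_iff
  proof (intro allI impI)
    fix e :: real assume "e > 0"
    then have "e / 2 > 0" by simp
    from diff_quot_uniform[OF assms this] obtain \<delta> where \<delta>: "\<delta> > 0"
      "\<forall>c\<in>C. \<forall>t. t \<noteq> 0 \<and> cmod t < \<delta> \<longrightarrow> (\<gamma> c)(i := \<gamma> c i + t) \<in> S \<and>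
        cmod ((f ((\<gamma> c)(i := \<gamma> c i + t)) - f (\<gamma> c)) / t - pd i f (\<gamma> c)) \<le> e / 2" by blast
    have "dist ((f ((\<gamma> c)(i := \<gamma> c i + t)) - f (\<gamma> c)) / t) (pd i f (\<gamma> c)) < e"
      if "c \<in> C" "t \<noteq> 0" "cmod t < \<delta>" for c t
      using \<delta>(2)[rule_format, OF that(1), of t] that \<open>e > 0\<close> by (simp add: dist_norm)
    then show "\<forall>\<^sub>F t in at 0. \<forall>c\<in>C. dist ((f ((\<gamma> c)(i := \<gamma> c i + t)) - f (\<gamma> c)) / t) (pd i f (\<gamma> c)) < e"
      unfolding eventually_at using \<delta>(1) by (intro exI[of _ \<delta>]) (auto simp: dist_norm)
  qed
  from diff_quot_uniform[OF assms, of 1] obtain \<delta> where "\<delta> > 0"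
      "\<forall>c\<in>C. \<forall>t. t \<noteq> 0 \<and> cmod t < \<delta> \<longrightarrow> (\<gamma> c)(i := \<gamma> c i + t) \<in> S" by auto
  then show "eventually (\<lambda>t. \<forall>c\<in>C. (\<gamma> c)(i := \<gamma> c i + t) \<in> S) (at 0)"
    unfolding eventually_at by (intro exI[of _ \<delta>]) (auto simp: dist_norm)
qed

text \<open>In the direction of another variable, \<open>pd i f\<close> is a locally uniform limit of difference quotients,
  which are holomorphic.\<close>
theorem holo_pd:
  assumes S: "openin (top_of_set (Cn d)) S" and f: "holo d S f" and i: "i < d"
  shows "holo d S (pd i f)"
  unfolding holo_iff[OF S]
proof
  note sep = holo_imp_sep[OF S f]
  show "continuous_on S (pd i f)" using continuous_on_pd[OF S sep i] .
  show "sep_holo d S (pd i f)"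
    unfolding sep_holo_def
  proof (intro ballI allI impI)
    fix x j assume x: "x \<in> S" and j: "j < d"
    have op: "open {z. x(j := z) \<in> S}" "x j \<in> {z. x(j := z) \<in> S}"
      using openin_Cn_line[OF S x j] x by auto
    have "(\<lambda>z. pd i f (x(j := z))) holomorphic_on ball (x j) s" if s: "s > 0" "cball (x j) s \<subseteq> {z. x(j := z) \<in> S}" for s
    proof (cases "j = i")
      case True
      have "(deriv (\<lambda>w. f (x(j := w)))) holomorphic_on {z. x(j := z) \<in> S}"
        using sep_holo_line[OF sep(2) j] op(1) by (rule holomorphic_deriv)
      moreover have "deriv (\<lambda>w. f (x(j := w))) = (\<lambda>z. pd i f (x(j := z)))"
        unfolding pd_def by (simp add: True)
      ultimately have "(\<lambda>z. pd i f (x(j := z))) holomorphic_on {z. x(j := z) \<in> S}" by simp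
      then show ?thesis by (rule holomorphic_on_subset) (use s(2) ball_subset_cball in blast)
    next
      case False
      have c\<gamma>: "continuous_on (cball (x j) s) (\<lambda>w. x(j := w))"
        by (intro continuous_on_fun_upd continuous_on_const continuous_on_id)
      have \<gamma>S: "(\<lambda>w. x(j := w)) ` cball (x j) s \<subseteq> S" using s(2) by blast
      note Q = diff_quot_uniform_limit[OF S f i compact_cball c\<gamma> \<gamma>S]
      have "eventually (\<lambda>t. continuous_on (cball (x j) s)
           (\<lambda>w. (f ((x(j := w))(i := (x(j := w)) i + t)) - f (x(j := w))) / t) \<and>
         (\<lambda>w. (f ((x(j := w))(i := (x(j := w)) i + t)) - f (x(j := w))) / t) holomorphic_on ball (x j) s) (at 0)"
        using Q(2) eventually_neq_at_within[of 0]
      proof eventually_elim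
        case (elim t)
        define Z where "Z = {z. x(j := z) \<in> S} \<inter> {z. (x(i := x i + t))(j := z) \<in> S}"
        have com: "(x(j := w))(i := (x(j := w)) i + t) = (x(i := x i + t))(j := w)" for w
          using False by (auto simp: fun_eq_iff)
        have "(\<lambda>w. (f ((x(i := x i + t))(j := w)) - f (x(j := w))) / t) holomorphic_on Z"
          using elim(2) sep_holo_line[OF sep(2) j, of x] sep_holo_line[OF sep(2) j, of "x(i := x i + t)"]
          unfolding Z_def
          by (intro holomorphic_on_divide holomorphic_on_diff) (auto intro: holomorphic_on_subset)
        moreover have "cball (x j) s \<subseteq> Z"
          unfolding Z_def using s(2) elim(1) com by auto
        ultimately have "(\<lambda>w. (f ((x(i := x i + t))(j := w)) - f (x(j := w))) / t) holomorphic_on cball (x j) s"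
          by (rule holomorphic_on_subset)
        then show ?case unfolding com
          using holomorphic_on_imp_continuous_on holomorphic_on_subset ball_subset_cball by blast
      qed
      from holomorphic_uniform_limit[OF this Q(1)] show ?thesis by auto
    qed
    moreover obtain s where "s > 0" "cball (x j) s \<subseteq> {z. x(j := z) \<in> S}"
      using op open_contains_cball by blast
    ultimately show "(\<lambda>z. pd i f (x(j := z))) field_differentiable at (x j)"
      by (meson centre_in_ball holomorphic_on_imp_differentiable_at open_ball)
  qed
qed

lemma holo_pd_funpow:
  assumes "openin (top_of_set (Cn d)) S" "holo d S f" "i < d"
  shows "holo d S ((pd i ^^ k) f)"
  by (induction k) (auto intro: assms holo_pd)

lemma pd_funpow: "(pd i ^^ k) f x = (deriv ^^ k) (\<lambda>z. f (x(i := z))) (x i)"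
proof (induction k arbitrary: x)
  case (Suc k)
  have "(pd i ^^ Suc k) f x = deriv (\<lambda>z. (pd i ^^ k) f (x(i := z))) (x i)" by (simp add: pd_def)
  also have "\<dots> = deriv (\<lambda>z. (deriv ^^ k) (\<lambda>w. f (x(i := w))) z) (x i)" by (simp only: Suc fun_upd_upd fun_upd_same)
  finally show ?case by (simp only: funpow.simps o_apply)
qed simp

section \<open>Invariance of domain and the inverse function theorem\<close>

text \<open>Real and imaginary parts are interleaved, so that \<open>Cn d\<close> becomes the Euclidean space of dimension
  \<open>2 * d\<close>, where invariance of domain is known.\<close>
definition Cn_to_R :: "cvec \<Rightarrow> nat \<Rightarrow> real" where
  "Cn_to_R x k = (if even k then Re (x (k div 2)) else Im (x (k div 2)))"

definition R_to_Cn :: "(nat \<Rightarrow> real) \<Rightarrow> cvec" where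
  "R_to_Cn y i = Complex (y (2 * i)) (y (2 * i + 1))"

lemma R_to_Cn_to_R [simp]: "R_to_Cn (Cn_to_R x) = x"
  by (auto simp: R_to_Cn_def Cn_to_R_def fun_eq_iff complex_eq_iff)

lemma Cn_to_R_to_Cn [simp]: "Cn_to_R (R_to_Cn y) = y"
  by (auto simp: R_to_Cn_def Cn_to_R_def fun_eq_iff)

lemma continuous_Cn_to_R: "continuous_on S Cn_to_R"
proof (rule continuous_on_coordinatewise_then_product)
  fix k
  have "continuous_on S (\<lambda>x. Re (x (k div 2)))" "continuous_on S (\<lambda>x. Im (x (k div 2)))"
    by (intro continuous_on_Re continuous_on_Im continuous_on_coordinate continuous_on_id)+
  then show "continuous_on S (\<lambda>x. Cn_to_R x k)"
    by (cases "even k") (simp_all add: Cn_to_R_def)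
qed

lemma continuous_R_to_Cn: "continuous_on S R_to_Cn"
proof (rule continuous_on_coordinatewise_then_product)
  fix i
  have *: "continuous_on S (\<lambda>y::nat \<Rightarrow> real. y k)" for k
    by (rule continuous_on_product_then_coordinatewise[OF continuous_on_id])
  show "continuous_on S (\<lambda>x. R_to_Cn x i)"
    unfolding R_to_Cn_def Complex_eq
    by (intro continuous_on_add continuous_on_mult continuous_on_const continuous_on_of_real *)
qed

lemma Cn_to_R_mem: "Cn_to_R x \<in> topspace (Euclidean_space (2 * d)) \<longleftrightarrow> x \<in> Cn d"
proof -
  have "(\<forall>i\<ge>2 * d. Cn_to_R x i = 0) \<longleftrightarrow> (\<forall>i\<ge>d. x i = 0)"
  proof
    assume "\<forall>i\<ge>2 * d. Cn_to_R x i = 0"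
    then have "Cn_to_R x (2 * i) = 0 \<and> Cn_to_R x (2 * i + 1) = 0" if "i \<ge> d" for i using that by simp
    then show "\<forall>i\<ge>d. x i = 0" by (auto simp: Cn_to_R_def complex_eq_iff)
  next
    assume "\<forall>i\<ge>d. x i = 0"
    then have "x (i div 2) = 0" if "i \<ge> 2 * d" for i using that by simp
    then show "\<forall>i\<ge>2 * d. Cn_to_R x i = 0" by (simp add: Cn_to_R_def)
  qed
  then show ?thesis by (simp add: topspace_Euclidean_space Cn_def)
qed

lemma Euclidean_space_top_of_set: "Euclidean_space n = top_of_set (topspace (Euclidean_space n))"
  by (simp add: Euclidean_space_def euclidean_product_topology topspace_Euclidean_space)

lemma homeomorphism_Cn_Euclidean:
  "homeomorphism (Cn d) (topspace (Euclidean_space (2 * d))) Cn_to_R R_to_Cn"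
proof (rule homeomorphismI)
  show "R_to_Cn ` topspace (Euclidean_space (2 * d)) \<subseteq> Cn d"
    by (rule image_subsetI) (simp add: Cn_to_R_mem[symmetric])
  show "Cn_to_R ` Cn d \<subseteq> topspace (Euclidean_space (2 * d))"
    by (rule image_subsetI) (simp add: Cn_to_R_mem)
qed (simp_all add: continuous_Cn_to_R continuous_R_to_Cn)

theorem invariance_of_domain_Cn:
  assumes S: "openin (top_of_set (Cn d)) S" and f: "continuous_on S f" "f ` S \<subseteq> Cn d" "inj_on f S"
  shows "openin (top_of_set (Cn d)) (f ` S)"
proof -
  let ?E = "topspace (Euclidean_space (2 * d))"
  define F where "F = Cn_to_R \<circ> f \<circ> R_to_Cn"
  define U where "U = Cn_to_R ` S"
  have oU: "openin (Euclidean_space (2 * d)) U"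
    using homeomorphism_imp_open_map[OF homeomorphism_Cn_Euclidean S]
    by (subst Euclidean_space_top_of_set) (simp add: U_def)
  have SC: "S \<subseteq> Cn d" using openin_imp_subset[OF S] .
  have UE: "U \<subseteq> ?E" using SC by (auto simp: U_def Cn_to_R_mem)
  have contF: "continuous_on U F" unfolding F_def
    by (intro continuous_on_compose continuous_R_to_Cn continuous_Cn_to_R)
       (auto simp: U_def image_image intro: f(1))
  have FU: "F ` U = Cn_to_R ` (f ` S)" by (simp add: F_def U_def image_image)
  have "openin (Euclidean_space (2 * d)) (F ` U)"
  proof (rule invariance_of_domain_Euclidean_space[OF oU])
    have "subtopology (Euclidean_space (2 * d)) U = top_of_set U"
      using UE by (subst Euclidean_space_top_of_set) (simp add: subtopology_subtopology Int_absorb1)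
    moreover have "F ` U \<subseteq> ?E" unfolding FU using f(2) by (auto simp: Cn_to_R_mem)
    ultimately show "continuous_map (subtopology (Euclidean_space (2 * d)) U) (Euclidean_space (2 * d)) F"
      using contF by (subst (2) Euclidean_space_top_of_set) auto
    show "inj_on F U"
    proof (rule inj_onI)
      fix a b assume "a \<in> U" "b \<in> U" "F a = F b"
      then obtain x y where xy: "x \<in> S" "y \<in> S" "a = Cn_to_R x" "b = Cn_to_R y" by (auto simp: U_def)
      with \<open>F a = F b\<close> have "R_to_Cn (Cn_to_R (f x)) = R_to_Cn (Cn_to_R (f y))" by (simp add: F_def)
      then show "a = b" using xy f(3) by (simp add: inj_on_eq_iff)
    qed
  qed
  then have "openin (top_of_set ?E) (Cn_to_R ` (f ` S))"
    unfolding FU by (subst (asm) Euclidean_space_top_of_set)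
  then have "openin (top_of_set (Cn d)) (R_to_Cn ` (Cn_to_R ` (f ` S)))"
    using homeomorphism_imp_open_map[OF homeomorphism_symD[OF homeomorphism_Cn_Euclidean]] by blast
  then show ?thesis by (simp add: image_image)
qed

lemma Cn_mono: "e \<le> d \<Longrightarrow> Cn e \<subseteq> Cn d"
  by (auto simp: Cn_def)

text \<open>A space of smaller dimension has empty interior in \<open>Cn d\<close>, whereas invariance of domain would make
  the image of \<open>S\<close> open there.\<close>
lemma openin_Cn_dim_le:
  assumes S: "openin (top_of_set (Cn d)) S" "S \<noteq> {}"
    and f: "continuous_on S f" "f ` S \<subseteq> Cn e" "inj_on f S"
  shows "d \<le> e"
proof (rule ccontr)
  assume "\<not> d \<le> e"
  then have ed: "e < d" by simp
  have "openin (top_of_set (Cn d)) (f ` S)"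
    using f Cn_mono[of e d] ed by (intro invariance_of_domain_Cn S) auto
  moreover obtain x where x: "x \<in> f ` S" using S(2) by blast
  ultimately obtain r where r: "r > 0" "\<And>y. y \<in> Cn d \<Longrightarrow> cdist d x y < r \<Longrightarrow> y \<in> f ` S"
    using openin_Cn_ball by blast
  have xe: "x e = 0" and xC: "x \<in> Cn d" using x f(2) Cn_mono[of e d] ed by (auto simp: Cn_def)
  have "x(e := of_real (r / 2)) \<in> f ` S"
    using r(1) xe by (intro r(2)) (auto simp: cdist_fun_upd[OF ed] intro!: Cn_fun_upd xC ed)
  then have "x(e := of_real (r / 2)) \<in> Cn e" using f(2) by blast
  then have "(x(e := of_real (r / 2))) e = 0" unfolding Cn_def by blast
  then show False using r(1) by simp
qed

text \<open>The image is open by invariance of domain, and it is invariant under scaling, so it is everything.\<close>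
lemma injective_matrix_surj:
  assumes inj: "\<And>v. v \<in> Cn d \<Longrightarrow> (\<And>k. k < d \<Longrightarrow> (\<Sum>j<d. A k j * v j) = 0) \<Longrightarrow> v = (\<lambda>_. 0)"
    and w: "w \<in> Cn d"
  shows "\<exists>v\<in>Cn d. \<forall>k<d. (\<Sum>j<d. A k j * v j) = (w k :: complex)"
proof -
  define L where "L v = (\<lambda>k. if k < d then \<Sum>j<d. A k j * v j else 0)" for v :: cvec
  have LC: "L ` Cn d \<subseteq> Cn d" by (auto simp: L_def Cn_def)
  have contL: "continuous_on (Cn d) L"
    by (rule continuous_on_into_Cn[of _ _ d])
       (auto simp: L_def Cn_def intro!: continuous_on_sum continuous_on_mult continuous_on_const
         continuous_on_product_then_coordinatewise[OF continuous_on_id])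
  have diff: "L (\<lambda>i. v i - v' i) = (\<lambda>k. L v k - L v' k)" for v v'
    by (auto simp: L_def fun_eq_iff sum_subtractf right_diff_distrib)
  have scale: "L (\<lambda>i. c * v i) = (\<lambda>k. c * L v k)" for c v
    by (auto simp: L_def fun_eq_iff sum_distrib_left mult_ac)
  have "inj_on L (Cn d)"
  proof (rule inj_onI)
    fix v v' assume v: "v \<in> Cn d" "v' \<in> Cn d" "L v = L v'"
    then have 0: "L (\<lambda>i. v i - v' i) = (\<lambda>_. 0)" by (simp add: diff)
    have "(\<lambda>i. v i - v' i) = (\<lambda>_. 0)"
    proof (rule inj)
      fix k assume "k < d" then show "(\<Sum>j<d. A k j * (v j - v' j)) = 0"
        using fun_cong[OF 0, of k] by (simp add: L_def)
    qed (use v in \<open>auto simp: Cn_def\<close>)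
    then show "v = v'" by (auto simp: fun_eq_iff)
  qed
  then have "openin (top_of_set (Cn d)) (L ` Cn d)"
    by (intro invariance_of_domain_Cn contL LC) auto
  moreover have "(\<lambda>_. 0) \<in> L ` Cn d"
    by (rule image_eqI[of _ _ "\<lambda>_. 0"]) (auto simp: L_def Cn_def fun_eq_iff)
  ultimately obtain r where r: "r > 0" "\<And>y. y \<in> Cn d \<Longrightarrow> cdist d (\<lambda>_. 0) y < r \<Longrightarrow> y \<in> L ` Cn d"
    using openin_Cn_ball by blast
  define c where "c = r / (2 * (cdist d (\<lambda>_. 0) w + 1))"
  have cp: "cdist d (\<lambda>_. 0) w + 1 > 0" by (simp add: add_nonneg_pos)
  have c: "c > 0" using cp r(1) by (simp add: c_def)
  have "cdist d (\<lambda>_. 0) (\<lambda>i. of_real c * w i) = c * cdist d (\<lambda>_. 0) w"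
    using c by (simp add: cdist_def norm_mult sum_distrib_left)
  also have "\<dots> < r"
  proof -
    have "c * cdist d (\<lambda>_. 0) w \<le> c * (cdist d (\<lambda>_. 0) w + 1)" using c by simp
    also have "\<dots> = r / 2" using cp by (simp add: c_def divide_simps)
    finally show ?thesis using r(1) by simp
  qed
  finally have "(\<lambda>i. of_real c * w i) \<in> L ` Cn d"
    using w by (intro r(2)) (auto simp: Cn_def)
  then obtain v where v: "v \<in> Cn d" "L v = (\<lambda>i. of_real c * w i)" by (metis imageE)
  have Lv: "L (\<lambda>i. (1 / of_real c) * v i) = w"
    unfolding scale v(2) using c by (auto simp: fun_eq_iff)
  show ?thesis
  proof (intro bexI[of _ "\<lambda>i. (1 / of_real c) * v i"] allI impI)
    fix k assume "k < d"
    then show "(\<Sum>j<d. A k j * (1 / complex_of_real c * v j)) = w k"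
      using fun_cong[OF Lv, of k] by (simp add: L_def)
  qed (use v(1) in \<open>auto simp: Cn_def\<close>)
qed

lemma injective_matrix_inverse:
  assumes inj: "\<And>v. v \<in> Cn d \<Longrightarrow> (\<And>k. k < d \<Longrightarrow> (\<Sum>j<d. A k j * v j) = 0) \<Longrightarrow> v = (\<lambda>_. 0)"
  shows "\<exists>B::nat \<Rightarrow> nat \<Rightarrow> complex. \<forall>v\<in>Cn d. \<forall>i<d. v i = (\<Sum>k<d. B i k * (\<Sum>j<d. A k j * v j))"
proof -
  have "\<exists>v\<in>Cn d. \<forall>k<d. (\<Sum>j<d. A k j * v j) = (if k = l then 1 else 0)" if "l < d" for l
    using injective_matrix_surj[of d A "\<lambda>k. if k = l then 1 else 0"] inj that by (auto simp: Cn_def)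
  then have "\<forall>l\<in>{..<d}. \<exists>v. v \<in> Cn d \<and> (\<forall>k<d. (\<Sum>j<d. A k j * v j) = (if k = l then 1 else 0))" by blast
  from bchoice[OF this] obtain b where "\<forall>l\<in>{..<d}. b l \<in> Cn d \<and> (\<forall>k<d. (\<Sum>j<d. A k j * b l j) = (if k = l then 1 else 0))"
    by (rule exE)
  then have b: "\<And>l. l < d \<Longrightarrow> b l \<in> Cn d"
    and bA: "\<And>l k. l < d \<Longrightarrow> k < d \<Longrightarrow> (\<Sum>j<d. A k j * b l j) = (if k = l then 1 else 0)" by simp_all
  have "v i = (\<Sum>l<d. b l i * (\<Sum>j<d. A l j * v j))" if v: "v \<in> Cn d" for v i
  proof -
    define c where "c l = (\<Sum>j<d. A l j * v j)" for l
    have "(\<lambda>i. v i - (\<Sum>l<d. b l i * c l)) = (\<lambda>_. 0)"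
    proof (rule inj)
      have "(\<Sum>l<d. b l i * c l) = 0" if "i \<ge> d" for i
      proof (intro sum.neutral ballI)
        fix l assume "l \<in> {..<d}"
        then show "b l i * c l = 0" using b[of l] that by (simp add: Cn_def)
      qed
      then show "(\<lambda>i. v i - (\<Sum>l<d. b l i * c l)) \<in> Cn d" using v by (auto simp: Cn_def)
      fix k assume k: "k < d"
      have "(\<Sum>j<d. A k j * (\<Sum>l<d. b l j * c l)) = (\<Sum>j<d. \<Sum>l<d. A k j * b l j * c l)"
        by (simp add: sum_distrib_left mult.assoc)
      also have "\<dots> = (\<Sum>l<d. \<Sum>j<d. A k j * b l j * c l)" by (rule sum.swap)
      also have "\<dots> = (\<Sum>l<d. (\<Sum>j<d. A k j * b l j) * c l)" by (simp add: sum_distrib_right)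
      also have "\<dots> = (\<Sum>l<d. (if k = l then 1 else 0) * c l)"
        by (rule sum.cong) (simp_all add: bA k)
      also have "\<dots> = c k" using k by (subst sum.remove[of _ k]) (auto intro!: sum.neutral)
      finally have "(\<Sum>j<d. A k j * v j) - (\<Sum>j<d. A k j * (\<Sum>l<d. b l j * c l)) = 0"
        by (simp add: c_def)
      then show "(\<Sum>j<d. A k j * (v j - (\<Sum>l<d. b l j * c l))) = 0"
        by (simp only: right_diff_distrib sum_subtractf)
    qed
    from fun_cong[OF this, of i] show ?thesis
      unfolding c_def by (rule iffD2[OF eq_iff_diff_eq_0])
  qed
  then show ?thesis by (intro exI[of _ "\<lambda>i l. b l i"] ballI allI impI)
qed

lemma common_radius:
  fixes P :: "nat \<Rightarrow> real \<Rightarrow> bool"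
  assumes "\<And>k. k < n \<Longrightarrow> \<exists>\<delta>>0. P k \<delta>" "\<And>k \<delta> \<delta>'. P k \<delta> \<Longrightarrow> 0 < \<delta>' \<Longrightarrow> \<delta>' \<le> \<delta> \<Longrightarrow> P k \<delta>'"
  shows "\<exists>\<delta>>0. \<forall>k<n. P k \<delta>"
  using assms(1)
proof (induction n)
  case (Suc n)
  obtain \<delta>1 where 1: "\<delta>1 > 0" "\<forall>k<n. P k \<delta>1" using Suc by (meson less_SucI)
  obtain \<delta>2 where 2: "\<delta>2 > 0" "P n \<delta>2" using Suc.prems[of n] by auto
  have "P k (min \<delta>1 \<delta>2)" if "k < Suc n" for k
    using that 1 2 assms(2)[of k \<delta>1 "min \<delta>1 \<delta>2"] assms(2)[of k \<delta>2 "min \<delta>1 \<delta>2"] by (cases "k = n") auto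
  then show ?case using 1 2 by (intro exI[of _ "min \<delta>1 \<delta>2"]) auto
qed (auto intro: exI[of _ 1])

lemma strict_deriv_common:
  fixes F :: "cvec \<Rightarrow> cvec"
  assumes "\<And>k. k < n \<Longrightarrow> strict_deriv d (\<lambda>x. F x k) (A k) x" "e > 0"
  obtains \<delta> where "\<delta> > 0" "\<And>k y z. k < n \<Longrightarrow> y \<in> Cn d \<Longrightarrow> z \<in> Cn d \<Longrightarrow> cdist d x y < \<delta> \<Longrightarrow> cdist d x z < \<delta> \<Longrightarrow>
     cmod (F z k - F y k - (\<Sum>i<d. A k i * (z i - y i))) \<le> e * cdist d y z"
proof -
  have "\<exists>\<delta>>0. \<forall>k<n. \<forall>y\<in>Cn d. \<forall>z\<in>Cn d. cdist d x y < \<delta> \<longrightarrow> cdist d x z < \<delta> \<longrightarrow>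
     cmod (F z k - F y k - (\<Sum>i<d. A k i * (z i - y i))) \<le> e * cdist d y z"
  proof (rule common_radius[where P = "\<lambda>k \<delta>. \<forall>y\<in>Cn d. \<forall>z\<in>Cn d. cdist d x y < \<delta> \<longrightarrow> cdist d x z < \<delta> \<longrightarrow>
     cmod (F z k - F y k - (\<Sum>i<d. A k i * (z i - y i))) \<le> e * cdist d y z"])
    fix k assume "k < n"
    from assms(1)[OF this] assms(2)
    show "\<exists>\<delta>>0. \<forall>y\<in>Cn d. \<forall>z\<in>Cn d. cdist d x y < \<delta> \<longrightarrow> cdist d x z < \<delta> \<longrightarrow>
       cmod (F z k - F y k - (\<Sum>i<d. A k i * (z i - y i))) \<le> e * cdist d y z"
      unfolding strict_deriv_def by blast
  qed auto
  then show thesis using that by (elim exE conjE) simp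
qed

text \<open>The inverse matrix bounds \<open>z - y\<close> by the linear part of \<open>F z - F y\<close>, and the error of the linear
  approximation is absorbed by choosing it small compared with that bound.\<close>
lemma strict_expansive:
  fixes F :: "cvec \<Rightarrow> cvec"
  assumes F: "\<And>k. k < d \<Longrightarrow> strict_deriv d (\<lambda>x. F x k) (A k) x"
    and inj: "\<And>v. v \<in> Cn d \<Longrightarrow> (\<And>k. k < d \<Longrightarrow> (\<Sum>j<d. A k j * v j) = 0) \<Longrightarrow> v = (\<lambda>_. 0)"
  shows "\<exists>c>0. \<exists>\<delta>>0. \<forall>y\<in>Cn d. \<forall>z\<in>Cn d. cdist d x y < \<delta> \<longrightarrow> cdist d x z < \<delta> \<longrightarrow>
    c * cdist d y z \<le> cdist d (F y) (F z)"
proof -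
  obtain B where B: "\<And>v i. v \<in> Cn d \<Longrightarrow> i < d \<Longrightarrow> v i = (\<Sum>k<d. B i k * (\<Sum>j<d. A k j * v j))"
    proof -
    have "\<exists>B::nat \<Rightarrow> nat \<Rightarrow> complex. \<forall>v\<in>Cn d. \<forall>i<d. v i = (\<Sum>k<d. B i k * (\<Sum>j<d. A k j * v j))"
      by (rule injective_matrix_inverse, rule inj)
    then obtain B where B: "\<forall>v\<in>Cn d. \<forall>i<d. v i = (\<Sum>k<d. B i k * (\<Sum>j<d. A k j * v j))" by (rule exE)
    show ?thesis by (rule that[of B], rule B[rule_format])
  qed
  define C where "C = 1 + (\<Sum>i<d. \<Sum>k<d. cmod (B i k))"
  have C: "C > 0" unfolding C_def by (intro add_pos_nonneg sum_nonneg) auto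
  define \<epsilon> where "\<epsilon> = 1 / (2 * C * (real d + 1))"
  have \<epsilon>: "\<epsilon> > 0" using C by (simp add: \<epsilon>_def)
  obtain \<delta> where \<delta>: "\<delta> > 0"
    "\<And>k y z. k < d \<Longrightarrow> y \<in> Cn d \<Longrightarrow> z \<in> Cn d \<Longrightarrow> cdist d x y < \<delta> \<Longrightarrow> cdist d x z < \<delta> \<Longrightarrow>
     cmod (F z k - F y k - (\<Sum>i<d. A k i * (z i - y i))) \<le> \<epsilon> * cdist d y z"
      by (rule strict_deriv_common[of d d F A x \<epsilon>], erule F, rule \<epsilon>, rule that)
  have "1 / (2 * C) * cdist d y z \<le> cdist d (F y) (F z)"
    if y: "y \<in> Cn d" "cdist d x y < \<delta>" and z: "z \<in> Cn d" "cdist d x z < \<delta>" for y z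
  proof -
    define a where "a k = (\<Sum>i<d. A k i * (z i - y i))" for k
    have vC: "(\<lambda>i. z i - y i) \<in> Cn d" using y z by (auto simp: Cn_def)
    define s where "s = (\<Sum>k<d. cmod (a k))"
    have s0: "s \<ge> 0" unfolding s_def by (simp add: sum_nonneg)
    have "cdist d y z \<le> (\<Sum>i<d. (\<Sum>k<d. cmod (B i k)) * s)"
      unfolding cdist_def
    proof (rule sum_mono)
      fix i assume "i \<in> {..<d}"
      then have "z i - y i = (\<Sum>k<d. B i k * a k)" using B[OF vC, of i] by (simp add: a_def)
      then have "cmod (z i - y i) \<le> (\<Sum>k<d. cmod (B i k * a k))" by (simp only:) (rule norm_sum)
      also have "\<dots> \<le> (\<Sum>k<d. cmod (B i k) * s)"
        unfolding norm_mult s_def by (intro sum_mono mult_left_mono member_le_sum) auto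
      finally show "cmod (z i - y i) \<le> (\<Sum>k<d. cmod (B i k)) * s" by (simp add: sum_distrib_right)
    qed
    also have "\<dots> = (\<Sum>i<d. \<Sum>k<d. cmod (B i k)) * s" by (simp add: sum_distrib_right)
    also have "\<dots> \<le> C * s" using s0 by (intro mult_right_mono) (auto simp: C_def)
    finally have 1: "cdist d y z \<le> C * s" .
    have "s \<le> (\<Sum>k<d. cmod (F z k - F y k) + \<epsilon> * cdist d y z)"
      unfolding s_def
    proof (rule sum_mono)
      fix k assume "k \<in> {..<d}"
      then have "cmod (F z k - F y k - a k) \<le> \<epsilon> * cdist d y z" using \<delta>(2) y z by (simp add: a_def)
      then show "cmod (a k) \<le> cmod (F z k - F y k) + \<epsilon> * cdist d y z"
        using norm_triangle_sub[of "a k" "F z k - F y k"] by (simp add: norm_minus_commute)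
    qed
    also have "\<dots> = cdist d (F y) (F z) + real d * \<epsilon> * cdist d y z"
      by (simp add: sum.distrib cdist_def)
    finally have "C * s \<le> C * (cdist d (F y) (F z) + real d * \<epsilon> * cdist d y z)" using C by simp
    also have "\<dots> = C * cdist d (F y) (F z) + (C * (real d * \<epsilon>)) * cdist d y z" by (simp add: algebra_simps)
    also have "\<dots> \<le> C * cdist d (F y) (F z) + 1 / 2 * cdist d y z"
    proof -
      have "C * (real d * \<epsilon>) = real d / (2 * (real d + 1))" using C by (simp add: \<epsilon>_def)
      also have "\<dots> \<le> 1 / 2" by (simp add: divide_simps)
      finally show ?thesis by (intro add_left_mono mult_right_mono) auto
    qed
    finally have "cdist d y z \<le> 2 * C * cdist d (F y) (F z)" using 1 by linarith
    then show ?thesis using C by (simp add: divide_simps mult_ac)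
  qed
  then show ?thesis using C \<delta>(1) by (intro exI[of _ "1 / (2 * C)"] conjI exI[of _ \<delta>]) auto
qed

text \<open>
  Openness of the image comes from invariance of domain. Expansiveness makes the derivative
  injective at every point, and then the inverse map is differentiable with the inverse matrix as
  its derivative.
\<close>
theorem holo_inverse:
  fixes F :: "cvec \<Rightarrow> cvec"
  assumes S: "openin (top_of_set (Cn d)) S" and F: "\<And>i. i < d \<Longrightarrow> holo d S (\<lambda>x. F x i)"
    and FC: "F ` S \<subseteq> Cn d" and inj: "inj_on F S"
    and exp: "\<And>x. x \<in> S \<Longrightarrow> \<exists>c>0. \<exists>\<delta>>0. \<forall>y\<in>S. cdist d x y < \<delta> \<longrightarrow> c * cdist d x y \<le> cdist d (F x) (F y)"
  shows "openin (top_of_set (Cn d)) (F ` S)" "continuous_on (F ` S) (inv_into S F)"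
    "\<And>i. i < d \<Longrightarrow> holo d (F ` S) (\<lambda>y. inv_into S F y i)"
proof -
  have SC: "S \<subseteq> Cn d" using openin_imp_subset[OF S] .
  have cF: "continuous_on S F"
    by (rule continuous_on_into_Cn[of _ _ d]) (use FC holo_imp_sep[OF S F] in auto)
  have op: "openin (top_of_set (Cn d)) (F ` U)" if "openin (top_of_set (Cn d)) U" "U \<subseteq> S" for U
    using that FC by (intro invariance_of_domain_Cn continuous_on_subset[OF cF] inj_on_subset[OF inj]) auto
  show oT: "openin (top_of_set (Cn d)) (F ` S)" using op[OF S] by simp
  show cG: "continuous_on (F ` S) (inv_into S F)"
  proof (rule continuous_on_inverse_open_map[OF cF refl])
    fix U assume U: "openin (top_of_set S) U"
    then have "U \<subseteq> S" by (rule openin_imp_subset)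
    moreover have "openin (top_of_set (Cn d)) (F ` U)"
      using openin_trans[OF U S] \<open>U \<subseteq> S\<close> by (rule op)
    ultimately show "openin (top_of_set (F ` S)) (F ` U)"
      by (intro openin_subset_trans[OF _ _ FC] image_mono)
  qed (use inj in simp)
  define G where "G = inv_into S F"
  have GF: "G (F x) = x" if "x \<in> S" for x using inj that by (simp add: G_def)
  have "holo d (F ` S) (\<lambda>y. G y i)" if i: "i < d" for i
    unfolding holo_eps_delta[OF FC]
  proof
    fix y0 assume "y0 \<in> F ` S"
    then obtain x0 where x0: "x0 \<in> S" "y0 = F x0" by blast
    obtain c \<delta>0 where c: "c > 0" "\<delta>0 > 0"
      "\<And>y. y \<in> S \<Longrightarrow> cdist d x0 y < \<delta>0 \<Longrightarrow> c * cdist d x0 y \<le> cdist d (F x0) (F y)"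
      using exp[OF x0(1)] by blast
    obtain r where r: "r > 0" "\<And>y. y \<in> Cn d \<Longrightarrow> cdist d x0 y < r \<Longrightarrow> y \<in> S"
      using openin_Cn_ball[OF S x0(1)] by blast
    have x0C: "x0 \<in> Cn d" using x0 SC by blast
    define A where "A k j = pd j (\<lambda>x. F x k) x0" for k j
    have sA: "strict_deriv d (\<lambda>x. F x k) (A k) x0" if "k < d" for k
      unfolding A_def using holo_imp_strict[OF S F[OF that] x0(1)] .
    \<comment> \<open>a vector in the kernel would contradict expansiveness at the points \<open>x0 + t v\<close> for small \<open>t\<close>\<close>
    have injA: "v = (\<lambda>_. 0)" if v: "v \<in> Cn d" and Av: "\<And>k. k < d \<Longrightarrow> (\<Sum>j<d. A k j * v j) = 0" for v
    proof -
      define n where "n = cdist d (\<lambda>_. 0) v"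
      define \<epsilon> where "\<epsilon> = c / (2 * (real d + 1))"
      have \<epsilon>: "\<epsilon> > 0" using c by (simp add: \<epsilon>_def)
      obtain \<delta> where \<delta>: "\<delta> > 0"
        "\<And>k y z. k < d \<Longrightarrow> y \<in> Cn d \<Longrightarrow> z \<in> Cn d \<Longrightarrow> cdist d x0 y < \<delta> \<Longrightarrow> cdist d x0 z < \<delta> \<Longrightarrow>
         cmod (F z k - F y k - (\<Sum>i<d. A k i * (z i - y i))) \<le> \<epsilon> * cdist d y z"
      by (rule strict_deriv_common[of d d F A x0 \<epsilon>], erule sA, rule \<epsilon>, rule that)
      define m where "m = min r (min \<delta> \<delta>0)"
      define t where "t = m / (2 * (n + 1))"
      have n0: "n \<ge> 0" by (simp add: n_def)
      have m: "m > 0" using r c \<delta> by (simp add: m_def)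
      have t: "t > 0" using m n0 by (simp add: t_def)
      define y where "y = (\<lambda>i. x0 i + of_real t * v i)"
      have yC: "y \<in> Cn d" using v x0C by (auto simp: y_def Cn_def)
      have yd: "cdist d x0 y = t * n"
        using t by (simp add: cdist_def y_def n_def norm_mult sum_distrib_left)
      have "t * n \<le> t * (n + 1)" using t by simp
      also have "\<dots> = m / 2" using n0 by (simp add: t_def divide_simps)
      finally have tn: "t * n < m" using m by simp
      have yS: "y \<in> S" using tn by (intro r(2) yC) (simp add: yd m_def)
      have "c * cdist d x0 y \<le> cdist d (F x0) (F y)" using tn by (intro c(3) yS) (simp add: yd m_def)
      also have "\<dots> \<le> (\<Sum>k<d. \<epsilon> * cdist d x0 y)"
        unfolding cdist_def[of d "F x0"]
      proof (rule sum_mono)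
        fix k assume "k \<in> {..<d}"
        then have k: "k < d" by simp
        have "(\<Sum>j<d. A k j * (y j - x0 j)) = of_real t * (\<Sum>j<d. A k j * v j)"
          by (simp add: y_def sum_distrib_left mult_ac)
        then have "(\<Sum>j<d. A k j * (y j - x0 j)) = 0" using Av[OF k] by simp
        then show "cmod (F y k - F x0 k) \<le> \<epsilon> * cdist d x0 y"
          using \<delta>(2)[OF k x0C yC] \<delta>(1) tn by (simp add: yd m_def)
      qed
      also have "\<dots> = real d * \<epsilon> * cdist d x0 y" by simp
      also have "\<dots> \<le> (c / 2) * cdist d x0 y"
        using c(1) by (intro mult_right_mono) (auto simp: \<epsilon>_def divide_simps)
      finally have "cdist d x0 y \<le> 0" using c(1) by (simp add: mult_le_cancel_right)
      then have "n \<le> 0" using t unfolding yd by (simp add: mult_le_0_iff)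
      then have "n = 0" using n0 by simp
      then show ?thesis using cdist_eq_0_iff[of "\<lambda>_. 0" d v] v by (auto simp: n_def Cn_def)
    qed
    obtain B where B: "\<And>v i. v \<in> Cn d \<Longrightarrow> i < d \<Longrightarrow> v i = (\<Sum>k<d. B i k * (\<Sum>j<d. A k j * v j))"
      proof -
      have "\<exists>B::nat \<Rightarrow> nat \<Rightarrow> complex. \<forall>v\<in>Cn d. \<forall>i<d. v i = (\<Sum>k<d. B i k * (\<Sum>j<d. A k j * v j))"
        by (rule injective_matrix_inverse, rule injA)
      then obtain B where B: "\<forall>v\<in>Cn d. \<forall>i<d. v i = (\<Sum>k<d. B i k * (\<Sum>j<d. A k j * v j))" by (rule exE)
    show ?thesis by (rule that[of B], rule B[rule_format])
    qed
    define C where "C = 1 + (\<Sum>k<d. cmod (B i k))"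
    have C: "C > 0" unfolding C_def by (intro add_pos_nonneg sum_nonneg) auto
    have "\<exists>\<delta>>0. \<forall>y\<in>F ` S. cdist d y0 y < \<delta> \<longrightarrow>
       cmod (G y i - G y0 i - (\<Sum>k<d. B i k * (y k - y0 k))) \<le> e * cdist d y0 y" if e: "e > 0" for e
    proof -
      define \<epsilon> where "\<epsilon> = e * c / C"
      have \<epsilon>: "\<epsilon> > 0" using c e C by (simp add: \<epsilon>_def)
      obtain \<delta> where \<delta>: "\<delta> > 0"
        "\<And>k y z. k < d \<Longrightarrow> y \<in> Cn d \<Longrightarrow> z \<in> Cn d \<Longrightarrow> cdist d x0 y < \<delta> \<Longrightarrow> cdist d x0 z < \<delta> \<Longrightarrow>
         cmod (F z k - F y k - (\<Sum>i<d. A k i * (z i - y i))) \<le> \<epsilon> * cdist d y z"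
      by (rule strict_deriv_common[of d d F A x0 \<epsilon>], erule sA, rule \<epsilon>, rule that)
      have "continuous_on (F ` S) (\<lambda>y. cdist d x0 (G y))"
        unfolding G_def by (intro continuous_on_cdist continuous_on_const cG)
      moreover have "y0 \<in> F ` S" "min \<delta> \<delta>0 > 0" using x0 \<delta> c by auto
      ultimately obtain \<delta>' where \<delta>': "\<delta>' > 0"
        "\<And>y. y \<in> F ` S \<Longrightarrow> cdist d y0 y < \<delta>' \<Longrightarrow> dist (cdist d x0 (G y)) (cdist d x0 (G y0)) < min \<delta> \<delta>0"
        unfolding continuous_on_Cn_iff[OF FC] by meson
      have "cmod (G y i - G y0 i - (\<Sum>k<d. B i k * (y k - y0 k))) \<le> e * cdist d y0 y"
        if y: "y \<in> F ` S" "cdist d y0 y < \<delta>'" for y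
      proof -
        obtain x where x: "x \<in> S" "y = F x" using y(1) by blast
        have xd: "cdist d x0 x < min \<delta> \<delta>0"
          using \<delta>'(2)[OF y] by (simp add: x x0 GF dist_real_def)
        have xC: "x \<in> Cn d" using x SC by blast
        have vC: "(\<lambda>j. x j - x0 j) \<in> Cn d" using xC x0C by (auto simp: Cn_def)
        have "G y i - G y0 i - (\<Sum>k<d. B i k * (y k - y0 k)) =
            (\<Sum>k<d. B i k * (\<Sum>j<d. A k j * (x j - x0 j))) - (\<Sum>k<d. B i k * (y k - y0 k))"
          using B[OF vC i] by (simp add: x x0 GF)
        also have "\<dots> = (\<Sum>k<d. B i k * ((\<Sum>j<d. A k j * (x j - x0 j)) - (F x k - F x0 k)))"
          by (simp only: x(2) x0(2) right_diff_distrib sum_subtractf)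
        finally have eq: "G y i - G y0 i - (\<Sum>k<d. B i k * (y k - y0 k)) =
          (\<Sum>k<d. B i k * ((\<Sum>j<d. A k j * (x j - x0 j)) - (F x k - F x0 k)))" .
        have "cmod (\<Sum>k<d. B i k * ((\<Sum>j<d. A k j * (x j - x0 j)) - (F x k - F x0 k))) \<le>
          (\<Sum>k<d. cmod (B i k) * (\<epsilon> * cdist d x0 x))"
        proof (rule sum_norm_le)
          fix k assume "k \<in> {..<d}"
          then have "cmod (F x k - F x0 k - (\<Sum>j<d. A k j * (x j - x0 j))) \<le> \<epsilon> * cdist d x0 x"
            using \<delta>(2)[OF _ x0C xC] \<delta>(1) xd by simp
          then show "cmod (B i k * ((\<Sum>j<d. A k j * (x j - x0 j)) - (F x k - F x0 k)))
             \<le> cmod (B i k) * (\<epsilon> * cdist d x0 x)"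
            unfolding norm_mult by (intro mult_left_mono) (auto simp: norm_minus_commute)
        qed
        also have "\<dots> = (\<Sum>k<d. cmod (B i k)) * (\<epsilon> * cdist d x0 x)" by (simp only: sum_distrib_right)
        also have "\<dots> \<le> C * (\<epsilon> * cdist d x0 x)" using \<epsilon> by (intro mult_right_mono) (auto simp: C_def)
        also have "\<dots> = e * (c * cdist d x0 x)" using C by (simp add: \<epsilon>_def)
        also have "\<dots> \<le> e * cdist d y0 y" using c(3)[OF x(1)] xd e by (simp add: x x0)
        finally show ?thesis unfolding eq .
      qed
      then show ?thesis using \<delta>'(1) by blast
    qed
    then show "\<exists>a. \<forall>e>0. \<exists>\<delta>>0. \<forall>y\<in>F ` S. cdist d y0 y < \<delta> \<longrightarrow>
       cmod (G y i - G y0 i - (\<Sum>k<d. a k * (y k - y0 k))) \<le> e * cdist d y0 y" by blast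
  qed
  then show "\<And>i. i < d \<Longrightarrow> holo d (F ` S) (\<lambda>y. inv_into S F y i)" unfolding G_def .
qed

text \<open>Near the diagonal strict differentiability gives the bound; away from it the distance is bounded
  below.\<close>
lemma holo_lipschitz_on_compact:
  assumes S: "openin (top_of_set (Cn d)) S" and f: "holo d S f" and K: "compact K" "K \<subseteq> S"
  shows "\<exists>L>0. \<forall>y\<in>K. \<forall>z\<in>K. cmod (f z - f y) \<le> L * cdist d y z"
proof -
  have SC: "S \<subseteq> Cn d" using openin_imp_subset[OF S] .
  have cK: "continuous_on K f" using holo_imp_sep(1)[OF S f] K(2) by (rule continuous_on_subset)
  have "\<exists>e>0. \<forall>p\<in>K \<times> K. e * cmod (f (snd p) - f (fst p)) \<le> cdist d (fst p) (snd p)"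
  proof (rule compact_locally_uniform[OF compact_Times[OF K(1) K(1)]])
    show "e' * cmod (f (snd p) - f (fst p)) \<le> cdist d (fst p) (snd p)"
      if "e * cmod (f (snd p) - f (fst p)) \<le> cdist d (fst p) (snd p)" "0 < e'" "e' \<le> e" for e e' p
      using that by (meson mult_right_mono norm_ge_zero order_trans)
  next
    fix p assume "p \<in> K \<times> K"
    then obtain y0 z0 where p: "p = (y0, z0)" "y0 \<in> K" "z0 \<in> K" by blast
    have y0C: "y0 \<in> Cn d" and z0C: "z0 \<in> Cn d" using p K(2) SC by auto
    have "\<exists>\<rho>>0. \<exists>e>0. \<forall>y\<in>K. \<forall>z\<in>K. cdist d y0 y < \<rho> \<longrightarrow> cdist d z0 z < \<rho> \<longrightarrow>
      e * cmod (f z - f y) \<le> cdist d y z"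
    proof (cases "y0 = z0")
      case True
      define a where "a i = pd i f y0" for i
      have "strict_deriv d f a y0" unfolding a_def using holo_imp_strict[OF S f] p K(2) by blast
      then obtain \<delta> where \<delta>: "\<delta> > 0" "\<And>y z. y \<in> Cn d \<Longrightarrow> z \<in> Cn d \<Longrightarrow> cdist d y0 y < \<delta> \<Longrightarrow> cdist d y0 z < \<delta> \<Longrightarrow>
         cmod (f z - f y - (\<Sum>i<d. a i * (z i - y i))) \<le> 1 * cdist d y z"
        unfolding strict_deriv_def by (meson zero_less_one)
      define M where "M = 1 + (\<Sum>i<d. cmod (a i))"
      have M: "M > 0" unfolding M_def by (simp add: add_pos_nonneg sum_nonneg)
      have "1 / M * cmod (f z - f y) \<le> cdist d y z"
        if "y \<in> K" "z \<in> K" "cdist d y0 y < \<delta>" "cdist d z0 z < \<delta>" for y z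
      proof -
        have "cmod (\<Sum>i<d. a i * (z i - y i)) \<le> (\<Sum>i<d. cmod (a i) * cdist d y z)"
          by (intro sum_norm_le) (auto simp: norm_mult intro!: mult_left_mono coordinate_le_cdist)
        moreover have "cmod (f z - f y - (\<Sum>i<d. a i * (z i - y i))) \<le> 1 * cdist d y z"
          using \<delta>(2)[of y z] that True K(2) SC by blast
        ultimately have "cmod (f z - f y) \<le> 1 * cdist d y z + (\<Sum>i<d. cmod (a i) * cdist d y z)"
          using norm_triangle_sub[of "f z - f y" "\<Sum>i<d. a i * (z i - y i)"] by linarith
        also have "\<dots> = M * cdist d y z" by (simp add: M_def sum_distrib_right distrib_right)
        finally show ?thesis using M by (simp add: divide_simps mult_ac)
      qed
      then show ?thesis using M \<delta>(1) by (intro exI[of _ \<delta>] conjI exI[of _ "1 / M"]) auto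
    next
      case False
      then have D: "cdist d y0 z0 > 0" using cdist_eq_0_iff[OF y0C z0C] cdist_ge_0[of d y0 z0] by linarith
      define M where "M = cmod (f z0 - f y0) + 2"
      have M: "M > 0" unfolding M_def by (simp add: add_nonneg_pos)
      have c: "\<exists>\<delta>>0. \<forall>y\<in>K. cdist d x y < \<delta> \<longrightarrow> dist (f y) (f x) < 1" if "x \<in> K" for x
        using cK that K(2) SC unfolding continuous_on_Cn_iff[OF subset_trans[OF K(2) SC]]
        by (meson zero_less_one)
      obtain \<delta>1 where \<delta>1: "\<delta>1 > 0" "\<forall>y\<in>K. cdist d y0 y < \<delta>1 \<longrightarrow> dist (f y) (f y0) < 1" using c[OF p(2)] by blast
      obtain \<delta>2 where \<delta>2: "\<delta>2 > 0" "\<forall>y\<in>K. cdist d z0 y < \<delta>2 \<longrightarrow> dist (f y) (f z0) < 1" using c[OF p(3)] by blast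
      define \<rho> where "\<rho> = min (cdist d y0 z0 / 4) (min \<delta>1 \<delta>2)"
      have "cdist d y0 z0 / (2 * M) * cmod (f z - f y) \<le> cdist d y z"
        if "y \<in> K" "z \<in> K" "cdist d y0 y < \<rho>" "cdist d z0 z < \<rho>" for y z
      proof -
        have "cmod (f y - f y0) < 1" "cmod (f z - f z0) < 1"
          using \<delta>1(2) \<delta>2(2) that by (auto simp: \<rho>_def dist_norm)
        moreover have "f z - f y = (f z - f z0) + (f z0 - f y0) - (f y - f y0)" by simp
        moreover have "cmod (f z - f y) = cmod ((f z - f z0) + (f z0 - f y0) - (f y - f y0))" by simp
        ultimately have "cmod (f z - f y) \<le> M"
          unfolding M_def using norm_triangle_ineq4[of "(f z - f z0) + (f z0 - f y0)" "f y - f y0"]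
            norm_triangle_ineq[of "f z - f z0" "f z0 - f y0"] by linarith
        then have "cdist d y0 z0 / (2 * M) * cmod (f z - f y) \<le> cdist d y0 z0 / (2 * M) * M"
          using D M by (intro mult_left_mono) auto
        also have "\<dots> = cdist d y0 z0 / 2" using M by simp
        also have "\<dots> \<le> cdist d y z"
          using cdist_triangle[of d y0 z0 y] cdist_triangle[of d y z0 z] that cdist_commute[of d z z0]
          by (simp add: \<rho>_def)
        finally show ?thesis .
      qed
      then show ?thesis using D M \<delta>1 \<delta>2
        by (intro exI[of _ \<rho>] conjI exI[of _ "cdist d y0 z0 / (2 * M)"]) (auto simp: \<rho>_def)
    qed
    then obtain \<rho> e where \<rho>: "\<rho> > 0" "e > 0" "\<forall>y\<in>K. \<forall>z\<in>K. cdist d y0 y < \<rho> \<longrightarrow> cdist d z0 z < \<rho> \<longrightarrow>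
      e * cmod (f z - f y) \<le> cdist d y z" by blast
    show "\<exists>U. open U \<and> p \<in> U \<and> (\<exists>e>0. \<forall>p\<in>U \<inter> K \<times> K. e * cmod (f (snd p) - f (fst p)) \<le> cdist d (fst p) (snd p))"
      using \<rho> p by (intro exI[of _ "{y. cdist d y0 y < \<rho>} \<times> {z. cdist d z0 z < \<rho>}"] conjI exI[of _ e])
        (auto intro!: open_Times open_cdist_ball)
  qed
  then obtain e where "e > 0" "\<forall>p\<in>K \<times> K. e * cmod (f (snd p) - f (fst p)) \<le> cdist d (fst p) (snd p)" by blast
  then show ?thesis by (intro exI[of _ "1 / e"]) (auto simp: divide_simps mult_ac)
qed

section \<open>Charts and holomorphic functions on complex manifolds\<close>

lemma is_chartD:
  assumes "is_chart (U, d, \<phi>)"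
  shows "open U" "openin (top_of_set (Cn d)) (\<phi> ` U)" "inj_on \<phi> U" "continuous_on U \<phi>"
    "continuous_on (\<phi> ` U) (inv_into U \<phi>)" "\<And>p. p \<in> U \<Longrightarrow> inv_into U \<phi> (\<phi> p) = p"
    "\<And>p. p \<in> U \<Longrightarrow> \<phi> p \<in> Cn d"
proof -
  have h: "homeomorphism U (\<phi> ` U) \<phi> (inv_into U \<phi>)" and o: "openin (top_of_set (Cn d)) (\<phi> ` U)"
    using assms by (auto simp: is_chart_def)
  show "open U" "openin (top_of_set (Cn d)) (\<phi> ` U)"
    using assms by (auto simp: is_chart_def)
  show "continuous_on U \<phi>" "continuous_on (\<phi> ` U) (inv_into U \<phi>)"
    and i: "\<And>p. p \<in> U \<Longrightarrow> inv_into U \<phi> (\<phi> p) = p"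
    using h by (auto simp: homeomorphism_def)
  show "inj_on \<phi> U" using i by (metis inj_onI)
  show "\<And>p. p \<in> U \<Longrightarrow> \<phi> p \<in> Cn d" using openin_imp_subset[OF o] by blast
qed

lemma chart_open_image:
  assumes c: "is_chart (U, d, \<phi>)" and S: "open S" "S \<subseteq> U"
  shows "openin (top_of_set (Cn d)) (\<phi> ` S)"
proof -
  have "homeomorphism U (\<phi> ` U) \<phi> (inv_into U \<phi>)" using c by (simp add: is_chart_def)
  moreover have "openin (top_of_set U) S" using S by (simp add: open_subset)
  ultimately have "openin (top_of_set (\<phi> ` U)) (\<phi> ` S)" by (rule homeomorphism_imp_open_map)
  then show ?thesis using is_chartD(2)[OF c] by (rule openin_trans)
qed

lemma chart_open_preimage:
  assumes c: "is_chart (U, d, \<phi>)" and T: "openin (top_of_set (Cn d)) T"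
  shows "open {p\<in>U. \<phi> p \<in> T}"
proof -
  obtain T' where T': "open T'" "T = Cn d \<inter> T'" using T by (auto simp: openin_open)
  have "{p\<in>U. \<phi> p \<in> T} = U \<inter> \<phi> -` T'" using T' is_chartD(7)[OF c] by auto
  moreover have "open (U \<inter> \<phi> -` T')"
    using continuous_open_preimage[OF is_chartD(4)[OF c] is_chartD(1)[OF c] T'(1)] .
  ultimately show ?thesis by simp
qed

text \<open>Openness of the map is the same as continuity of its inverse.\<close>
lemma is_chartI:
  assumes "open U" "inj_on \<phi> U" "continuous_on U \<phi>"
    and op: "\<And>S. open S \<Longrightarrow> S \<subseteq> U \<Longrightarrow> openin (top_of_set (Cn d)) (\<phi> ` S)"
  shows "is_chart (U, d, \<phi>)"
proof -
  have o: "openin (top_of_set (Cn d)) (\<phi> ` U)" using op[OF assms(1)] by simp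
  have "continuous_on (\<phi> ` U) (inv_into U \<phi>)"
  proof (rule continuous_on_inverse_open_map[OF assms(3) refl])
    fix S assume S: "openin (top_of_set U) S"
    have "openin (top_of_set (Cn d)) (\<phi> ` S)"
      by (rule op) (use S assms(1) openin_open_eq openin_imp_subset[OF S] in blast)+
    then show "openin (top_of_set (\<phi> ` U)) (\<phi> ` S)"
      by (rule openin_subset_trans[OF _ image_mono[OF openin_imp_subset[OF S]] openin_imp_subset[OF o]])
  qed (use assms(2) in simp)
  then have "homeomorphism U (\<phi> ` U) \<phi> (inv_into U \<phi>)"
    using assms(2,3) unfolding homeomorphism_def by (auto simp: image_image f_inv_into_f)
  then show ?thesis using assms(1) o by (simp add: is_chart_def)
qed

lemma complex_atlasD:
  assumes "complex_atlas A"
  shows "(U, d, \<phi>) \<in> A \<Longrightarrow> is_chart (U, d, \<phi>)"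
    "c \<in> A \<Longrightarrow> c' \<in> A \<Longrightarrow> holo_transition c c'"
    "\<exists>U d \<phi>. (U, d, \<phi>) \<in> A \<and> p \<in> U"
proof -
  show "(U, d, \<phi>) \<in> A \<Longrightarrow> is_chart (U, d, \<phi>)" "c \<in> A \<Longrightarrow> c' \<in> A \<Longrightarrow> holo_transition c c'"
    using assms by (auto simp: complex_atlas_def)
  have "p \<in> (\<Union>(U, d, \<phi>)\<in>A. U)" using assms by (simp add: complex_atlas_def)
  then show "\<exists>U d \<phi>. (U, d, \<phi>) \<in> A \<and> p \<in> U" by auto
qed

lemma atlas_holo_coords: "complex_atlas A \<Longrightarrow> (U, d, \<phi>) \<in> A \<Longrightarrow> holo_coords A U d \<phi>"
  by (auto simp: holo_coords_def intro: complex_atlasD)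

lemma holo_coordsD:
  assumes "holo_coords A U d \<phi>"
  shows "is_chart (U, d, \<phi>)"
    "(V, e, \<psi>) \<in> A \<Longrightarrow> i < e \<Longrightarrow> holo d (\<phi> ` (U \<inter> V)) (\<lambda>x. \<psi> (inv_into U \<phi> x) i)"
    "(V, e, \<psi>) \<in> A \<Longrightarrow> i < d \<Longrightarrow> holo e (\<psi> ` (V \<inter> U)) (\<lambda>x. \<phi> (inv_into V \<psi> x) i)"
  using assms unfolding holo_coords_def holo_transition_def by fast+

lemma holo_funD:
  "holo_fun A U f \<Longrightarrow> (V, d, \<phi>) \<in> A \<Longrightarrow> holo d (\<phi> ` (U \<inter> V)) (\<lambda>x. f (inv_into V \<phi> x))"
  unfolding holo_fun_def o_def by fast

lemma holo_funI:
  "(\<And>V d \<phi>. (V, d, \<phi>) \<in> A \<Longrightarrow> holo d (\<phi> ` (U \<inter> V)) (\<lambda>x. f (inv_into V \<phi> x))) \<Longrightarrow> holo_fun A U f"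
  unfolding holo_fun_def o_def by fast

context
  fixes A :: "'a::topological_space chart set"
  assumes A: "complex_atlas A"
begin

lemma chart_image_openin: "open U \<Longrightarrow> (V, d, \<phi>) \<in> A \<Longrightarrow> openin (top_of_set (Cn d)) (\<phi> ` (U \<inter> V))"
  using chart_open_image[OF complex_atlasD(1)[OF A]] is_chartD(1)[OF complex_atlasD(1)[OF A]]
  by (meson inf_le2 open_Int)

lemma chart_inv: "(V, d, \<phi>) \<in> A \<Longrightarrow> p \<in> V \<Longrightarrow> inv_into V \<phi> (\<phi> p) = p"
  using is_chartD(6)[OF complex_atlasD(1)[OF A]] by blast

lemma holo_fun_const: "holo_fun A U (\<lambda>_. c)"
  by (rule holo_funI) simp

lemma holo_fun_add: "open U \<Longrightarrow> holo_fun A U f \<Longrightarrow> holo_fun A U g \<Longrightarrow> holo_fun A U (\<lambda>p. f p + g p)"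
  by (intro holo_funI holo_add chart_image_openin) (auto dest: holo_funD)

lemma holo_fun_mult: "open U \<Longrightarrow> holo_fun A U f \<Longrightarrow> holo_fun A U g \<Longrightarrow> holo_fun A U (\<lambda>p. f p * g p)"
  by (intro holo_funI holo_mult chart_image_openin) (auto dest: holo_funD)

lemma holo_fun_sum:
  "open U \<Longrightarrow> (\<And>i. i \<in> I \<Longrightarrow> holo_fun A U (f i)) \<Longrightarrow> holo_fun A U (\<lambda>p. \<Sum>i\<in>I. f i p)"
  by (intro holo_funI holo_sum chart_image_openin) (auto dest: holo_funD)

lemma holo_fun_divide:
  assumes "open U" "holo_fun A U f" "holo_fun A U g" "\<And>p. p \<in> U \<Longrightarrow> g p \<noteq> 0"
  shows "holo_fun A U (\<lambda>p. f p / g p)"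
proof (intro holo_funI holo_divide chart_image_openin)
  fix V d \<phi> x assume "(V, d, \<phi>) \<in> A" "x \<in> \<phi> ` (U \<inter> V)"
  then show "g (inv_into V \<phi> x) \<noteq> 0" using assms(4) chart_inv by fastforce
qed (use assms in \<open>auto dest: holo_funD\<close>)

lemma holo_fun_cong:
  assumes "\<And>p. p \<in> U \<Longrightarrow> f p = g p" "holo_fun A U f" "open U"
  shows "holo_fun A U g"
proof (rule holo_funI)
  fix V d \<phi> assume V: "(V, d, \<phi>) \<in> A"
  have "holo d (\<phi> ` (U \<inter> V)) (\<lambda>x. f (inv_into V \<phi> x)) \<longleftrightarrow> holo d (\<phi> ` (U \<inter> V)) (\<lambda>x. g (inv_into V \<phi> x))"
  proof (rule holo_cong)
    show "\<phi> ` (U \<inter> V) \<subseteq> Cn d" using openin_imp_subset[OF chart_image_openin[OF assms(3) V]] .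
    fix x assume "x \<in> \<phi> ` (U \<inter> V)"
    then have "inv_into V \<phi> x \<in> U" using chart_inv[OF V] by force
    then show "f (inv_into V \<phi> x) = g (inv_into V \<phi> x)" by (rule assms(1))
  qed
  then show "holo d (\<phi> ` (U \<inter> V)) (\<lambda>x. g (inv_into V \<phi> x))" using holo_funD[OF assms(2) V] by simp
qed

lemma holo_fun_subset:
  assumes "holo_fun A U f" "U' \<subseteq> U" "open U" "open U'"
  shows "holo_fun A U' f"
proof (rule holo_funI)
  fix V d \<phi> assume V: "(V, d, \<phi>) \<in> A"
  show "holo d (\<phi> ` (U' \<inter> V)) (\<lambda>x. f (inv_into V \<phi> x))"
    using assms(2) by (intro holo_subset[OF chart_image_openin[OF assms(3) V] chart_image_openin[OF assms(4) V]
          _ holo_funD[OF assms(1) V]]) blast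
qed

lemma holo_fun_local:
  assumes U: "open U" and loc: "\<And>p. p \<in> U \<Longrightarrow> \<exists>U'. open U' \<and> p \<in> U' \<and> holo_fun A U' f"
  shows "holo_fun A U f"
proof (rule holo_funI, rule holo_local)
  fix V d \<phi> x assume V: "(V, d, \<phi>) \<in> A" and x: "x \<in> \<phi> ` (U \<inter> V)"
  then obtain p where p: "p \<in> U" "p \<in> V" "x = \<phi> p" by blast
  from loc[OF p(1)] obtain U' where U': "open U'" "p \<in> U'" "holo_fun A U' f" by blast
  show "\<exists>S'. openin (top_of_set (Cn d)) S' \<and> x \<in> S' \<and> holo d S' (\<lambda>x. f (inv_into V \<phi> x))"
    by (intro exI[of _ "\<phi> ` (U' \<inter> V)"] conjI chart_image_openin V U' holo_funD[OF U'(3) V])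
       (use p U' in blast)
qed (rule openin_imp_subset[OF chart_image_openin[OF U]])

lemma holo_fun_continuous:
  assumes U: "open U" and f: "holo_fun A U f"
  shows "continuous_on U f"
proof -
  have "continuous_on (\<Union>{U \<inter> V |V d \<phi>. (V, d, \<phi>) \<in> A}) f"
  proof (rule continuous_on_open_Union)
    fix s assume "s \<in> {U \<inter> V |V d \<phi>. (V, d, \<phi>) \<in> A}"
    then obtain V d \<phi> where V: "(V, d, \<phi>) \<in> A" and s: "s = U \<inter> V" by blast
    note c = complex_atlasD(1)[OF A V]
    show "open s" using U is_chartD(1)[OF c] by (auto simp: s)
    have "continuous_on (U \<inter> V) (\<lambda>q. f (inv_into V \<phi> (\<phi> q)))"
      by (rule continuous_on_compose2[OF holo_imp_sep(1)[OF chart_image_openin[OF U V] holo_funD[OF f V]]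
            continuous_on_subset[OF is_chartD(4)[OF c]]]) auto
    then show "continuous_on s f" unfolding s
      by (rule iffD1[OF continuous_on_cong[OF refl], rotated]) (use chart_inv[OF V] in simp)
  qed
  moreover have "p \<in> \<Union>{U \<inter> V |V d \<phi>. (V, d, \<phi>) \<in> A}" if "p \<in> U" for p
  proof -
    obtain V d \<phi> where "(V, d, \<phi>) \<in> A" "p \<in> V" using complex_atlasD(3)[OF A] by blast
    with that show ?thesis by (intro UnionI[of "U \<inter> V"]) blast+
  qed
  ultimately show ?thesis by (meson continuous_on_subset subsetI)
qed

lemma holo_fun_compose_Cn:
  assumes S: "open S" and F: "\<And>p. p \<in> S \<Longrightarrow> F p \<in> T" "\<And>i. i < e \<Longrightarrow> holo_fun A S (\<lambda>p. F p i)"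
    and T: "openin (top_of_set (Cn e)) T" and g: "holo e T g"
  shows "holo_fun A S (\<lambda>p. g (F p))"
proof (rule holo_funI)
  fix V d \<phi> assume V: "(V, d, \<phi>) \<in> A"
  show "holo d (\<phi> ` (S \<inter> V)) (\<lambda>x. g (F (inv_into V \<phi> x)))"
    by (rule holo_compose[OF chart_image_openin[OF S V] T _ holo_funD[OF F(2) V] g])
       (use F(1) chart_inv[OF V] in auto)
qed

lemma holo_fun_of_coords:
  assumes c: "holo_coords A W d c" and S: "open S" "S \<subseteq> W"
    and f: "holo d (c ` S) (\<lambda>x. f (inv_into W c x))"
  shows "holo_fun A S f"
proof -
  note ch = holo_coordsD(1)[OF c]
  have "holo_fun A S (\<lambda>p. f (inv_into W c (c p)))"
  proof (rule holo_fun_compose_Cn[OF S(1) _ _ chart_open_image[OF ch S] f])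
    fix i assume i: "i < d"
    show "holo_fun A S (\<lambda>p. c p i)"
    proof (rule holo_funI)
      fix V e \<psi> assume V: "(V, e, \<psi>) \<in> A"
      show "holo e (\<psi> ` (S \<inter> V)) (\<lambda>x. c (inv_into V \<psi> x) i)"
        by (rule holo_subset[OF _ chart_image_openin[OF S(1) V] _ holo_coordsD(3)[OF c V i]])
           (use chart_image_openin[OF is_chartD(1)[OF ch] V] S(2) in \<open>auto simp: Int_commute\<close>)
    qed
  qed blast
  then show ?thesis by (rule holo_fun_cong[rotated]) (use is_chartD(6)[OF ch] S in auto)
qed

text \<open>Charts outside the atlas are allowed, so the transition to some chart of the atlas enters at each
  point.\<close>
lemma holo_in_coords:
  assumes c: "holo_coords A W d c" and S: "open S" "S \<subseteq> W" and f: "holo_fun A S f"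
  shows "holo d (c ` S) (\<lambda>x. f (inv_into W c x))"
proof (rule holo_local)
  note ch = holo_coordsD(1)[OF c]
  show "c ` S \<subseteq> Cn d" using openin_imp_subset[OF chart_open_image[OF ch S]] .
  fix x assume "x \<in> c ` S"
  then obtain p where p: "p \<in> S" "x = c p" by blast
  obtain V e \<psi> where V: "(V, e, \<psi>) \<in> A" "p \<in> V" using complex_atlasD(3)[OF A] by blast
  note chV = complex_atlasD(1)[OF A V(1)]
  have SV: "open (S \<inter> V)" "S \<inter> V \<subseteq> W" using S is_chartD(1)[OF chV] by auto
  have o: "openin (top_of_set (Cn d)) (c ` (S \<inter> V))" using chart_open_image[OF ch SV] .
  have "holo d (c ` (S \<inter> V)) (\<lambda>x. f (inv_into V \<psi> (\<psi> (inv_into W c x))))"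
  proof (rule holo_compose[OF o chart_image_openin[OF S(1) V(1)] _ _ holo_funD[OF f V(1)]])
    show "\<psi> (inv_into W c x) \<in> \<psi> ` (S \<inter> V)" if "x \<in> c ` (S \<inter> V)" for x
      using that is_chartD(6)[OF ch] S by force
    show "holo d (c ` (S \<inter> V)) (\<lambda>x. \<psi> (inv_into W c x) i)" if "i < e" for i
      by (rule holo_subset[OF _ o _ holo_coordsD(2)[OF c V(1) that]])
         (use chart_open_image[OF ch, of "W \<inter> V"] is_chartD(1)[OF ch] is_chartD(1)[OF chV] S in auto)
  qed
  then have "holo d (c ` (S \<inter> V)) (\<lambda>x. f (inv_into W c x))"
  proof (rule iffD1[OF holo_cong[OF openin_imp_subset[OF o]], rotated])
    fix x assume "x \<in> c ` (S \<inter> V)"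
    then have "inv_into W c x \<in> V" using is_chartD(6)[OF ch] S by force
    then show "f (inv_into V \<psi> (\<psi> (inv_into W c x))) = f (inv_into W c x)" by (simp add: chart_inv[OF V(1)])
  qed
  then show "\<exists>S'. openin (top_of_set (Cn d)) S' \<and> x \<in> S' \<and> holo d S' (\<lambda>x. f (inv_into W c x))"
    using o p V by blast
qed

lemma holo_fun_coordinate:
  assumes c: "holo_coords A W d c" and i: "i < d"
  shows "holo_fun A W (\<lambda>p. c p i)"
proof (rule holo_fun_of_coords[OF c is_chartD(1)[OF holo_coordsD(1)[OF c]] subset_refl])
  have "holo d (c ` W) (\<lambda>x. x i)"
    by (rule holo_coordinate[OF i openin_imp_subset[OF is_chartD(2)[OF holo_coordsD(1)[OF c]]]])
  then show "holo d (c ` W) (\<lambda>x. c (inv_into W c x) i)"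
    by (rule iffD1[OF holo_cong[OF openin_imp_subset[OF is_chartD(2)[OF holo_coordsD(1)[OF c]]]], rotated])
       (simp add: f_inv_into_f)
qed

end

lemma holo_map_open_preimage:
  "holo_map A A' S F \<Longrightarrow> open S \<Longrightarrow> open N \<Longrightarrow> open (S \<inter> F -` N)"
  unfolding holo_map_def using continuous_open_preimage by blast

lemma holo_map_compose_fun:
  assumes A: "complex_atlas A" and A': "complex_atlas A'" and S: "open S" and F: "holo_map A A' S F"
    and N: "open N" and f: "holo_fun A' N f"
  shows "holo_fun A (S \<inter> F -` N) (\<lambda>p. f (F p))"
proof (rule holo_fun_local[OF A holo_map_open_preimage[OF F S N]])
  fix p assume p: "p \<in> S \<inter> F -` N"
  obtain V e \<psi> where V: "(V, e, \<psi>) \<in> A'" "F p \<in> V" using complex_atlasD(3)[OF A'] by blast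
  note chV = complex_atlasD(1)[OF A' V(1)]
  define S0 where "S0 = S \<inter> F -` (N \<inter> V)"
  have o1: "open (S \<inter> F -` V)" using holo_map_open_preimage[OF F S is_chartD(1)[OF chV]] .
  have S0: "open S0" "p \<in> S0"
    unfolding S0_def using holo_map_open_preimage[OF F S open_Int[OF N is_chartD(1)[OF chV]]] p V by auto
  have "holo_fun A S0 (\<lambda>q. f (inv_into V \<psi> (\<psi> (F q))))"
  proof (rule holo_fun_compose_Cn[OF A S0(1) _ _ chart_image_openin[OF A' N V(1)] holo_funD[OF f V(1)]])
    show "holo_fun A S0 (\<lambda>q. \<psi> (F q) i)" if "i < e" for i
    proof (rule holo_fun_subset[OF A _ _ o1 S0(1)])
      show "holo_fun A (S \<inter> F -` V) (\<lambda>q. \<psi> (F q) i)" using F V(1) that unfolding holo_map_def by fast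
    qed (auto simp: S0_def)
  qed (auto simp: S0_def)
  then have "holo_fun A S0 (\<lambda>q. f (F q))"
    by (rule holo_fun_cong[OF A _ _ S0(1), rotated]) (use chart_inv[OF A' V(1)] in \<open>auto simp: S0_def\<close>)
  then show "\<exists>U'. open U' \<and> p \<in> U' \<and> holo_fun A U' (\<lambda>p. f (F p))" using S0 by blast
qed

lemma holo_map_of_coords:
  assumes A: "complex_atlas A" and A': "complex_atlas A'" and c: "holo_coords A' W e c"
    and S: "open S" and F: "F ` S \<subseteq> W" "\<And>i. i < e \<Longrightarrow> holo_fun A S (\<lambda>p. c (F p) i)"
  shows "holo_map A A' S F"
proof -
  note ch = holo_coordsD(1)[OF c]
  have "continuous_on S (\<lambda>p. c (F p))"
    by (rule continuous_on_into_Cn[of _ _ e]) (use F is_chartD(7)[OF ch] holo_fun_continuous[OF A S] in auto)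
  then have "continuous_on S (\<lambda>p. inv_into W c (c (F p)))"
    by (rule continuous_on_compose2[OF is_chartD(5)[OF ch]]) (use F in auto)
  then have cF: "continuous_on S F"
    by (rule iffD1[OF continuous_on_cong[OF refl], rotated]) (use is_chartD(6)[OF ch] F(1) in auto)
  have "holo_fun A (S \<inter> F -` V) (\<lambda>p. \<psi> (F p) i)" if V: "(V, e', \<psi>) \<in> A'" "i < e'" for V e' \<psi> i
  proof -
    note chV = complex_atlasD(1)[OF A' V(1)]
    have o: "open (S \<inter> F -` V)" using continuous_open_preimage[OF cF S is_chartD(1)[OF chV]] .
    have "holo_fun A (S \<inter> F -` V) (\<lambda>p. \<psi> (inv_into W c (c (F p))) i)"
    proof (rule holo_fun_compose_Cn[OF A o, of "\<lambda>p. c (F p)" "c ` (W \<inter> V)" e])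
      show "openin (top_of_set (Cn e)) (c ` (W \<inter> V))"
        by (rule chart_open_image[OF ch]) (auto intro: is_chartD(1)[OF ch] is_chartD(1)[OF chV])
      show "holo e (c ` (W \<inter> V)) (\<lambda>x. \<psi> (inv_into W c x) i)" using holo_coordsD(2)[OF c V] .
      show "holo_fun A (S \<inter> F -` V) (\<lambda>p. c (F p) j)" if "j < e" for j
        by (rule holo_fun_subset[OF A F(2)[OF that] _ S o]) auto
    qed (use F(1) in auto)
    then show ?thesis
      by (rule holo_fun_cong[OF A _ _ o, rotated]) (use is_chartD(6)[OF ch] F(1) in auto)
  qed
  then show ?thesis unfolding holo_map_def using cF by auto
qed

section \<open>Products with the complex plane\<close>

definition Cn_tail :: "cvec \<Rightarrow> cvec" where
  "Cn_tail y = (\<lambda>i. y (Suc i))"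

lemma Cn_tail_case_nat [simp]: "Cn_tail (case_nat z x) = x"
  by (simp add: Cn_tail_def)

lemma case_nat_Cn_tail: "case_nat (y 0) (Cn_tail y) = y"
  by (auto simp: Cn_tail_def fun_eq_iff split: nat.split)

lemma Cn_tail_mem: "y \<in> Cn (Suc d) \<longleftrightarrow> Cn_tail y \<in> Cn d"
proof
  assume "Cn_tail y \<in> Cn d"
  then have *: "y (Suc i) = 0" if "i \<ge> d" for i using that by (simp add: Cn_def Cn_tail_def)
  have "y i = 0" if "i \<ge> Suc d" for i using *[of "i - 1"] that by simp
  then show "y \<in> Cn (Suc d)" by (simp add: Cn_def)
qed (simp add: Cn_def Cn_tail_def)

lemma case_nat_mem_Cn: "x \<in> Cn d \<Longrightarrow> case_nat z x \<in> Cn (Suc d)"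
  by (simp add: Cn_tail_mem)

lemma continuous_Cn_tail: "continuous_on S Cn_tail"
  unfolding Cn_tail_def
  by (rule continuous_on_coordinatewise_then_product) (rule continuous_on_coordinate[OF continuous_on_id])

lemma openin_Cn_tail:
  assumes "openin (top_of_set (Cn d)) T"
  shows "openin (top_of_set (Cn (Suc d))) {y. Cn_tail y \<in> T}"
proof -
  obtain O' where O': "open O'" "T = Cn d \<inter> O'" using assms by (auto simp: openin_open)
  have "open (Cn_tail -` O')" using continuous_open_vimage[OF O'(1)] continuous_Cn_tail
    by (simp add: O'(1) continuous_on_eq_continuous_at open_vimage)
  moreover have "{y. Cn_tail y \<in> T} = Cn (Suc d) \<inter> Cn_tail -` O'" using O' by (auto simp: Cn_tail_mem)
  ultimately show ?thesis by (auto simp: openin_open)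
qed

definition times_chart :: "('a \<Rightarrow> cvec) \<Rightarrow> complex \<times> 'a \<Rightarrow> cvec" where
  "times_chart \<phi> = (\<lambda>(z, p). case_nat z (\<phi> p))"

lemma times_chart_apply [simp]: "times_chart \<phi> (z, p) = case_nat z (\<phi> p)"
  by (simp add: times_chart_def)

lemma times_chart_image: "times_chart \<phi> ` (UNIV \<times> S) = {y. Cn_tail y \<in> \<phi> ` S}"
proof safe
  fix y p assume "Cn_tail y = \<phi> p" "p \<in> S"
  then have "y = times_chart \<phi> (y 0, p)" using case_nat_Cn_tail[of y] by simp
  then show "y \<in> times_chart \<phi> ` (UNIV \<times> S)" using \<open>p \<in> S\<close> by blast
qed auto

lemma times_chart_inv:
  assumes "inj_on \<phi> U" "Cn_tail y \<in> \<phi> ` U"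
  shows "inv_into (UNIV \<times> U) (times_chart \<phi>) y = (y 0, inv_into U \<phi> (Cn_tail y))"
proof (rule inv_into_f_eq)
  show "inj_on (times_chart \<phi>) (UNIV \<times> U)"
  proof (rule inj_onI, clarify)
    fix z p z' p' assume *: "p \<in> U" "p' \<in> U" "times_chart \<phi> (z, p) = times_chart \<phi> (z', p')"
    from fun_cong[OF *(3), of 0] have "z = z'" by simp
    moreover from arg_cong[OF *(3), of Cn_tail] have "\<phi> p = \<phi> p'" by simp
    ultimately show "z = z' \<and> p = p'" using assms(1) * by (simp add: inj_on_eq_iff)
  qed
  show "(y 0, inv_into U \<phi> (Cn_tail y)) \<in> UNIV \<times> U" using assms(2) by (simp add: inv_into_into)
  show "times_chart \<phi> (y 0, inv_into U \<phi> (Cn_tail y)) = y"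
    using assms(2) by (simp add: f_inv_into_f case_nat_Cn_tail)
qed

lemma is_chart_times:
  assumes c: "is_chart (U, d, \<phi>)"
  shows "is_chart (UNIV \<times> U, Suc d, times_chart \<phi>)"
proof -
  have 1: "open (UNIV \<times> U)" using is_chartD(1)[OF c] by (simp add: open_Times)
  have 2: "openin (top_of_set (Cn (Suc d))) (times_chart \<phi> ` (UNIV \<times> U))"
    unfolding times_chart_image by (rule openin_Cn_tail[OF is_chartD(2)[OF c]])
  have 3: "continuous_on (UNIV \<times> U) (times_chart \<phi>)"
    unfolding times_chart_def case_prod_unfold
    by (intro continuous_on_case_nat continuous_on_fst continuous_on_id
        continuous_on_compose2[OF is_chartD(4)[OF c] continuous_on_snd]) auto
  have "continuous_on (times_chart \<phi> ` (UNIV \<times> U)) (\<lambda>y. (y 0, inv_into U \<phi> (Cn_tail y)))"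
    by (intro continuous_on_Pair continuous_on_coordinate continuous_on_id
        continuous_on_compose2[OF is_chartD(5)[OF c] continuous_Cn_tail]) (auto simp: times_chart_image)
  then have 4: "continuous_on (times_chart \<phi> ` (UNIV \<times> U)) (inv_into (UNIV \<times> U) (times_chart \<phi>))"
    by (rule iffD1[OF continuous_on_cong[OF refl], rotated])
       (simp add: times_chart_image times_chart_inv[OF is_chartD(3)[OF c]])
  have 5: "inv_into (UNIV \<times> U) (times_chart \<phi>) (times_chart \<phi> x) = x" if "x \<in> UNIV \<times> U" for x
  proof -
    obtain z p where x: "x = (z, p)" "p \<in> U" using \<open>x \<in> UNIV \<times> U\<close> by auto
    then have "Cn_tail (times_chart \<phi> x) \<in> \<phi> ` U" by simp
    from times_chart_inv[OF is_chartD(3)[OF c] this] show ?thesis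
      using x is_chartD(6)[OF c] by simp
  qed
  have "homeomorphism (UNIV \<times> U) (times_chart \<phi> ` (UNIV \<times> U)) (times_chart \<phi>) (inv_into (UNIV \<times> U) (times_chart \<phi>))"
    unfolding homeomorphism_def using 3 4 5 by (auto simp: image_image f_inv_into_f)
  then show ?thesis using 1 2 by (simp add: is_chart_def)
qed

lemma holo_transition_times:
  assumes c: "is_chart (U, d, \<phi>)" and c': "is_chart (V, e, \<psi>)" and t: "holo_transition (U, d, \<phi>) (V, e, \<psi>)"
  shows "holo_transition (UNIV \<times> U, Suc d, times_chart \<phi>) (UNIV \<times> V, Suc e, times_chart \<psi>)"
proof -
  have oUV: "openin (top_of_set (Cn d)) (\<phi> ` (U \<inter> V))"
    by (rule chart_open_image[OF c]) (use is_chartD(1)[OF c] is_chartD(1)[OF c'] in auto)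
  have o: "openin (top_of_set (Cn (Suc d))) {y. Cn_tail y \<in> \<phi> ` (U \<inter> V)}"
    by (rule openin_Cn_tail[OF oUV])
  have sub: "{y. Cn_tail y \<in> \<phi> ` (U \<inter> V)} \<subseteq> Cn (Suc d)" using openin_imp_subset[OF o] .
  have inv: "inv_into (UNIV \<times> U) (times_chart \<phi>) y = (y 0, inv_into U \<phi> (Cn_tail y))"
    if "Cn_tail y \<in> \<phi> ` (U \<inter> V)" for y
    using that by (intro times_chart_inv is_chartD(3)[OF c]) blast
  have "holo (Suc d) {y. Cn_tail y \<in> \<phi> ` (U \<inter> V)}
      (\<lambda>x. times_chart \<psi> (inv_into (UNIV \<times> U) (times_chart \<phi>) x) i)" if i: "i < Suc e" for i
  proof (cases i)
    case 0
    have "holo (Suc d) {y. Cn_tail y \<in> \<phi> ` (U \<inter> V)} (\<lambda>x. x 0)" by (rule holo_coordinate[OF _ sub]) simp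
    then show ?thesis
      by (rule iffD1[OF holo_cong[OF sub], rotated]) (simp add: inv 0)
  next
    case (Suc j)
    have "holo (Suc d) {y. Cn_tail y \<in> \<phi> ` (U \<inter> V)} (\<lambda>x. \<psi> (inv_into U \<phi> (Cn_tail x)) j)"
    proof (rule holo_compose[where F = Cn_tail and g = "\<lambda>x. \<psi> (inv_into U \<phi> x) j", OF o oUV])
      show "holo (Suc d) {y. Cn_tail y \<in> \<phi> ` (U \<inter> V)} (\<lambda>x. Cn_tail x i)" if "i < d" for i
        unfolding Cn_tail_def by (rule holo_coordinate[OF _ sub[unfolded Cn_tail_def]]) (use that in simp)
      show "holo d (\<phi> ` (U \<inter> V)) (\<lambda>x. \<psi> (inv_into U \<phi> x) j)"
        using t Suc i by (simp add: holo_transition_def)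
    qed simp
    then show ?thesis
      by (rule iffD1[OF holo_cong[OF sub], rotated]) (simp add: inv Suc)
  qed
  moreover have "times_chart \<phi> ` ((UNIV \<times> U) \<inter> (UNIV \<times> V)) = {y. Cn_tail y \<in> \<phi> ` (U \<inter> V)}"
    unfolding times_chart_image[symmetric] by (rule arg_cong[where f = "image _"]) auto
  ultimately show ?thesis by (simp add: holo_transition_def)
qed

lemma times_C_eq: "times_C A = (\<lambda>(U, d, \<phi>). (UNIV \<times> U, Suc d, times_chart \<phi>)) ` A"
  by (simp add: times_C_def times_chart_def)

lemma complex_atlas_times:
  assumes A: "complex_atlas A"
  shows "complex_atlas (times_C A)"
  unfolding complex_atlas_def
proof (intro conjI ballI)
  fix c assume "c \<in> times_C A"
  then show "is_chart c" by (auto simp: times_C_eq intro: is_chart_times complex_atlasD(1)[OF A])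
next
  fix c c' assume "c \<in> times_C A" "c' \<in> times_C A"
  then show "holo_transition c c'"
    by (auto simp: times_C_eq intro!: holo_transition_times complex_atlasD(1)[OF A] complex_atlasD(2)[OF A])
next
  have "(z, p) \<in> (\<Union>(U, d, \<phi>)\<in>times_C A. U)" for z p
  proof -
    obtain U d \<phi> where "(U, d, \<phi>) \<in> A" "p \<in> U" using complex_atlasD(3)[OF A] by blast
    then show ?thesis unfolding times_C_eq by force
  qed
  then show "(\<Union>(U, d, \<phi>)\<in>times_C A. U) = UNIV" by auto
qed

lemma holo_coords_times:
  assumes A: "complex_atlas A" and c: "holo_coords A W d c"
  shows "holo_coords (times_C A) (UNIV \<times> W) (Suc d) (times_chart c)"
  using c is_chart_times[of W d c] unfolding holo_coords_def
  by (auto simp: times_C_eq intro!: holo_transition_times complex_atlasD(1)[OF A])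

section \<open>Fiber coordinates are part of coordinate systems\<close>

lemma chart_dim_le:
  assumes c: "is_chart (U, d, \<phi>)" and c': "is_chart (V, e, \<psi>)" and "U \<inter> V \<noteq> {}"
  shows "d \<le> e"
proof (rule openin_Cn_dim_le)
  have o: "open (U \<inter> V)" using is_chartD(1)[OF c] is_chartD(1)[OF c'] by auto
  show "openin (top_of_set (Cn d)) (\<phi> ` (U \<inter> V))" using chart_open_image[OF c o] by simp
  show "continuous_on (\<phi> ` (U \<inter> V)) (\<lambda>x. \<psi> (inv_into U \<phi> x))"
    by (rule continuous_on_compose2[OF is_chartD(4)[OF c'] continuous_on_subset[OF is_chartD(5)[OF c]]])
       (use is_chartD(6)[OF c] in auto)
  show "(\<lambda>x. \<psi> (inv_into U \<phi> x)) ` \<phi> ` (U \<inter> V) \<subseteq> Cn e"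
    using is_chartD(6)[OF c] is_chartD(7)[OF c'] by auto
  show "inj_on (\<lambda>x. \<psi> (inv_into U \<phi> x)) (\<phi> ` (U \<inter> V))"
    using is_chartD(6)[OF c] is_chartD(3)[OF c'] by (auto simp: inj_on_def)
qed (use assms(3) in blast)

lemma chart_dim_eq:
  "is_chart (U, d, \<phi>) \<Longrightarrow> is_chart (V, e, \<psi>) \<Longrightarrow> b \<in> U \<Longrightarrow> b \<in> V \<Longrightarrow> d = e"
  using chart_dim_le by (metis IntI antisym empty_iff)

lemma pd_cong:
  assumes "openin (top_of_set (Cn d)) S" "x \<in> S" "i < d" "\<And>y. y \<in> S \<Longrightarrow> f y = g y"
  shows "pd i f x = pd i g x"
  unfolding pd_def
  by (rule deriv_cong_ev[OF eventually_mono[OF eventually_line_in[OF assms(1-3)]]]) (simp_all add: assms)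

text \<open>
  The kernel of a surjective linear map from \<open>\<complex>\<^sup>e\<^sup>+\<^sup>1\<close> to \<open>\<complex>\<^sup>e\<close> is the line spanned by \<open>\<xi>\<close>: the vector
  \<open>\<xi>\<close> and preimages of the basis vectors form a basis of \<open>\<complex>\<^sup>e\<^sup>+\<^sup>1\<close>.
\<close>
lemma kernel_line:
  fixes A :: "nat \<Rightarrow> nat \<Rightarrow> complex"
  assumes surj: "\<And>y. \<exists>x. \<forall>i<e. (\<Sum>j<Suc e. A i j * x j) = y i"
    and v: "v \<in> Cn (Suc e)" "\<And>i. i < e \<Longrightarrow> (\<Sum>j<Suc e. A i j * v j) = 0"
    and \<xi>: "\<And>i. i < e \<Longrightarrow> (\<Sum>j<Suc e. A i j * \<xi> j) = 0" "i0 < Suc e" "\<xi> i0 \<noteq> 0" "v i0 = 0"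
  shows "v = (\<lambda>_. 0)"
proof -
  note sum.lessThan_Suc [simp del]
  have "\<forall>k. \<exists>x. \<forall>i<e. (\<Sum>j<Suc e. A i j * x j) = (if i = k then 1 else 0)" by (intro allI surj)
  from choice[OF this] obtain X where "\<forall>k. \<forall>i<e. (\<Sum>j<Suc e. A i j * X k j) = (if i = k then 1 else 0)"
    by (rule exE)
  then have X: "(\<Sum>j<Suc e. A i j * X k j) = (if i = k then 1 else 0)" if "i < e" for i k using that by simp
  define M where "M j l = (case l of 0 \<Rightarrow> \<xi> j | Suc k \<Rightarrow> X k j)" for j l
  have AM: "(\<Sum>j<Suc e. A i j * (\<Sum>l<Suc e. M j l * c l)) = c (Suc i)" if i: "i < e" for i c
  proof -
    have "(\<Sum>j<Suc e. A i j * (\<Sum>l<Suc e. M j l * c l)) = (\<Sum>j<Suc e. \<Sum>l<Suc e. A i j * M j l * c l)"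
      by (simp only: sum_distrib_left mult.assoc)
    also have "\<dots> = (\<Sum>l<Suc e. \<Sum>j<Suc e. A i j * M j l * c l)" by (rule sum.swap)
    also have "\<dots> = (\<Sum>l<Suc e. (\<Sum>j<Suc e. A i j * M j l) * c l)" by (simp only: sum_distrib_right)
    also have "\<dots> = (\<Sum>l<Suc e. (if l = Suc i then 1 else 0) * c l)"
    proof (rule sum.cong[OF refl])
      fix l show "(\<Sum>j<Suc e. A i j * M j l) * c l = (if l = Suc i then 1 else 0) * c l"
        using X[OF i] \<xi>(1)[OF i] by (cases l) (auto simp: M_def simp del: sum.lessThan_Suc)
    qed
    also have "\<dots> = c (Suc i)" using i
      by (subst sum.remove[of _ "Suc i"]) (auto intro!: sum.neutral)
    finally show ?thesis .
  qed
  have injM: "c = (\<lambda>_. 0)" if c: "c \<in> Cn (Suc e)" "\<And>k. k < Suc e \<Longrightarrow> (\<Sum>l<Suc e. M k l * c l) = 0" for c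
  proof -
    have 1: "c (Suc i) = 0" if "i < e" for i using AM[OF that, of c] c(2) by simp
    have z: "c l = 0" if "0 < l" "l < Suc e" for l using 1[of "l - 1"] that by simp
    have "(\<Sum>l<Suc e. M i0 l * c l) = M i0 0 * c 0"
      by (subst sum.remove[of _ 0]) (auto intro!: sum.neutral simp: z)
    then have "c 0 = 0" using c(2)[OF \<xi>(2)] \<xi>(3) by (simp add: M_def)
    have "c k = 0" for k
    proof (cases k)
      case (Suc i)
      then show ?thesis using 1[of i] c(1) by (cases "i < e") (auto simp: Cn_def)
    qed (use \<open>c 0 = 0\<close> in simp)
    then show ?thesis by auto
  qed
  have "\<exists>c\<in>Cn (Suc e). \<forall>k<Suc e. (\<Sum>l<Suc e. M k l * c l) = v k"
    by (rule injective_matrix_surj[OF _ v(1)], rule injM)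
  then obtain c where "c \<in> Cn (Suc e)" and c0: "\<forall>k<Suc e. (\<Sum>l<Suc e. M k l * c l) = v k" by (rule bexE)
  have c: "(\<Sum>l<Suc e. M k l * c l) = v k" if "k < Suc e" for k using c0 that by blast
  have 1: "c (Suc i) = 0" if "i < e" for i
  proof -
    have "(\<Sum>j<Suc e. A i j * (\<Sum>l<Suc e. M j l * c l)) = (\<Sum>j<Suc e. A i j * v j)"
      by (intro sum.cong refl) (simp_all add: c)
    then show ?thesis using AM[OF that, of c] v(2)[OF that] by simp
  qed
  have vk: "v k = \<xi> k * c 0" if "k < Suc e" for k
  proof -
    have z: "c l = 0" if "0 < l" "l < Suc e" for l using 1[of "l - 1"] that by simp
    have "(\<Sum>l<Suc e. M k l * c l) = M k 0 * c 0"
      by (subst sum.remove[of _ 0]) (auto intro!: sum.neutral simp: z)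
    then show ?thesis using c[OF that] by (simp only: M_def nat.case)
  qed
  have "c 0 = 0" using vk[OF \<xi>(2)] unfolding \<xi>(4) using \<xi>(3) by simp
  show ?thesis
  proof
    fix k show "v k = 0" using vk[of k] \<open>c 0 = 0\<close> v(1) by (cases "k < Suc e") (auto simp: Cn_def)
  qed
qed

lemma RS_familyD:
  assumes "RS_family X"
  shows "complex_atlas (tot X)" "complex_atlas (base X)" "holo_map (tot X) (base X) UNIV (proj X)"
    and "(U, d, \<phi>) \<in> tot X \<Longrightarrow> (V, e, \<psi>) \<in> base X \<Longrightarrow> p \<in> U \<Longrightarrow> proj X p \<in> V \<Longrightarrow> d = Suc e"
    and "(U, d, \<phi>) \<in> tot X \<Longrightarrow> (V, e, \<psi>) \<in> base X \<Longrightarrow> p \<in> U \<Longrightarrow> proj X p \<in> V \<Longrightarrow>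
      \<exists>x. \<forall>i<e. (\<Sum>j<d. pd j (\<lambda>z. \<psi> (proj X (inv_into U \<phi> z)) i) (\<phi> p) * x j) = y i"
  using assms unfolding RS_family_def by fastforce+

lemma open_proj_preimage:
  assumes "RS_family X" "open B"
  shows "open (proj X -` B)"
  using holo_map_open_preimage[OF RS_familyD(3)[OF assms(1)] open_UNIV assms(2)] by simp

lemma proj_continuous: "RS_family X \<Longrightarrow> continuous_on S (proj X)"
  using RS_familyD(3) unfolding holo_map_def by (meson continuous_on_subset subset_UNIV)

lemma holo_fun_base_coords:
  assumes X: "RS_family X" and c: "holo_coords (base X) B e \<psi>" and i: "i < e"
  shows "holo_fun (tot X) (proj X -` B) (\<lambda>p. \<psi> (proj X p) i)"
  using holo_map_compose_fun[OF RS_familyD(1,2)[OF X] open_UNIV RS_familyD(3)[OF X]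
      is_chartD(1)[OF holo_coordsD(1)[OF c]] holo_fun_coordinate[OF RS_familyD(2)[OF X] c i]]
  by simp

lemma fiber_coordD:
  assumes "fiber_coord X U \<mu>"
  shows "open U" "holo_fun (tot X) U \<mu>"
    "\<And>p q. p \<in> U \<Longrightarrow> q \<in> U \<Longrightarrow> proj X p = proj X q \<Longrightarrow> \<mu> p = \<mu> q \<Longrightarrow> p = q"
  using assms unfolding fiber_coord_def inj_on_def by auto

text \<open>
  The fiber through \<open>p\<close> contains a holomorphic curve whose tangent vector at \<open>p\<close> spans the kernel of
  the differential of the projection. An injective holomorphic function of one variable has nonzero
  derivative, so the differential of \<open>\<mu>\<close> does not vanish on that tangent vector.
\<close>
lemma fiber_jacobian_atlas:
  assumes X: "RS_family X" and \<mu>: "fiber_coord X U \<mu>"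
    and U1: "(U1, d, \<phi>) \<in> tot X" and B: "(B, e, \<psi>) \<in> base X"
    and p: "p \<in> U" "p \<in> U1" "proj X p \<in> B"
    and v: "v \<in> Cn d" "(\<Sum>j<d. pd j (\<lambda>x. \<mu> (inv_into U1 \<phi> x)) (\<phi> p) * v j) = 0"
      "\<And>i. i < e \<Longrightarrow> (\<Sum>j<d. pd j (\<lambda>x. \<psi> (proj X (inv_into U1 \<phi> x)) i) (\<phi> p) * v j) = 0"
  shows "v = (\<lambda>_. 0)"
proof (rule ccontr)
  assume "v \<noteq> (\<lambda>_. 0)"
  then obtain i0 where i0: "v i0 \<noteq> 0" by auto
  have i0d: "i0 < d" using i0 v(1) unfolding Cn_def using not_le by blast
  have d: "d = Suc e" using RS_familyD(4)[OF X U1 B p(2,3)] .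
  note tot = RS_familyD(1)[OF X] and bas = RS_familyD(2)[OF X]
  note ch = complex_atlasD(1)[OF tot U1] and chB = complex_atlasD(1)[OF bas B]
  define N where "N = U \<inter> U1 \<inter> proj X -` B"
  have oN: "open N" "N \<subseteq> U1" "p \<in> N" "open (proj X -` B)"
    unfolding N_def using fiber_coordD(1)[OF \<mu>] is_chartD(1)[OF ch] open_proj_preimage[OF X is_chartD(1)[OF chB]] p
    by auto
  define S where "S = \<phi> ` N"
  have S: "openin (top_of_set (Cn d)) S" unfolding S_def using chart_open_image[OF ch oN(1,2)] .
  have inv: "inv_into U1 \<phi> (\<phi> q) = q" if "q \<in> N" for q using is_chartD(6)[OF ch] that oN(2) by blast
  define x0 where "x0 = \<phi> p"
  have x0: "x0 \<in> S" using oN by (simp add: x0_def S_def)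
  have x0C: "x0 \<in> Cn d" using openin_CnD[OF S x0] .
  define m where "m x = \<mu> (inv_into U1 \<phi> x)" for x
  define P where "P i x = \<psi> (proj X (inv_into U1 \<phi> x)) i" for i x
  have m_abs: "m = (\<lambda>x. \<mu> (inv_into U1 \<phi> x))" and P_abs: "P i = (\<lambda>x. \<psi> (proj X (inv_into U1 \<phi> x)) i)" for i
    by (simp_all add: m_def P_def fun_eq_iff)
  have hm: "holo d S m"
    unfolding S_def m_def
    by (rule holo_in_coords[OF tot atlas_holo_coords[OF tot U1] oN(1,2)
        holo_fun_subset[OF tot fiber_coordD(2)[OF \<mu>] _ fiber_coordD(1)[OF \<mu>] oN(1)]])
       (auto simp: N_def)
  have hP: "holo d S (P i)" if "i < e" for i
    unfolding S_def P_def
    by (rule holo_in_coords[OF tot atlas_holo_coords[OF tot U1] oN(1,2)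
        holo_fun_subset[OF tot holo_fun_base_coords[OF X atlas_holo_coords[OF bas B] that] _ oN(4,1)]])
       (auto simp: N_def)
  \<comment> \<open>near \<open>x0\<close>, the coordinate \<open>x i0\<close> and the base coordinates form a coordinate system, as \<open>v i0 \<noteq> 0\<close>\<close>
  define G where "G x = case_nat (x i0) (\<psi> (proj X (inv_into U1 \<phi> x)))" for x
  have G0: "G x 0 = x i0" and GS: "G x (Suc i) = P i x" for x i by (simp_all add: G_def P_def)
  have GC: "G x \<in> Cn d" if "x \<in> S" for x
  proof -
    have "proj X (inv_into U1 \<phi> x) \<in> B" using that inv by (auto simp: S_def) (auto simp: N_def)
    then show ?thesis unfolding G_def d by (intro case_nat_mem_Cn is_chartD(7)[OF chB])
  qed
  have SC: "S \<subseteq> Cn d" using openin_imp_subset[OF S] .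
  have hG: "holo d S (\<lambda>x. G x k)" if "k < d" for k
    using that hP holo_coordinate[OF i0d SC] by (cases k) (simp_all add: G0 GS d)
  define A where "A i j = pd j (P i) x0" for i j
  have surjA: "\<exists>x. \<forall>i<e. (\<Sum>j<Suc e. A i j * x j) = y i" for y
    using RS_familyD(5)[OF X U1 B p(2,3), of y] unfolding A_def P_abs x0_def d .
  have vA: "(\<Sum>j<Suc e. A i j * v j) = 0" if "i < e" for i
    using v(3)[OF that] unfolding A_def P_abs x0_def d .
  have ker: "w = (\<lambda>_. 0)" if "w \<in> Cn (Suc e)" "\<And>i. i < e \<Longrightarrow> (\<Sum>j<Suc e. A i j * w j) = 0" "w i0 = 0" for w
    by (rule kernel_line[of e A w v i0]) (use surjA that vA i0 i0d d in auto)
  have pdG0: "pd j (\<lambda>x. G x 0) x0 = (if j = i0 then 1 else 0)" for j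
    by (cases "j = i0") (simp_all add: G0 pd_def)
  have "\<exists>c>0. \<exists>\<delta>>0. \<forall>y\<in>Cn d. \<forall>z\<in>Cn d. cdist d x0 y < \<delta> \<longrightarrow> cdist d x0 z < \<delta> \<longrightarrow>
    c * cdist d y z \<le> cdist d (G y) (G z)"
  proof (rule strict_expansive[where A = "\<lambda>k j. pd j (\<lambda>x. G x k) x0"])
    show "strict_deriv d (\<lambda>x. G x k) (\<lambda>j. pd j (\<lambda>x. G x k) x0) x0" if "k < d" for k
      using holo_imp_strict[OF S hG[OF that] x0] .
    fix w assume w: "w \<in> Cn d" "\<And>k. k < d \<Longrightarrow> (\<Sum>j<d. pd j (\<lambda>x. G x k) x0 * w j) = 0"
    show "w = (\<lambda>_. 0)"
    proof (rule ker)
      show "w \<in> Cn (Suc e)" using w(1) d by simp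
      show "(\<Sum>j<Suc e. A i j * w j) = 0" if "i < e" for i
        using w(2)[of "Suc i"] that d unfolding A_def GS by simp
      have "(\<Sum>j<d. (if j = i0 then 1 else 0) * w j) = 0" using w(2)[of 0] d unfolding pdG0 by simp
      then show "w i0 = 0" by (subst (asm) sum.remove[of _ i0]) (use i0d in \<open>auto simp: sum.neutral\<close>)
    qed
  qed
  then obtain c \<delta> where c: "c > 0" "\<delta> > 0" and cG: "\<forall>y\<in>Cn d. \<forall>z\<in>Cn d. cdist d x0 y < \<delta> \<longrightarrow> cdist d x0 z < \<delta> \<longrightarrow>
    c * cdist d y z \<le> cdist d (G y) (G z)" by blast
  define S0 where "S0 = S \<inter> {x\<in>Cn d. cdist d x0 x < \<delta>}"
  have S0: "openin (top_of_set (Cn d)) S0" unfolding S0_def by (intro openin_Int S openin_cdist_ball x0C)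
  have x0S0: "x0 \<in> S0" using x0 x0C c by (simp add: S0_def)
  have exp: "c * cdist d y z \<le> cdist d (G y) (G z)" if "y \<in> S0" "z \<in> S0" for y z
    using cG that by (auto simp: S0_def)
  have hG0: "holo d S0 (\<lambda>x. G x k)" if "k < d" for k
    by (rule holo_subset[OF S S0 _ hG[OF that]]) (simp add: S0_def)
  have injG: "inj_on G S0"
  proof (rule inj_onI)
    fix y z assume yz: "y \<in> S0" "z \<in> S0" "G y = G z"
    then have "c * cdist d y z \<le> 0" using exp[OF yz(1,2)] by simp
    then have "cdist d y z = 0" using c cdist_ge_0[of d y z] by (simp add: mult_le_0_iff)
    then show "y = z" using cdist_eq_0_iff[of y d z] yz by (simp add: S0_def)
  qed
  have GC0: "G ` S0 \<subseteq> Cn d" using GC by (auto simp: S0_def)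
  have exp': "\<exists>c>0. \<exists>\<delta>>0. \<forall>y\<in>S0. cdist d x y < \<delta> \<longrightarrow> c * cdist d x y \<le> cdist d (G x) (G y)" if "x \<in> S0" for x
    using exp[OF that] c(1) zero_less_one by blast
  have hinv1: "openin (top_of_set (Cn d)) (G ` S0)"
    by (rule holo_inverse(1)[OF S0 _ GC0 injG], erule hG0, erule exp')
  have hinv3: "holo d (G ` S0) (\<lambda>y. inv_into S0 G y i)" if "i < d" for i
    by (rule holo_inverse(3)[OF S0 _ GC0 injG _ that], erule hG0, erule exp')
  have GI: "inv_into S0 G (G x) = x" if "x \<in> S0" for x using injG that by simp
  \<comment> \<open>a curve in the fiber: the base coordinates are constant along it\<close>
  define \<gamma> where "\<gamma> t = inv_into S0 G ((G x0)(0 := t))" for t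
  define t0 where "t0 = x0 i0"
  have Gx0: "(G x0)(0 := t0) = G x0" using G0[of x0] by (simp add: t0_def fun_upd_idem)
  have d0: "0 < d" using d by simp
  have "open {t. (G x0)(0 := t) \<in> G ` S0}" by (rule openin_Cn_line[OF hinv1 _ d0]) (rule imageI[OF x0S0])
  moreover have "t0 \<in> {t. (G x0)(0 := t) \<in> G ` S0}" using Gx0 x0S0 by auto
  ultimately obtain r where r: "r > 0" "ball t0 r \<subseteq> {t. (G x0)(0 := t) \<in> G ` S0}"
    using open_contains_ball by blast
  have mem: "(G x0)(0 := t) \<in> G ` S0" if "t \<in> ball t0 r" for t using r(2) that by blast
  have G\<gamma>: "G (\<gamma> t) = (G x0)(0 := t)" and \<gamma>S0: "\<gamma> t \<in> S0" if "t \<in> ball t0 r" for t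
    unfolding \<gamma>_def by (rule f_inv_into_f[OF mem[OF that]], rule inv_into_into[OF mem[OF that]])
  have \<gamma>t0: "\<gamma> t0 = x0" unfolding \<gamma>_def Gx0 using GI[OF x0S0] .
  have t0b: "t0 \<in> ball t0 r" using r(1) by simp
  have \<gamma>hol: "(\<lambda>t. \<gamma> t j) holomorphic_on ball t0 r" if "j < d" for j
    unfolding \<gamma>_def
    by (rule holomorphic_on_subset[OF sep_holo_line[OF holo_imp_sep(2)[OF hinv1 hinv3[OF that]] d0] r(2)])
  define \<gamma>' where "\<gamma>' j = (if j < d then deriv (\<lambda>t. \<gamma> t j) t0 else 0)" for j
  have d\<gamma>: "((\<lambda>t. \<gamma> t j) has_field_derivative \<gamma>' j) (at t)" if "j < d" "t = t0" for j t
    using \<gamma>hol[OF that(1)] that t0b by (simp add: \<gamma>'_def holomorphic_derivI)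
  have ev: "eventually (\<lambda>t. t \<in> ball t0 r) (nhds t0)" using r(1) by (intro eventually_nhds_in_open) auto
  have ev\<gamma>: "eventually (\<lambda>t. \<gamma> t \<in> Cn d) (nhds t0)"
    using ev by eventually_elim (use \<gamma>S0 S0_def in blast)
  have dP: "((\<lambda>t. P i (\<gamma> t)) has_field_derivative (\<Sum>j<d. pd j (P i) (\<gamma> t0) * \<gamma>' j)) (at t0)" if "i < e" for i
    by (rule holo_chain[OF S hP[OF that] _ ev\<gamma>]) (use x0 \<gamma>t0 d\<gamma> in auto)
  \<comment> \<open>the tangent vector of the curve is in the kernel of the differential of the projection, so it is a multiple of \<open>v\<close>\<close>
  have "(\<Sum>j<Suc e. A i j * \<gamma>' j) = 0" if i: "i < e" for i
  proof -
    have "eventually (\<lambda>t. P i (\<gamma> t) = P i x0) (nhds t0)"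
      using ev
    proof eventually_elim
      case (elim t)
      have "P i (\<gamma> t) = G (\<gamma> t) (Suc i)" by (simp add: GS)
      also have "\<dots> = P i x0" unfolding G\<gamma>[OF elim] by (simp add: GS)
      finally show ?case .
    qed
    then have "((\<lambda>_. P i x0) has_field_derivative (\<Sum>j<d. pd j (P i) (\<gamma> t0) * \<gamma>' j)) (at t0)"
      by (rule iffD1[OF DERIV_cong_ev[OF refl _ refl] dP[OF i]])
    then have "(\<Sum>j<d. pd j (P i) (\<gamma> t0) * \<gamma>' j) = 0" using DERIV_unique DERIV_const by blast
    then show ?thesis unfolding \<gamma>t0 A_def d .
  qed
  moreover have "\<gamma>' i0 = 1"
  proof -
    have "eventually (\<lambda>t. \<gamma> t i0 = t) (nhds t0)"
      using ev
    proof eventually_elim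
      case (elim t)
      have "\<gamma> t i0 = G (\<gamma> t) 0" by (simp add: G0)
      also have "\<dots> = t" unfolding G\<gamma>[OF elim] by simp
      finally show ?case .
    qed
    then have "((\<lambda>t. t) has_field_derivative \<gamma>' i0) (at t0)"
      by (rule iffD1[OF DERIV_cong_ev[OF refl _ refl] d\<gamma>[OF i0d refl]])
    then show ?thesis using DERIV_unique DERIV_ident by blast
  qed
  ultimately have "(\<lambda>j. \<gamma>' j - (1 / v i0) * v j) = (\<lambda>_. 0)"
  proof (intro ker)
    show "(\<lambda>j. \<gamma>' j - 1 / v i0 * v j) \<in> Cn (Suc e)" using v(1) by (auto simp: Cn_def \<gamma>'_def d)
    assume *: "\<And>i. i < e \<Longrightarrow> (\<Sum>j<Suc e. A i j * \<gamma>' j) = 0"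
    show "(\<Sum>j<Suc e. A i j * (\<gamma>' j - 1 / v i0 * v j)) = 0" if "i < e" for i
    proof -
      have "(\<Sum>j<Suc e. A i j * (\<gamma>' j - 1 / v i0 * v j)) =
        (\<Sum>j<Suc e. A i j * \<gamma>' j) - 1 / v i0 * (\<Sum>j<Suc e. A i j * v j)"
        by (simp only: right_diff_distrib sum_subtractf sum_distrib_left mult.left_commute)
      then show ?thesis using * vA that by (simp del: sum.lessThan_Suc)
    qed
  qed (use i0 in simp)
  then have \<gamma>'v: "\<gamma>' j = (1 / v i0) * v j" for j by (auto simp: fun_eq_iff)
  \<comment> \<open>\<open>\<mu>\<close> along the curve is injective, so its derivative is nonzero; but this derivative is a multiple of the differential of \<open>\<mu>\<close> on \<open>v\<close>\<close>
  define f where "f t = m (\<gamma> t)" for t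
  have df: "(f has_field_derivative (\<Sum>j<d. pd j m (\<gamma> t) * deriv (\<lambda>t. \<gamma> t j) t)) (at t)" if "t \<in> ball t0 r" for t
    unfolding f_def
  proof (rule holo_chain[OF S hm])
    show "\<gamma> t \<in> S" using \<gamma>S0[OF that] by (simp add: S0_def)
    have "eventually (\<lambda>t. t \<in> ball t0 r) (nhds t)" using that by (intro eventually_nhds_in_open) auto
    then show "eventually (\<lambda>t. \<gamma> t \<in> Cn d) (nhds t)" by eventually_elim (use \<gamma>S0 S0_def in blast)
    show "((\<lambda>t. \<gamma> t j) has_field_derivative deriv (\<lambda>t. \<gamma> t j) t) (at t)" if "j < d" for j
      using \<gamma>hol[OF that] \<open>t \<in> ball t0 r\<close> by (simp add: holomorphic_derivI)
  qed
  have fhol: "f holomorphic_on ball t0 r"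
    using df unfolding holomorphic_on_def field_differentiable_def
    by (meson has_field_derivative_at_within)
  have finj: "inj_on f (ball t0 r)"
  proof (rule inj_onI)
    fix s t assume st: "s \<in> ball t0 r" "t \<in> ball t0 r" "f s = f t"
    define a where "a = inv_into U1 \<phi> (\<gamma> s)"
    define b where "b = inv_into U1 \<phi> (\<gamma> t)"
    have "\<gamma> s \<in> \<phi> ` N" "\<gamma> t \<in> \<phi> ` N" using \<gamma>S0 st by (auto simp: S0_def S_def)
    then have ab: "a \<in> N" "b \<in> N" "\<phi> a = \<gamma> s" "\<phi> b = \<gamma> t" unfolding a_def b_def using inv by auto
    have "\<psi> (proj X a) = Cn_tail (G (\<gamma> s))" "\<psi> (proj X b) = Cn_tail (G (\<gamma> t))"
      by (simp_all add: G_def a_def b_def)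
    moreover have "Cn_tail (G (\<gamma> s)) = Cn_tail (G (\<gamma> t))"
      unfolding G\<gamma>[OF st(1)] G\<gamma>[OF st(2)] by (simp add: Cn_tail_def)
    ultimately have "\<psi> (proj X a) = \<psi> (proj X b)" by simp
    then have "proj X a = proj X b"
      by (rule inj_onD[OF is_chartD(3)[OF chB]]) (use ab(1,2) in \<open>auto simp: N_def\<close>)
    moreover have "\<mu> a = \<mu> b" using st(3) by (simp add: f_def m_def a_def b_def)
    ultimately have "a = b" using fiber_coordD(3)[OF \<mu>, of a b] ab(1,2) by (simp add: N_def)
    then have "G (\<gamma> s) = G (\<gamma> t)" using ab by simp
    then have "(G x0)(0 := s) = (G x0)(0 := t)" unfolding G\<gamma>[OF st(1)] G\<gamma>[OF st(2)] .
    from fun_cong[OF this, of 0] show "s = t" by simp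
  qed
  have "deriv f t0 \<noteq> 0" using holomorphic_injective_imp_regular[OF fhol open_ball finj t0b] .
  moreover have "deriv f t0 = (\<Sum>j<d. pd j m x0 * ((1 / v i0) * v j))"
  proof -
    have "deriv f t0 = (\<Sum>j<d. pd j m (\<gamma> t0) * deriv (\<lambda>t. \<gamma> t j) t0)" by (rule DERIV_imp_deriv[OF df[OF t0b]])
    also have "\<dots> = (\<Sum>j<d. pd j m x0 * \<gamma>' j)" unfolding \<gamma>t0 by (rule sum.cong) (auto simp: \<gamma>'_def)
    finally show ?thesis unfolding \<gamma>'v .
  qed
  moreover have "(\<Sum>j<d. pd j m x0 * ((1 / v i0) * v j)) = (1 / v i0) * (\<Sum>j<d. pd j m x0 * v j)"
    by (simp only: sum_distrib_left mult.left_commute)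
  ultimately show False using v(2) unfolding m_abs x0_def by simp
qed

text \<open>Arbitrary base coordinates \<open>\<psi>\<close> instead of charts of the atlas, by the chain rule.\<close>
lemma fiber_jacobian:
  assumes X: "RS_family X" and \<mu>: "fiber_coord X U \<mu>"
    and U1: "(U1, d, \<phi>) \<in> tot X" and B: "holo_coords (base X) B e \<psi>"
    and p: "p \<in> U" "p \<in> U1" "proj X p \<in> B"
    and v: "v \<in> Cn d" "(\<Sum>j<d. pd j (\<lambda>x. \<mu> (inv_into U1 \<phi> x)) (\<phi> p) * v j) = 0"
      "\<And>i. i < e \<Longrightarrow> (\<Sum>j<d. pd j (\<lambda>x. \<psi> (proj X (inv_into U1 \<phi> x)) i) (\<phi> p) * v j) = 0"
  shows "v = (\<lambda>_. 0)"
proof -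
  note tot = RS_familyD(1)[OF X] and bas = RS_familyD(2)[OF X]
  obtain B' e' \<psi>' where B': "(B', e', \<psi>') \<in> base X" "proj X p \<in> B'" using complex_atlasD(3)[OF bas] by blast
  note ch = complex_atlasD(1)[OF tot U1] and chB' = complex_atlasD(1)[OF bas B'(1)] and chB = holo_coordsD(1)[OF B]
  have ee: "e' = e" using chart_dim_eq[OF chB' chB B'(2) p(3)] .
  have oB: "open (B \<inter> B')" using is_chartD(1)[OF chB'] is_chartD(1)[OF chB] by auto
  define S where "S = \<phi> ` (proj X -` (B \<inter> B') \<inter> U1)"
  have S: "openin (top_of_set (Cn d)) S"
    unfolding S_def using chart_image_openin[OF tot open_proj_preimage[OF X oB] U1] .
  have x0: "\<phi> p \<in> S" using p B' by (auto simp: S_def)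
  define T where "T = \<psi> ` (B \<inter> B')"
  have T: "openin (top_of_set (Cn e)) T" unfolding T_def using chart_open_image[OF chB oB] by simp
  define F where "F x = \<psi> (proj X (inv_into U1 \<phi> x))" for x
  have inB: "proj X (inv_into U1 \<phi> x) \<in> B \<inter> B'" if "x \<in> S" for x
    using that chart_inv[OF tot U1] by (auto simp: S_def)
  have FT: "F x \<in> T" if "x \<in> S" for x using inB[OF that] by (simp add: F_def T_def)
  have hF: "holo d S (\<lambda>x. F x i)" if "i < e" for i
  proof -
    have "holo d (\<phi> ` (proj X -` B \<inter> U1)) (\<lambda>x. F x i)"
      unfolding F_def by (rule holo_funD[OF holo_fun_base_coords[OF X B that] U1])
    then show ?thesis
      by (rule holo_subset[OF chart_image_openin[OF tot open_proj_preimage[OF X is_chartD(1)[OF chB]] U1] S, rotated])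
         (auto simp: S_def)
  qed
  show ?thesis
  proof (rule fiber_jacobian_atlas[OF X \<mu> U1 B'(1) p(1,2) B'(2) v(1,2)])
    fix i assume "i < e'"
    then have i: "i < e" "i < e'" using ee by auto
    define g where "g y = \<psi>' (inv_into B \<psi> y) i" for y
    have hg: "holo e T g" unfolding g_def T_def by (rule holo_coordsD(2)[OF B B'(1) i(2)])
    have pd_eq: "pd j (\<lambda>x. \<psi>' (proj X (inv_into U1 \<phi> x)) i) (\<phi> p) =
      (\<Sum>k<e. pd k g (F (\<phi> p)) * pd j (\<lambda>x. F x k) (\<phi> p))" if j: "j < d" for j
    proof -
      have "pd j (\<lambda>x. \<psi>' (proj X (inv_into U1 \<phi> x)) i) (\<phi> p) = pd j (\<lambda>x. g (F x)) (\<phi> p)"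
        by (rule pd_cong[OF S x0 j]) (use inB is_chartD(6)[OF chB] in \<open>auto simp: g_def F_def\<close>)
      also have "\<dots> = (\<Sum>k<e. pd k g (F (\<phi> p)) * pd j (\<lambda>x. F x k) (\<phi> p))"
        by (rule pd_compose[OF S T _ _ hg x0 j]) (use FT hF in auto)
      finally show ?thesis .
    qed
    have "(\<Sum>j<d. pd j (\<lambda>x. \<psi>' (proj X (inv_into U1 \<phi> x)) i) (\<phi> p) * v j) =
      (\<Sum>j<d. \<Sum>k<e. pd k g (F (\<phi> p)) * (pd j (\<lambda>x. F x k) (\<phi> p) * v j))"
      by (rule sum.cong) (simp_all add: pd_eq sum_distrib_right mult.assoc)
    also have "\<dots> = (\<Sum>k<e. \<Sum>j<d. pd k g (F (\<phi> p)) * (pd j (\<lambda>x. F x k) (\<phi> p) * v j))" by (rule sum.swap)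
    also have "\<dots> = (\<Sum>k<e. pd k g (F (\<phi> p)) * (\<Sum>j<d. pd j (\<lambda>x. F x k) (\<phi> p) * v j))"
      by (simp only: sum_distrib_left)
    also have "\<dots> = 0" using v(3) by (intro sum.neutral) (simp add: F_def)
    finally show "(\<Sum>j<d. pd j (\<lambda>x. \<psi>' (proj X (inv_into U1 \<phi> x)) i) (\<phi> p) * v j) = 0" .
  qed
qed

text \<open>
  Injectivity of the differential (\<open>fiber_jacobian\<close>) makes the map locally expansive, so its local
  inverses are holomorphic by \<open>holo_inverse\<close>.
\<close>
theorem fiber_chart:
  assumes X: "RS_family X" and \<mu>: "fiber_coord X U \<mu>" and B: "holo_coords (base X) B e \<psi>"
  shows "holo_coords (tot X) (U \<inter> proj X -` B) (Suc e) (\<lambda>p. case_nat (\<mu> p) (\<psi> (proj X p)))"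
proof -
  note tot = RS_familyD(1)[OF X] and bas = RS_familyD(2)[OF X]
  note chB = holo_coordsD(1)[OF B]
  define N where "N = U \<inter> proj X -` B"
  define c where "c p = case_nat (\<mu> p) (\<psi> (proj X p))" for p
  have oB: "open (proj X -` B)" using open_proj_preimage[OF X is_chartD(1)[OF chB]] .
  have oN: "open N" unfolding N_def using fiber_coordD(1)[OF \<mu>] oB by auto
  have inj: "inj_on c N"
  proof (rule inj_onI)
    fix p q assume pq: "p \<in> N" "q \<in> N" "c p = c q"
    from arg_cong[OF pq(3), of Cn_tail] have "\<psi> (proj X p) = \<psi> (proj X q)" by (simp add: c_def)
    then have "proj X p = proj X q"
      by (rule inj_onD[OF is_chartD(3)[OF chB]]) (use pq in \<open>auto simp: N_def\<close>)
    moreover from fun_cong[OF pq(3), of 0] have "\<mu> p = \<mu> q" by (simp add: c_def)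
    ultimately show "p = q" using fiber_coordD(3)[OF \<mu>, of p q] pq by (simp add: N_def)
  qed
  have cC: "c p \<in> Cn (Suc e)" if "p \<in> N" for p
    using that unfolding c_def by (intro case_nat_mem_Cn is_chartD(7)[OF chB]) (simp add: N_def)
  have hc: "holo_fun (tot X) N (\<lambda>p. c p i)" if "i < Suc e" for i
  proof (cases i)
    case 0
    have "holo_fun (tot X) N \<mu>"
      by (rule holo_fun_subset[OF tot fiber_coordD(2)[OF \<mu>] _ fiber_coordD(1)[OF \<mu>] oN]) (simp add: N_def)
    then show ?thesis by (simp add: c_def 0)
  next
    case (Suc j)
    have "holo_fun (tot X) N (\<lambda>p. \<psi> (proj X p) j)"
      by (rule holo_fun_subset[OF tot holo_fun_base_coords[OF X B] _ oB oN]) (use that Suc in \<open>auto simp: N_def\<close>)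
    then show ?thesis by (simp add: c_def Suc)
  qed
  have cont: "continuous_on N c"
    by (rule continuous_on_into_Cn[OF cC]) (use hc holo_fun_continuous[OF tot oN] in auto)
  have local: "openin (top_of_set (Cn (Suc e))) (c ` (N' \<inter> U1)) \<and>
      (\<forall>i<d. holo (Suc e) (c ` (N' \<inter> U1)) (\<lambda>y. \<phi> (inv_into N c y) i))"
    if N': "open N'" "N' \<subseteq> N" and U1: "(U1, d, \<phi>) \<in> tot X" and ne: "N' \<inter> U1 \<noteq> {}" for N' U1 d \<phi>
  proof -
    note ch = complex_atlasD(1)[OF tot U1]
    obtain p0 where p0: "p0 \<in> N'" "p0 \<in> U1" using ne by blast
    obtain B' e' \<psi>' where B': "(B', e', \<psi>') \<in> base X" "proj X p0 \<in> B'" using complex_atlasD(3)[OF bas] by blast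
    have "e' = e"
      using chart_dim_eq[OF complex_atlasD(1)[OF bas B'(1)] chB B'(2)] p0 N' by (auto simp: N_def)
    then have d: "d = Suc e" using RS_familyD(4)[OF X U1 B'(1) p0(2) B'(2)] by simp
    define S where "S = \<phi> ` (N' \<inter> U1)"
    have S: "openin (top_of_set (Cn d)) S" unfolding S_def using chart_image_openin[OF tot N'(1) U1] .
    define F where "F x = c (inv_into U1 \<phi> x)" for x
    have inv: "inv_into U1 \<phi> x \<in> N' \<inter> U1" if "x \<in> S" for x
      using that chart_inv[OF tot U1] by (auto simp: S_def)
    have \<phi>inv: "\<phi> (inv_into U1 \<phi> x) = x" if "x \<in> S" for x
      using that chart_inv[OF tot U1] by (auto simp: S_def)
    have FS: "F ` S = c ` (N' \<inter> U1)" unfolding S_def F_def image_image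
      by (rule image_cong) (use chart_inv[OF tot U1] in auto)
    have hF: "holo d S (\<lambda>x. F x i)" if "i < d" for i
      unfolding F_def S_def
      by (rule holo_funD[OF holo_fun_subset[OF tot hc N'(2) oN N'(1)] U1]) (use that d in simp)
    have FC: "F ` S \<subseteq> Cn d" unfolding FS d using cC N' by blast
    have injF: "inj_on F S"
    proof (rule inj_onI)
      fix x y assume xy: "x \<in> S" "y \<in> S" "F x = F y"
      have "inv_into U1 \<phi> x = inv_into U1 \<phi> y"
        by (rule inj_onD[OF inj]) (use xy inv N' in \<open>auto simp: F_def\<close>)
      then show "x = y" using \<phi>inv xy by metis
    qed
    have exp: "\<exists>c>0. \<exists>\<delta>>0. \<forall>y\<in>S. cdist d x y < \<delta> \<longrightarrow> c * cdist d x y \<le> cdist d (F x) (F y)" if x: "x \<in> S" for x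
    proof -
      define p where "p = inv_into U1 \<phi> x"
      have p: "p \<in> N'" "p \<in> U1" "x = \<phi> p" using inv[OF x] \<phi>inv[OF x] by (auto simp: p_def)
      have "\<exists>c>0. \<exists>\<delta>>0. \<forall>y\<in>Cn d. \<forall>z\<in>Cn d. cdist d x y < \<delta> \<longrightarrow> cdist d x z < \<delta> \<longrightarrow>
          c * cdist d y z \<le> cdist d (F y) (F z)"
      proof (rule strict_expansive[where A = "\<lambda>k j. pd j (\<lambda>x. F x k) x"])
        show "strict_deriv d (\<lambda>x. F x k) (\<lambda>j. pd j (\<lambda>x. F x k) x) x" if "k < d" for k
          using holo_imp_strict[OF S hF[OF that] x] .
        fix v assume v: "v \<in> Cn d" "\<And>k. k < d \<Longrightarrow> (\<Sum>j<d. pd j (\<lambda>x. F x k) x * v j) = 0"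
        show "v = (\<lambda>_. 0)"
        proof (rule fiber_jacobian[OF X \<mu> U1 B _ p(2) _ v(1)])
          show "p \<in> U" "proj X p \<in> B" using p(1) N'(2) by (auto simp: N_def)
          show "(\<Sum>j<d. pd j (\<lambda>x. \<mu> (inv_into U1 \<phi> x)) (\<phi> p) * v j) = 0"
            using v(2)[of 0] unfolding p(3) F_def c_def by (simp add: d del: sum.lessThan_Suc)
          show "(\<Sum>j<d. pd j (\<lambda>x. \<psi> (proj X (inv_into U1 \<phi> x)) i) (\<phi> p) * v j) = 0" if "i < e" for i
            using v(2)[of "Suc i"] that unfolding p(3) F_def c_def by (simp add: d del: sum.lessThan_Suc)
        qed
      qed
      then obtain a \<delta> where a: "a > 0" "\<delta> > 0" "\<forall>y\<in>Cn d. \<forall>z\<in>Cn d. cdist d x y < \<delta> \<longrightarrow> cdist d x z < \<delta> \<longrightarrow>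
          a * cdist d y z \<le> cdist d (F y) (F z)" by blast
      have xC: "x \<in> Cn d" using openin_CnD[OF S x] .
      have "a * cdist d x y \<le> cdist d (F x) (F y)" if "y \<in> S" "cdist d x y < \<delta>" for y
        using a(3)[rule_format, OF xC openin_CnD[OF S that(1)]] a(2) that by simp
      then show ?thesis using a by blast
    qed
    have 1: "openin (top_of_set (Cn d)) (F ` S)"
      by (rule holo_inverse(1)[OF S _ FC injF], erule hF, erule exp)
    have 3: "holo d (F ` S) (\<lambda>y. inv_into S F y i)" if "i < d" for i
      by (rule holo_inverse(3)[OF S _ FC injF _ that], erule hF, erule exp)
    have eq: "inv_into S F y = \<phi> (inv_into N c y)" if y: "y \<in> F ` S" for y
    proof -
      obtain x where x: "x \<in> S" "y = F x" using y by blast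
      have "inv_into N c y = inv_into U1 \<phi> x"
        unfolding x(2) F_def by (rule inv_into_f_f[OF inj]) (use inv[OF x(1)] N'(2) in blast)
      moreover have "inv_into S F y = x" unfolding x(2) by (rule inv_into_f_f[OF injF x(1)])
      ultimately show ?thesis using \<phi>inv[OF x(1)] by simp
    qed
    have "holo (Suc e) (c ` (N' \<inter> U1)) (\<lambda>y. \<phi> (inv_into N c y) i)" if "i < d" for i
      using iffD1[OF holo_cong[OF openin_imp_subset[OF 1]] 3[OF that]] eq unfolding FS d by metis
    then show ?thesis using 1 unfolding FS d by blast
  qed
  have chart: "is_chart (N, Suc e, c)"
  proof (rule is_chartI[OF oN inj cont])
    fix S assume S: "open S" "S \<subseteq> N"
    have "openin (top_of_set (Cn (Suc e))) (\<Union>{c ` (S \<inter> U1) |U1 d \<phi>. (U1, d, \<phi>) \<in> tot X})"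
    proof (rule openin_Union)
      fix K assume "K \<in> {c ` (S \<inter> U1) |U1 d \<phi>. (U1, d, \<phi>) \<in> tot X}"
      then obtain U1 d \<phi> where U1: "(U1, d, \<phi>) \<in> tot X" "K = c ` (S \<inter> U1)" by blast
      show "openin (top_of_set (Cn (Suc e))) K"
        using local[OF S U1(1)] U1(2) by (cases "S \<inter> U1 = {}") auto
    qed
    moreover have "\<Union>{c ` (S \<inter> U1) |U1 d \<phi>. (U1, d, \<phi>) \<in> tot X} = c ` S"
    proof
      show "c ` S \<subseteq> \<Union>{c ` (S \<inter> U1) |U1 d \<phi>. (U1, d, \<phi>) \<in> tot X}"
      proof (rule image_subsetI)
        fix q assume "q \<in> S"
        moreover obtain U1 d \<phi> where "(U1, d, \<phi>) \<in> tot X" "q \<in> U1" using complex_atlasD(3)[OF tot] by blast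
        ultimately show "c q \<in> \<Union>{c ` (S \<inter> U1) |U1 d \<phi>. (U1, d, \<phi>) \<in> tot X}"
          by (intro UnionI[of "c ` (S \<inter> U1)"]) blast+
      qed
    qed auto
    ultimately show "openin (top_of_set (Cn (Suc e))) (c ` S)" by simp
  qed
  have "holo_coords (tot X) N (Suc e) c"
    unfolding holo_coords_def
  proof (intro conjI chart ballI)
    fix a assume a: "a \<in> tot X"
    obtain U1 d \<phi> where a': "a = (U1, d, \<phi>)" by (cases a)
    note U1 = a[unfolded a']
    show "holo_transition (N, Suc e, c) a"
    proof (cases "N \<inter> U1 = {}")
      case True
      then show ?thesis by (simp add: holo_transition_def a' holo_def)
    next
      case False
      then show ?thesis using local[OF oN subset_refl U1] by (simp add: holo_transition_def a')
    qed
    show "holo_transition a (N, Suc e, c)"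
      unfolding holo_transition_def a' using holo_funD[OF hc U1] by (simp add: Int_commute)
  qed
  then show ?thesis unfolding N_def c_def .
qed

section \<open>Holomorphic curves in the fibers and changes of fiber coordinates\<close>

text \<open>The curve in the fiber through \<open>p\<close> parametrized by \<open>\<mu> - \<mu> p\<close>. Its points are those at which \<open>coord_change\<close>
  evaluates the other coordinate. Its germ at \<open>0\<close> is independent of \<open>U\<close>.\<close>
definition fiber_curve :: "('c, 'b) family_data \<Rightarrow> 'c set \<Rightarrow> ('c \<Rightarrow> complex) \<Rightarrow> 'c \<Rightarrow> complex \<Rightarrow> 'c" where
  "fiber_curve X U \<mu> p z = inv_into U (\<lambda>q. (\<mu> q, proj X q)) (z + \<mu> p, proj X p)"

lemma coord_change_fiber_curve: "coord_change X U \<eta> \<mu> p z = \<eta> (fiber_curve X U \<mu> p z) - \<eta> p"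
  by (simp add: coord_change_def fiber_curve_def)

lemma fiber_curve_eq:
  assumes "fiber_coord X U \<mu>" "q \<in> U" "\<mu> q = z + \<mu> p" "proj X q = proj X p"
  shows "fiber_curve X U \<mu> p z = q"
  unfolding fiber_curve_def
proof (rule inv_into_f_eq)
  show "inj_on (\<lambda>q. (\<mu> q, proj X q)) U" using fiber_coordD(3)[OF assms(1)] by (auto intro!: inj_onI)
qed (use assms in auto)

lemma fiber_curve_0: "fiber_coord X U \<mu> \<Longrightarrow> p \<in> U \<Longrightarrow> fiber_curve X U \<mu> p 0 = p"
  by (rule fiber_curve_eq) auto

lemma fiber_coord_subset:
  assumes "RS_family X" "fiber_coord X U \<mu>" "open U'" "U' \<subseteq> U"
  shows "fiber_coord X U' \<mu>"
  unfolding fiber_coord_def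
  using holo_fun_subset[OF RS_familyD(1)[OF assms(1)] fiber_coordD(2)[OF assms(2)] assms(4) fiber_coordD(1)[OF assms(2)] assms(3)]
    assms by (auto simp: inj_on_def intro: fiber_coordD(3)[OF assms(2)])

lemma fiber_coord_Int:
  assumes "RS_family X" "fiber_coord X U \<mu>" "open U'"
  shows "fiber_coord X (U \<inter> U') \<mu>" "fiber_coord X (U' \<inter> U) \<mu>"
  using assms fiber_coordD(1)[OF assms(2)] by (auto intro: fiber_coord_subset)

text \<open>In the coordinates of \<open>fiber_chart\<close>, the curve \<open>fiber_curve\<close> moves along the first axis.\<close>
lemma fiber_curve_in_chart:
  assumes X: "RS_family X" and \<mu>: "fiber_coord X U \<mu>" and B: "holo_coords (base X) B e \<psi>"
    and p: "p \<in> U" "proj X p \<in> B"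
    and N: "N = U \<inter> proj X -` B" and c: "c = (\<lambda>q. case_nat (\<mu> q) (\<psi> (proj X q)))"
    and M: "open M" "M \<subseteq> N" and z: "(c p)(0 := z + \<mu> p) \<in> c ` M"
  shows "fiber_curve X U \<mu> p z \<in> M" "c (fiber_curve X U \<mu> p z) = (c p)(0 := z + \<mu> p)"
    "inv_into N c ((c p)(0 := z + \<mu> p)) = fiber_curve X U \<mu> p z"
    "\<mu> (fiber_curve X U \<mu> p z) = z + \<mu> p" "proj X (fiber_curve X U \<mu> p z) = proj X p"
proof -
  have ch: "is_chart (N, Suc e, c)" unfolding N c by (rule holo_coordsD(1)[OF fiber_chart[OF X \<mu> B]])
  obtain q where q: "q \<in> M" "c q = (c p)(0 := z + \<mu> p)" using z by (metis imageE)
  have 1: "\<mu> q = z + \<mu> p" using fun_cong[OF q(2), of 0] by (simp add: c)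
  have "Cn_tail (c q) = Cn_tail (c p)" unfolding q(2) by (simp add: Cn_tail_def)
  then have "\<psi> (proj X q) = \<psi> (proj X p)" by (simp add: c)
  then have 2: "proj X q = proj X p"
    by (rule inj_onD[OF is_chartD(3)[OF holo_coordsD(1)[OF B]]]) (use q(1) M p in \<open>auto simp: N\<close>)
  have eq: "fiber_curve X U \<mu> p z = q" by (rule fiber_curve_eq[OF \<mu> _ 1 2]) (use q M in \<open>auto simp: N\<close>)
  show "fiber_curve X U \<mu> p z \<in> M" "c (fiber_curve X U \<mu> p z) = (c p)(0 := z + \<mu> p)"
    "\<mu> (fiber_curve X U \<mu> p z) = z + \<mu> p" "proj X (fiber_curve X U \<mu> p z) = proj X p"
    unfolding eq using q 1 2 by auto
  show "inv_into N c ((c p)(0 := z + \<mu> p)) = fiber_curve X U \<mu> p z"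
    unfolding eq q(2)[symmetric] by (rule is_chartD(6)[OF ch]) (use q M in auto)
qed

lemma fiber_curve_ball:
  assumes X: "RS_family X" and \<mu>: "fiber_coord X U \<mu>" and B: "holo_coords (base X) B e \<psi>"
    and p: "p \<in> U" "proj X p \<in> B"
    and N: "N = U \<inter> proj X -` B" and c: "c = (\<lambda>q. case_nat (\<mu> q) (\<psi> (proj X q)))"
    and M: "open M" "M \<subseteq> N" "p \<in> M"
  obtains r where "r > 0" "\<And>z. z \<in> ball 0 r \<Longrightarrow> (c p)(0 := z + \<mu> p) \<in> c ` M"
proof -
  have ch: "is_chart (N, Suc e, c)" unfolding N c by (rule holo_coordsD(1)[OF fiber_chart[OF X \<mu> B]])
  have "open {t. (c p)(0 := t) \<in> c ` M}"
    by (rule openin_Cn_line[OF chart_open_image[OF ch M(1,2)]]) (use M(3) in auto)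
  moreover have "\<mu> p \<in> {t. (c p)(0 := t) \<in> c ` M}"
  proof -
    have "(c p)(0 := \<mu> p) = c p" by (simp add: c fun_upd_idem)
    then show ?thesis using M(3) by simp
  qed
  ultimately obtain r where r: "r > 0" "ball (\<mu> p) r \<subseteq> {t. (c p)(0 := t) \<in> c ` M}"
    using open_contains_ball by blast
  have "(c p)(0 := z + \<mu> p) \<in> c ` M" if "z \<in> ball 0 r" for z
  proof -
    have "z + \<mu> p \<in> ball (\<mu> p) r" using that by (simp add: dist_norm norm_minus_commute)
    then show ?thesis using r(2) by blast
  qed
  then show thesis using that r(1) by blast
qed

lemma deriv_shift: "(deriv ^^ k) (\<lambda>z. f (z + a)) = (\<lambda>z. (deriv ^^ k) f (z + a :: complex))"
proof (induction k)
  case (Suc k)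
  have "deriv (\<lambda>z. g (z + a)) = (\<lambda>z. deriv g (z + a))" for g :: "complex \<Rightarrow> complex"
    unfolding deriv_def by (simp add: DERIV_shift)
  then show ?case using Suc by simp
qed simp

lemma fiber_curve_holo:
  assumes X: "RS_family X" and \<mu>: "fiber_coord X U \<mu>" and p: "p \<in> U" "p \<in> M"
    and f: "open M" "holo_fun (tot X) M f"
  obtains r where "r > 0" "\<And>z. z \<in> ball 0 r \<Longrightarrow> fiber_curve X U \<mu> p z \<in> U \<inter> M"
    "\<And>z. z \<in> ball 0 r \<Longrightarrow> \<mu> (fiber_curve X U \<mu> p z) = z + \<mu> p"
    "\<And>z. z \<in> ball 0 r \<Longrightarrow> proj X (fiber_curve X U \<mu> p z) = proj X p"
    "(\<lambda>z. f (fiber_curve X U \<mu> p z)) holomorphic_on ball 0 r"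
proof -
  note tot = RS_familyD(1)[OF X] and bas = RS_familyD(2)[OF X]
  obtain B e \<psi> where B: "(B, e, \<psi>) \<in> base X" "proj X p \<in> B" using complex_atlasD(3)[OF bas] by blast
  note hB = atlas_holo_coords[OF bas B(1)]
  define N where "N = U \<inter> proj X -` B"
  define c where "c q = case_nat (\<mu> q) (\<psi> (proj X q))" for q
  have c': "c = (\<lambda>q. case_nat (\<mu> q) (\<psi> (proj X q)))" by (simp add: c_def fun_eq_iff)
  have hc: "holo_coords (tot X) N (Suc e) c" unfolding N_def c' by (rule fiber_chart[OF X \<mu> hB])
  note ch = holo_coordsD(1)[OF hc]
  define M' where "M' = M \<inter> N"
  have M': "open M'" "M' \<subseteq> N" "p \<in> M'"
    unfolding M'_def using f(1) is_chartD(1)[OF ch] p B by (auto simp: N_def)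
  obtain r where r: "r > 0" "\<And>z. z \<in> ball 0 r \<Longrightarrow> (c p)(0 := z + \<mu> p) \<in> c ` M'"
    by (rule fiber_curve_ball[OF X \<mu> hB p(1) B(2) N_def c' M'], rule that)
  note q = fiber_curve_in_chart[OF X \<mu> hB p(1) B(2) N_def c' M'(1,2) r(2)]
  define g where "g y = f (inv_into N c y)" for y
  have hg: "holo (Suc e) (c ` M') g"
    unfolding g_def
    by (rule holo_in_coords[OF tot hc M'(1,2) holo_fun_subset[OF tot f(2) _ f(1) M'(1)]]) (simp add: M'_def)
  have "(\<lambda>t. g ((c p)(0 := t))) holomorphic_on {t. (c p)(0 := t) \<in> c ` M'}"
    by (rule sep_holo_line[OF holo_imp_sep(2)[OF chart_open_image[OF ch M'(1,2)] hg]]) simp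
  then have "((\<lambda>t. g ((c p)(0 := t))) \<circ> (\<lambda>z. z + \<mu> p)) holomorphic_on ball 0 r"
    by (rule holomorphic_on_compose_gen[rotated]) (use r(2) in \<open>auto intro!: holomorphic_intros\<close>)
  then have "(\<lambda>z. f (fiber_curve X U \<mu> p z)) holomorphic_on ball 0 r"
    by (rule holomorphic_transform) (use q(3) in \<open>auto simp: g_def\<close>)
  moreover have "fiber_curve X U \<mu> p z \<in> U \<inter> M" if "z \<in> ball 0 r" for z
    using q(1)[OF that] by (auto simp: M'_def N_def)
  ultimately show thesis by (intro that[OF r(1)]) (use q in auto)
qed

text \<open>Both curves stay in \<open>M\<close> for small \<open>z\<close>, and there they are determined by \<open>\<mu>\<close> and the fiber.\<close>
lemma coord_change_germ:
  assumes X: "RS_family X" and \<mu>: "fiber_coord X U \<mu>" "fiber_coord X U' \<mu>'" and p: "p \<in> U" "p \<in> U'"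
    and M: "open M" "p \<in> M" "\<And>q. q \<in> M \<Longrightarrow> \<mu> q = \<mu>' q" "\<And>q. q \<in> M \<Longrightarrow> \<eta> q = \<eta>' q"
  shows "eventually (\<lambda>z. coord_change X U \<eta> \<mu> p z = coord_change X U' \<eta>' \<mu>' p z) (nhds 0)"
proof -
  define K where "K = U \<inter> U' \<inter> M"
  have K: "open K" "p \<in> K" "K \<subseteq> U" "K \<subseteq> U'" "K \<subseteq> M"
    using M p fiber_coordD(1)[OF \<mu>(1)] fiber_coordD(1)[OF \<mu>(2)] by (auto simp: K_def)
  have \<mu>K: "fiber_coord X K \<mu>" using fiber_coord_subset[OF X \<mu>(1) K(1,3)] .
  obtain r where r: "r > 0" "\<And>z. z \<in> ball 0 r \<Longrightarrow> fiber_curve X K \<mu> p z \<in> K \<inter> K"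
    "\<And>z. z \<in> ball 0 r \<Longrightarrow> \<mu> (fiber_curve X K \<mu> p z) = z + \<mu> p"
    "\<And>z. z \<in> ball 0 r \<Longrightarrow> proj X (fiber_curve X K \<mu> p z) = proj X p"
    by (rule fiber_curve_holo[OF X \<mu>K K(2,2,1) fiber_coordD(2)[OF \<mu>K]], rule that)
  have "coord_change X U \<eta> \<mu> p z = coord_change X U' \<eta>' \<mu>' p z" if "z \<in> ball 0 r" for z
  proof -
    have q: "fiber_curve X K \<mu> p z \<in> M" using r(2)[OF that] K(5) by blast
    have "fiber_curve X U \<mu> p z = fiber_curve X K \<mu> p z"
      by (rule fiber_curve_eq[OF \<mu>(1)]) (use r that K in auto)
    moreover have "fiber_curve X U' \<mu>' p z = fiber_curve X K \<mu> p z"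
      by (rule fiber_curve_eq[OF \<mu>(2)]) (use r that K M(3)[OF q] M(3)[OF M(2)] in auto)
    ultimately show ?thesis unfolding coord_change_fiber_curve using M(4)[OF q] M(4)[OF M(2)] by simp
  qed
  moreover have "eventually (\<lambda>z. z \<in> ball 0 r) (nhds (0::complex))"
    using r(1) by (intro eventually_nhds_in_open) auto
  ultimately show ?thesis by (auto elim: eventually_mono)
qed

lemma coord_change_holo:
  assumes X: "RS_family X" and \<mu>: "fiber_coord X U \<mu>" and \<eta>: "fiber_coord X U \<eta>" and p: "p \<in> U"
  shows "\<exists>r>0. coord_change X U \<eta> \<mu> p holomorphic_on ball 0 r"
    and "coord_change X U \<eta> \<mu> p 0 = 0" and "deriv (coord_change X U \<eta> \<mu> p) 0 \<noteq> 0"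
proof -
  obtain r where r: "r > 0" "\<And>z. z \<in> ball 0 r \<Longrightarrow> fiber_curve X U \<mu> p z \<in> U \<inter> U"
    "\<And>z. z \<in> ball 0 r \<Longrightarrow> \<mu> (fiber_curve X U \<mu> p z) = z + \<mu> p"
    "\<And>z. z \<in> ball 0 r \<Longrightarrow> proj X (fiber_curve X U \<mu> p z) = proj X p"
    "(\<lambda>z. \<eta> (fiber_curve X U \<mu> p z)) holomorphic_on ball 0 r"
    by (rule fiber_curve_holo[OF X \<mu> p p fiber_coordD(1,2)[OF \<eta>]], rule that)
  have eq: "coord_change X U \<eta> \<mu> p = (\<lambda>z. \<eta> (fiber_curve X U \<mu> p z) - \<eta> p)"
    by (simp add: coord_change_fiber_curve fun_eq_iff)
  have h: "coord_change X U \<eta> \<mu> p holomorphic_on ball 0 r"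
    unfolding eq by (intro holomorphic_on_diff r(5) holomorphic_on_const)
  then show "\<exists>r>0. coord_change X U \<eta> \<mu> p holomorphic_on ball 0 r" using r(1) by blast
  show "coord_change X U \<eta> \<mu> p 0 = 0" unfolding eq by (simp add: fiber_curve_0[OF \<mu> p])
  have "inj_on (coord_change X U \<eta> \<mu> p) (ball 0 r)"
  proof (rule inj_onI)
    fix y z assume yz: "y \<in> ball 0 r" "z \<in> ball 0 r" "coord_change X U \<eta> \<mu> p y = coord_change X U \<eta> \<mu> p z"
    have "fiber_curve X U \<mu> p y = fiber_curve X U \<mu> p z"
      by (rule fiber_coordD(3)[OF \<eta>]) (use r yz in \<open>auto simp: eq\<close>)
    then have "\<mu> (fiber_curve X U \<mu> p y) = \<mu> (fiber_curve X U \<mu> p z)" by (rule arg_cong)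
    then show "y = z" unfolding r(3)[OF yz(1)] r(3)[OF yz(2)] by (rule add_right_imp_eq)
  qed
  then show "deriv (coord_change X U \<eta> \<mu> p) 0 \<noteq> 0"
    using r(1) by (intro holomorphic_injective_imp_regular[OF h open_ball]) auto
qed

text \<open>The curve of \<open>\<eta>\<close> and the curve of \<open>\<mu>\<close> run through the same points of the fiber.\<close>
lemma coord_change_inverse:
  assumes X: "RS_family X" and \<mu>: "fiber_coord X U \<mu>" and \<eta>: "fiber_coord X U \<eta>" and p: "p \<in> U"
  shows "eventually (\<lambda>z. coord_change X U \<mu> \<eta> p (coord_change X U \<eta> \<mu> p z) = z) (nhds 0)"
proof -
  obtain r where r: "r > 0" "\<And>z. z \<in> ball 0 r \<Longrightarrow> fiber_curve X U \<mu> p z \<in> U \<inter> U"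
    "\<And>z. z \<in> ball 0 r \<Longrightarrow> \<mu> (fiber_curve X U \<mu> p z) = z + \<mu> p"
    "\<And>z. z \<in> ball 0 r \<Longrightarrow> proj X (fiber_curve X U \<mu> p z) = proj X p"
    by (rule fiber_curve_holo[OF X \<mu> p p fiber_coordD(1,2)[OF \<eta>]], rule that)
  have "coord_change X U \<mu> \<eta> p (coord_change X U \<eta> \<mu> p z) = z" if "z \<in> ball 0 r" for z
  proof -
    have "fiber_curve X U \<eta> p (coord_change X U \<eta> \<mu> p z) = fiber_curve X U \<mu> p z"
      by (rule fiber_curve_eq[OF \<eta>]) (use r that in \<open>auto simp: coord_change_fiber_curve\<close>)
    then show ?thesis using r(3)[OF that] by (simp add: coord_change_fiber_curve[of X U \<mu> \<eta>])
  qed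
  moreover have "eventually (\<lambda>z. z \<in> ball 0 r) (nhds (0::complex))"
    using r(1) by (intro eventually_nhds_in_open) auto
  ultimately show ?thesis by (auto elim: eventually_mono)
qed

lemma coord_change_self:
  assumes X: "RS_family X" and \<mu>: "fiber_coord X U \<mu>" and p: "p \<in> U"
  shows "eventually (\<lambda>z. coord_change X U \<mu> \<mu> p z = z) (nhds 0)"
proof -
  obtain r where r: "r > 0" "\<And>z. z \<in> ball 0 r \<Longrightarrow> \<mu> (fiber_curve X U \<mu> p z) = z + \<mu> p"
    by (rule fiber_curve_holo[OF X \<mu> p p fiber_coordD(1,2)[OF \<mu>]], rule that)
  moreover have "eventually (\<lambda>z. z \<in> ball 0 r) (nhds (0::complex))"
    using r(1) by (intro eventually_nhds_in_open) auto
  ultimately show ?thesis by (auto elim!: eventually_mono simp: coord_change_fiber_curve)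
qed

text \<open>Taylor coefficients along the fibers are partial derivatives, hence holomorphic in the base point.\<close>
lemma fiber_curve_taylor:
  assumes X: "RS_family X" and \<mu>: "fiber_coord X U \<mu>" and B: "holo_coords (base X) B e \<psi>"
    and p: "p \<in> U" "proj X p \<in> B"
    and N: "N = U \<inter> proj X -` B" and c: "c = (\<lambda>q. case_nat (\<mu> q) (\<psi> (proj X q)))"
  shows "(deriv ^^ k) (\<lambda>z. f (fiber_curve X U \<mu> p z)) 0 = (pd 0 ^^ k) (\<lambda>y. f (inv_into N c y)) (c p)"
proof -
  have ch: "is_chart (N, Suc e, c)" unfolding N c by (rule holo_coordsD(1)[OF fiber_chart[OF X \<mu> B]])
  have pN: "p \<in> N" using p by (simp add: N)
  obtain r where r: "r > 0" "\<And>z. z \<in> ball 0 r \<Longrightarrow> (c p)(0 := z + \<mu> p) \<in> c ` N"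
    by (rule fiber_curve_ball[OF X \<mu> B p N c is_chartD(1)[OF ch] subset_refl pN], rule that)
  have "eventually (\<lambda>z. z \<in> ball 0 r) (nhds (0::complex))"
    using r(1) by (intro eventually_nhds_in_open) auto
  then have "eventually (\<lambda>z. f (fiber_curve X U \<mu> p z) = f (inv_into N c ((c p)(0 := z + \<mu> p)))) (nhds 0)"
    by eventually_elim
      (use fiber_curve_in_chart(3)[OF X \<mu> B p N c is_chartD(1)[OF ch] subset_refl r(2)] in simp)
  then have "(deriv ^^ k) (\<lambda>z. f (fiber_curve X U \<mu> p z)) 0 =
      (deriv ^^ k) (\<lambda>z. f (inv_into N c ((c p)(0 := z + \<mu> p)))) 0"
    by (rule higher_deriv_cong_ev) simp
  also have "\<dots> = (deriv ^^ k) (\<lambda>t. f (inv_into N c ((c p)(0 := t)))) (\<mu> p)"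
    using deriv_shift[of k "\<lambda>t. f (inv_into N c ((c p)(0 := t)))" "\<mu> p"] by simp
  also have "\<dots> = (pd 0 ^^ k) (\<lambda>y. f (inv_into N c y)) (c p)"
    unfolding pd_funpow by (simp add: c)
  finally show ?thesis .
qed

section \<open>The coefficients of a germ in its exponential form\<close>

lemma vf_nth: "fps_nth (vf c f) N =
  (\<Sum>i=0..N. (if i \<ge> 2 then c (i - 1) else 0) * (of_nat (N - i + 1) * fps_nth f (N - i + 1)))"
  by (simp add: vf_def fps_mult_nth)

text \<open>The vector field is divisible by \<open>z\<^sup>2\<close>, so each application of \<open>vf c\<close> raises the order of vanishing,
  which is \<open>1\<close> for \<open>z\<close> itself.\<close>
lemma vf_funpow_low: "N \<le> Suc k \<Longrightarrow> fps_nth ((vf c ^^ Suc k) fps_X) N = 0"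
proof (induction k arbitrary: N)
  case 0
  then show ?case by (auto simp: vf_nth intro!: sum.neutral)
next
  case (Suc k)
  show ?case unfolding funpow.simps(2)[of "Suc k"] o_apply vf_nth
  proof (intro sum.neutral ballI)
    fix i assume i: "i \<in> {0..N}"
    show "(if i \<ge> 2 then c (i - 1) else 0) *
      (of_nat (N - i + 1) * fps_nth ((vf c ^^ Suc k) fps_X) (N - i + 1)) = 0"
    proof (cases "i \<ge> 2")
      case True
      then have "N - i + 1 \<le> Suc k" using i Suc.prems by auto
      from Suc.IH[OF this] show ?thesis by (simp del: funpow.simps)
    qed simp
  qed
qed

lemma vf_funpow_cong_le:
  assumes "\<And>i. 1 \<le> i \<Longrightarrow> i < n \<Longrightarrow> c i = c' i" "N \<le> n"
  shows "fps_nth ((vf c ^^ k) fps_X) N = fps_nth ((vf c' ^^ k) fps_X) N"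
  using assms(2)
proof (induction k arbitrary: N)
  case (Suc k)
  show ?case unfolding funpow.simps(2)[of k] o_apply vf_nth
  proof (intro sum.cong refl)
    fix i assume i: "i \<in> {0..N}"
    show "(if i \<ge> 2 then c (i - 1) else 0) * (of_nat (N - i + 1) * fps_nth ((vf c ^^ k) fps_X) (N - i + 1)) =
      (if i \<ge> 2 then c' (i - 1) else 0) * (of_nat (N - i + 1) * fps_nth ((vf c' ^^ k) fps_X) (N - i + 1))"
    proof (cases "i \<ge> 2")
      case True
      then have "c (i - 1) = c' (i - 1)" using i Suc.prems by (intro assms(1)) auto
      moreover have "N - i + 1 \<le> n" using True i Suc.prems by auto
      from Suc.IH[OF this] have "fps_nth ((vf c ^^ k) fps_X) (N - i + 1) = fps_nth ((vf c' ^^ k) fps_X) (N - i + 1)" .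
      ultimately show ?thesis by simp
    qed simp
  qed
qed simp

lemma vf_funpow_cong_Suc:
  assumes "\<And>i. 1 \<le> i \<Longrightarrow> i < n \<Longrightarrow> c i = c' i"
  shows "fps_nth ((vf c ^^ Suc (Suc k)) fps_X) (Suc n) = fps_nth ((vf c' ^^ Suc (Suc k)) fps_X) (Suc n)"
  unfolding funpow.simps(2)[of "Suc k"] o_apply vf_nth
proof (intro sum.cong refl)
  fix i assume i: "i \<in> {0..Suc n}"
  show "(if i \<ge> 2 then c (i - 1) else 0) * (of_nat (Suc n - i + 1) * fps_nth ((vf c ^^ Suc k) fps_X) (Suc n - i + 1)) =
    (if i \<ge> 2 then c' (i - 1) else 0) * (of_nat (Suc n - i + 1) * fps_nth ((vf c' ^^ Suc k) fps_X) (Suc n - i + 1))"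
  proof (cases "i = Suc n")
    case True
    then show ?thesis using vf_funpow_low[of 1 k c] vf_funpow_low[of 1 k c'] by simp
  next
    case False
    show ?thesis
    proof (cases "i \<ge> 2")
      case True
      then have "c (i - 1) = c' (i - 1)" using i False by (intro assms) auto
      moreover have "Suc n - i + 1 \<le> n" using True i by auto
      from vf_funpow_cong_le[OF assms this] have
        "fps_nth ((vf c ^^ Suc k) fps_X) (Suc n - i + 1) = fps_nth ((vf c' ^^ Suc k) fps_X) (Suc n - i + 1)" .
      ultimately show ?thesis by simp
    qed simp
  qed
qed

text \<open>The coefficient of \<open>z\<^sup>n\<^sup>+\<^sup>1\<close> in \<open>exp_vf c\<close> is \<open>c n\<close> plus a polynomial in \<open>c 1, \<dots>, c (n - 1)\<close>.\<close>
definition exp_vf_rest :: "(nat \<Rightarrow> complex) \<Rightarrow> nat \<Rightarrow> complex" where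
  "exp_vf_rest c n = (\<Sum>k<n. fps_nth ((vf c ^^ Suc (Suc k)) fps_X) (Suc n) / fact (Suc (Suc k)))"

lemma exp_vf_nth:
  "fps_nth (exp_vf c) 0 = 0" "fps_nth (exp_vf c) 1 = 1"
  "n \<ge> 1 \<Longrightarrow> fps_nth (exp_vf c) (Suc n) = c n + exp_vf_rest c n"
proof -
  have 1: "fps_nth ((vf c ^^ 1) fps_X) N = (if N \<ge> 2 then c (N - 1) else 0)" for N
    by (simp add: vf_def)
  show "fps_nth (exp_vf c) 0 = 0" "fps_nth (exp_vf c) 1 = 1"
    using 1[of 1] by (simp_all add: exp_vf_def)
  assume n: "n \<ge> 1"
  have "fps_nth (exp_vf c) (Suc n) = (\<Sum>k<Suc (Suc n). fps_nth ((vf c ^^ k) fps_X) (Suc n) / fact k)"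
    by (simp only: exp_vf_def fps_nth_Abs_fps lessThan_Suc_atMost)
  also have "\<dots> = fps_nth ((vf c ^^ 0) fps_X) (Suc n) / fact 0 + (fps_nth ((vf c ^^ Suc 0) fps_X) (Suc n) / fact (Suc 0) +
     (\<Sum>k<n. fps_nth ((vf c ^^ Suc (Suc k)) fps_X) (Suc n) / fact (Suc (Suc k))))"
    by (simp only: sum.lessThan_Suc_shift)
  also have "\<dots> = c n + exp_vf_rest c n"
    unfolding exp_vf_rest_def using 1[of "Suc n"] n by (simp del: funpow.simps(2))
  finally show "fps_nth (exp_vf c) (Suc n) = c n + exp_vf_rest c n" .
qed

lemma exp_vf_rest_cong:
  "(\<And>i. 1 \<le> i \<Longrightarrow> i < n \<Longrightarrow> c i = c' i) \<Longrightarrow> exp_vf_rest c n = exp_vf_rest c' n"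
  unfolding exp_vf_rest_def by (intro sum.cong refl arg_cong2[where f = "(/)"] vf_funpow_cong_Suc)

text \<open>The solution of the triangular system in \<open>eq_exp_vf_iff\<close>, with one more entry at each step.\<close>
primrec exp_coeffs_upto :: "complex fps \<Rightarrow> nat \<Rightarrow> nat \<Rightarrow> complex" where
  "exp_coeffs_upto F 0 = (\<lambda>_. 0)"
| "exp_coeffs_upto F (Suc k) = (exp_coeffs_upto F k)
     (Suc k := fps_nth F (Suc (Suc k)) / fps_nth F 1 - exp_vf_rest (exp_coeffs_upto F k) (Suc k))"

lemma exp_coeffs_upto_stable: "j \<le> k \<Longrightarrow> exp_coeffs_upto F k j = exp_coeffs_upto F j j"
  by (induction k) (auto simp: le_Suc_eq)

text \<open>Comparison of coefficients gives a triangular system. It has exactly one solution with \<open>c 0 = 0\<close>, which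
  is the sequence chosen by \<open>germ_coeffs\<close>.\<close>
lemma eq_exp_vf_iff:
  assumes "fps_nth F 0 = 0" "fps_nth F 1 \<noteq> 0"
  shows "F = fps_const (fps_nth F 1) * exp_vf c \<longleftrightarrow>
    (\<forall>n\<ge>1. c n = fps_nth F (Suc n) / fps_nth F 1 - exp_vf_rest c n)"
proof -
  have "F = fps_const (fps_nth F 1) * exp_vf c \<longleftrightarrow>
    (\<forall>n. fps_nth F n = fps_nth F 1 * fps_nth (exp_vf c) n)" by (simp add: fps_eq_iff)
  also have "\<dots> \<longleftrightarrow> (\<forall>n\<ge>1. fps_nth F (Suc n) = fps_nth F 1 * fps_nth (exp_vf c) (Suc n))"
  proof (intro iffI allI impI)
    fix n assume *: "\<forall>n\<ge>1. fps_nth F (Suc n) = fps_nth F 1 * fps_nth (exp_vf c) (Suc n)"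
    show "fps_nth F n = fps_nth F 1 * fps_nth (exp_vf c) n"
    proof (cases n)
      case 0
      then show ?thesis by (simp add: assms exp_vf_nth)
    next
      case (Suc k)
      then show ?thesis using * exp_vf_nth(2)[of c] by (cases "k = 0") auto
    qed
  qed blast
  also have "\<dots> \<longleftrightarrow> (\<forall>n\<ge>1. c n = fps_nth F (Suc n) / fps_nth F 1 - exp_vf_rest c n)"
  proof (intro all_cong)
    fix n :: nat assume "1 \<le> n"
    have "a = b * (x + r) \<longleftrightarrow> x = a / b - r" if "b \<noteq> 0" for a b x r :: complex
      using that by (auto simp: field_simps)
    from this[OF assms(2)] show "fps_nth F (Suc n) = fps_nth F 1 * fps_nth (exp_vf c) (Suc n) \<longleftrightarrow>
        c n = fps_nth F (Suc n) / fps_nth F 1 - exp_vf_rest c n"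
      unfolding exp_vf_nth(3)[OF \<open>1 \<le> n\<close>] .
  qed
  finally show ?thesis .
qed

lemma germ_coeffs_eq:
  fixes \<rho> :: "complex \<Rightarrow> complex"
  defines "F \<equiv> fps_expansion \<rho> 0"
  assumes F: "fps_nth F 0 = 0" "fps_nth F 1 \<noteq> 0" and n: "n \<ge> 1"
  shows "germ_coeffs \<rho> n = fps_nth F (Suc n) / fps_nth F 1 - exp_vf_rest (germ_coeffs \<rho>) n"
proof -
  have d: "deriv \<rho> 0 = fps_nth F 1" by (simp add: F_def fps_expansion_def)
  define P where "P c \<longleftrightarrow> c 0 = 0 \<and> F = fps_const (deriv \<rho> 0) * exp_vf c" for c
  have P: "P c \<longleftrightarrow> c 0 = 0 \<and> (\<forall>n\<ge>1. c n = fps_nth F (Suc n) / fps_nth F 1 - exp_vf_rest c n)" for c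
    unfolding P_def d eq_exp_vf_iff[OF F] by simp
  have "\<exists>!c. P c"
  proof (rule ex_ex1I)
    define c where "c n = exp_coeffs_upto F n n" for n
    have "P c" unfolding P
    proof (intro conjI allI impI)
      show "c 0 = 0" by (simp add: c_def)
      fix n :: nat assume "n \<ge> 1"
      then obtain k where k: "n = Suc k" by (cases n) auto
      have "exp_vf_rest c n = exp_vf_rest (exp_coeffs_upto F k) n"
        unfolding c_def
        by (rule exp_vf_rest_cong, rule exp_coeffs_upto_stable[symmetric]) (simp add: k)
      then show "c n = fps_nth F (Suc n) / fps_nth F 1 - exp_vf_rest c n" by (simp add: c_def k)
    qed
    then show "\<exists>c. P c" by (intro exI[of _ c])
  next
    fix c c' assume c: "P c" and c': "P c'"
    have "c n = c' n" for n
    proof (induction n rule: less_induct)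
      case (less n)
      show ?case
      proof (cases "n = 0")
        case False
        then have n: "n \<ge> 1" by simp
        have "exp_vf_rest c n = exp_vf_rest c' n" by (rule exp_vf_rest_cong) (use less in auto)
        moreover have "c n = fps_nth F (Suc n) / fps_nth F 1 - exp_vf_rest c n"
          "c' n = fps_nth F (Suc n) / fps_nth F 1 - exp_vf_rest c' n"
          by (rule mp[OF spec[OF conjunct2[OF c[unfolded P]]] n], rule mp[OF spec[OF conjunct2[OF c'[unfolded P]]] n])
        ultimately show ?thesis by (simp only:)
      qed (use c c' P_def in auto)
    qed
    then show "c = c'" by auto
  qed
  then have "P (THE c. P c)" by (rule theI')
  moreover have "(THE c. P c) = germ_coeffs \<rho>" unfolding germ_coeffs_def P_def F_def ..
  ultimately have "P (germ_coeffs \<rho>)" by simp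
  with n show ?thesis unfolding P by (elim conjE allE[of _ n] impE)
qed

lemma fps_expansion_nth: "fps_nth (fps_expansion f z) n = (deriv ^^ n) f z / fact n"
  by (simp add: fps_expansion_def)

lemma germ_coeffs_cong:
  assumes "eventually (\<lambda>z. \<rho> z = \<rho>' z) (nhds 0)"
  shows "deriv \<rho> 0 = deriv \<rho>' 0" "germ_coeffs \<rho> = germ_coeffs \<rho>'"
proof -
  show 1: "deriv \<rho> 0 = deriv \<rho>' 0" using assms by (rule deriv_cong_ev) simp
  have "fps_expansion \<rho> 0 = fps_expansion \<rho>' 0"
    by (simp add: fps_eq_iff fps_expansion_nth) (use higher_deriv_cong_ev[OF assms refl] in simp)
  then show "germ_coeffs \<rho> = germ_coeffs \<rho>'" unfolding germ_coeffs_def 1 by simp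
qed

lemma vf_zero: "vf (\<lambda>_. 0) f = 0"
  by (simp add: fps_eq_iff vf_nth sum.neutral)

lemma exp_vf_rest_zero: "exp_vf_rest (\<lambda>_. 0) n = 0"
  unfolding exp_vf_rest_def by (intro sum.neutral) (simp add: vf_zero)

lemma germ_coeffs_id:
  assumes "eventually (\<lambda>z. \<rho> z = z) (nhds 0)"
  shows "deriv \<rho> 0 = 1" "n \<ge> 1 \<Longrightarrow> germ_coeffs \<rho> n = 0"
proof -
  show d: "deriv \<rho> 0 = 1" using germ_coeffs_cong(1)[OF assms] by simp
  have dn: "(deriv ^^ k) \<rho> 0 = (deriv ^^ k) (\<lambda>z. z) 0" for k by (rule higher_deriv_cong_ev[OF assms refl])
  have F: "fps_nth (fps_expansion \<rho> 0) k = (if k = 1 then 1 else 0)" for k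
    unfolding fps_expansion_nth dn higher_deriv_ident by simp
  show "germ_coeffs \<rho> n = 0" if "n \<ge> 1" for n
    using that
  proof (induction n rule: less_induct)
    case (less n)
    have "exp_vf_rest (germ_coeffs \<rho>) n = exp_vf_rest (\<lambda>_. 0) n"
      by (rule exp_vf_rest_cong) (use less in auto)
    then show ?case using germ_coeffs_eq[of \<rho> n] less.prems by (simp add: F exp_vf_rest_zero)
  qed
qed

subsection \<open>Regular dependence on parameters\<close>

text \<open>The coefficients of a germ in exponential form are obtained from its Taylor coefficients, normalized
  by \<open>\<rho>\<^sup>\<prime>(0)\<close>, by sums and products only. So they inherit every kind of regularity that is preserved by
  these operations. The last clause says that only the values on \<open>D\<close> matter.\<close>
definition function_algebra :: "'a set \<Rightarrow> ('a \<Rightarrow> complex) set \<Rightarrow> bool" where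
  "function_algebra D \<F> \<longleftrightarrow> (\<forall>k. (\<lambda>_. k) \<in> \<F>) \<and> (\<forall>f\<in>\<F>. \<forall>g\<in>\<F>. (\<lambda>p. f p + g p) \<in> \<F> \<and> (\<lambda>p. f p * g p) \<in> \<F>) \<and>
     (\<forall>f\<in>\<F>. \<forall>g. (\<forall>p\<in>D. g p = f p) \<longrightarrow> g \<in> \<F>)"

context
  fixes D :: "'a set" and \<F> :: "('a \<Rightarrow> complex) set"
  assumes F: "function_algebra D \<F>"
begin

lemma fa_const: "(\<lambda>_. k) \<in> \<F>" and fa_add: "f \<in> \<F> \<Longrightarrow> g \<in> \<F> \<Longrightarrow> (\<lambda>p. f p + g p) \<in> \<F>"
  and fa_mult: "f \<in> \<F> \<Longrightarrow> g \<in> \<F> \<Longrightarrow> (\<lambda>p. f p * g p) \<in> \<F>"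
  and fa_cong: "f \<in> \<F> \<Longrightarrow> (\<And>p. p \<in> D \<Longrightarrow> g p = f p) \<Longrightarrow> g \<in> \<F>"
  using F unfolding function_algebra_def by blast+

lemma fa_sum: "(\<And>i. i \<in> I \<Longrightarrow> f i \<in> \<F>) \<Longrightarrow> (\<lambda>p. \<Sum>i\<in>I. f i p) \<in> \<F>"
  by (induction I rule: infinite_finite_induct) (auto intro: fa_const fa_add)

lemma fa_diff: "f \<in> \<F> \<Longrightarrow> g \<in> \<F> \<Longrightarrow> (\<lambda>p. f p - g p) \<in> \<F>"
  using fa_add[OF _ fa_mult[OF fa_const[of "-1"]], of f g] by simp

lemma fa_divide_const: "f \<in> \<F> \<Longrightarrow> (\<lambda>p. f p / k) \<in> \<F>"
  using fa_mult[OF _ fa_const[of "1 / k"], of f] by simp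

lemma fa_power: "f \<in> \<F> \<Longrightarrow> (\<lambda>p. f p ^ k) \<in> \<F>"
  by (induction k) (auto intro: fa_const fa_mult)

lemma fa_vf_funpow:
  assumes "\<And>i. (\<lambda>p. c p i) \<in> \<F>"
  shows "(\<lambda>p. fps_nth ((vf (c p) ^^ k) fps_X) N) \<in> \<F>"
proof (induction k arbitrary: N)
  case (Suc k)
  have "(\<lambda>p. if 2 \<le> i then c p (i - 1) else 0) \<in> \<F>" for i :: nat
    using assms fa_const by (cases "i \<ge> 2") auto
  then show ?case unfolding funpow.simps o_apply vf_nth
    by (intro fa_sum fa_mult fa_const Suc)
qed (simp add: fa_const)

lemma fa_exp_vf_rest:
  assumes "\<And>i. i < n \<Longrightarrow> (\<lambda>p. c p i) \<in> \<F>"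
  shows "(\<lambda>p. exp_vf_rest (c p) n) \<in> \<F>"
proof -
  have "(\<lambda>p. if i < n then c p i else 0) \<in> \<F>" for i
    using assms fa_const by (cases "i < n") auto
  then have "(\<lambda>p. exp_vf_rest (\<lambda>i. if i < n then c p i else 0) n) \<in> \<F>"
    unfolding exp_vf_rest_def by (intro fa_sum fa_divide_const fa_vf_funpow)
  moreover have "exp_vf_rest (\<lambda>i. if i < n then c p i else 0) n = exp_vf_rest (c p) n" for p
    by (rule exp_vf_rest_cong) simp
  ultimately show ?thesis by simp
qed

lemma fa_germ_coeffs:
  fixes \<rho> :: "'a \<Rightarrow> complex \<Rightarrow> complex"
  assumes \<rho>: "\<And>p. p \<in> D \<Longrightarrow> \<rho> p 0 = 0" "\<And>p. p \<in> D \<Longrightarrow> deriv (\<rho> p) 0 \<noteq> 0"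
    and fa: "\<And>n. (\<lambda>p. (deriv ^^ n) (\<rho> p) 0 / deriv (\<rho> p) 0) \<in> \<F>" and n: "n \<ge> 1"
  shows "(\<lambda>p. germ_coeffs (\<rho> p) n) \<in> \<F>"
  using n
proof (induction n rule: less_induct)
  case (less n)
  have "(\<lambda>p. if i = 0 then 0 else germ_coeffs (\<rho> p) i) \<in> \<F>" if "i < n" for i
    using less.IH[OF that] fa_const by (cases "i = 0") auto
  then have "(\<lambda>p. exp_vf_rest (\<lambda>i. if i = 0 then 0 else germ_coeffs (\<rho> p) i) n) \<in> \<F>" by (rule fa_exp_vf_rest)
  moreover have "exp_vf_rest (\<lambda>i. if i = 0 then 0 else germ_coeffs (\<rho> p) i) n = exp_vf_rest (germ_coeffs (\<rho> p)) n" for p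
    by (rule exp_vf_rest_cong) simp
  ultimately have "(\<lambda>p. (deriv ^^ Suc n) (\<rho> p) 0 / deriv (\<rho> p) 0 / fact (Suc n) - exp_vf_rest (germ_coeffs (\<rho> p)) n) \<in> \<F>"
    using fa_diff[OF fa_divide_const[OF fa[of "Suc n"]]] by simp
  then show ?case
  proof (rule fa_cong)
    fix p assume "p \<in> D"
    then show "germ_coeffs (\<rho> p) n = (deriv ^^ Suc n) (\<rho> p) 0 / deriv (\<rho> p) 0 / fact (Suc n) - exp_vf_rest (germ_coeffs (\<rho> p)) n"
      using germ_coeffs_eq[of "\<rho> p" n] \<rho> less.prems by (simp add: fps_expansion_nth)
  qed
qed

end

text \<open>Both factors of the product vanish at \<open>\<zeta> = 0\<close>.\<close>
lemma vf_deriv_at_0: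
  assumes c: "\<And>i. ((\<lambda>\<zeta>. c \<zeta> i) has_field_derivative c' i) (at 0)" "\<And>i. c 0 i = (0::complex)"
    and g: "\<And>i. ((\<lambda>\<zeta>. fps_nth (g \<zeta>) i) has_field_derivative g' i) (at 0)" "\<And>i. fps_nth (g 0) i = 0"
  shows "((\<lambda>\<zeta>. fps_nth (vf (c \<zeta>) (g \<zeta>)) N) has_field_derivative 0) (at 0)"
proof -
  have "((\<lambda>\<zeta>. (if i \<ge> 2 then c \<zeta> (i - 1) else 0) * (of_nat (N - i + 1) * fps_nth (g \<zeta>) (N - i + 1)))
      has_field_derivative 0) (at 0)" for i
  proof (cases "i \<ge> 2")
    case True
    have "((\<lambda>\<zeta>. c \<zeta> (i - 1) * (of_nat (N - i + 1) * fps_nth (g \<zeta>) (N - i + 1)))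
      has_field_derivative c' (i - 1) * (of_nat (N - i + 1) * fps_nth (g 0) (N - i + 1)) +
        (of_nat (N - i + 1) * g' (N - i + 1)) * c 0 (i - 1)) (at 0)"
      by (intro DERIV_mult c g DERIV_cmult)
    then show ?thesis using True by (simp add: c g)
  qed simp
  then have "((\<lambda>\<zeta>. \<Sum>i=0..N. (if i \<ge> 2 then c \<zeta> (i - 1) else 0) * (of_nat (N - i + 1) * fps_nth (g \<zeta>) (N - i + 1)))
      has_field_derivative (\<Sum>i=0..N. 0)) (at 0)"
    by (intro DERIV_sum)
  then show ?thesis by (simp add: vf_nth)
qed

text \<open>Each term applies the vector field at least twice, so it is at least quadratic in \<open>c\<close>.\<close>
lemma exp_vf_rest_deriv_at_0:
  assumes c: "\<And>i. ((\<lambda>\<zeta>. c \<zeta> i) has_field_derivative c' i) (at 0)" "\<And>i. c 0 i = (0::complex)"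
  shows "((\<lambda>\<zeta>. exp_vf_rest (c \<zeta>) n) has_field_derivative 0) (at 0)"
proof -
  have c0: "c 0 = (\<lambda>_. 0)" using c(2) by auto
  have z: "fps_nth ((vf (c 0) ^^ Suc k) fps_X) i = 0" for k i by (simp add: c0 vf_zero)
  have 1: "((\<lambda>\<zeta>. fps_nth ((vf (c \<zeta>) ^^ Suc 0) fps_X) i) has_field_derivative (if i \<ge> 2 then c' (i - 1) else 0)) (at 0)" for i
    by (cases "i \<ge> 2") (simp_all add: vf_def c)
  have ex: "\<exists>g'. \<forall>i. ((\<lambda>\<zeta>. fps_nth ((vf (c \<zeta>) ^^ Suc k) fps_X) i) has_field_derivative g' i) (at 0)" for k
  proof (induction k)
    case 0
    show ?case using 1 by (intro exI[of _ "\<lambda>i. if i \<ge> 2 then c' (i - 1) else 0"] allI)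
  next
    case (Suc k)
    then obtain g' where g': "\<forall>i. ((\<lambda>\<zeta>. fps_nth ((vf (c \<zeta>) ^^ Suc k) fps_X) i) has_field_derivative g' i) (at 0)"
      by (rule exE)
    show ?case
    proof (intro exI[of _ "\<lambda>_. 0"] allI)
      fix i
      show "((\<lambda>\<zeta>. fps_nth ((vf (c \<zeta>) ^^ Suc (Suc k)) fps_X) i) has_field_derivative 0) (at 0)"
        unfolding funpow.simps(2)[of "Suc k"] o_apply
        by (rule vf_deriv_at_0[OF c spec[OF g'] z])
    qed
  qed
  have "((\<lambda>\<zeta>. fps_nth ((vf (c \<zeta>) ^^ Suc (Suc k)) fps_X) i) has_field_derivative 0) (at 0)" for k i
  proof -
    obtain g' where g': "\<forall>i. ((\<lambda>\<zeta>. fps_nth ((vf (c \<zeta>) ^^ Suc k) fps_X) i) has_field_derivative g' i) (at 0)"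
      using ex by (rule exE)
    show ?thesis
      unfolding funpow.simps(2)[of "Suc k"] o_apply
      by (rule vf_deriv_at_0[OF c spec[OF g'] z])
  qed
  then have "((\<lambda>\<zeta>. exp_vf_rest (c \<zeta>) n) has_field_derivative (\<Sum>k<n. 0 / fact (Suc (Suc k)))) (at 0)"
    unfolding exp_vf_rest_def by (intro DERIV_sum DERIV_cdivide)
  then show ?thesis by simp
qed

text \<open>At the identity, \<open>germ_coeffs\<close> has the same differential as the map to the Taylor coefficients.\<close>
lemma germ_coeffs_deriv_at_id:
  fixes \<rho> :: "complex \<Rightarrow> complex \<Rightarrow> complex"
  assumes ev: "eventually (\<lambda>\<zeta>. \<rho> \<zeta> 0 = 0) (nhds 0)"
    and d: "\<And>k. ((\<lambda>\<zeta>. fps_nth (fps_expansion (\<rho> \<zeta>) 0) k) has_field_derivative F' k) (at 0)"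
    and F0: "\<And>k. fps_nth (fps_expansion (\<rho> 0) 0) k = (if k = 1 then 1 else 0)" and n: "n \<ge> 1"
  shows "germ_coeffs (\<rho> 0) n = 0 \<and> ((\<lambda>\<zeta>. germ_coeffs (\<rho> \<zeta>) n) has_field_derivative F' (Suc n)) (at 0)"
  using n
proof (induction n rule: less_induct)
  case (less n)
  define c where "c \<zeta> i = (if 1 \<le> i \<and> i < n then germ_coeffs (\<rho> \<zeta>) i else 0)" for \<zeta> i
  define c' where "c' i = (if 1 \<le> i \<and> i < n then F' (Suc i) else 0)" for i
  have c: "((\<lambda>\<zeta>. c \<zeta> i) has_field_derivative c' i) (at 0)" "c 0 i = 0" for i
    using less.IH[of i] by (auto simp: c_def c'_def)
  have r: "exp_vf_rest (germ_coeffs (\<rho> \<zeta>)) n = exp_vf_rest (c \<zeta>) n" for \<zeta>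
    by (rule exp_vf_rest_cong) (simp add: c_def)
  have "isCont (\<lambda>\<zeta>. fps_nth (fps_expansion (\<rho> \<zeta>) 0) 1) 0" using d by (rule DERIV_isCont)
  then have "((\<lambda>\<zeta>. fps_nth (fps_expansion (\<rho> \<zeta>) 0) 1) \<longlongrightarrow> fps_nth (fps_expansion (\<rho> 0) 0) 1) (nhds 0)"
    unfolding isCont_def by (rule iffD1[OF tendsto_at_iff_tendsto_nhds])
  then have "eventually (\<lambda>\<zeta>. fps_nth (fps_expansion (\<rho> \<zeta>) 0) 1 \<noteq> 0) (nhds 0)"
    by (rule tendsto_imp_eventually_ne) (simp add: F0)
  with ev have eq: "eventually (\<lambda>\<zeta>. germ_coeffs (\<rho> \<zeta>) n =
      fps_nth (fps_expansion (\<rho> \<zeta>) 0) (Suc n) / fps_nth (fps_expansion (\<rho> \<zeta>) 0) 1 - exp_vf_rest (c \<zeta>) n) (nhds 0)"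
  proof eventually_elim
    case (elim \<zeta>)
    show ?case using germ_coeffs_eq[OF _ elim(2) less.prems] elim(1) unfolding r by (simp add: fps_expansion_nth)
  qed
  have c0: "c 0 = (\<lambda>_. 0)" using c(2) by auto
  have "((\<lambda>\<zeta>. fps_nth (fps_expansion (\<rho> \<zeta>) 0) (Suc n) / fps_nth (fps_expansion (\<rho> \<zeta>) 0) 1 - exp_vf_rest (c \<zeta>) n)
      has_field_derivative (F' (Suc n) * fps_nth (fps_expansion (\<rho> 0) 0) 1 - fps_nth (fps_expansion (\<rho> 0) 0) (Suc n) * F' 1) /
        (fps_nth (fps_expansion (\<rho> 0) 0) 1 * fps_nth (fps_expansion (\<rho> 0) 0) 1) - 0) (at 0)"
    by (intro DERIV_diff DERIV_divide d exp_vf_rest_deriv_at_0[OF c]) (simp add: F0)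
  then have D: "((\<lambda>\<zeta>. fps_nth (fps_expansion (\<rho> \<zeta>) 0) (Suc n) / fps_nth (fps_expansion (\<rho> \<zeta>) 0) 1 - exp_vf_rest (c \<zeta>) n)
      has_field_derivative F' (Suc n)) (at 0)"
    using less.prems by (simp add: F0)
  have "((\<lambda>\<zeta>. germ_coeffs (\<rho> \<zeta>) n) has_field_derivative F' (Suc n)) (at 0)"
    by (rule iffD2[OF DERIV_cong_ev[OF refl eq refl] D])
  moreover have "germ_coeffs (\<rho> 0) n = 0"
    using eventually_nhds_x_imp_x[OF eq] less.prems by (simp add: F0 c0 exp_vf_rest_zero)
  ultimately show ?case by blast
qed

text \<open>Differentiating \<open>P \<circ> S = id\<close> at \<open>P = S = id\<close> gives \<open>P\<^sup>\<prime> + S\<^sup>\<prime> = 0\<close>. Differentiability of the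
  coefficients of \<open>P\<close> is part of the claim; it follows by induction, since the coefficient of order \<open>n\<close> of the
  composition is the one of \<open>P\<close>, multiplied by a power of the first coefficient of \<open>S\<close>, plus terms with earlier coefficients of \<open>P\<close>.\<close>
lemma fps_compose_inverse_deriv:
  fixes S P :: "complex \<Rightarrow> complex fps"
  assumes ev: "eventually (\<lambda>\<zeta>. P \<zeta> oo S \<zeta> = fps_X \<and> fps_nth (S \<zeta>) 0 = 0) (nhds 0)"
    and S: "\<And>k. ((\<lambda>\<zeta>. fps_nth (S \<zeta>) k) has_field_derivative S' k) (at 0)"
    and S0: "S 0 = fps_X" and n: "n \<ge> 1"
  shows "((\<lambda>\<zeta>. fps_nth (P \<zeta>) n) has_field_derivative - S' n) (at 0)"
proof -
  have P0: "P 0 = fps_X" using eventually_nhds_x_imp_x[OF ev] by (simp add: S0)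
  have pw: "\<exists>D. \<forall>k. ((\<lambda>\<zeta>. fps_nth (S \<zeta> ^ i) k) has_field_derivative D k) (at 0)" for i
  proof (induction i)
    case 0
    show ?case by (intro exI[of _ "\<lambda>_. 0"]) simp
  next
    case (Suc i)
    then obtain D where D: "\<And>k. ((\<lambda>\<zeta>. fps_nth (S \<zeta> ^ i) k) has_field_derivative D k) (at 0)" by (elim exE) blast
    show ?case
    proof (intro exI allI)
      fix k show "((\<lambda>\<zeta>. fps_nth (S \<zeta> ^ Suc i) k) has_field_derivative
          (\<Sum>j=0..k. S' j * fps_nth (S 0 ^ i) (k - j) + D (k - j) * fps_nth (S 0) j)) (at 0)"
        unfolding power_Suc fps_mult_nth by (intro DERIV_sum DERIV_mult S D)
    qed
  qed
  have "\<forall>i. \<exists>D. \<forall>k. ((\<lambda>\<zeta>. fps_nth (S \<zeta> ^ i) k) has_field_derivative D k) (at 0)" using pw by blast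
  from choice[OF this] obtain D where D: "\<forall>i k. ((\<lambda>\<zeta>. fps_nth (S \<zeta> ^ i) k) has_field_derivative D i k) (at 0)" by (rule exE)
  have D1: "D 1 k = S' k" for k using D[rule_format, of 1 k] S[of k] by (simp add: DERIV_unique)
  define P' where "P' k = (if k = 0 then 0 else - S' k)" for k
  have "((\<lambda>\<zeta>. fps_nth (P \<zeta>) n) has_field_derivative P' n) (at 0)" for n
  proof (induction n rule: less_induct)
    case (less n)
    define R where "R \<zeta> = fps_nth fps_X n - (\<Sum>i<n. fps_nth (P \<zeta>) i * fps_nth (S \<zeta> ^ i) n)" for \<zeta>
    have "isCont (\<lambda>\<zeta>. fps_nth (S \<zeta>) 1) 0" using S by (rule DERIV_isCont)
    then have "((\<lambda>\<zeta>. fps_nth (S \<zeta>) 1) \<longlongrightarrow> fps_nth (S 0) 1) (nhds 0)"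
      unfolding isCont_def by (rule iffD1[OF tendsto_at_iff_tendsto_nhds])
    then have "eventually (\<lambda>\<zeta>. fps_nth (S \<zeta>) 1 \<noteq> 0) (nhds 0)"
      by (rule tendsto_imp_eventually_ne) (simp add: S0)
    with ev have eq: "eventually (\<lambda>\<zeta>. fps_nth (P \<zeta>) n = R \<zeta> / fps_nth (S \<zeta> ^ n) n) (nhds 0)"
    proof eventually_elim
      case (elim \<zeta>)
      have "fps_nth fps_X n = (\<Sum>i=0..n. fps_nth (P \<zeta>) i * fps_nth (S \<zeta> ^ i) n)"
        using elim by (metis fps_compose_nth)
      also have "{0..n} = insert n {..<n}" by auto
      finally have "fps_nth fps_X n = fps_nth (P \<zeta>) n * fps_nth (S \<zeta> ^ n) n + (\<Sum>i<n. fps_nth (P \<zeta>) i * fps_nth (S \<zeta> ^ i) n)"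
        by simp
      moreover have "fps_nth (S \<zeta> ^ n) n \<noteq> 0" using elim startsby_zero_power_nth_same[of "S \<zeta>" n] by simp
      ultimately show ?case by (simp add: R_def)
    qed
    have "(R has_field_derivative 0 - (\<Sum>i<n. P' i * fps_nth (S 0 ^ i) n + D i n * fps_nth (P 0) i)) (at 0)"
      unfolding R_def by (intro DERIV_diff DERIV_const DERIV_sum DERIV_mult less.IH) (use D in auto)
    moreover have "(\<Sum>i<n. P' i * fps_nth (S 0 ^ i) n + D i n * fps_nth (P 0) i) = (if n \<ge> 2 then S' n else 0)"
    proof -
      have "(\<Sum>i<n. P' i * fps_nth (S 0 ^ i) n + D i n * fps_nth (P 0) i) = (\<Sum>i<n. if i = 1 then S' n else 0)"
        by (rule sum.cong) (auto simp: S0 P0 fps_X_power_nth D1[unfolded One_nat_def])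
      then show ?thesis by (simp add: sum.delta')
    qed
    ultimately have R: "(R has_field_derivative (if n \<ge> 2 then - S' n else 0)) (at 0)" by auto
    have R0: "R 0 = (if n = 1 then 1 else 0)"
    proof -
      have "(\<Sum>i<n. fps_nth (P 0) i * fps_nth (S 0 ^ i) n) = 0"
        by (rule sum.neutral) (auto simp: S0 P0 fps_X_power_nth)
      then show ?thesis by (simp add: R_def)
    qed
    have S0n: "fps_nth (S 0 ^ n) n = 1" by (simp add: S0 fps_X_power_nth)
    have "((\<lambda>\<zeta>. R \<zeta> / fps_nth (S \<zeta> ^ n) n) has_field_derivative
       ((if n \<ge> 2 then - S' n else 0) * fps_nth (S 0 ^ n) n - R 0 * D n n) / (fps_nth (S 0 ^ n) n * fps_nth (S 0 ^ n) n)) (at 0)"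
      by (intro DERIV_divide R) (use D S0n in auto)
    moreover have "((if n \<ge> 2 then - S' n else 0) * fps_nth (S 0 ^ n) n - R 0 * D n n) / (fps_nth (S 0 ^ n) n * fps_nth (S 0 ^ n) n) = P' n"
      unfolding S0n R0 P'_def using D1 by (cases "n = 0"; cases "n = 1") auto
    ultimately have "((\<lambda>\<zeta>. R \<zeta> / fps_nth (S \<zeta> ^ n) n) has_field_derivative P' n) (at 0)" by simp
    then show ?case by (rule iffD2[OF DERIV_cong_ev[OF refl eq refl]])
  qed
  then show ?thesis using n by (metis P'_def not_one_le_zero)
qed

section \<open>Virasoro operators on the graded space\<close>

lemma vector_space_complex: "vector_space ((*) :: complex \<Rightarrow> complex \<Rightarrow> complex)"
  by unfold_locales (simp_all add: algebra_simps)

lemma Sum_any_eq_sum: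
  assumes "finite A" "\<And>k. k \<notin> A \<Longrightarrow> f k = 0"
  shows "Sum_any f = sum f A"
  by (rule Sum_any.expand_superset) (use assms in auto)

abbreviation dual :: "'v::ab_group_add voa_data \<Rightarrow> ('v \<Rightarrow> complex) \<Rightarrow> bool" where
  "dual V \<equiv> Vector_Spaces.linear (scl V) (*)"

abbreviation lin :: "'v::ab_group_add voa_data \<Rightarrow> ('v \<Rightarrow> 'v) \<Rightarrow> bool" where
  "lin V \<equiv> Vector_Spaces.linear (scl V) (scl V)"

context voa
begin

interpretation vs: vector_space "scl V" by (rule vector_space)
interpretation vp: vector_space_pair "scl V" "(*) :: complex \<Rightarrow> complex \<Rightarrow> complex"
  by (intro vector_space_pair.intro vector_space vector_space_complex)
interpretation vv: vector_space_pair "scl V" "scl V"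
  by (intro vector_space_pair.intro vector_space)

lemma dual_iff: "dual V \<alpha> \<longleftrightarrow> (\<forall>x y. \<alpha> (x + y) = \<alpha> x + \<alpha> y) \<and> (\<forall>c x. \<alpha> (scl V c x) = c * \<alpha> x)"
  unfolding Vector_Spaces.linear_iff using vector_space vector_space_complex by simp

lemma lin_iff: "lin V f \<longleftrightarrow> (\<forall>x y. f (x + y) = f x + f y) \<and> (\<forall>c x. f (scl V c x) = scl V c (f x))"
  unfolding Vector_Spaces.linear_iff using vector_space by simp

lemma dualD:
  assumes "dual V \<alpha>"
  shows "\<alpha> (x + y) = \<alpha> x + \<alpha> y" "\<alpha> (scl V c x) = c * \<alpha> x" "\<alpha> 0 = 0" "\<alpha> (- x) = - \<alpha> x"
    "\<alpha> (x - y) = \<alpha> x - \<alpha> y" "\<alpha> (sum F I) = (\<Sum>i\<in>I. \<alpha> (F i))"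
proof -
  show a: "\<alpha> (x + y) = \<alpha> x + \<alpha> y" and s: "\<alpha> (scl V c x) = c * \<alpha> x" for x y c
    using assms unfolding dual_iff by blast+
  show 0: "\<alpha> 0 = 0" using s[of 0 0] by simp
  show m: "\<alpha> (- x) = - \<alpha> x" for x using a[of "- x" x] 0 by (simp add: eq_neg_iff_add_eq_0)
  show "\<alpha> (x - y) = \<alpha> x - \<alpha> y" using a[of x "- y"] m[of y] by simp
  show "\<alpha> (sum F I) = (\<Sum>i\<in>I. \<alpha> (F i))"
    by (induction I rule: infinite_finite_induct) (simp_all add: 0 a)
qed

lemma linD:
  assumes "lin V f"
  shows "f (x + y) = f x + f y" "f (scl V c x) = scl V c (f x)" "f 0 = 0"
    "f (x - y) = f x - f y" "f (sum F I) = (\<Sum>i\<in>I. f (F i))"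
proof -
  show a: "f (x + y) = f x + f y" and s: "f (scl V c x) = scl V c (f x)" for x y c
    using assms unfolding lin_iff by blast+
  show 0: "f 0 = 0" using s[of 0 0] by simp
  show "f (x - y) = f x - f y" using a[of "x - y" y] by simp
  show "f (sum F I) = (\<Sum>i\<in>I. f (F i))"
    by (induction I rule: infinite_finite_induct) (simp_all add: 0 a)
qed

lemma lin_sum: "(\<And>i. i \<in> I \<Longrightarrow> lin V (f i)) \<Longrightarrow> lin V (\<lambda>v. \<Sum>i\<in>I. f i v)"
  unfolding lin_iff by (simp add: sum.distrib vs.scale_sum_right)

lemma lin_scl: "lin V f \<Longrightarrow> lin V (\<lambda>v. scl V c (f v))"
  unfolding lin_iff by (simp add: vs.scale_right_distrib mult.commute)

lemma lin_comp: "lin V f \<Longrightarrow> lin V g \<Longrightarrow> lin V (\<lambda>v. f (g v))"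
  unfolding lin_iff by simp

lemma lin_id: "lin V (\<lambda>v. v)"
  unfolding lin_iff by simp

lemma lin_funpow: "lin V f \<Longrightarrow> lin V (f ^^ k)"
  by (induction k) (auto simp: lin_iff)

lemma dual_lin: "dual V \<alpha> \<Longrightarrow> lin V f \<Longrightarrow> dual V (\<lambda>v. \<alpha> (f v))"
  unfolding lin_iff dual_iff by simp

lemma lin_vir: "lin V (vir V n)"
  unfolding vir_def by (rule linear_right)

text \<open>A nonzero vector extends to a basis, so some functional does not vanish on it.\<close>
lemma dual_separates:
  assumes "\<And>\<alpha>. dual V \<alpha> \<Longrightarrow> \<alpha> x = \<alpha> y"
  shows "x = y"
proof (rule ccontr)
  assume "x \<noteq> y"
  then have "vs.independent {x - y}" by simp
  from vp.linear_independent_extend[OF this, of "\<lambda>_. 1"]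
  obtain \<alpha> where \<alpha>: "dual V \<alpha>" "\<forall>v\<in>{x - y}. \<alpha> v = 1" by blast
  then have "\<alpha> x - \<alpha> y = 1" using dualD(5)[OF \<alpha>(1)] by simp
  then show False using assms[OF \<alpha>(1)] by simp
qed

lemma vtendsto_unique:
  assumes "vtendsto V f l F" "vtendsto V f l' F" "F \<noteq> bot"
  shows "l = l'"
proof (rule dual_separates)
  fix \<alpha> assume "dual V \<alpha>"
  then have "((\<lambda>x. \<alpha> (f x)) \<longlongrightarrow> \<alpha> l) F" "((\<lambda>x. \<alpha> (f x)) \<longlongrightarrow> \<alpha> l') F"
    using assms(1,2) unfolding vtendsto_def by blast+
  then show "\<alpha> l = \<alpha> l'" by (rule tendsto_unique[OF assms(3)])
qed

lemma gr_subspace: "0 \<in> gr V k" "x \<in> gr V k \<Longrightarrow> y \<in> gr V k \<Longrightarrow> x + y \<in> gr V k"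
  "x \<in> gr V k \<Longrightarrow> scl V c x \<in> gr V k"
  using graded_subspace[of k] unfolding vs.subspace_def by blast+

lemma is_decomp_iff:
  "is_decomp V v f \<longleftrightarrow> (\<forall>n. f n \<in> gr V n) \<and> (\<exists>N. (\<forall>n>N. f n = 0) \<and> v = (\<Sum>k\<le>N. f k))"
proof
  assume d: "is_decomp V v f"
  then have "finite {n. f n \<noteq> 0}" by (simp add: is_decomp_def)
  then obtain N where N: "\<forall>n\<in>{n. f n \<noteq> 0}. n \<le> N" by (meson finite_nat_set_iff_bounded_le)
  then have "Sum_any f = (\<Sum>k\<le>N. f k)" by (intro Sum_any_eq_sum) auto
  then show "(\<forall>n. f n \<in> gr V n) \<and> (\<exists>N. (\<forall>n>N. f n = 0) \<and> v = (\<Sum>k\<le>N. f k))"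
    using d N unfolding is_decomp_def by (metis mem_Collect_eq not_le)
next
  assume "(\<forall>n. f n \<in> gr V n) \<and> (\<exists>N. (\<forall>n>N. f n = 0) \<and> v = (\<Sum>k\<le>N. f k))"
  then obtain N where N: "\<forall>n. f n \<in> gr V n" "\<forall>n>N. f n = 0" "v = (\<Sum>k\<le>N. f k)" by blast
  have "{n. f n \<noteq> 0} \<subseteq> {..N}" using N(2) not_le by auto
  then have "finite {n. f n \<noteq> 0}" by (rule finite_subset) simp
  moreover have "Sum_any f = (\<Sum>k\<le>N. f k)" using N(2) by (intro Sum_any_eq_sum) auto
  ultimately show "is_decomp V v f" using N unfolding is_decomp_def by simp
qed

lemma is_decomp_hcomp: "is_decomp V v (\<lambda>n. hcomp V n v)"
  unfolding hcomp_def using theI'[OF graded_sum[of v]] by simp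

lemma hcomp_eqI: "is_decomp V v f \<Longrightarrow> hcomp V n v = f n"
  unfolding hcomp_def using the1_equality[OF graded_sum[of v]] by metis

lemma hcomp_in_gr: "hcomp V n v \<in> gr V n"
  using is_decomp_hcomp unfolding is_decomp_def by blast

lemma gr_le_iff: "v \<in> gr_le V N \<longleftrightarrow> (\<forall>k>N. hcomp V k v = 0)"
proof
  assume "v \<in> gr_le V N"
  then obtain f where f: "\<forall>k. f k \<in> gr V k" "v = (\<Sum>k\<le>N. f k)" unfolding gr_le_def by blast
  have "is_decomp V v (\<lambda>k. if k \<le> N then f k else 0)"
    unfolding is_decomp_iff using f gr_subspace(1) by (auto intro!: exI[of _ N])
  then show "\<forall>k>N. hcomp V k v = 0" using hcomp_eqI by force
next
  assume *: "\<forall>k>N. hcomp V k v = 0"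
  obtain M where M: "\<forall>k>M. hcomp V k v = 0" "v = (\<Sum>k\<le>M. hcomp V k v)"
    using is_decomp_hcomp[of v] unfolding is_decomp_iff by blast
  have "(\<Sum>k\<le>M. hcomp V k v) = (\<Sum>k\<le>N. hcomp V k v)"
    by (rule sum.mono_neutral_cong) (use * M(1) in \<open>auto simp: not_le\<close>)
  then have "v = (\<Sum>k\<le>N. hcomp V k v)" using M(2) by (rule trans[rotated])
  then show "v \<in> gr_le V N" unfolding gr_le_def using hcomp_in_gr by blast
qed

lemma sum_hcomp: "v \<in> gr_le V N \<Longrightarrow> (\<Sum>k\<le>N. hcomp V k v) = v"
proof -
  assume *: "v \<in> gr_le V N"
  obtain M where M: "\<forall>k>M. hcomp V k v = 0" "v = (\<Sum>k\<le>M. hcomp V k v)"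
    using is_decomp_hcomp[of v] unfolding is_decomp_iff by blast
  have "(\<Sum>k\<le>M. hcomp V k v) = (\<Sum>k\<le>N. hcomp V k v)"
    by (rule sum.mono_neutral_cong) (use * M(1) in \<open>auto simp: not_le gr_le_iff\<close>)
  then show ?thesis using M(2) by simp
qed

lemma ex_gr_le: "\<exists>N. v \<in> gr_le V N"
  using is_decomp_hcomp[of v] unfolding is_decomp_iff gr_le_iff by blast

lemma gr_le_mono: "v \<in> gr_le V N \<Longrightarrow> N \<le> M \<Longrightarrow> v \<in> gr_le V M"
  unfolding gr_le_iff by simp

lemma lin_hcomp: "lin V (hcomp V k)"
  unfolding lin_iff
proof (intro conjI allI)
  fix x y
  obtain N where N: "x \<in> gr_le V N" using ex_gr_le by blast
  obtain M where M: "y \<in> gr_le V M" using ex_gr_le by blast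
  have xy: "x \<in> gr_le V (max N M)" "y \<in> gr_le V (max N M)" using gr_le_mono N M by auto
  have "is_decomp V (x + y) (\<lambda>k. hcomp V k x + hcomp V k y)"
    unfolding is_decomp_iff
  proof (intro conjI allI exI[of _ "max N M"] impI)
    show "x + y = (\<Sum>k\<le>max N M. hcomp V k x + hcomp V k y)"
      unfolding sum.distrib using sum_hcomp xy by simp
  qed (use xy in \<open>auto simp: gr_le_iff intro: gr_subspace hcomp_in_gr\<close>)
  then show "hcomp V k (x + y) = hcomp V k x + hcomp V k y" by (rule hcomp_eqI)
next
  fix c x
  obtain N where N: "x \<in> gr_le V N" using ex_gr_le by blast
  have "is_decomp V (scl V c x) (\<lambda>k. scl V c (hcomp V k x))"
    unfolding is_decomp_iff
  proof (intro conjI allI exI[of _ N] impI)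
    show "scl V c x = (\<Sum>k\<le>N. scl V c (hcomp V k x))"
      unfolding vs.scale_sum_right[symmetric] using sum_hcomp[OF N] by simp
  qed (use N in \<open>auto simp: gr_le_iff intro: gr_subspace hcomp_in_gr\<close>)
  then show "hcomp V k (scl V c x) = scl V c (hcomp V k x)" by (rule hcomp_eqI)
qed

lemma gr_le_closed:
  shows "0 \<in> gr_le V N" "x \<in> gr_le V N \<Longrightarrow> y \<in> gr_le V N \<Longrightarrow> x + y \<in> gr_le V N"
    "x \<in> gr_le V N \<Longrightarrow> y \<in> gr_le V N \<Longrightarrow> x - y \<in> gr_le V N"
    "x \<in> gr_le V N \<Longrightarrow> scl V c x \<in> gr_le V N"
    "(\<And>i. i \<in> I \<Longrightarrow> F i \<in> gr_le V N) \<Longrightarrow> (\<Sum>i\<in>I. F i) \<in> gr_le V N"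
  unfolding gr_le_iff by (simp_all add: linD[OF lin_hcomp])

lemma gr_hcomp: "v \<in> gr V k \<Longrightarrow> hcomp V j v = (if j = k then v else 0)"
proof -
  assume v: "v \<in> gr V k"
  have "is_decomp V v (\<lambda>j. if j = k then v else 0)"
    unfolding is_decomp_iff using v gr_subspace(1) by (auto intro!: exI[of _ k])
  then show ?thesis by (rule hcomp_eqI)
qed

lemma gr_subset_gr_le: "v \<in> gr V k \<Longrightarrow> k \<le> N \<Longrightarrow> v \<in> gr_le V N"
  unfolding gr_le_iff by (simp add: gr_hcomp)

lemma vir_0: "v \<in> gr_le V N \<Longrightarrow> vir V 0 v = (\<Sum>k\<le>N. scl V (of_nat k) (hcomp V k v))"
proof -
  assume v: "v \<in> gr_le V N"
  have "vir V 0 v = vir V 0 (\<Sum>k\<le>N. hcomp V k v)" by (simp add: sum_hcomp[OF v])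
  also have "\<dots> = (\<Sum>k\<le>N. vir V 0 (hcomp V k v))" by (rule linD(5)[OF lin_vir])
  also have "\<dots> = (\<Sum>k\<le>N. scl V (of_nat k) (hcomp V k v))"
    by (rule sum.cong[OF refl]) (rule L0_grading[OF hcomp_in_gr])
  finally show ?thesis .
qed

text \<open>
  By the commutator of \<open>L\<^sub>0\<close> and \<open>L\<^sub>n\<close>, the operator \<open>L\<^sub>n\<close> lowers eigenvalues of \<open>L\<^sub>0\<close> by \<open>n\<close>, and the
  graded pieces are the eigenspaces of \<open>L\<^sub>0\<close>.
\<close>
lemma vir_gr:
  assumes w: "w \<in> gr V k"
  shows "n \<le> k \<Longrightarrow> vir V (int n) w \<in> gr V (k - n)" "n > k \<Longrightarrow> vir V (int n) w = 0"
proof -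
  define y where "y = vir V (int n) w"
  define l where "l = (of_nat k - of_nat n :: complex)"
  obtain c :: complex where c: "\<forall>m n w. vir V m (vir V n w) - vir V n (vir V m w) =
       scl V (of_int (m - n)) (vir V (m + n) w)
       + (if m + n = 0 then scl V (of_int (m ^ 3 - m) / 12 * c) w else 0)" using virasoro by (rule exE)
  have "vir V 0 y - vir V (int n) (vir V 0 w) = scl V (of_int (0 - int n)) y"
    using c[rule_format, of 0 "int n" w] by (simp add: y_def)
  moreover have "vir V (int n) (vir V 0 w) = scl V (of_nat k) y"
    unfolding L0_grading[OF w] linD(2)[OF lin_vir] y_def ..
  ultimately have "vir V 0 y = scl V (of_nat k) y + scl V (- of_nat n) y"
    by (simp add: diff_eq_eq add.commute)
  then have L0y: "vir V 0 y = scl V l y" by (simp add: vs.scale_left_diff_distrib l_def)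
  obtain N where N: "y \<in> gr_le V N" using ex_gr_le by blast
  have h0: "hcomp V j y = 0" if j: "of_nat j \<noteq> l" for j
  proof -
    have "is_decomp V (vir V 0 y) (\<lambda>j. scl V (of_nat j) (hcomp V j y))"
      unfolding is_decomp_iff
      by (intro conjI allI exI[of _ N] impI vir_0[OF N] gr_subspace(3) hcomp_in_gr) (use N in \<open>simp add: gr_le_iff\<close>)
    then have "hcomp V j (scl V l y) = scl V (of_nat j) (hcomp V j y)" unfolding L0y by (rule hcomp_eqI)
    then have "scl V (of_nat j - l) (hcomp V j y) = 0"
      unfolding linD(2)[OF lin_hcomp] vs.scale_left_diff_distrib by auto
    then show ?thesis unfolding vs.scale_eq_0_iff using j by auto
  qed
  show "vir V (int n) w = 0" if "n > k"
  proof -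
    have "of_nat j \<noteq> l" for j
    proof
      assume "of_nat j = l"
      then have "(of_nat (j + n) :: complex) = of_nat k" by (simp add: l_def)
      then show False using that by (simp only: of_nat_eq_iff)
    qed
    then have "hcomp V j y = 0" for j using h0 by blast
    then show ?thesis using sum_hcomp[OF N] by (simp add: y_def)
  qed
  show "vir V (int n) w \<in> gr V (k - n)" if "n \<le> k"
  proof -
    have "l = of_nat (k - n)" using that by (simp add: l_def of_nat_diff)
    then have h: "hcomp V j y = 0" if "j \<noteq> k - n" for j using that h0[of j] by simp
    then have "y \<in> gr_le V (k - n)" unfolding gr_le_iff by auto
    then have "y = (\<Sum>j\<le>k - n. hcomp V j y)" using sum_hcomp by simp
    also have "\<dots> = hcomp V (k - n) y" by (subst sum.remove[of _ "k - n"]) (auto simp: h intro!: sum.neutral)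
    finally show ?thesis using hcomp_in_gr[of "k - n" y] by (simp add: y_def)
  qed
qed

lemma vir_gr_le:
  assumes v: "v \<in> gr_le V N"
  shows "n \<le> N \<Longrightarrow> vir V (int n) v \<in> gr_le V (N - n)" "n > N \<Longrightarrow> vir V (int n) v = 0"
proof -
  have e: "vir V (int n) v = (\<Sum>k\<le>N. vir V (int n) (hcomp V k v))"
    unfolding linD(5)[OF lin_vir, symmetric] sum_hcomp[OF v] ..
  show "n > N \<Longrightarrow> vir V (int n) v = 0"
    unfolding e by (intro sum.neutral ballI vir_gr(2)[OF hcomp_in_gr]) auto
  assume n: "n \<le> N"
  show "vir V (int n) v \<in> gr_le V (N - n)"
    unfolding e
  proof (rule gr_le_closed(5))
    fix k assume "k \<in> {..N}"
    then show "vir V (int n) (hcomp V k v) \<in> gr_le V (N - n)"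
      using vir_gr[OF hcomp_in_gr[of k v], of n] gr_le_closed(1) n
      by (cases "n \<le> k") (auto intro: gr_subset_gr_le)
  qed
qed

lemma vir_gr_le_mem: "v \<in> gr_le V N \<Longrightarrow> vir V (int n) v \<in> gr_le V N"
  using vir_gr_le[of v N n] gr_le_closed(1) by (cases "n \<le> N") (auto intro: gr_le_mono)

section \<open>The operators of changes of coordinates\<close>

definition vir_comb :: "nat \<Rightarrow> (nat \<Rightarrow> complex) \<Rightarrow> 'v \<Rightarrow> 'v" where
  "vir_comb N c v = (\<Sum>n=1..N. scl V (c n) (vir V (int n) v))"

lemma lin_vir_comb: "lin V (vir_comb N c)"
  unfolding vir_comb_def by (intro lin_sum lin_scl lin_vir)

lemma sum_vir_gr_le:
  assumes "v \<in> gr_le V N"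
  shows "sum_vir V c v = vir_comb N c v"
proof -
  have "sum_vir V c v = (\<Sum>n\<in>{1..N}. if n > 0 then scl V (c n) (vir V (int n) v) else 0)"
    unfolding sum_vir_def
  proof (rule Sum_any_eq_sum)
    fix k assume "k \<notin> {1..N}"
    then show "(if k > 0 then scl V (c k) (vir V (int k) v) else 0) = 0"
      using vir_gr_le(2)[OF assms, of k] by auto
  qed simp
  also have "\<dots> = vir_comb N c v" unfolding vir_comb_def by (rule sum.cong) auto
  finally show ?thesis .
qed

lemma vir_comb_gr_le: "v \<in> gr_le V N \<Longrightarrow> vir_comb M c v \<in> gr_le V N"
  unfolding vir_comb_def by (intro gr_le_closed(4,5) vir_gr_le_mem)

lemma vir_comb_funpow_gr_le: "v \<in> gr_le V N \<Longrightarrow> (vir_comb M c ^^ k) v \<in> gr_le V N"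
  by (induction k) (auto intro: vir_comb_gr_le)

lemma sum_vir_funpow: "v \<in> gr_le V N \<Longrightarrow> (sum_vir V c ^^ k) v = (vir_comb N c ^^ k) v"
  by (induction k) (auto simp: sum_vir_gr_le[OF vir_comb_funpow_gr_le])

lemma sum_vir_lowers:
  assumes "v \<in> gr_le V N"
  shows "N \<ge> 1 \<Longrightarrow> sum_vir V c v \<in> gr_le V (N - 1)" "N = 0 \<Longrightarrow> sum_vir V c v = 0"
proof -
  assume "N \<ge> 1"
  show "sum_vir V c v \<in> gr_le V (N - 1)"
    unfolding sum_vir_gr_le[OF assms] vir_comb_def
    by (intro gr_le_closed(4,5) gr_le_mono[OF vir_gr_le(1)[OF assms]]) auto
qed (simp add: sum_vir_gr_le[OF assms] vir_comb_def)

lemma sum_vir_funpow_lowers: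
  assumes "v \<in> gr_le V N"
  shows "(k \<le> N \<longrightarrow> (sum_vir V c ^^ k) v \<in> gr_le V (N - k)) \<and> (k > N \<longrightarrow> (sum_vir V c ^^ k) v = 0)"
proof (induction k)
  case (Suc k)
  have z: "sum_vir V c 0 = 0" using sum_vir_lowers(2)[OF gr_le_closed(1)] by simp
  show ?case
  proof (cases "k < N")
    case True
    then show ?thesis using Suc sum_vir_lowers(1)[of "(sum_vir V c ^^ k) v" "N - k" c] by auto
  next
    case False
    then show ?thesis using Suc z sum_vir_lowers(2)[of "(sum_vir V c ^^ k) v" "N - k" c]
      by (cases "k = N") auto
  qed
qed (use assms in simp)

definition exp_vir :: "nat \<Rightarrow> (nat \<Rightarrow> complex) \<Rightarrow> 'v \<Rightarrow> 'v" where
  "exp_vir N c v = (\<Sum>k\<le>N. scl V (1 / fact k) ((vir_comb N c ^^ k) v))"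

lemma lin_exp_vir: "lin V (exp_vir N c)"
  unfolding exp_vir_def by (intro lin_sum lin_scl lin_funpow lin_vir_comb)

lemma exp_vir_gr_le: "v \<in> gr_le V N \<Longrightarrow> exp_vir M c v \<in> gr_le V N"
  unfolding exp_vir_def by (intro gr_le_closed(4,5) vir_comb_funpow_gr_le)

definition pow_gr :: "nat \<Rightarrow> complex \<Rightarrow> 'v \<Rightarrow> 'v" where
  "pow_gr N a v = (\<Sum>k\<le>N. scl V (a ^ k) (hcomp V k v))"

lemma lin_pow_gr: "lin V (pow_gr N a)"
  unfolding pow_gr_def by (intro lin_sum lin_scl lin_hcomp)

text \<open>On \<open>gr_le V N\<close> the operators \<open>L\<^sub>n\<close> with \<open>n > N\<close> and all products of more than \<open>N\<close> operators of
  positive index vanish, so the sums in \<open>coord_op\<close> have bounds that are independent of \<open>\<rho>\<close>.\<close>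
lemma coord_op_gr_le:
  assumes v: "v \<in> gr_le V N"
  shows "coord_op V \<rho> v = pow_gr N (deriv \<rho> 0) (exp_vir N (germ_coeffs \<rho>) v)"
proof -
  let ?c = "germ_coeffs \<rho>"
  have "Sum_any (\<lambda>k. scl V (1 / fact k) ((sum_vir V ?c ^^ k) v)) = (\<Sum>k\<le>N. scl V (1 / fact k) ((sum_vir V ?c ^^ k) v))"
    by (rule Sum_any_eq_sum) (use sum_vir_funpow_lowers[OF v] in auto)
  also have "\<dots> = exp_vir N ?c v" by (simp add: exp_vir_def sum_vir_funpow[OF v])
  finally have 1: "Sum_any (\<lambda>k. scl V (1 / fact k) ((sum_vir V ?c ^^ k) v)) = exp_vir N ?c v" .
  have "pow_L0 V a w = pow_gr N a w" if "w \<in> gr_le V N" for a w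
    unfolding pow_L0_def pow_gr_def by (rule Sum_any_eq_sum) (use that in \<open>auto simp: gr_le_iff\<close>)
  from this[OF exp_vir_gr_le[OF v]] show ?thesis unfolding coord_op_def 1 .
qed

lemma coord_op_mem: "v \<in> gr_le V N \<Longrightarrow> coord_op V \<rho> v \<in> gr_le V N"
  unfolding coord_op_gr_le pow_gr_def
  by (intro gr_le_closed(4,5)) (auto intro: gr_subset_gr_le[OF hcomp_in_gr])

lemma lin_coord_op: "lin V (coord_op V \<rho>)"
proof -
  have l: "lin V (\<lambda>v. pow_gr N (deriv \<rho> 0) (exp_vir N (germ_coeffs \<rho>) v))" for N
    by (rule lin_comp[OF lin_pow_gr lin_exp_vir])
  show ?thesis
    unfolding lin_iff
  proof (intro conjI allI)
    fix x y
    obtain N where N: "x \<in> gr_le V N" using ex_gr_le by blast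
    obtain M where M: "y \<in> gr_le V M" using ex_gr_le by blast
    have xy: "x \<in> gr_le V (max N M)" "y \<in> gr_le V (max N M)" using gr_le_mono N M by auto
    show "coord_op V \<rho> (x + y) = coord_op V \<rho> x + coord_op V \<rho> y"
      unfolding coord_op_gr_le[OF xy(1)] coord_op_gr_le[OF xy(2)] coord_op_gr_le[OF gr_le_closed(2)[OF xy]]
      by (rule linD(1)[OF l])
  next
    fix c x
    obtain N where N: "x \<in> gr_le V N" using ex_gr_le by blast
    show "coord_op V \<rho> (scl V c x) = scl V c (coord_op V \<rho> x)"
      unfolding coord_op_gr_le[OF N] coord_op_gr_le[OF gr_le_closed(4)[OF N]] by (rule linD(2)[OF l])
  qed
qed

lemma coord_op_cong:
  assumes "eventually (\<lambda>z. \<rho> z = \<rho>' z) (nhds 0)"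
  shows "coord_op V \<rho> = coord_op V \<rho>'"
  unfolding coord_op_def germ_coeffs_cong[OF assms] ..

lemma vir_comb_zero: "(\<And>n. 1 \<le> n \<Longrightarrow> c n = 0) \<Longrightarrow> vir_comb N c v = 0"
  unfolding vir_comb_def by (intro sum.neutral) auto

lemma exp_vir_zero:
  assumes "\<And>n. 1 \<le> n \<Longrightarrow> c n = 0"
  shows "exp_vir N c v = v"
proof -
  have "(vir_comb N c ^^ k) v = 0" if "k > 0" for k
    using that by (cases k) (auto simp: vir_comb_zero[OF assms])
  then show ?thesis unfolding exp_vir_def by (subst sum.remove[of _ 0]) (auto intro!: sum.neutral)
qed

lemma pow_gr_1: "v \<in> gr_le V N \<Longrightarrow> pow_gr N 1 v = v"
  by (simp add: pow_gr_def sum_hcomp)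

lemma coord_op_id:
  assumes "eventually (\<lambda>z. \<rho> z = z) (nhds 0)"
  shows "coord_op V \<rho> v = v"
proof -
  obtain N where N: "v \<in> gr_le V N" using ex_gr_le by blast
  show ?thesis
    unfolding coord_op_gr_le[OF N] germ_coeffs_id(1)[OF assms]
    by (simp add: exp_vir_zero[OF germ_coeffs_id(2)[OF assms]] pow_gr_1[OF N])
qed

subsection \<open>Regularity tested on linear functionals\<close>

lemma weak_coord_op:
  assumes fa: "function_algebra D \<F>"
    and a: "(\<lambda>p. deriv (\<rho> p) 0) \<in> \<F>" and c: "\<And>n. n \<ge> 1 \<Longrightarrow> (\<lambda>p. germ_coeffs (\<rho> p) n) \<in> \<F>"
    and F: "\<And>p. p \<in> D \<Longrightarrow> F p \<in> gr_le V N" "\<And>\<alpha>. dual V \<alpha> \<Longrightarrow> (\<lambda>p. \<alpha> (F p)) \<in> \<F>"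
    and \<alpha>: "dual V \<alpha>"
  shows "(\<lambda>p. \<alpha> (coord_op V (\<rho> p) (F p))) \<in> \<F>"
proof -
  have T: "(\<lambda>p. \<alpha> ((vir_comb N (germ_coeffs (\<rho> p)) ^^ k) (F p))) \<in> \<F>" if "dual V \<alpha>" for k \<alpha>
    using that
  proof (induction k arbitrary: \<alpha>)
    case (Suc k)
    have "(\<lambda>p. \<Sum>n=1..N. germ_coeffs (\<rho> p) n * \<alpha> (vir V (int n) ((vir_comb N (germ_coeffs (\<rho> p)) ^^ k) (F p)))) \<in> \<F>"
      by (intro fa_sum[OF fa] fa_mult[OF fa] c Suc.IH[OF dual_lin[OF Suc.prems lin_vir]]) auto
    moreover have "\<alpha> (vir_comb N c v) = (\<Sum>n=1..N. c n * \<alpha> (vir V (int n) v))" for c v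
      unfolding vir_comb_def by (simp add: dualD[OF Suc.prems])
    ultimately show ?case unfolding funpow.simps o_apply by (simp only:)
  qed (simp add: F)
  have "(\<lambda>p. \<Sum>j\<le>N. deriv (\<rho> p) 0 ^ j * (\<Sum>k\<le>N. (1 / fact k) * \<alpha> (hcomp V j ((vir_comb N (germ_coeffs (\<rho> p)) ^^ k) (F p))))) \<in> \<F>"
    by (intro fa_sum[OF fa] fa_mult[OF fa] fa_power[OF fa] fa_const[OF fa] a T dual_lin[OF \<alpha> lin_hcomp])
  then show ?thesis
    by (rule fa_cong[OF fa])
       (simp add: coord_op_gr_le[OF F(1)] pow_gr_def exp_vir_def dualD[OF \<alpha>] linD[OF lin_hcomp])
qed

text \<open>Differentiability at \<open>0\<close> in the sense of \<open>vtendsto\<close>, that is, tested on all linear functionals.\<close>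
definition weak_deriv :: "(complex \<Rightarrow> 'v) \<Rightarrow> 'v \<Rightarrow> bool" where
  "weak_deriv F F' \<longleftrightarrow> (\<forall>\<alpha>. dual V \<alpha> \<longrightarrow> ((\<lambda>\<zeta>. \<alpha> (F \<zeta>)) has_field_derivative \<alpha> F') (at 0))"

lemma weak_derivI: "(\<And>\<alpha>. dual V \<alpha> \<Longrightarrow> ((\<lambda>\<zeta>. \<alpha> (F \<zeta>)) has_field_derivative \<alpha> F') (at 0)) \<Longrightarrow> weak_deriv F F'"
  and weak_derivD: "weak_deriv F F' \<Longrightarrow> dual V \<alpha> \<Longrightarrow> ((\<lambda>\<zeta>. \<alpha> (F \<zeta>)) has_field_derivative \<alpha> F') (at 0)"
  unfolding weak_deriv_def by blast+

lemma weak_deriv_lin: "weak_deriv F F' \<Longrightarrow> lin V f \<Longrightarrow> weak_deriv (\<lambda>\<zeta>. f (F \<zeta>)) (f F')"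
  unfolding weak_deriv_def using dual_lin by blast

lemma weak_deriv_sum:
  "(\<And>i. i \<in> I \<Longrightarrow> weak_deriv (F i) (F' i)) \<Longrightarrow> weak_deriv (\<lambda>\<zeta>. \<Sum>i\<in>I. F i \<zeta>) (\<Sum>i\<in>I. F' i)"
  by (intro weak_derivI) (auto simp: dualD intro!: DERIV_sum weak_derivD)

lemma weak_deriv_scl:
  assumes "(f has_field_derivative f') (at 0)" "weak_deriv F F'"
  shows "weak_deriv (\<lambda>\<zeta>. scl V (f \<zeta>) (F \<zeta>)) (scl V f' (F 0) + scl V (f 0) F')"
proof (rule weak_derivI)
  fix \<alpha> assume \<alpha>: "dual V \<alpha>"
  have "((\<lambda>\<zeta>. f \<zeta> * \<alpha> (F \<zeta>)) has_field_derivative f' * \<alpha> (F 0) + \<alpha> F' * f 0) (at 0)"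
    by (rule DERIV_mult[OF assms(1) weak_derivD[OF assms(2) \<alpha>]])
  then show "((\<lambda>\<zeta>. \<alpha> (scl V (f \<zeta>) (F \<zeta>))) has_field_derivative \<alpha> (scl V f' (F 0) + scl V (f 0) F')) (at 0)"
    by (simp add: dualD[OF \<alpha>] mult.commute)
qed

lemma weak_deriv_cong_ev:
  assumes "eventually (\<lambda>\<zeta>. F \<zeta> = G \<zeta>) (nhds 0)" "weak_deriv G F'"
  shows "weak_deriv F F'"
proof (rule weak_derivI)
  fix \<alpha> assume \<alpha>: "dual V \<alpha>"
  have "eventually (\<lambda>\<zeta>. \<alpha> (F \<zeta>) = \<alpha> (G \<zeta>)) (nhds 0)"
    using assms(1) by (rule eventually_mono) simp
  from DERIV_cong_ev[OF refl this refl]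
  show "((\<lambda>\<zeta>. \<alpha> (F \<zeta>)) has_field_derivative \<alpha> F') (at 0)" using weak_derivD[OF assms(2) \<alpha>] by blast
qed

lemma weak_deriv_vtendsto:
  assumes "weak_deriv F F'"
  shows "vtendsto V (\<lambda>\<zeta>. scl V (1 / \<zeta>) (F \<zeta> - F 0)) F' (at 0)"
  unfolding vtendsto_def
proof (intro allI impI)
  fix \<alpha> assume \<alpha>: "dual V \<alpha>"
  show "((\<lambda>\<zeta>. \<alpha> (scl V (1 / \<zeta>) (F \<zeta> - F 0))) \<longlongrightarrow> \<alpha> F') (at 0)"
    using weak_derivD[OF assms \<alpha>] unfolding has_field_derivative_iff by (simp add: dualD[OF \<alpha>])
qed

text \<open>
  The product rule for \<open>\<U>(\<rho>\<^sub>\<zeta>) F(\<zeta>)\<close>. At the identity the exponential contributes its linear term, and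
  \<open>a\<^bsup>L_0\<^esup>\<close> contributes \<open>a\<^sup>\<prime> L\<^sub>0\<close>.
\<close>
lemma weak_deriv_coord_op:
  fixes \<rho> :: "complex \<Rightarrow> complex \<Rightarrow> complex"
  assumes a: "((\<lambda>\<zeta>. deriv (\<rho> \<zeta>) 0) has_field_derivative a') (at 0)" "deriv (\<rho> 0) 0 = 1"
    and c: "\<And>n. n \<ge> 1 \<Longrightarrow> ((\<lambda>\<zeta>. germ_coeffs (\<rho> \<zeta>) n) has_field_derivative c' n) (at 0)"
      "\<And>n. n \<ge> 1 \<Longrightarrow> germ_coeffs (\<rho> 0) n = 0"
    and F: "eventually (\<lambda>\<zeta>. F \<zeta> \<in> gr_le V N) (nhds 0)" "weak_deriv F F'" "F' \<in> gr_le V N"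
  shows "weak_deriv (\<lambda>\<zeta>. coord_op V (\<rho> \<zeta>) (F \<zeta>)) (F' + scl V a' (vir V 0 (F 0)) + vir_comb N c' (F 0))"
proof -
  let ?c = "\<lambda>\<zeta>. germ_coeffs (\<rho> \<zeta>)"
  have F0: "F 0 \<in> gr_le V N" using F(1) by (rule eventually_nhds_x_imp_x)
  have T: "weak_deriv (\<lambda>\<zeta>. vir_comb N (?c \<zeta>) (G \<zeta>)) (vir_comb N c' (G 0))" if "weak_deriv G G'" for G G'
  proof -
    have "weak_deriv (\<lambda>\<zeta>. \<Sum>n=1..N. scl V (?c \<zeta> n) (vir V (int n) (G \<zeta>)))
        (\<Sum>n=1..N. scl V (c' n) (vir V (int n) (G 0)) + scl V (?c 0 n) (vir V (int n) G'))"
      by (intro weak_deriv_sum weak_deriv_scl c weak_deriv_lin[OF that lin_vir]) auto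
    moreover have "(\<Sum>n=1..N. scl V (c' n) (vir V (int n) (G 0)) + scl V (?c 0 n) (vir V (int n) G')) = vir_comb N c' (G 0)"
      unfolding vir_comb_def by (rule sum.cong) (simp_all add: c(2))
    ultimately show ?thesis unfolding vir_comb_def[of N "?c _"] by simp
  qed
  have T0: "vir_comb N (?c 0) v = 0" for v by (rule vir_comb_zero) (rule c(2))
  define D where "D k = (if k = 0 then F' else if k = 1 then vir_comb N c' (F 0) else 0)" for k :: nat
  have pw: "weak_deriv (\<lambda>\<zeta>. (vir_comb N (?c \<zeta>) ^^ k) (F \<zeta>)) (D k)" for k
  proof (induction k)
    case 0
    show ?case using F(2) by (simp add: D_def)
  next
    case (Suc k)
    have "D (Suc k) = vir_comb N c' ((vir_comb N (?c 0) ^^ k) (F 0))"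
    proof (cases k)
      case (Suc j)
      then show ?thesis by (simp add: D_def T0 linD(3)[OF lin_vir_comb])
    qed (simp add: D_def)
    then show ?case using T[OF Suc] by simp
  qed
  have one: "((\<lambda>_. 1 / fact k) has_field_derivative 0) (at 0)" for k by simp
  have E: "weak_deriv (\<lambda>\<zeta>. exp_vir N (?c \<zeta>) (F \<zeta>)) (F' + vir_comb N c' (F 0))"
  proof -
    have "weak_deriv (\<lambda>\<zeta>. exp_vir N (?c \<zeta>) (F \<zeta>)) (\<Sum>k\<le>N. scl V (1 / fact k) (D k))"
      unfolding exp_vir_def by (intro weak_deriv_sum weak_deriv_lin[OF pw] lin_scl lin_id)
    moreover have "(\<Sum>k\<le>N. scl V (1 / fact k) (D k)) = F' + vir_comb N c' (F 0)"
    proof (cases N)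
      case 0
      then show ?thesis by (simp add: D_def vir_comb_def)
    next
      case (Suc M)
      have "(\<Sum>k\<le>N. scl V (1 / fact k) (D k)) = (\<Sum>k\<in>{0, 1}. scl V (1 / fact k) (D k))"
        by (rule sum.mono_neutral_right) (auto simp: Suc D_def)
      then show ?thesis by (simp add: D_def)
    qed
    ultimately show ?thesis by simp
  qed
  have E0: "exp_vir N (?c 0) (F 0) = F 0" by (rule exp_vir_zero) (rule c(2))
  have "weak_deriv (\<lambda>\<zeta>. pow_gr N (deriv (\<rho> \<zeta>) 0) (exp_vir N (?c \<zeta>) (F \<zeta>)))
      (\<Sum>k\<le>N. scl V (of_nat k * a') (hcomp V k (exp_vir N (?c 0) (F 0))) +
        scl V (deriv (\<rho> 0) 0 ^ k) (hcomp V k (F' + vir_comb N c' (F 0))))"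
    unfolding pow_gr_def
  proof (intro weak_deriv_sum weak_deriv_scl weak_deriv_lin[OF E lin_hcomp])
    fix k
    have "((\<lambda>\<zeta>. deriv (\<rho> \<zeta>) 0 ^ k) has_field_derivative of_nat k * (a' * deriv (\<rho> 0) 0 ^ (k - Suc 0))) (at 0)"
      by (rule DERIV_power[OF a(1)])
    then show "((\<lambda>\<zeta>. deriv (\<rho> \<zeta>) 0 ^ k) has_field_derivative of_nat k * a') (at 0)" by (simp add: a(2))
  qed
  moreover have "(\<Sum>k\<le>N. scl V (of_nat k * a') (hcomp V k (exp_vir N (?c 0) (F 0))) +
        scl V (deriv (\<rho> 0) 0 ^ k) (hcomp V k (F' + vir_comb N c' (F 0)))) =
      F' + scl V a' (vir V 0 (F 0)) + vir_comb N c' (F 0)"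
  proof -
    have "(\<Sum>k\<le>N. scl V (of_nat k * a') (hcomp V k (F 0))) = scl V a' (vir V 0 (F 0))"
      unfolding vir_0[OF F0] vs.scale_sum_right by (simp add: mult.commute)
    moreover have "(\<Sum>k\<le>N. hcomp V k (F' + vir_comb N c' (F 0))) = F' + vir_comb N c' (F 0)"
      by (intro sum_hcomp gr_le_closed(2) F(3) vir_comb_gr_le F0)
    ultimately show ?thesis by (simp add: E0 a(2) sum.distrib)
  qed
  ultimately have "weak_deriv (\<lambda>\<zeta>. pow_gr N (deriv (\<rho> \<zeta>) 0) (exp_vir N (?c \<zeta>) (F \<zeta>)))
      (F' + scl V a' (vir V 0 (F 0)) + vir_comb N c' (F 0))" by simp
  then show ?thesis
    by (rule weak_deriv_cong_ev[rotated]) (use F(1) in \<open>rule eventually_mono\<close>, rule coord_op_gr_le)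
qed

subsection \<open>Holomorphic functions with values in a finite-dimensional subspace\<close>

lemma gr_le_span: "\<exists>B. finite B \<and> B \<subseteq> gr_le V N \<and> gr_le V N \<subseteq> vs.span B"
proof -
  have "\<forall>k. \<exists>B. finite B \<and> vs.span B = gr V k" using graded_finite_dim by blast
  from choice[OF this] obtain B where B: "\<forall>k. finite (B k) \<and> vs.span (B k) = gr V k" by (rule exE)
  define C where "C = (\<Union>k\<le>N. B k)"
  have "gr_le V N \<subseteq> vs.span C"
  proof
    fix v assume v: "v \<in> gr_le V N"
    have "(\<Sum>k\<le>N. hcomp V k v) \<in> vs.span C"
    proof (rule vs.span_sum)
      fix k assume "k \<in> {..N}"
      then have "B k \<subseteq> C" by (auto simp: C_def)
      moreover have "hcomp V k v \<in> vs.span (B k)" using B hcomp_in_gr by blast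
      ultimately show "hcomp V k v \<in> vs.span C" using vs.span_mono by blast
    qed
    then show "v \<in> vs.span C" by (simp add: sum_hcomp[OF v])
  qed
  moreover have "C \<subseteq> gr_le V N"
  proof
    fix b assume "b \<in> C"
    then obtain k where "k \<le> N" "b \<in> B k" by (auto simp: C_def)
    then show "b \<in> gr_le V N" using B vs.span_base[of b "B k"] gr_subset_gr_le by blast
  qed
  moreover have "finite C" using B by (simp add: C_def)
  ultimately show ?thesis by blast
qed

text \<open>A finite-dimensional subspace has a basis, whose coordinate functionals extend to the whole space.
  With them, weak regularity of functions with values in \<open>gr_le V N\<close> is regularity of the coordinates.\<close>
lemma gr_le_dual_basis:
  obtains B \<beta> where "finite B" "B \<subseteq> gr_le V N" "\<And>b. b \<in> B \<Longrightarrow> dual V (\<beta> b)"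
    "\<And>v. v \<in> gr_le V N \<Longrightarrow> v = (\<Sum>b\<in>B. scl V (\<beta> b v) b)"
proof -
  obtain C where C: "finite C" "C \<subseteq> gr_le V N" "gr_le V N \<subseteq> vs.span C" using gr_le_span by blast
  obtain B where B: "B \<subseteq> C" "vs.independent B" "C \<subseteq> vs.span B" by (rule vs.maximal_independent_subset)
  have sp: "gr_le V N \<subseteq> vs.span B" using C(3) B(3) vs.span_mono[OF B(3)] vs.span_span by blast
  have "\<forall>b. \<exists>\<alpha>. dual V \<alpha> \<and> (\<forall>v\<in>B. \<alpha> v = (if v = b then 1 else 0))"
    by (rule allI, rule vp.linear_independent_extend[OF B(2)])
  from choice[OF this] obtain \<beta> where \<beta>: "\<forall>b. dual V (\<beta> b) \<and> (\<forall>v\<in>B. \<beta> b v = (if v = b then 1 else 0))" by (rule exE)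
  have fB: "finite B" using B(1) C(1) finite_subset by blast
  have "v = (\<Sum>b\<in>B. scl V (\<beta> b v) b)" if v: "v \<in> gr_le V N" for v
  proof -
    define r where "r = vs.representation B v"
    have v1: "(\<Sum>b\<in>B. scl V (r b) b) = v"
      unfolding r_def using sp v by (intro vs.sum_representation_eq B fB) auto
    have "\<beta> b v = r b" if b: "b \<in> B" for b
    proof -
      have \<beta>b: "dual V (\<beta> b)" "\<And>v. v \<in> B \<Longrightarrow> \<beta> b v = (if v = b then 1 else 0)" using \<beta> by blast+
      have "\<beta> b v = (\<Sum>v\<in>B. r v * \<beta> b v)" by (subst v1[symmetric]) (simp add: dualD[OF \<beta>b(1)])
      also have "\<dots> = (\<Sum>v\<in>B. if v = b then r v else 0)" by (rule sum.cong) (simp_all add: \<beta>b(2))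
      also have "\<dots> = r b" using fB b by simp
      finally show ?thesis .
    qed
    then have "(\<Sum>b\<in>B. scl V (\<beta> b v) b) = (\<Sum>b\<in>B. scl V (r b) b)" by simp
    then show ?thesis using v1 by (rule trans[OF _ _, symmetric])
  qed
  then show thesis using that[of B \<beta>] fB B(1) C(2) \<beta> by blast
qed

lemma gr_le_O_iff:
  assumes A: "complex_atlas A" and U: "open U"
  shows "u \<in> gr_le_O V A N U \<longleftrightarrow> (\<forall>p\<in>U. u p \<in> gr_le V N) \<and> (\<forall>\<alpha>. dual V \<alpha> \<longrightarrow> holo_fun A U (\<lambda>p. \<alpha> (u p)))"
proof
  assume "u \<in> gr_le_O V A N U"
  then obtain B f where B: "finite B" "B \<subseteq> gr_le V N" "\<forall>b\<in>B. holo_fun A U (f b)"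
    "\<forall>p\<in>U. u p = (\<Sum>b\<in>B. scl V (f b p) b)" unfolding gr_le_O_def by blast
  have "u p \<in> gr_le V N" if "p \<in> U" for p
    using B(4) that B(2) by (auto intro!: gr_le_closed)
  moreover have "holo_fun A U (\<lambda>p. \<alpha> (u p))" if \<alpha>: "dual V \<alpha>" for \<alpha>
  proof (rule holo_fun_cong[OF A _ _ U])
    show "holo_fun A U (\<lambda>p. \<Sum>b\<in>B. f b p * \<alpha> b)"
      using B(3) by (intro holo_fun_sum[OF A U] holo_fun_mult[OF A U] holo_fun_const[OF A]) blast
  qed (use B(4) in \<open>simp add: dualD[OF \<alpha>]\<close>)
  ultimately show "(\<forall>p\<in>U. u p \<in> gr_le V N) \<and> (\<forall>\<alpha>. dual V \<alpha> \<longrightarrow> holo_fun A U (\<lambda>p. \<alpha> (u p)))" by blast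
next
  assume *: "(\<forall>p\<in>U. u p \<in> gr_le V N) \<and> (\<forall>\<alpha>. dual V \<alpha> \<longrightarrow> holo_fun A U (\<lambda>p. \<alpha> (u p)))"
  obtain B \<beta> where B: "finite B" "B \<subseteq> gr_le V N" "\<And>b. b \<in> B \<Longrightarrow> dual V (\<beta> b)"
    "\<And>v. v \<in> gr_le V N \<Longrightarrow> v = (\<Sum>b\<in>B. scl V (\<beta> b v) b)" by (rule gr_le_dual_basis, rule that)
  show "u \<in> gr_le_O V A N U"
    unfolding gr_le_O_def
    by (intro CollectI exI[of _ B] exI[of _ "\<lambda>b p. \<beta> b (u p)"] conjI ballI B(1,2)) (use * B in auto)
qed

end

section \<open>Transport of the fibers along fiber-preserving maps\<close>

lemma fiber_biholoD:
  assumes "fiber_biholo X U U' \<phi>"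
  shows "open U" "open U'" "bij_betw \<phi> U U'" "holo_map (tot X) (tot X) U \<phi>"
    "holo_map (tot X) (tot X) U' (inv_into U \<phi>)"
    "p \<in> U \<Longrightarrow> \<phi> ` (U \<inter> proj X -` {proj X p}) = U' \<inter> proj X -` {proj X (\<phi> p)}"
    "p \<in> U \<Longrightarrow> \<phi> p \<in> U'" "p \<in> U \<Longrightarrow> inv_into U \<phi> (\<phi> p) = p"
    "q \<in> U' \<Longrightarrow> inv_into U \<phi> q \<in> U" "q \<in> U' \<Longrightarrow> \<phi> (inv_into U \<phi> q) = q"
  using assms unfolding fiber_biholo_def
  by (auto simp: bij_betw_def f_inv_into_f inv_into_into)

lemma fiber_biholo_proj:
  assumes "fiber_biholo X U U' \<phi>" "p \<in> U" "q \<in> U"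
  shows "proj X (\<phi> p) = proj X (\<phi> q) \<longleftrightarrow> proj X p = proj X q"
proof
  assume "proj X p = proj X q"
  then have "\<phi> q \<in> \<phi> ` (U \<inter> proj X -` {proj X p})" using assms(3) by auto
  then show "proj X (\<phi> p) = proj X (\<phi> q)" unfolding fiber_biholoD(6)[OF assms(1,2)] by simp
next
  assume "proj X (\<phi> p) = proj X (\<phi> q)"
  then have "\<phi> q \<in> \<phi> ` (U \<inter> proj X -` {proj X p})"
    unfolding fiber_biholoD(6)[OF assms(1,2)] using fiber_biholoD(7)[OF assms(1,3)] by simp
  then obtain q' where "q' \<in> U" "proj X q' = proj X p" "\<phi> q = \<phi> q'" by auto
  then show "proj X p = proj X q"
    using fiber_biholoD(8)[OF assms(1), of q] fiber_biholoD(8)[OF assms(1), of q'] assms(3) by metis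
qed

lemma holo_map_cong:
  assumes A: "complex_atlas A" and A': "complex_atlas A'" and S: "open S" and F: "holo_map A A' S F" and eq: "\<And>p. p \<in> S \<Longrightarrow> F p = G p"
  shows "holo_map A A' S G"
proof -
  have "continuous_on S G"
    using F eq unfolding holo_map_def by (metis continuous_on_cong)
  moreover have "holo_fun A (S \<inter> G -` V) (\<lambda>p. \<psi> (G p) i)" if V: "(V, e, \<psi>) \<in> A'" "i < e" for V e \<psi> i
  proof -
    have "S \<inter> G -` V = S \<inter> F -` V" using eq by auto
    moreover have "holo_fun A (S \<inter> F -` V) (\<lambda>p. \<psi> (G p) i)"
    proof (rule holo_fun_cong[OF A])
      show "holo_fun A (S \<inter> F -` V) (\<lambda>p. \<psi> (F p) i)" using F V unfolding holo_map_def by fast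
      show "open (S \<inter> F -` V)"
        using holo_map_open_preimage[OF F S is_chartD(1)[OF complex_atlasD(1)[OF A' V(1)]]] .
    qed (simp add: eq)
    ultimately show ?thesis by simp
  qed
  ultimately show ?thesis unfolding holo_map_def by auto
qed

text \<open>Makes the transport invertible: its inverse is the transport along \<open>inv_into U \<phi>\<close>.\<close>
lemma fiber_biholo_inv:
  assumes X: "RS_family X" and b: "fiber_biholo X U U' \<phi>"
  shows "fiber_biholo X U' U (inv_into U \<phi>)"
proof -
  note D = fiber_biholoD[OF b]
  have bi: "bij_betw (inv_into U \<phi>) U' U" by (rule bij_betw_inv_into[OF D(3)])
  have "holo_map (tot X) (tot X) U (inv_into U' (inv_into U \<phi>))"
  proof (rule holo_map_cong[OF RS_familyD(1,1)[OF X] D(1,4)])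
    fix p assume "p \<in> U"
    then show "\<phi> p = inv_into U' (inv_into U \<phi>) p"
      using inv_into_f_f[OF bij_betw_imp_inj_on[OF bi] D(7), of p] D(8) by simp
  qed
  moreover have "inv_into U \<phi> ` (U' \<inter> proj X -` {proj X q}) = U \<inter> proj X -` {proj X (inv_into U \<phi> q)}" if q: "q \<in> U'" for q
  proof -
    have "\<phi> ` (U \<inter> proj X -` {proj X (inv_into U \<phi> q)}) = U' \<inter> proj X -` {proj X q}"
      using D(6)[OF D(9)[OF q]] D(10)[OF q] by simp
    then have "inv_into U \<phi> ` (U' \<inter> proj X -` {proj X q}) =
      (\<lambda>p. inv_into U \<phi> (\<phi> p)) ` (U \<inter> proj X -` {proj X (inv_into U \<phi> q)})" by (metis image_image)
    also have "\<dots> = (\<lambda>p. p) ` (U \<inter> proj X -` {proj X (inv_into U \<phi> q)})"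
      by (rule image_cong) (auto simp: D(8))
    finally show ?thesis by simp
  qed
  ultimately show ?thesis unfolding fiber_biholo_def using D(1,2,5) bi by blast
qed

lemma fiber_coordI:
  "open U \<Longrightarrow> holo_fun (tot X) U \<eta> \<Longrightarrow> (\<And>b. inj_on \<eta> (U \<inter> proj X -` {b})) \<Longrightarrow> fiber_coord X U \<eta>"
  by (simp add: fiber_coord_def)

lemma fiber_coord_pullback:
  assumes X: "RS_family X" and b: "fiber_biholo X U U' \<phi>" and \<mu>: "fiber_coord X N \<mu>"
  shows "fiber_coord X (U \<inter> \<phi> -` N) (\<mu> \<circ> \<phi>)"
proof -
  note D = fiber_biholoD[OF b]
  have "inj_on (\<mu> \<circ> \<phi>) ((U \<inter> \<phi> -` N) \<inter> proj X -` {c})" for c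
  proof (rule inj_onI)
    fix p q assume pq: "p \<in> (U \<inter> \<phi> -` N) \<inter> proj X -` {c}" "q \<in> (U \<inter> \<phi> -` N) \<inter> proj X -` {c}"
      "(\<mu> \<circ> \<phi>) p = (\<mu> \<circ> \<phi>) q"
    then have "proj X (\<phi> p) = proj X (\<phi> q)" using fiber_biholo_proj[OF b, of p q] by simp
    then have "\<phi> p = \<phi> q" using fiber_coordD(3)[OF \<mu>, of "\<phi> p" "\<phi> q"] pq by simp
    then show "p = q" using inj_onD[OF bij_betw_imp_inj_on[OF D(3)]] pq by blast
  qed
  then show ?thesis
  proof (rule fiber_coordI[rotated 2])
    show "open (U \<inter> \<phi> -` N)" using holo_map_open_preimage[OF D(4,1) fiber_coordD(1)[OF \<mu>]] .
    show "holo_fun (tot X) (U \<inter> \<phi> -` N) (\<mu> \<circ> \<phi>)"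
      unfolding o_def by (rule holo_map_compose_fun[OF RS_familyD(1,1)[OF X] D(1,4) fiber_coordD(1,2)[OF \<mu>]])
  qed
qed

lemma loc_coordsD:
  assumes "(U, \<eta>) \<in> loc_coords X p"
  shows "fiber_coord X U \<eta>" "p \<in> U"
  using assms by (auto simp: loc_coords_def)

lemma loc_coords_pullback:
  assumes X: "RS_family X" and b: "fiber_biholo X U U' \<phi>" and p: "p \<in> U" and l: "(N, \<mu>) \<in> loc_coords X (\<phi> p)"
  shows "(U \<inter> \<phi> -` N, \<mu> \<circ> \<phi>) \<in> loc_coords X p"
  using fiber_coord_pullback[OF X b loc_coordsD(1)[OF l]] p loc_coordsD(2)[OF l]
  by (auto simp: loc_coords_def)

text \<open>Naturality of changes of coordinates: \<open>\<phi>\<close> maps fibers to fibers, hence the curve of \<open>\<mu> \<circ> \<phi>\<close> through \<open>p\<close>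
  to the curve of \<open>\<mu>\<close> through \<open>\<phi> p\<close>.\<close>
lemma coord_change_pullback:
  assumes X: "RS_family X" and b: "fiber_biholo X U U' \<phi>" and p: "p \<in> U"
    and l: "(N, \<mu>) \<in> loc_coords X (\<phi> p)" and l': "(N', \<eta>) \<in> loc_coords X (\<phi> p)"
  shows "eventually (\<lambda>z. coord_change X ((U \<inter> \<phi> -` N') \<inter> (U \<inter> \<phi> -` N)) (\<eta> \<circ> \<phi>) (\<mu> \<circ> \<phi>) p z =
    coord_change X (N' \<inter> N) \<eta> \<mu> (\<phi> p) z) (nhds 0)"
proof -
  define K where "K = (U \<inter> \<phi> -` N') \<inter> (U \<inter> \<phi> -` N)"
  have \<mu>: "fiber_coord X (N' \<inter> N) \<mu>"
    using fiber_coord_Int(2)[OF X loc_coordsD(1)[OF l] fiber_coordD(1)[OF loc_coordsD(1)[OF l']]] .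
  have "K = U \<inter> \<phi> -` (N' \<inter> N)" by (auto simp: K_def)
  then have \<mu>\<phi>: "fiber_coord X K (\<mu> \<circ> \<phi>)" using fiber_coord_pullback[OF X b \<mu>] by simp
  have pK: "p \<in> K" using p loc_coordsD(2)[OF l] loc_coordsD(2)[OF l'] by (simp add: K_def)
  obtain r where r: "r > 0" "\<And>z. z \<in> ball 0 r \<Longrightarrow> fiber_curve X K (\<mu> \<circ> \<phi>) p z \<in> K \<inter> K"
    "\<And>z. z \<in> ball 0 r \<Longrightarrow> (\<mu> \<circ> \<phi>) (fiber_curve X K (\<mu> \<circ> \<phi>) p z) = z + (\<mu> \<circ> \<phi>) p"
    "\<And>z. z \<in> ball 0 r \<Longrightarrow> proj X (fiber_curve X K (\<mu> \<circ> \<phi>) p z) = proj X p"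
    by (rule fiber_curve_holo[OF X \<mu>\<phi> pK pK fiber_coordD(1,2)[OF \<mu>\<phi>]], rule that)
  have "coord_change X K (\<eta> \<circ> \<phi>) (\<mu> \<circ> \<phi>) p z = coord_change X (N' \<inter> N) \<eta> \<mu> (\<phi> p) z" if z: "z \<in> ball 0 r" for z
  proof -
    define q where "q = fiber_curve X K (\<mu> \<circ> \<phi>) p z"
    have q: "q \<in> K" "\<mu> (\<phi> q) = z + \<mu> (\<phi> p)" "proj X q = proj X p"
      using r(2-4)[OF z] by (simp_all add: q_def)
    have qU: "q \<in> U" using q(1) by (simp add: K_def)
    have "fiber_curve X (N' \<inter> N) \<mu> (\<phi> p) z = \<phi> q"
      by (rule fiber_curve_eq[OF \<mu> _ q(2)]) (use q(1,3) fiber_biholo_proj[OF b qU p] in \<open>simp_all add: K_def\<close>)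
    then show ?thesis by (simp add: coord_change_fiber_curve q_def)
  qed
  moreover have "eventually (\<lambda>z. z \<in> ball 0 r) (nhds (0::complex))"
    using r(1) by (intro eventually_nhds_in_open) auto
  ultimately show ?thesis unfolding K_def[symmetric] by (auto elim: eventually_mono)
qed

context voa
begin

lemma voa_fiberD:
  assumes "a \<in> voa_fiber V X n p"
  shows "l \<in> loc_coords X p \<Longrightarrow> a l \<in> gr_le V n"
    "(U, \<eta>) \<in> loc_coords X p \<Longrightarrow> (U', \<mu>) \<in> loc_coords X p \<Longrightarrow>
      a (U, \<eta>) = coord_op V (coord_change X (U \<inter> U') \<eta> \<mu> p) (a (U', \<mu>))"
    "l \<notin> loc_coords X p \<Longrightarrow> a l = undefined"
proof -
  have *: "a \<in> loc_coords X p \<rightarrow>\<^sub>E gr_le V n \<and> (\<forall>l\<in>loc_coords X p. \<forall>l'\<in>loc_coords X p.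
       a (fst l, snd l) = coord_op V (coord_change X (fst l \<inter> fst l') (snd l) (snd l') p) (a (fst l', snd l')))"
    using assms unfolding voa_fiber_def case_prod_unfold mem_Collect_eq .
  note a = conjunct1[OF *] and c = conjunct2[OF *]
  show "l \<in> loc_coords X p \<Longrightarrow> a l \<in> gr_le V n" using a by (rule PiE_mem)
  show "l \<notin> loc_coords X p \<Longrightarrow> a l = undefined" using a by (rule PiE_arb)
  show "a (U, \<eta>) = coord_op V (coord_change X (U \<inter> U') \<eta> \<mu> p) (a (U', \<mu>))"
    if "(U, \<eta>) \<in> loc_coords X p" "(U', \<mu>) \<in> loc_coords X p"
    using bspec[OF bspec[OF c that(1)] that(2)] by (simp only: fst_conv snd_conv)
qed

lemma voa_fiberI:
  assumes "\<And>l. l \<in> loc_coords X p \<Longrightarrow> a l \<in> gr_le V n" "\<And>l. l \<notin> loc_coords X p \<Longrightarrow> a l = undefined"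
    "\<And>U \<eta> U' \<mu>. (U, \<eta>) \<in> loc_coords X p \<Longrightarrow> (U', \<mu>) \<in> loc_coords X p \<Longrightarrow>
      a (U, \<eta>) = coord_op V (coord_change X (U \<inter> U') \<eta> \<mu> p) (a (U', \<mu>))"
  shows "a \<in> voa_fiber V X n p"
proof -
  have "a \<in> loc_coords X p \<rightarrow>\<^sub>E gr_le V n" using assms(1,2) by (rule PiE_I)
  moreover have "\<forall>l\<in>loc_coords X p. \<forall>l'\<in>loc_coords X p.
       a (fst l, snd l) = coord_op V (coord_change X (fst l \<inter> fst l') (snd l) (snd l') p) (a (fst l', snd l'))"
    by (intro ballI assms(3)) simp_all
  ultimately show ?thesis unfolding voa_fiber_def case_prod_unfold by (simp only: mem_Collect_eq)
qed

text \<open>The change between two coordinates with the same germ is the identity germ, on which \<open>coord_op\<close> is the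
  identity.\<close>
lemma voa_fiber_same_germ:
  assumes X: "RS_family X" and a: "a \<in> voa_fiber V X n p"
    and l: "(U, \<eta>) \<in> loc_coords X p" "(U', \<eta>') \<in> loc_coords X p"
    and M: "open M" "p \<in> M" "\<And>q. q \<in> M \<Longrightarrow> \<eta> q = \<eta>' q"
  shows "a (U, \<eta>) = a (U', \<eta>')"
proof -
  note c = loc_coordsD[OF l(1)] and c' = loc_coordsD[OF l(2)]
  have 1: "fiber_coord X (U \<inter> U') \<eta>'" using fiber_coord_Int(2)[OF X c'(1) fiber_coordD(1)[OF c(1)]] .
  have "eventually (\<lambda>z. coord_change X (U \<inter> U') \<eta> \<eta>' p z = coord_change X (U \<inter> U') \<eta>' \<eta>' p z) (nhds 0)"
    by (rule coord_change_germ[OF X 1 1 _ _ M(1,2)]) (use M c c' in auto)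
  moreover have "eventually (\<lambda>z. coord_change X (U \<inter> U') \<eta>' \<eta>' p z = z) (nhds 0)"
    by (rule coord_change_self[OF X 1]) (use c c' in auto)
  ultimately have "eventually (\<lambda>z. coord_change X (U \<inter> U') \<eta> \<eta>' p z = z) (nhds 0)"
    by eventually_elim simp
  then show ?thesis using voa_fiberD(2)[OF a l] coord_op_id by simp
qed

lemma transport_mem:
  assumes X: "RS_family X" and b: "fiber_biholo X U U' \<phi>" and p: "p \<in> U" and a: "a \<in> voa_fiber V X n p"
  shows "transport X U \<phi> p a \<in> voa_fiber V X n (\<phi> p)"
proof (rule voa_fiberI)
  fix l assume l: "l \<in> loc_coords X (\<phi> p)"
  obtain N \<mu> where N: "l = (N, \<mu>)" by (cases l)
  show "transport X U \<phi> p a l \<in> gr_le V n"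
    using voa_fiberD(1)[OF a loc_coords_pullback[OF X b p l[unfolded N]]] l by (simp add: transport_def N)
next
  fix N \<eta> N' \<mu> assume l: "(N, \<eta>) \<in> loc_coords X (\<phi> p)" "(N', \<mu>) \<in> loc_coords X (\<phi> p)"
  show "transport X U \<phi> p a (N, \<eta>) = coord_op V (coord_change X (N \<inter> N') \<eta> \<mu> (\<phi> p)) (transport X U \<phi> p a (N', \<mu>))"
    using voa_fiberD(2)[OF a loc_coords_pullback[OF X b p l(1)] loc_coords_pullback[OF X b p l(2)]]
      coord_op_cong[OF coord_change_pullback[OF X b p l(2,1)]] l by (simp add: transport_def)
qed (simp add: transport_def)

lemma transport_transport_inv:
  assumes X: "RS_family X" and b: "fiber_biholo X U U' \<phi>" and p: "p \<in> U" and a: "a \<in> voa_fiber V X n (\<phi> p)"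
  shows "transport X U \<phi> p (transport X U' (inv_into U \<phi>) (\<phi> p) a) = a"
proof
  note D = fiber_biholoD[OF b]
  have pp: "inv_into U \<phi> (\<phi> p) = p" using D(8)[OF p] .
  fix l
  show "transport X U \<phi> p (transport X U' (inv_into U \<phi>) (\<phi> p) a) l = a l"
  proof (cases "l \<in> loc_coords X (\<phi> p)")
    case True
    obtain N \<mu> where N: "l = (N, \<mu>)" by (cases l)
    note l = True[unfolded N]
    note l1 = loc_coords_pullback[OF X b p l]
    have l1': "(U \<inter> \<phi> -` N, \<mu> \<circ> \<phi>) \<in> loc_coords X (inv_into U \<phi> (\<phi> p))" using l1 pp by simp
    note l2 = loc_coords_pullback[OF X fiber_biholo_inv[OF X b] D(7)[OF p] l1']
    have "transport X U \<phi> p (transport X U' (inv_into U \<phi>) (\<phi> p) a) l =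
      a (U' \<inter> inv_into U \<phi> -` (U \<inter> \<phi> -` N), \<mu> \<circ> \<phi> \<circ> inv_into U \<phi>)"
      using l l1 by (simp add: transport_def N pp)
    also have "\<dots> = a (N, \<mu>)"
      by (rule voa_fiber_same_germ[OF X a l2 l D(2) D(7)[OF p]]) (simp add: D(10))
    finally show ?thesis by (simp add: N)
  next
    case False
    then show ?thesis using voa_fiberD(3)[OF a] by (simp add: transport_def)
  qed
qed

lemma transport_inv_mem:
  assumes X: "RS_family X" and b: "fiber_biholo X U U' \<phi>" and p: "p \<in> U" and s: "s (\<phi> p) \<in> voa_fiber V X n (\<phi> p)"
  shows "transport_inv V X n U \<phi> s p \<in> voa_fiber V X n p"
    and "transport X U \<phi> p (transport_inv V X n U \<phi> s p) = s (\<phi> p)"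
proof -
  note D = fiber_biholoD[OF b]
  have "transport X U' (inv_into U \<phi>) (\<phi> p) (s (\<phi> p)) \<in> voa_fiber V X n p"
    using transport_mem[OF X fiber_biholo_inv[OF X b] D(7)[OF p] s] D(8)[OF p] by simp
  then have "s (\<phi> p) \<in> transport X U \<phi> p ` voa_fiber V X n p"
    using transport_transport_inv[OF X b p s] by (intro image_eqI[of _ _ "transport X U' (inv_into U \<phi>) (\<phi> p) (s (\<phi> p))"]) simp_all
  then show "transport_inv V X n U \<phi> s p \<in> voa_fiber V X n p"
    "transport X U \<phi> p (transport_inv V X n U \<phi> s p) = s (\<phi> p)"
    unfolding transport_inv_def by (rule inv_into_into, rule f_inv_into_f)
qed

text \<open>
  The transported value at \<open>p\<close> is known in the coordinate \<open>\<eta> \<circ> \<phi>\<close>; a change of coordinates at the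
  same point \<open>p\<close> expresses it in \<open>\<eta>\<close>.
\<close>
lemma transport_inv_value:
  assumes X: "RS_family X" and b: "fiber_biholo X U U' \<phi>" and p: "p \<in> U" and s: "s (\<phi> p) \<in> voa_fiber V X n (\<phi> p)"
    and \<eta>: "fiber_coord X W \<eta>" and UW: "U \<subseteq> W" "U' \<subseteq> W"
  shows "transport_inv V X n U \<phi> s p (W, \<eta>) = coord_op V (coord_change X U \<eta> (\<eta> \<circ> \<phi>) p) (s (\<phi> p) (W, \<eta>))"
proof -
  note D = fiber_biholoD[OF b]
  define a where "a = transport_inv V X n U \<phi> s p"
  have l: "(W, \<eta>) \<in> loc_coords X p" using \<eta> p UW by (auto simp: loc_coords_def)
  have l': "(W, \<eta>) \<in> loc_coords X (\<phi> p)" using \<eta> D(7)[OF p] UW by (auto simp: loc_coords_def)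
  have eq: "U \<inter> \<phi> -` W = U" using D(7) UW by auto
  note l2 = loc_coords_pullback[OF X b p l', unfolded eq]
  have "transport X U \<phi> p a (W, \<eta>) = s (\<phi> p) (W, \<eta>)"
    unfolding a_def transport_inv_mem(2)[where s = s, OF X b p s] ..
  then have 1: "a (U, \<eta> \<circ> \<phi>) = s (\<phi> p) (W, \<eta>)" using l' by (simp add: transport_def eq)
  have "W \<inter> U = U" using UW by auto
  then show ?thesis
    using voa_fiberD(2)[OF transport_inv_mem(1)[where s = s, OF X b p s] l l2] 1 by (simp add: a_def)
qed

end

section \<open>Infinitesimal change of the fiber coordinate along a flow\<close>

lemma local_flowD:
  assumes "local_flow X W x U T \<phi>"
  shows "open T" "0 \<in> T" "holo_map (times_C (tot X)) (tot X) (T \<times> U) (\<lambda>(\<zeta>, p). \<phi> \<zeta> p)"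
    "\<zeta> \<in> T \<Longrightarrow> \<phi> \<zeta> ` U \<subseteq> W" "\<zeta> \<in> T \<Longrightarrow> fiber_biholo X U (\<phi> \<zeta> ` U) (\<phi> \<zeta>)" "p \<in> U \<Longrightarrow> \<phi> 0 p = p"
    "p \<in> U \<Longrightarrow> open N \<Longrightarrow> p \<in> N \<Longrightarrow> holo_fun (tot X) N f \<Longrightarrow>
       ((\<lambda>\<zeta>. f (\<phi> \<zeta> p)) has_field_derivative x f p) (at 0)"
proof -
  note F = assms[unfolded local_flow_def]
  show "open T" "0 \<in> T" "holo_map (times_C (tot X)) (tot X) (T \<times> U) (\<lambda>(\<zeta>, p). \<phi> \<zeta> p)"
    using F by (simp_all only: simp_thms)
  show "\<zeta> \<in> T \<Longrightarrow> \<phi> \<zeta> ` U \<subseteq> W" "\<zeta> \<in> T \<Longrightarrow> fiber_biholo X U (\<phi> \<zeta> ` U) (\<phi> \<zeta>)"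
    using bspec[OF F[THEN conjunct2, THEN conjunct2, THEN conjunct2, THEN conjunct1]] by simp_all
  show "p \<in> U \<Longrightarrow> \<phi> 0 p = p"
    using bspec[OF F[THEN conjunct2, THEN conjunct2, THEN conjunct2, THEN conjunct2, THEN conjunct1]] .
  show "((\<lambda>\<zeta>. f (\<phi> \<zeta> p)) has_field_derivative x f p) (at 0)"
    if "p \<in> U" "open N" "p \<in> N" "holo_fun (tot X) N f"
    using bspec[OF F[THEN conjunct2, THEN conjunct2, THEN conjunct2, THEN conjunct2, THEN conjunct2] that(1)] that(2-4)
    by simp
qed

lemma fun_upd_case_nat_Suc: "(case_nat t y)(Suc i := w) = case_nat t (y(i := w))"
  by (auto simp: fun_eq_iff split: nat.split)

lemma fun_upd_case_nat_0: "(case_nat t y)(0 := w) = case_nat w y"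
  by (auto simp: fun_eq_iff split: nat.split)

context
  fixes X :: "('c::{t2_space,second_countable_topology}, 'b::{t2_space,second_countable_topology}) family_data"
    and W :: "'c set" and \<eta> :: "'c \<Rightarrow> complex" and m :: nat and \<tau> :: "'b \<Rightarrow> cvec" and c :: "'c \<Rightarrow> cvec"
  assumes X: "RS_family X" and \<eta>: "fiber_coord X W \<eta>" and \<tau>: "holo_coords (base X) (proj X ` W) m \<tau>"
    and c: "c = (\<lambda>p. case_nat (\<eta> p) (\<tau> (proj X p)))"
begin

lemma W_eq: "W = W \<inter> proj X -` (proj X ` W)"
  by auto

lemma total_coords: "holo_coords (tot X) W (Suc m) c"
  using fiber_chart[OF X \<eta> \<tau>] unfolding W_eq[symmetric] c .

context
  fixes U :: "'c set" and T :: "complex set" and \<phi> :: "complex \<Rightarrow> 'c \<Rightarrow> 'c" and x :: "'c vfield"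
    and h :: "cvec \<Rightarrow> complex" and p :: 'c
  assumes flow: "local_flow X W x U T \<phi>" and U: "open U" "U \<subseteq> W" and p: "p \<in> U"
    and h: "holo (Suc m) (c ` W) h" and x\<eta>: "\<And>q. q \<in> W \<Longrightarrow> x \<eta> q = h (c q)"
begin

lemma flow_fiber_coord: "\<zeta> \<in> T \<Longrightarrow> fiber_coord X U (\<eta> \<circ> \<phi> \<zeta>)"
proof -
  assume \<zeta>: "\<zeta> \<in> T"
  have "U \<inter> \<phi> \<zeta> -` W = U" using local_flowD(4)[OF flow \<zeta>] by auto
  then show ?thesis using fiber_coord_pullback[OF X local_flowD(5)[OF flow \<zeta>] \<eta>] by simp
qed

lemma fiber_coord_U: "fiber_coord X U \<eta>"
  by (rule fiber_coord_subset[OF X \<eta> U])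

text \<open>On the curve through \<open>p\<close>, the difference quotients of \<open>\<eta> \<circ> \<phi> \<zeta>\<close> in \<open>\<zeta>\<close> converge to \<open>h\<close> uniformly near \<open>z = 0\<close>.
  By Weierstrass, their \<open>z\<close>-derivatives converge as well.\<close>
lemma flow_curve_taylor:
  fixes k :: nat
  defines "f \<equiv> \<lambda>\<zeta> z. \<eta> (\<phi> \<zeta> (fiber_curve X U \<eta> p z))"
  shows "((\<lambda>\<zeta>. (deriv ^^ k) (f \<zeta>) 0) has_field_derivative (pd 0 ^^ k) h (c p)) (at 0)"
    and "\<exists>r>0. \<forall>\<zeta>\<in>T. f \<zeta> holomorphic_on ball 0 r"
proof -
  note tot = RS_familyD(1)[OF X]
  note ch = holo_coordsD(1)[OF total_coords]
  have pW: "p \<in> W" using p U by blast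
  have p\<pi>: "proj X p \<in> proj X ` W" using pW by blast
  obtain r where r: "r > 0" "\<And>z. z \<in> ball 0 r \<Longrightarrow> (c p)(0 := z + \<eta> p) \<in> c ` U"
    by (rule fiber_curve_ball[OF X \<eta> \<tau> pW p\<pi> W_eq c U p], rule that)
  define q where "q z = fiber_curve X W \<eta> p z" for z
  have q: "q z \<in> U" "c (q z) = (c p)(0 := z + \<eta> p)" if "z \<in> ball 0 r" for z
    unfolding q_def using fiber_curve_in_chart(1,2)[OF X \<eta> \<tau> pW p\<pi> W_eq c U r(2)[OF that]] .
  have qU: "fiber_curve X U \<eta> p z = q z" if "z \<in> ball 0 r" for z
    by (rule fiber_curve_eq[OF fiber_coord_U q(1)[OF that]])
       (use fiber_curve_in_chart(4,5)[OF X \<eta> \<tau> pW p\<pi> W_eq c U r(2)[OF that]] in \<open>simp_all add: q_def\<close>)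
  have f: "f \<zeta> z = \<eta> (\<phi> \<zeta> (q z))" if "z \<in> ball 0 r" for \<zeta> z by (simp add: f_def qU[OF that])
  \<comment> \<open>in the coordinates \<open>(\<zeta>, c)\<close> of the product, \<open>\<zeta>\<close> is the variable of index \<open>0\<close> and \<open>\<eta>\<close> that of index \<open>1\<close>\<close>
  define \<Psi> where "\<Psi> a = \<eta> (\<phi> (fst a) (snd a))" for a
  have TU: "open (T \<times> U)" using local_flowD(1)[OF flow] U by (simp add: open_Times)
  have "(T \<times> U) \<inter> (\<lambda>(\<zeta>, p). \<phi> \<zeta> p) -` W = T \<times> U"
  proof (rule Int_absorb2, rule subsetI)
    fix a assume "a \<in> T \<times> U"
    then have "fst a \<in> T" "snd a \<in> U" by auto
    then have "\<phi> (fst a) (snd a) \<in> W" using local_flowD(4)[OF flow, of "fst a"] by blast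
    then show "a \<in> (\<lambda>(\<zeta>, p). \<phi> \<zeta> p) -` W" by (simp add: case_prod_unfold)
  qed
  then have "holo_fun (times_C (tot X)) (T \<times> U) (\<lambda>a. \<eta> ((\<lambda>(\<zeta>, p). \<phi> \<zeta> p) a))"
    using holo_map_compose_fun[OF complex_atlas_times[OF tot] tot TU local_flowD(3)[OF flow] fiber_coordD(1,2)[OF \<eta>]] by simp
  moreover have "(\<lambda>a. \<eta> ((\<lambda>(\<zeta>, p). \<phi> \<zeta> p) a)) = \<Psi>" by (simp add: \<Psi>_def case_prod_unfold fun_eq_iff)
  ultimately have h\<Psi>: "holo_fun (times_C (tot X)) (T \<times> U) \<Psi>" by simp
  have hcT: "holo_coords (times_C (tot X)) (UNIV \<times> W) (Suc (Suc m)) (times_chart c)"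
    by (rule holo_coords_times[OF tot total_coords])
  note chT = holo_coordsD(1)[OF hcT]
  have TUW: "T \<times> U \<subseteq> UNIV \<times> W" using U by auto
  define S where "S = times_chart c ` (T \<times> U)"
  have S: "openin (top_of_set (Cn (Suc (Suc m)))) S" unfolding S_def by (rule chart_open_image[OF chT TU TUW])
  define ft where "ft y = \<Psi> (inv_into (UNIV \<times> W) (times_chart c) y)" for y
  have hft: "holo (Suc (Suc m)) S ft"
    unfolding S_def ft_def by (rule holo_in_coords[OF complex_atlas_times[OF tot] hcT TU TUW h\<Psi>])
  have ft: "ft (case_nat t (c q)) = \<eta> (\<phi> t q)" if "q \<in> W" for t q
    unfolding ft_def times_chart_apply[symmetric]
    by (subst is_chartD(6)[OF chT]) (use that in \<open>auto simp: \<Psi>_def\<close>)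
  have fline: "f \<zeta> z = ft ((case_nat \<zeta> (c p))(Suc 0 := z + \<eta> p))" if "z \<in> ball 0 r" for \<zeta> z
    unfolding f[OF that] fun_upd_case_nat_Suc q(2)[OF that, symmetric]
    by (rule ft[symmetric]) (use q(1)[OF that] U in blast)
  have fhol: "f \<zeta> holomorphic_on ball 0 r" if \<zeta>: "\<zeta> \<in> T" for \<zeta>
  proof -
    have sub: "(case_nat \<zeta> (c p))(Suc 0 := z + \<eta> p) \<in> S" if "z \<in> ball 0 r" for z
    proof -
      have "(case_nat \<zeta> (c p))(Suc 0 := z + \<eta> p) = times_chart c (\<zeta>, q z)"
        using q(2)[OF that] by (simp add: fun_upd_case_nat_Suc)
      then show ?thesis unfolding S_def using q(1)[OF that] \<zeta> by blast
    qed
    have "(\<lambda>w. ft ((case_nat \<zeta> (c p))(Suc 0 := w))) holomorphic_on {w. (case_nat \<zeta> (c p))(Suc 0 := w) \<in> S}"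
      by (rule sep_holo_line[OF holo_imp_sep(2)[OF S hft]]) simp
    then have "((\<lambda>w. ft ((case_nat \<zeta> (c p))(Suc 0 := w))) \<circ> (\<lambda>z. z + \<eta> p)) holomorphic_on ball 0 r"
      by (rule holomorphic_on_compose_gen[rotated]) (use sub in \<open>auto intro!: holomorphic_intros\<close>)
    then show ?thesis by (rule holomorphic_transform) (simp only: o_def fline)
  qed
  show "\<exists>r>0. \<forall>\<zeta>\<in>T. f \<zeta> holomorphic_on ball 0 r" using r(1) fhol by blast
  define r1 where "r1 = r / 2"
  have r1: "r1 > 0" "cball 0 r1 \<subseteq> ball (0::complex) r" "ball 0 r1 \<subseteq> ball (0::complex) r" using r(1) by (auto simp: r1_def)
  define \<gamma> where "\<gamma> z = case_nat 0 ((c p)(0 := z + \<eta> p))" for z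
  have \<gamma>q: "\<gamma> z = times_chart c (0, q z)" if "z \<in> ball 0 r" for z
    using q(2)[OF that] by (simp add: \<gamma>_def)
  have c\<gamma>: "continuous_on (cball 0 r1) \<gamma>"
    unfolding \<gamma>_def by (intro continuous_on_case_nat continuous_on_fun_upd continuous_on_add continuous_on_const continuous_on_id)
  have \<gamma>S: "\<gamma> ` cball 0 r1 \<subseteq> S"
  proof (rule image_subsetI)
    fix z :: complex assume "z \<in> cball 0 r1"
    then have z: "z \<in> ball 0 r" using r1(2) by blast
    show "\<gamma> z \<in> S" unfolding \<gamma>q[OF z] S_def using q(1)[OF z] local_flowD(2)[OF flow] by blast
  qed
  have ft\<gamma>: "ft ((\<gamma> z)(0 := t)) = f t z" if "z \<in> ball 0 r" for t z
    unfolding \<gamma>_def fun_upd_case_nat_0 f[OF that] q(2)[OF that, symmetric]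
    by (rule ft) (use q(1)[OF that] U in blast)
  have pdft: "pd 0 ft (\<gamma> z) = h ((c p)(0 := z + \<eta> p))" if z: "z \<in> ball 0 r" for z
  proof -
    have qW: "q z \<in> W" using q(1)[OF z] U by blast
    have "pd 0 ft (\<gamma> z) = deriv (\<lambda>t. \<eta> (\<phi> t (q z))) 0"
      unfolding pd_def ft\<gamma>[OF z] by (simp add: \<gamma>_def f[OF z])
    also have "\<dots> = x \<eta> (q z)"
      by (rule DERIV_imp_deriv[OF local_flowD(7)[OF flow q(1)[OF z] fiber_coordD(1)[OF \<eta>] qW fiber_coordD(2)[OF \<eta>]]])
    also have "\<dots> = h ((c p)(0 := z + \<eta> p))" by (simp add: x\<eta>[OF qW] q(2)[OF z])
    finally show ?thesis .
  qed
  have "uniform_limit (cball 0 r1) (\<lambda>t z. (ft ((\<gamma> z)(0 := \<gamma> z 0 + t)) - ft (\<gamma> z)) / t) (\<lambda>z. pd 0 ft (\<gamma> z)) (at 0)"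
    by (rule diff_quot_uniform_limit(1)[OF S hft _ compact_cball c\<gamma> \<gamma>S]) simp
  then have "uniform_limit (cball 0 r1) (\<lambda>t z. (f t z - f 0 z) / t) (\<lambda>z. h ((c p)(0 := z + \<eta> p))) (at 0)"
  proof (rule iffD1[OF uniform_limit_cong', rotated 2])
    fix t z :: complex assume "z \<in> cball 0 r1"
    then have z: "z \<in> ball 0 r" using r1(2) by blast
    have "\<gamma> z 0 = 0" by (simp add: \<gamma>_def)
    moreover have "ft (\<gamma> z) = f 0 z" using ft\<gamma>[OF z, of 0] by (simp add: \<gamma>_def fun_upd_case_nat_0)
    ultimately show "(ft ((\<gamma> z)(0 := \<gamma> z 0 + t)) - ft (\<gamma> z)) / t = (f t z - f 0 z) / t"
      using ft\<gamma>[OF z, of t] by simp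
  next
    fix z :: complex assume "z \<in> cball 0 r1"
    then show "pd 0 ft (\<gamma> z) = h ((c p)(0 := z + \<eta> p))" using pdft r1(2) by blast
  qed
  then have ul: "uniform_limit (ball 0 r1) (\<lambda>t z. (f t z - f 0 z) / t) (\<lambda>z. h ((c p)(0 := z + \<eta> p))) (at 0)"
    by (rule uniform_limit_on_subset) auto
  have evT: "eventually (\<lambda>t. t \<in> T \<and> t \<noteq> 0) (at 0)"
    using eventually_at_in_open[OF local_flowD(1,2)[OF flow]] by (simp add: eventually_mono)
  have fhol1: "f \<zeta> holomorphic_on ball 0 r1" if "\<zeta> \<in> T" for \<zeta>
    using fhol[OF that] r1(3) by (rule holomorphic_on_subset)
  have "((\<lambda>t. (deriv ^^ k) (\<lambda>z. (f t z - f 0 z) / t) 0) \<longlongrightarrow> (deriv ^^ k) (\<lambda>z. h ((c p)(0 := z + \<eta> p))) 0) (at 0)"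
  proof (rule higher_deriv_complex_uniform_limit[OF ul])
    show "\<forall>\<^sub>F t in at 0. (\<lambda>z. (f t z - f 0 z) / t) holomorphic_on ball 0 r1"
      using evT by eventually_elim (intro holomorphic_intros fhol1 local_flowD(2)[OF flow], auto)
  qed (use r1 in auto)
  moreover have "(deriv ^^ k) (\<lambda>z. h ((c p)(0 := z + \<eta> p))) 0 = (pd 0 ^^ k) h (c p)"
    unfolding pd_funpow using deriv_shift[of k "\<lambda>t. h ((c p)(0 := t))" "\<eta> p"] by (simp add: c)
  moreover have "eventually (\<lambda>t. (deriv ^^ k) (\<lambda>z. (f t z - f 0 z) / t) 0 = ((deriv ^^ k) (f t) 0 - (deriv ^^ k) (f 0) 0) / t) (at 0)"
    using evT
  proof eventually_elim
    case (elim t)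
    have d: "(\<lambda>z. f t z - f 0 z) holomorphic_on ball 0 r1"
      by (intro holomorphic_on_diff fhol1 local_flowD(2)[OF flow]) (use elim in auto)
    have "(deriv ^^ k) (\<lambda>z. (1 / t) * (f t z - f 0 z)) 0 = (1 / t) * (deriv ^^ k) (\<lambda>z. f t z - f 0 z) 0"
      by (rule higher_deriv_cmult[OF d]) (use r1 in auto)
    also have "(deriv ^^ k) (\<lambda>z. f t z - f 0 z) 0 = (deriv ^^ k) (f t) 0 - (deriv ^^ k) (f 0) 0"
      by (rule higher_deriv_diff[OF fhol1 fhol1]) (use elim local_flowD(2)[OF flow] r1 in auto)
    finally show ?case by simp
  qed
  ultimately have "((\<lambda>t. ((deriv ^^ k) (f t) 0 - (deriv ^^ k) (f 0) 0) / t) \<longlongrightarrow> (pd 0 ^^ k) h (c p)) (at 0)"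
    by (simp add: tendsto_cong)
  then show "((\<lambda>\<zeta>. (deriv ^^ k) (f \<zeta>) 0) has_field_derivative (pd 0 ^^ k) h (c p)) (at 0)"
    by (simp add: has_field_derivative_iff)
qed

lemma flow_coord_change_fps:
  shows "\<zeta> \<in> T \<Longrightarrow> fps_nth (fps_expansion (coord_change X U (\<eta> \<circ> \<phi> \<zeta>) \<eta> p) 0) 0 = 0"
    and "k \<ge> 1 \<Longrightarrow> ((\<lambda>\<zeta>. fps_nth (fps_expansion (coord_change X U (\<eta> \<circ> \<phi> \<zeta>) \<eta> p) 0) k)
      has_field_derivative (pd 0 ^^ k) h (c p) / fact k) (at 0)"
proof -
  show "fps_nth (fps_expansion (coord_change X U (\<eta> \<circ> \<phi> \<zeta>) \<eta> p) 0) 0 = 0" if "\<zeta> \<in> T"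
    using coord_change_holo(2)[OF X fiber_coord_U flow_fiber_coord[OF that] p] by (simp add: fps_expansion_nth)
  assume k: "k \<ge> 1"
  define f where "f = (\<lambda>\<zeta> z. \<eta> (\<phi> \<zeta> (fiber_curve X U \<eta> p z)))"
  obtain r where r: "r > 0" "\<And>\<zeta>. \<zeta> \<in> T \<Longrightarrow> f \<zeta> holomorphic_on ball 0 r"
    using flow_curve_taylor(2) unfolding f_def by blast
  have D: "((\<lambda>\<zeta>. (deriv ^^ k) (f \<zeta>) 0 / fact k) has_field_derivative (pd 0 ^^ k) h (c p) / fact k) (at 0)"
    unfolding f_def by (rule DERIV_cdivide[OF flow_curve_taylor(1)])
  have ev: "eventually (\<lambda>\<zeta>. fps_nth (fps_expansion (coord_change X U (\<eta> \<circ> \<phi> \<zeta>) \<eta> p) 0) k = (deriv ^^ k) (f \<zeta>) 0 / fact k) (nhds 0)"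
    using eventually_nhds_in_open[OF local_flowD(1,2)[OF flow]]
  proof eventually_elim
    case (elim \<zeta>)
    have "coord_change X U (\<eta> \<circ> \<phi> \<zeta>) \<eta> p = (\<lambda>z. f \<zeta> z - \<eta> (\<phi> \<zeta> p))"
      by (simp add: coord_change_fiber_curve f_def fun_eq_iff)
    moreover have "(deriv ^^ k) (\<lambda>z. f \<zeta> z - \<eta> (\<phi> \<zeta> p)) 0 = (deriv ^^ k) (f \<zeta>) 0 - (deriv ^^ k) (\<lambda>z. \<eta> (\<phi> \<zeta> p)) 0"
      by (rule higher_deriv_diff[OF r(2)[OF elim] holomorphic_on_const]) (use r(1) in auto)
    moreover have "(deriv ^^ k) (\<lambda>z. \<eta> (\<phi> \<zeta> p)) (0::complex) = 0" using k by (simp add: higher_deriv_const)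
    ultimately show ?case by (simp add: fps_expansion_nth)
  qed
  show "((\<lambda>\<zeta>. fps_nth (fps_expansion (coord_change X U (\<eta> \<circ> \<phi> \<zeta>) \<eta> p) 0) k)
      has_field_derivative (pd 0 ^^ k) h (c p) / fact k) (at 0)"
    by (rule iffD2[OF DERIV_cong_ev[OF refl ev refl] D])
qed

lemma coord_change_fps_id:
  assumes "eventually (\<lambda>z. \<rho> z = z) (nhds 0)"
  shows "fps_expansion \<rho> 0 = fps_X"
  unfolding fps_eq_iff fps_expansion_nth higher_deriv_cong_ev[OF assms refl] higher_deriv_ident by simp

lemma flow_germ_0:
  "eventually (\<lambda>z. coord_change X U (\<eta> \<circ> \<phi> 0) \<eta> p z = z) (nhds 0)"
  "eventually (\<lambda>z. coord_change X U \<eta> (\<eta> \<circ> \<phi> 0) p z = z) (nhds 0)"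
proof -
  note s = coord_change_self[OF X fiber_coord_U p]
  have "eventually (\<lambda>z. coord_change X U (\<eta> \<circ> \<phi> 0) \<eta> p z = coord_change X U \<eta> \<eta> p z) (nhds 0)"
    by (rule coord_change_germ[OF X fiber_coord_U fiber_coord_U p p U(1) p]) (simp_all add: local_flowD(6)[OF flow])
  with s show "eventually (\<lambda>z. coord_change X U (\<eta> \<circ> \<phi> 0) \<eta> p z = z) (nhds 0)" by eventually_elim simp
  have "eventually (\<lambda>z. coord_change X U \<eta> (\<eta> \<circ> \<phi> 0) p z = coord_change X U \<eta> \<eta> p z) (nhds 0)"
    by (rule coord_change_germ[OF X flow_fiber_coord[OF local_flowD(2)[OF flow]] fiber_coord_U p p U(1) p])
       (simp_all add: local_flowD(6)[OF flow])
  with s show "eventually (\<lambda>z. coord_change X U \<eta> (\<eta> \<circ> \<phi> 0) p z = z) (nhds 0)" by eventually_elim simp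
qed

text \<open>The inverse germ is the one that enters the Lie derivative; inverting changes the sign at first order.\<close>
lemma flow_germ_deriv:
  defines "\<rho> \<equiv> \<lambda>\<zeta>. coord_change X U \<eta> (\<eta> \<circ> \<phi> \<zeta>) p"
  shows "((\<lambda>\<zeta>. deriv (\<rho> \<zeta>) 0) has_field_derivative - pd 0 h (c p)) (at 0)" "deriv (\<rho> 0) 0 = 1"
    "n \<ge> 1 \<Longrightarrow> ((\<lambda>\<zeta>. germ_coeffs (\<rho> \<zeta>) n) has_field_derivative - (pd 0 ^^ Suc n) h (c p) / fact (Suc n)) (at 0)"
    "n \<ge> 1 \<Longrightarrow> germ_coeffs (\<rho> 0) n = 0"
proof -
  define \<sigma> where "\<sigma> \<zeta> = coord_change X U (\<eta> \<circ> \<phi> \<zeta>) \<eta> p" for \<zeta>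
  define S where "S \<zeta> = fps_expansion (\<sigma> \<zeta>) 0" for \<zeta>
  define P where "P \<zeta> = fps_expansion (\<rho> \<zeta>) 0" for \<zeta>
  define S' where "S' k = (if k = 0 then 0 else (pd 0 ^^ k) h (c p) / fact k)" for k
  have evT: "eventually (\<lambda>\<zeta>. \<zeta> \<in> T) (nhds 0)" using eventually_nhds_in_open[OF local_flowD(1,2)[OF flow]] .
  have ev: "eventually (\<lambda>\<zeta>. P \<zeta> oo S \<zeta> = fps_X \<and> fps_nth (S \<zeta>) 0 = 0) (nhds 0)"
    using evT
  proof eventually_elim
    case (elim \<zeta>)
    note fc = flow_fiber_coord[OF elim]
    obtain r where r: "r > 0" "\<sigma> \<zeta> holomorphic_on ball 0 r"
      using coord_change_holo(1)[OF X fiber_coord_U fc p] unfolding \<sigma>_def by blast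
    obtain r' where r': "r' > 0" "\<rho> \<zeta> holomorphic_on ball 0 r'"
      using coord_change_holo(1)[OF X fc fiber_coord_U p] unfolding \<rho>_def by blast
    have S: "\<sigma> \<zeta> has_fps_expansion S \<zeta>" unfolding S_def
      by (rule has_fps_expansion_fps_expansion[OF open_ball _ r(2)]) (use r in simp)
    have P: "\<rho> \<zeta> has_fps_expansion P \<zeta>" unfolding P_def
      by (rule has_fps_expansion_fps_expansion[OF open_ball _ r'(2)]) (use r' in simp)
    have S0: "fps_nth (S \<zeta>) 0 = 0" unfolding S_def \<sigma>_def by (rule flow_coord_change_fps(1)[OF elim])
    have H: "(\<rho> \<zeta> \<circ> \<sigma> \<zeta>) has_fps_expansion (P \<zeta> oo S \<zeta>)" by (rule has_fps_expansion_compose[OF P S S0])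
    have e: "eventually (\<lambda>z. (\<rho> \<zeta> \<circ> \<sigma> \<zeta>) z = z) (nhds 0)"
      using coord_change_inverse[OF X fiber_coord_U fc p] by (simp add: \<rho>_def \<sigma>_def)
    have H': "(\<lambda>z. z) has_fps_expansion (P \<zeta> oo S \<zeta>)"
      by (rule iffD1[OF has_fps_expansion_cong[OF e refl] H])
    have "P \<zeta> oo S \<zeta> = fps_X" by (rule fps_expansion_unique_complex[OF H' has_fps_expansion_fps_X])
    then show ?case using S0 by simp
  qed
  have S': "((\<lambda>\<zeta>. fps_nth (S \<zeta>) k) has_field_derivative S' k) (at 0)" for k
  proof (cases "k = 0")
    case True
    have "eventually (\<lambda>\<zeta>. fps_nth (S \<zeta>) 0 = 0) (nhds 0)" using ev by eventually_elim simp
    from DERIV_cong_ev[OF refl this refl] show ?thesis using True by (simp add: S'_def)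
  next
    case False
    then show ?thesis using flow_coord_change_fps(2)[of k] by (simp add: S_def \<sigma>_def S'_def)
  qed
  have S0: "S 0 = fps_X" unfolding S_def \<sigma>_def by (rule coord_change_fps_id[OF flow_germ_0(1)])
  have P0: "P 0 = fps_X" unfolding P_def \<rho>_def by (rule coord_change_fps_id[OF flow_germ_0(2)])
  have P': "((\<lambda>\<zeta>. fps_nth (P \<zeta>) n) has_field_derivative - S' n) (at 0)" if "n \<ge> 1" for n
    by (rule fps_compose_inverse_deriv[OF ev S' S0 that])
  have ev0: "eventually (\<lambda>\<zeta>. \<rho> \<zeta> 0 = 0) (nhds 0)"
    using evT by eventually_elim (simp add: \<rho>_def coord_change_holo(2)[OF X flow_fiber_coord fiber_coord_U p])
  have P'0: "((\<lambda>\<zeta>. fps_nth (P \<zeta>) n) has_field_derivative - S' n) (at 0)" for n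
  proof (cases "n = 0")
    case True
    have "eventually (\<lambda>\<zeta>. fps_nth (P \<zeta>) 0 = 0) (nhds 0)"
      using ev0 by eventually_elim (simp add: P_def fps_expansion_nth)
    from DERIV_cong_ev[OF refl this refl] show ?thesis using True by (simp add: S'_def)
  qed (use P' in simp)
  have d: "deriv (\<rho> \<zeta>) 0 = fps_nth (P \<zeta>) 1" for \<zeta> by (simp add: P_def fps_expansion_nth)
  show "((\<lambda>\<zeta>. deriv (\<rho> \<zeta>) 0) has_field_derivative - pd 0 h (c p)) (at 0)"
    using P'[of 1] unfolding d by (simp add: S'_def)
  show "deriv (\<rho> 0) 0 = 1" unfolding d P0 by simp
  have "germ_coeffs (\<rho> 0) n = 0 \<and> ((\<lambda>\<zeta>. germ_coeffs (\<rho> \<zeta>) n) has_field_derivative - S' (Suc n)) (at 0)" if "n \<ge> 1" for n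
  proof (rule germ_coeffs_deriv_at_id[where \<rho> = \<rho> and F' = "\<lambda>k. - S' k", OF ev0 _ _ that])
    show "((\<lambda>\<zeta>. fps_nth (fps_expansion (\<rho> \<zeta>) 0) k) has_field_derivative - S' k) (at 0)" for k
      using P'0 by (simp add: P_def)
    show "fps_nth (fps_expansion (\<rho> 0) 0) k = (if k = 1 then 1 else 0)" for k
      using P0 by (simp add: P_def)
  qed
  then show "n \<ge> 1 \<Longrightarrow> germ_coeffs (\<rho> 0) n = 0"
    "n \<ge> 1 \<Longrightarrow> ((\<lambda>\<zeta>. germ_coeffs (\<rho> \<zeta>) n) has_field_derivative - (pd 0 ^^ Suc n) h (c p) / fact (Suc n)) (at 0)"
    by (simp_all add: S'_def)
qed

end

end

section \<open>Existence of local flows\<close>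

lemma compact_polydisc: "compact {y\<in>Cn d. \<forall>i<d. cmod (y i - x i) \<le> s}"
proof -
  define K where "K i = (if i < d then cball (x i) s else {0})" for i
  have "y \<in> {y\<in>Cn d. \<forall>i<d. cmod (y i - x i) \<le> s} \<longleftrightarrow> (\<forall>i. y i \<in> K i)" for y
    by (auto simp: K_def Cn_def dist_norm norm_minus_commute not_less split: if_splits)
  then have eq: "{y\<in>Cn d. \<forall>i<d. cmod (y i - x i) \<le> s} = Pi\<^sub>E UNIV K"
    by (auto simp: PiE_UNIV_domain)
  have "compactin (product_topology (\<lambda>_. euclidean) UNIV) (Pi\<^sub>E UNIV K)"
    unfolding compactin_PiE by (simp add: K_def)
  then show ?thesis unfolding eq by (simp add: euclidean_product_topology)
qed

text \<open>The limit that defines the Lie derivative is taken on precompact open sets, so each point has to lie in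
  one of them.\<close>
lemma chart_compact_neighborhood:
  fixes W :: "'c::t2_space set"
  assumes ch: "is_chart (W, d, c)" and p: "p \<in> W"
  obtains U where "open U" "p \<in> U" "compact (closure U)" "closure U \<subseteq> W"
proof -
  have o: "openin (top_of_set (Cn d)) (c ` W)" by (rule is_chartD(2)[OF ch])
  have cp: "c p \<in> c ` W" using p by blast
  obtain r where r: "r > 0" "\<And>y. y \<in> Cn d \<Longrightarrow> cdist d (c p) y < r \<Longrightarrow> y \<in> c ` W"
    using openin_Cn_ball[OF o cp] by blast
  define s where "s = r / (real d + 1)"
  have s: "s > 0" using r(1) by (simp add: s_def)
  define K where "K = {y\<in>Cn d. \<forall>i<d. cmod (y i - c p i) \<le> s}"
  have K: "compact K" unfolding K_def by (rule compact_polydisc)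
  have KW: "K \<subseteq> c ` W"
  proof
    fix y assume y: "y \<in> K"
    have "cdist d (c p) y \<le> (\<Sum>i<d. s)" unfolding cdist_def by (rule sum_mono) (use y in \<open>simp add: K_def\<close>)
    also have "\<dots> < r" using r(1) by (simp add: s_def divide_simps)
    finally show "y \<in> c ` W" using y by (intro r(2)) (simp_all add: K_def)
  qed
  define U where "U = {q\<in>W. c q \<in> {y\<in>Cn d. cdist d (c p) y < s}}"
  have oU: "open U" unfolding U_def
    by (rule chart_open_preimage[OF ch openin_cdist_ball[OF is_chartD(7)[OF ch p]]])
  have pU: "p \<in> U" using p s is_chartD(7)[OF ch p] by (simp add: U_def)
  define K' where "K' = inv_into W c ` K"
  have K': "compact K'" unfolding K'_def
    by (rule compact_continuous_image[OF continuous_on_subset[OF is_chartD(5)[OF ch] KW] K])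
  have UK: "U \<subseteq> K'"
  proof
    fix q assume q: "q \<in> U"
    have "c q \<in> K" unfolding K_def
      using q order_trans[OF coordinate_le_cdist[of _ d "c q" "c p"]] by (auto simp: U_def intro: less_imp_le)
    moreover have "inv_into W c (c q) = q" using is_chartD(6)[OF ch] q by (simp add: U_def)
    ultimately show "q \<in> K'" unfolding K'_def by (metis imageI)
  qed
  have "closure U \<subseteq> K'" using closure_minimal[OF UK compact_imp_closed[OF K']] .
  moreover have "K' \<subseteq> W" unfolding K'_def using KW by (auto intro: inv_into_into)
  ultimately show thesis
    using that[OF oU pU] compact_Int_closed[OF K' closed_closure, of U] by (auto simp: Int_absorb1)
qed

text \<open>
  The condition on a flow concerns its first order at \<open>\<zeta> = 0\<close>, so the Euler step \<open>y + \<zeta> G(y)\<close> in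
  coordinates satisfies it. On a compact set \<open>G\<close> is Lipschitz, so for small \<open>\<zeta>\<close> the step is injective
  and expansive, and \<open>holo_inverse\<close> makes it biholomorphic onto its image. The base components of \<open>G\<close> depend
  on the base point only, which makes it fiber-preserving.
\<close>
lemma local_flow_exists:
  fixes X :: "('c::{t2_space,second_countable_topology}, 'b::{t2_space,second_countable_topology}) family_data"
  assumes X: "RS_family X" and \<eta>: "fiber_coord X W \<eta>" and \<tau>: "holo_coords (base X) (proj X ` W) m \<tau>"
    and c: "c = (\<lambda>p. case_nat (\<eta> p) (\<tau> (proj X p)))"
    and h: "holo (Suc m) (c ` W) h" and g: "\<And>j. j < m \<Longrightarrow> holo m (\<tau> ` proj X ` W) (g j)"
    and U: "open U" "compact (closure U)" "closure U \<subseteq> W"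
  shows "\<exists>T \<phi>. local_flow X W (\<lambda>f p. h (c p) * coord_deriv W c 0 f p
      + (\<Sum>j<m. g j (\<tau> (proj X p)) * coord_deriv W c (Suc j) f p)) U T \<phi>"
proof -
  note tot = RS_familyD(1)[OF X]
  have hc: "holo_coords (tot X) W (Suc m) c" by (rule total_coords[OF X \<eta> \<tau> c])
  note ch = holo_coordsD(1)[OF hc] and ch\<tau> = holo_coordsD(1)[OF \<tau>]
  define d where "d = Suc m"
  define \<Omega> where "\<Omega> = c ` W"
  have \<Omega>: "openin (top_of_set (Cn d)) \<Omega>" unfolding d_def \<Omega>_def by (rule is_chartD(2)[OF ch])
  have UW: "U \<subseteq> W" using U(3) closure_subset by blast
  \<comment> \<open>the components of the vector field; the base components depend on the tail of \<open>y\<close> only\<close>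
  define G where "G y = case_nat (h y) (\<lambda>j. if j < m then g j (Cn_tail y) else 0)" for y
  have tail: "Cn_tail (c p) = \<tau> (proj X p)" for p by (simp add: c)
  have GC: "G y \<in> Cn d" for y unfolding d_def G_def by (rule case_nat_mem_Cn) (simp add: Cn_def)
  have o\<tau>: "openin (top_of_set (Cn m)) (\<tau> ` proj X ` W)" by (rule is_chartD(2)[OF ch\<tau>])
  have hG: "holo d \<Omega> (\<lambda>y. G y i)" if "i < d" for i
  proof (cases i)
    case 0
    then show ?thesis using h by (simp add: G_def d_def \<Omega>_def)
  next
    case (Suc j)
    then have j: "j < m" using that by (simp add: d_def)
    have "holo d \<Omega> (\<lambda>y. g j (Cn_tail y))"
    proof (rule holo_compose[where F = Cn_tail and g = "g j", OF \<Omega> o\<tau> _ _ g[OF j]])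
      show "Cn_tail y \<in> \<tau> ` proj X ` W" if "y \<in> \<Omega>" for y using that tail by (auto simp: \<Omega>_def)
      show "holo d \<Omega> (\<lambda>y. Cn_tail y k)" if "k < m" for k
        unfolding Cn_tail_def by (rule holo_coordinate[OF _ openin_imp_subset[OF \<Omega>]]) (use that in \<open>simp add: d_def\<close>)
    qed
    then show ?thesis using j by (simp add: G_def Suc)
  qed
  define E where "E \<zeta> y = (\<lambda>i. y i + \<zeta> * G y i)" for \<zeta> :: complex and y
  have EC: "E \<zeta> y \<in> Cn d" if "y \<in> Cn d" for \<zeta> y using that GC[of y] by (auto simp: E_def Cn_def)
  have hE: "holo d \<Omega> (\<lambda>y. E \<zeta> y i)" if "i < d" for \<zeta> i
    unfolding E_def using that
    by (intro holo_add[OF \<Omega>] holo_mult[OF \<Omega>] holo_const holo_coordinate openin_imp_subset[OF \<Omega>] hG)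
  define K where "K = c ` closure U"
  have K: "compact K" unfolding K_def
    by (rule compact_continuous_image[OF continuous_on_subset[OF is_chartD(4)[OF ch] U(3)] U(2)])
  have K\<Omega>: "K \<subseteq> \<Omega>" using U(3) by (auto simp: K_def \<Omega>_def)
  have UK: "c ` U \<subseteq> K" unfolding K_def using closure_subset by blast
  have "\<forall>i. \<exists>L>0. i < d \<longrightarrow> (\<forall>y\<in>K. \<forall>z\<in>K. cmod (G z i - G y i) \<le> L * cdist d y z)"
    using holo_lipschitz_on_compact[OF \<Omega> hG K K\<Omega>] zero_less_one by meson
  from choice[OF this] obtain L where L: "\<And>i. L i > 0"
    "\<And>i y z. i < d \<Longrightarrow> y \<in> K \<Longrightarrow> z \<in> K \<Longrightarrow> cmod (G z i - G y i) \<le> L i * cdist d y z" by blast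
  define K' where "K' = \<tau> ` proj X ` closure U"
  have "compact (proj X ` closure U)"
    by (rule compact_continuous_image[OF proj_continuous[OF X] U(2)])
  then have K': "compact K'" unfolding K'_def
    by (rule compact_continuous_image[OF continuous_on_subset[OF is_chartD(4)[OF ch\<tau>] image_mono[OF U(3)]]])
  have K'\<Omega>: "K' \<subseteq> \<tau> ` proj X ` W" unfolding K'_def using U(3) by blast
  have "\<forall>j. \<exists>L>0. j < m \<longrightarrow> (\<forall>y\<in>K'. \<forall>z\<in>K'. cmod (g j z - g j y) \<le> L * cdist m y z)"
    using holo_lipschitz_on_compact[OF o\<tau> g K' K'\<Omega>] zero_less_one by meson
  from choice[OF this] obtain L' where L': "\<And>j. L' j > 0"
    "\<And>j y z. j < m \<Longrightarrow> y \<in> K' \<Longrightarrow> z \<in> K' \<Longrightarrow> cmod (g j z - g j y) \<le> L' j * cdist m y z" by blast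
  define \<Lambda> where "\<Lambda> = 1 + (\<Sum>i<d. L i) + (\<Sum>j<m. L' j)"
  have sums: "(\<Sum>i<d. L i) \<ge> 0" "(\<Sum>j<m. L' j) \<ge> 0" by (intro sum_nonneg less_imp_le L(1) L'(1))+
  have \<Lambda>: "\<Lambda> > 0" "(\<Sum>i<d. L i) \<le> \<Lambda>" "(\<Sum>j<m. L' j) \<le> \<Lambda>" using sums by (auto simp: \<Lambda>_def)
  have "\<exists>e>0. \<forall>y\<in>K. \<forall>\<zeta>. cmod \<zeta> < e \<longrightarrow> E \<zeta> y \<in> \<Omega>"
  proof (rule compact_locally_uniform[OF K])
    fix y0 assume y0: "y0 \<in> K"
    then have y0\<Omega>: "y0 \<in> \<Omega>" using K\<Omega> by blast
    obtain r where r: "r > 0" "\<And>y. y \<in> Cn d \<Longrightarrow> cdist d y0 y < r \<Longrightarrow> y \<in> \<Omega>"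
      using openin_Cn_ball[OF \<Omega> y0\<Omega>] by blast
    define M where "M y = (\<Sum>i<d. cmod (G y i))" for y
    have M0: "M y \<ge> 0" for y by (simp add: M_def sum_nonneg)
    have "continuous_on \<Omega> M" unfolding M_def
      by (intro continuous_on_sum continuous_on_norm holo_imp_sep(1)[OF \<Omega> hG]) simp
    then obtain \<delta> where \<delta>: "\<delta> > 0" "\<forall>y\<in>\<Omega>. cdist d y0 y < \<delta> \<longrightarrow> dist (M y) (M y0) < 1"
      using y0\<Omega> unfolding continuous_on_Cn_iff[OF openin_imp_subset[OF \<Omega>]] by (meson zero_less_one)
    define e where "e = r / (2 * (M y0 + 1))"
    have e: "e > 0" using r(1) M0[of y0] by (simp add: e_def)
    have "E \<zeta> y \<in> \<Omega>" if y: "y \<in> K" "cdist d y0 y < min \<delta> (r / 2)" and \<zeta>: "cmod \<zeta> < e" for y \<zeta>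
    proof (rule r(2))
      have y\<Omega>: "y \<in> \<Omega>" using y(1) K\<Omega> by blast
      then show "E \<zeta> y \<in> Cn d" by (intro EC openin_CnD[OF \<Omega>])
      have "M y < M y0 + 1" using \<delta>(2) y\<Omega> y(2) by (auto simp: dist_real_def)
      moreover have "cdist d y (E \<zeta> y) = cmod \<zeta> * M y"
        by (simp add: cdist_def E_def M_def norm_mult sum_distrib_left)
      ultimately have "cdist d y (E \<zeta> y) \<le> e * (M y0 + 1)" using \<zeta> M0[of y] e by (simp add: mult_mono)
      also have "\<dots> = r / 2" using M0[of y0] by (simp add: e_def divide_simps)
      finally show "cdist d y0 (E \<zeta> y) < r" using cdist_triangle[of d y0 "E \<zeta> y" y] y(2) by simp
    qed
    then show "\<exists>U. open U \<and> y0 \<in> U \<and> (\<exists>e>0. \<forall>y\<in>U \<inter> K. \<forall>\<zeta>. cmod \<zeta> < e \<longrightarrow> E \<zeta> y \<in> \<Omega>)"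
      using e \<delta>(1) r(1)
      by (intro exI[of _ "{y. cdist d y0 y < min \<delta> (r / 2)}"] conjI open_cdist_ball exI[of _ e]) auto
  qed auto
  then obtain e1 where e1: "e1 > 0" "\<And>y \<zeta>. y \<in> K \<Longrightarrow> cmod \<zeta> < e1 \<Longrightarrow> E \<zeta> y \<in> \<Omega>" by blast
  \<comment> \<open>the second bound makes the Lipschitz constant of \<open>\<zeta> G\<close> at most \<open>1 / 2\<close>\<close>
  define \<epsilon> where "\<epsilon> = min e1 (1 / (2 * \<Lambda>))"
  have \<epsilon>: "\<epsilon> > 0" using e1(1) \<Lambda>(1) by (simp add: \<epsilon>_def)
  define T where "T = ball (0::complex) \<epsilon>"
  have T: "open T" "0 \<in> T" using \<epsilon> by (simp_all add: T_def)
  have small: "cmod \<zeta> * \<Lambda> \<le> 1 / 2" if "\<zeta> \<in> T" for \<zeta>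
  proof -
    have "cmod \<zeta> \<le> 1 / (2 * \<Lambda>)" using that by (simp add: T_def \<epsilon>_def)
    then have "cmod \<zeta> * \<Lambda> \<le> 1 / (2 * \<Lambda>) * \<Lambda>" using \<Lambda>(1) by (intro mult_right_mono) auto
    then show ?thesis using \<Lambda>(1) by simp
  qed
  define \<phi> where "\<phi> \<zeta> p = inv_into W c (E \<zeta> (c p))" for \<zeta> p
  have E\<Omega>: "E \<zeta> (c p) \<in> \<Omega>" if "\<zeta> \<in> T" "p \<in> U" for \<zeta> p
    using that UK by (intro e1(2)) (auto simp: T_def \<epsilon>_def)
  have \<phi>W: "\<phi> \<zeta> p \<in> W" and c\<phi>: "c (\<phi> \<zeta> p) = E \<zeta> (c p)" if "\<zeta> \<in> T" "p \<in> U" for \<zeta> p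
    using E\<Omega>[OF that] unfolding \<phi>_def \<Omega>_def by (auto intro: inv_into_into f_inv_into_f)
  have expand: "1 / 2 * cdist d y z \<le> cdist d (E \<zeta> y) (E \<zeta> z)" if \<zeta>: "\<zeta> \<in> T" and yz: "y \<in> K" "z \<in> K" for \<zeta> y z
  proof -
    have "cdist d y z \<le> (\<Sum>i<d. cmod (E \<zeta> z i - E \<zeta> y i) + cmod \<zeta> * (L i * cdist d y z))"
      unfolding cdist_def[of d y z]
    proof (rule sum_mono)
      fix i assume "i \<in> {..<d}"
      then have "cmod (\<zeta> * (G z i - G y i)) \<le> cmod \<zeta> * (L i * cdist d y z)"
        unfolding norm_mult using L(2) yz by (intro mult_left_mono) auto
      moreover have "z i - y i = (E \<zeta> z i - E \<zeta> y i) - \<zeta> * (G z i - G y i)" by (simp add: E_def algebra_simps)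
      ultimately have "cmod (z i - y i) \<le> cmod (E \<zeta> z i - E \<zeta> y i) + cmod \<zeta> * (L i * cdist d y z)"
        using norm_triangle_ineq4[of "E \<zeta> z i - E \<zeta> y i" "\<zeta> * (G z i - G y i)"] by simp
      then show "cmod (z i - y i) \<le> cmod (E \<zeta> z i - E \<zeta> y i) + cmod \<zeta> * (L i * (\<Sum>i<d. cmod (z i - y i)))"
        unfolding cdist_def .
    qed
    also have "\<dots> = cdist d (E \<zeta> y) (E \<zeta> z) + (cmod \<zeta> * (\<Sum>i<d. L i)) * cdist d y z"
      by (simp add: sum.distrib cdist_def[of d "E \<zeta> y"] sum_distrib_left sum_distrib_right mult.assoc)
    also have "\<dots> \<le> cdist d (E \<zeta> y) (E \<zeta> z) + 1 / 2 * cdist d y z"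
    proof -
      have "cmod \<zeta> * (\<Sum>i<d. L i) \<le> cmod \<zeta> * \<Lambda>" using \<Lambda>(2) by (intro mult_left_mono) auto
      then show ?thesis using small[OF \<zeta>] by (intro add_left_mono mult_right_mono) auto
    qed
    finally show ?thesis by simp
  qed
  have injE: "inj_on (E \<zeta>) (c ` U)" if "\<zeta> \<in> T" for \<zeta>
  proof (rule inj_onI)
    fix y z assume yz: "y \<in> c ` U" "z \<in> c ` U" "E \<zeta> y = E \<zeta> z"
    then have K: "y \<in> K" "z \<in> K" using UK by auto
    have "cdist d y z \<le> 0" using expand[OF that K] yz(3) by simp
    then have "cdist d y z = 0" using cdist_ge_0[of d y z] by linarith
    then show "y = z" using cdist_eq_0_iff[of y d z] K K\<Omega> openin_CnD[OF \<Omega>] by blast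
  qed
  \<comment> \<open>the same estimate for the base components alone: different fibers have disjoint images\<close>
  have base_inj: "\<tau> (proj X p) = \<tau> (proj X q)"
    if \<zeta>: "\<zeta> \<in> T" and pq: "p \<in> U" "q \<in> U" and eq: "Cn_tail (E \<zeta> (c p)) = Cn_tail (E \<zeta> (c q))" for \<zeta> p q
  proof -
    define s where "s = \<tau> (proj X p)"
    define t where "t = \<tau> (proj X q)"
    have st: "s \<in> K'" "t \<in> K'" unfolding s_def t_def K'_def using pq closure_subset by blast+
    have "cdist m s t \<le> (\<Sum>j<m. cmod \<zeta> * (L' j * cdist m s t))"
      unfolding cdist_def[of m s t]
    proof (rule sum_mono)
      fix j assume j: "j \<in> {..<m}"
      have "s j + \<zeta> * g j s = t j + \<zeta> * g j t"
        using fun_cong[OF eq, of j] j by (simp add: Cn_tail_def E_def G_def c s_def t_def)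
      then have "t j - s j = - (\<zeta> * (g j t - g j s))" by (simp add: algebra_simps)
      then have "cmod (t j - s j) = cmod \<zeta> * cmod (g j t - g j s)" by (simp add: norm_mult)
      also have "\<dots> \<le> cmod \<zeta> * (L' j * cdist m s t)" using L'(2)[of j s t] st j by (intro mult_left_mono) auto
      finally show "cmod (t j - s j) \<le> cmod \<zeta> * (L' j * (\<Sum>i<m. cmod (t i - s i)))" unfolding cdist_def .
    qed
    also have "\<dots> = (cmod \<zeta> * (\<Sum>j<m. L' j)) * cdist m s t"
      by (simp add: sum_distrib_left sum_distrib_right mult.assoc)
    also have "\<dots> \<le> 1 / 2 * cdist m s t"
    proof (rule mult_right_mono)
      have "cmod \<zeta> * (\<Sum>j<m. L' j) \<le> cmod \<zeta> * \<Lambda>" using \<Lambda>(3) by (intro mult_left_mono) auto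
      then show "cmod \<zeta> * (\<Sum>j<m. L' j) \<le> 1 / 2" using small[OF \<zeta>] by linarith
    qed simp
    finally have "cdist m s t = 0" using cdist_ge_0[of m s t] by linarith
    then show ?thesis using cdist_eq_0_iff[of s m t] st K'\<Omega> openin_CnD[OF o\<tau>] by (auto simp: s_def t_def)
  qed
  have proj\<phi>: "proj X (\<phi> \<zeta> p) = proj X (\<phi> \<zeta> q) \<longleftrightarrow> proj X p = proj X q"
    if \<zeta>: "\<zeta> \<in> T" and pq: "p \<in> U" "q \<in> U" for \<zeta> p q
  proof
    assume "proj X (\<phi> \<zeta> p) = proj X (\<phi> \<zeta> q)"
    then have "Cn_tail (c (\<phi> \<zeta> p)) = Cn_tail (c (\<phi> \<zeta> q))" unfolding tail by simp
    then have "\<tau> (proj X p) = \<tau> (proj X q)" unfolding c\<phi>[OF \<zeta> pq(1)] c\<phi>[OF \<zeta> pq(2)] by (rule base_inj[OF \<zeta> pq])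
    then show "proj X p = proj X q"
      by (rule inj_onD[OF is_chartD(3)[OF ch\<tau>]]) (use pq UW in auto)
  next
    assume "proj X p = proj X q"
    then have "Cn_tail (E \<zeta> (c p)) = Cn_tail (E \<zeta> (c q))"
      by (simp add: Cn_tail_def E_def G_def c fun_eq_iff)
    then have "\<tau> (proj X (\<phi> \<zeta> p)) = \<tau> (proj X (\<phi> \<zeta> q))"
      unfolding c\<phi>[OF \<zeta> pq(1), symmetric] c\<phi>[OF \<zeta> pq(2), symmetric] tail .
    then show "proj X (\<phi> \<zeta> p) = proj X (\<phi> \<zeta> q)"
      by (rule inj_onD[OF is_chartD(3)[OF ch\<tau>]]) (use \<phi>W[OF \<zeta>] pq in auto)
  qed
  have hcc: "holo_fun (tot X) W (\<lambda>p. c p i)" if "i < d" for i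
    using holo_fun_coordinate[OF tot hc] that by (simp add: d_def)
  have oW: "open W" by (rule is_chartD(1)[OF ch])
  have oU: "openin (top_of_set (Cn d)) (c ` U)" unfolding d_def by (rule chart_open_image[OF ch U(1) UW])
  have cU\<Omega>: "c ` U \<subseteq> \<Omega>" using UW by (auto simp: \<Omega>_def)
  have biholo: "fiber_biholo X U (\<phi> \<zeta> ` U) (\<phi> \<zeta>)" if \<zeta>: "\<zeta> \<in> T" for \<zeta>
  proof -
    have hEU: "holo d (c ` U) (\<lambda>y. E \<zeta> y i)" if "i < d" for i
      by (rule holo_subset[OF \<Omega> oU cU\<Omega> hE[OF that]])
    have ECU: "E \<zeta> ` (c ` U) \<subseteq> Cn d" using cU\<Omega> openin_CnD[OF \<Omega>] EC by blast
    have exp: "\<exists>a>0. \<exists>\<delta>>0. \<forall>z\<in>c ` U. cdist d y z < \<delta> \<longrightarrow> a * cdist d y z \<le> cdist d (E \<zeta> y) (E \<zeta> z)"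
      if "y \<in> c ` U" for y
      using expand[OF \<zeta>] UK that by (intro exI[of _ "1 / 2"] conjI exI[of _ 1] ballI impI) auto
    have i1: "openin (top_of_set (Cn d)) (E \<zeta> ` (c ` U))"
      by (rule holo_inverse(1)[OF oU _ ECU injE[OF \<zeta>]], erule hEU, erule exp)
    have i3: "holo d (E \<zeta> ` (c ` U)) (\<lambda>y. inv_into (c ` U) (E \<zeta>) y i)" if "i < d" for i
      by (rule holo_inverse(3)[OF oU _ ECU injE[OF \<zeta>] _ that], erule hEU, erule exp)
    have img: "\<phi> \<zeta> ` U = {q\<in>W. c q \<in> E \<zeta> ` (c ` U)}"
    proof (rule equalityI; rule subsetI)
      fix q assume "q \<in> \<phi> \<zeta> ` U"
      then show "q \<in> {q\<in>W. c q \<in> E \<zeta> ` (c ` U)}" using \<phi>W[OF \<zeta>] c\<phi>[OF \<zeta>] by auto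
    next
      fix q assume "q \<in> {q\<in>W. c q \<in> E \<zeta> ` (c ` U)}"
      then obtain p where "p \<in> U" "q \<in> W" "c q = E \<zeta> (c p)" by blast
      then have "\<phi> \<zeta> p = q" unfolding \<phi>_def using is_chartD(6)[OF ch, of q] by simp
      then show "q \<in> \<phi> \<zeta> ` U" using \<open>p \<in> U\<close> by blast
    qed
    have o2: "open (\<phi> \<zeta> ` U)" unfolding img using chart_open_preimage[OF ch i1[unfolded d_def]] by (simp add: d_def)
    have inj\<phi>: "inj_on (\<phi> \<zeta>) U"
    proof (rule inj_onI)
      fix p q assume pq: "p \<in> U" "q \<in> U" "\<phi> \<zeta> p = \<phi> \<zeta> q"
      then have "E \<zeta> (c p) = E \<zeta> (c q)" using c\<phi>[OF \<zeta>] by metis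
      then have "c p = c q" by (rule inj_onD[OF injE[OF \<zeta>]]) (use pq in auto)
      then show "p = q" by (rule inj_onD[OF is_chartD(3)[OF ch]]) (use pq UW in auto)
    qed
    have m1: "holo_map (tot X) (tot X) U (\<phi> \<zeta>)"
    proof (rule holo_map_of_coords[OF tot tot hc U(1)])
      show "\<phi> \<zeta> ` U \<subseteq> W" using \<phi>W[OF \<zeta>] by blast
      fix i assume "i < Suc m"
      then have i: "i < d" by (simp add: d_def)
      have "holo_fun (tot X) U (\<lambda>p. E \<zeta> (c p) i)"
      proof (rule holo_fun_compose_Cn[where F = c and g = "\<lambda>y. E \<zeta> y i", OF tot U(1) _ _ \<Omega> hE[OF i]])
        show "holo_fun (tot X) U (\<lambda>p. c p k)" if "k < d" for k
          by (rule holo_fun_subset[OF tot hcc[OF that] UW oW U(1)])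
      qed (use cU\<Omega> in blast)
      then show "holo_fun (tot X) U (\<lambda>p. c (\<phi> \<zeta> p) i)"
        by (rule holo_fun_cong[OF tot _ _ U(1), rotated]) (simp add: c\<phi>[OF \<zeta>])
    qed
    have m2: "holo_map (tot X) (tot X) (\<phi> \<zeta> ` U) (inv_into U (\<phi> \<zeta>))"
    proof (rule holo_map_of_coords[OF tot tot hc o2])
      show "inv_into U (\<phi> \<zeta>) ` \<phi> \<zeta> ` U \<subseteq> W" using UW inj\<phi> by auto
      fix i assume "i < Suc m"
      then have i: "i < d" by (simp add: d_def)
      have "holo_fun (tot X) (\<phi> \<zeta> ` U) (\<lambda>q. inv_into (c ` U) (E \<zeta>) (c q) i)"
      proof (rule holo_fun_compose_Cn[where F = c and g = "\<lambda>y. inv_into (c ` U) (E \<zeta>) y i", OF tot o2 _ _ i1 i3[OF i]])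
        show "holo_fun (tot X) (\<phi> \<zeta> ` U) (\<lambda>p. c p k)" if "k < d" for k
          by (rule holo_fun_subset[OF tot hcc[OF that] _ oW o2]) (simp add: img)
      qed (simp add: img)
      then show "holo_fun (tot X) (\<phi> \<zeta> ` U) (\<lambda>q. c (inv_into U (\<phi> \<zeta>) q) i)"
      proof (rule holo_fun_cong[OF tot _ _ o2, rotated])
        fix q assume "q \<in> \<phi> \<zeta> ` U"
        then obtain p where p: "p \<in> U" "q = \<phi> \<zeta> p" by blast
        have "inv_into (c ` U) (E \<zeta>) (c q) = c p"
          unfolding p(2) c\<phi>[OF \<zeta> p(1)] by (rule inv_into_f_f[OF injE[OF \<zeta>]]) (use p in blast)
        then show "inv_into (c ` U) (E \<zeta>) (c q) i = c (inv_into U (\<phi> \<zeta>) q) i"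
          using inv_into_f_f[OF inj\<phi> p(1)] p(2) by simp
      qed
    qed
    have fib: "\<phi> \<zeta> ` (U \<inter> proj X -` {proj X p}) = \<phi> \<zeta> ` U \<inter> proj X -` {proj X (\<phi> \<zeta> p)}" if p: "p \<in> U" for p
      using proj\<phi>[OF \<zeta> _ p] by auto
    show ?thesis
      unfolding fiber_biholo_def using U(1) o2 inj_on_imp_bij_betw[OF inj\<phi>] m1 m2 fib by blast
  qed
  have m: "holo_map (times_C (tot X)) (tot X) (T \<times> U) (\<lambda>(\<zeta>, p). \<phi> \<zeta> p)"
  proof (rule holo_map_of_coords[OF complex_atlas_times[OF tot] tot hc])
    note At = complex_atlas_times[OF tot]
    show TU: "open (T \<times> U)" using T U(1) by (simp add: open_Times)
    show "(\<lambda>(\<zeta>, p). \<phi> \<zeta> p) ` (T \<times> U) \<subseteq> W" using \<phi>W by auto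
    have hcT: "holo_coords (times_C (tot X)) (UNIV \<times> W) (Suc (Suc m)) (times_chart c)"
      by (rule holo_coords_times[OF tot hc])
    have oTW: "open (UNIV \<times> W :: (complex \<times> 'c) set)" using oW by (simp add: open_Times)
    have sub: "T \<times> U \<subseteq> UNIV \<times> W" using UW by auto
    have f0: "holo_fun (times_C (tot X)) (T \<times> U) fst"
    proof -
      have "holo_fun (times_C (tot X)) (UNIV \<times> W) (\<lambda>a. times_chart c a 0)" by (rule holo_fun_coordinate[OF At hcT]) simp
      then have "holo_fun (times_C (tot X)) (T \<times> U) (\<lambda>a. times_chart c a 0)" by (rule holo_fun_subset[OF At _ sub oTW TU])
      then show ?thesis by (rule holo_fun_cong[OF At _ _ TU, rotated]) auto
    qed
    have f1: "holo_fun (times_C (tot X)) (T \<times> U) (\<lambda>a. c (snd a) k)" if "k < d" for k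
    proof -
      have "holo_fun (times_C (tot X)) (UNIV \<times> W) (\<lambda>a. times_chart c a (Suc k))"
        by (rule holo_fun_coordinate[OF At hcT]) (use that in \<open>simp add: d_def\<close>)
      then have "holo_fun (times_C (tot X)) (T \<times> U) (\<lambda>a. times_chart c a (Suc k))" by (rule holo_fun_subset[OF At _ sub oTW TU])
      then show ?thesis by (rule holo_fun_cong[OF At _ _ TU, rotated]) auto
    qed
    fix i assume "i < Suc m"
    then have i: "i < d" by (simp add: d_def)
    have "holo_fun (times_C (tot X)) (T \<times> U) (\<lambda>a. G (c (snd a)) i)"
      by (rule holo_fun_compose_Cn[where F = "\<lambda>a. c (snd a)" and g = "\<lambda>y. G y i", OF At TU _ f1 \<Omega> hG[OF i]])
         (use cU\<Omega> in auto)
    then have "holo_fun (times_C (tot X)) (T \<times> U) (\<lambda>a. c (snd a) i + fst a * G (c (snd a)) i)"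
      by (intro holo_fun_add[OF At TU] holo_fun_mult[OF At TU] f0 f1 i)
    then show "holo_fun (times_C (tot X)) (T \<times> U) (\<lambda>a. c ((\<lambda>(\<zeta>, p). \<phi> \<zeta> p) a) i)"
      by (rule holo_fun_cong[OF At _ _ TU, rotated]) (auto simp: c\<phi> E_def)
  qed
  have \<phi>0: "\<phi> 0 p = p" if "p \<in> U" for p
    using is_chartD(6)[OF ch] that UW by (auto simp: \<phi>_def E_def)
  have der: "((\<lambda>\<zeta>. f (\<phi> \<zeta> p)) has_field_derivative h (c p) * coord_deriv W c 0 f p
      + (\<Sum>j<m. g j (\<tau> (proj X p)) * coord_deriv W c (Suc j) f p)) (at 0)"
    if p: "p \<in> U" and N: "open N" "p \<in> N" "holo_fun (tot X) N f" for p N f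
  proof -
    define f' where "f' y = f (inv_into W c y)" for y
    have N': "open (N \<inter> W)" "N \<inter> W \<subseteq> W" using N oW by auto
    have hf: "holo d (c ` (N \<inter> W)) f'"
      unfolding f'_def d_def by (rule holo_in_coords[OF tot hc N' holo_fun_subset[OF tot N(3) _ N(1) N'(1)]]) blast
    have o: "openin (top_of_set (Cn d)) (c ` (N \<inter> W))" unfolding d_def by (rule chart_open_image[OF ch N'])
    have cp: "c p \<in> c ` (N \<inter> W)" using p N(2) UW by blast
    have E0: "E 0 (c p) = c p" by (simp add: E_def)
    have "((\<lambda>\<zeta>. f' (E \<zeta> (c p))) has_field_derivative (\<Sum>i<d. pd i f' (E 0 (c p)) * G (c p) i)) (at 0)"
    proof (rule holo_chain[where \<gamma> = "\<lambda>\<zeta>. E \<zeta> (c p)", OF o hf])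
      show "E 0 (c p) \<in> c ` (N \<inter> W)" using cp E0 by simp
      show "\<forall>\<^sub>F \<zeta> in nhds 0. E \<zeta> (c p) \<in> Cn d" using EC[OF openin_CnD[OF o cp]] by simp
      show "((\<lambda>\<zeta>. E \<zeta> (c p) i) has_field_derivative G (c p) i) (at 0)" for i
        unfolding E_def by (auto intro!: derivative_eq_intros)
    qed
    moreover have "(\<Sum>i<d. pd i f' (E 0 (c p)) * G (c p) i) = h (c p) * coord_deriv W c 0 f p
      + (\<Sum>j<m. g j (\<tau> (proj X p)) * coord_deriv W c (Suc j) f p)"
    proof -
      have cd: "coord_deriv W c i f p = pd i f' (c p)" for i
        by (simp add: coord_deriv_def f'_def[abs_def] o_def)
      have "(\<Sum>j<m. pd (Suc j) f' (c p) * G (c p) (Suc j)) = (\<Sum>j<m. g j (\<tau> (proj X p)) * pd (Suc j) f' (c p))"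
        by (rule sum.cong) (simp_all add: G_def tail)
      then show ?thesis unfolding d_def sum.lessThan_Suc_shift E0 cd by (simp add: G_def)
    qed
    ultimately show ?thesis by (simp add: f'_def \<phi>_def)
  qed
  have "local_flow X W (\<lambda>f p. h (c p) * coord_deriv W c 0 f p
      + (\<Sum>j<m. g j (\<tau> (proj X p)) * coord_deriv W c (Suc j) f p)) U T \<phi>"
    unfolding local_flow_def
  proof (intro conjI ballI allI impI)
    show "\<phi> \<zeta> ` U \<subseteq> W" if "\<zeta> \<in> T" for \<zeta> using \<phi>W[OF that] by blast
  qed (use T m biholo \<phi>0 der in auto)
  then show ?thesis by (intro exI)
qed

section \<open>The Lie derivative\<close>

context voa
begin

interpretation vs: vector_space "scl V" by (rule vector_space)

text \<open>Existence of the limit in the definition of \<open>vpd\<close>: with a dual basis it reduces to partial derivatives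
  of the coordinates.\<close>
lemma vpd_weak:
  assumes S: "openin (top_of_set (Cn d)) S" and f: "\<And>y. y \<in> S \<Longrightarrow> f y \<in> gr_le V N"
    "\<And>\<alpha>. dual V \<alpha> \<Longrightarrow> holo d S (\<lambda>y. \<alpha> (f y))" and y: "y \<in> S" and i: "i < d"
  shows "vpd V i f y \<in> gr_le V N" "dual V \<alpha> \<Longrightarrow> \<alpha> (vpd V i f y) = pd i (\<lambda>y. \<alpha> (f y)) y"
proof -
  obtain B \<beta> where B: "finite B" "B \<subseteq> gr_le V N" "\<And>b. b \<in> B \<Longrightarrow> dual V (\<beta> b)"
    "\<And>v. v \<in> gr_le V N \<Longrightarrow> v = (\<Sum>b\<in>B. scl V (\<beta> b v) b)"
    by (rule gr_le_dual_basis[of N], rule that)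
  define D where "D = (\<Sum>b\<in>B. scl V (pd i (\<lambda>z. \<beta> b (f z)) y) b)"
  have D: "D \<in> gr_le V N" unfolding D_def
    by (rule gr_le_closed(5), rule gr_le_closed(4), rule subsetD[OF B(2)])
  have \<alpha>f: "\<alpha> (f z) = (\<Sum>b\<in>B. \<beta> b (f z) * \<alpha> b)" if \<alpha>: "dual V \<alpha>" and z: "z \<in> S" for \<alpha> z
    using arg_cong[OF B(4)[OF f(1)[OF z]], of \<alpha>] unfolding dualD(6)[OF \<alpha>] dualD(2)[OF \<alpha>] .
  have der: "((\<lambda>z. \<alpha> (f (y(i := z)))) has_field_derivative \<alpha> D) (at (y i))" if \<alpha>: "dual V \<alpha>" for \<alpha>
  proof -
    have H: "((\<lambda>z. \<Sum>b\<in>B. \<beta> b (f (y(i := z))) * \<alpha> b) has_field_derivative \<alpha> D) (at (y i))"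
      unfolding D_def dualD(6)[OF \<alpha>] dualD(2)[OF \<alpha>]
      by (rule DERIV_sum, rule DERIV_cmult_right, rule holo_line_deriv[OF S f(2)[OF B(3)] y i])
    have "eventually (\<lambda>z. \<alpha> (f (y(i := z))) = (\<Sum>b\<in>B. \<beta> b (f (y(i := z))) * \<alpha> b)) (nhds (y i))"
      using eventually_line_in[OF S y i] by eventually_elim (rule \<alpha>f[OF \<alpha>])
    then show ?thesis by (rule iffD2[OF DERIV_cong_ev[OF refl _ refl] H])
  qed
  have lim: "vtendsto V (\<lambda>t. scl V (1 / t) (f (y(i := y i + t)) - f y)) D (at 0)"
    unfolding vtendsto_def
  proof (intro allI impI)
    fix \<alpha> assume \<alpha>: "dual V \<alpha>"
    show "((\<lambda>t. \<alpha> (scl V (1 / t) (f (y(i := y i + t)) - f y))) \<longlongrightarrow> \<alpha> D) (at 0)"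
      using der[OF \<alpha>] by (simp add: DERIV_def dualD(2,5)[OF \<alpha>])
  qed
  have eq: "vpd V i f y = D" unfolding vpd_def
    by (rule the_equality, rule lim) (rule vtendsto_unique[OF _ lim], auto)
  show "vpd V i f y \<in> gr_le V N" unfolding eq by (rule D)
  show "\<alpha> (vpd V i f y) = pd i (\<lambda>y. \<alpha> (f y)) y" if \<alpha>: "dual V \<alpha>"
    unfolding eq pd_def by (rule DERIV_imp_deriv[OF der[OF \<alpha>], symmetric])
qed

lemma vtendsto_lin: "vtendsto V f l F \<Longrightarrow> lin V L \<Longrightarrow> vtendsto V (\<lambda>x. L (f x)) (L l) F"
  using dual_lin unfolding vtendsto_def by blast

lemma vtendsto_cong:
  assumes "eventually (\<lambda>x. f x = g x) F" "vtendsto V f l F"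
  shows "vtendsto V g l F"
  unfolding vtendsto_def
proof (intro allI impI)
  fix \<alpha> assume "dual V \<alpha>"
  then have "((\<lambda>x. \<alpha> (f x)) \<longlongrightarrow> \<alpha> l) F" using assms(2) by (simp add: vtendsto_def)
  moreover have "eventually (\<lambda>x. \<alpha> (f x) = \<alpha> (g x)) F" using assms(1) by eventually_elim simp
  ultimately show "((\<lambda>x. \<alpha> (g x)) \<longlongrightarrow> \<alpha> l) F" by (rule Lim_transform_eventually)
qed

lemma deriv_diff_const: "deriv (\<lambda>z. f z - a) = deriv f"
proof -
  have "((\<lambda>z. f z - a) has_field_derivative D) (at w) \<longleftrightarrow> (f has_field_derivative D) (at w)" for D w
    using DERIV_diff[OF _ DERIV_const, of f D w UNIV a] DERIV_add[OF _ DERIV_const, of "\<lambda>z. f z - a" D w UNIV a] by auto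
  then show ?thesis by (simp add: deriv_def[abs_def])
qed

lemma higher_deriv_diff_const: "k \<ge> 1 \<Longrightarrow> (deriv ^^ k) (\<lambda>z. f z - a) = (deriv ^^ k) f"
  by (cases k) (simp_all add: funpow_Suc_right deriv_diff_const del: funpow.simps)

lemma holo_fun_algebra:
  assumes "complex_atlas A" "open K"
  shows "function_algebra K {f. holo_fun A K f}"
  unfolding function_algebra_def
proof (intro conjI ballI allI impI CollectI)
  fix f g assume fg: "f \<in> {f. holo_fun A K f}" "g \<in> {f. holo_fun A K f}"
  show "holo_fun A K (\<lambda>p. f p + g p)" "holo_fun A K (\<lambda>p. f p * g p)"
    using fg by (auto intro: holo_fun_add[OF assms] holo_fun_mult[OF assms])
next
  fix f g assume fg: "f \<in> {f. holo_fun A K f}" "\<forall>p\<in>K. g p = f p"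
  show "holo_fun A K g" by (rule holo_fun_cong[OF assms(1) _ _ assms(2), of f]) (use fg in auto)
qed (rule holo_fun_const[OF assms(1)])

text \<open>In the following, \<open>w0\<close> is the right-hand side of the formula, as a function on \<open>W\<close>.\<close>
context
  fixes X :: "('c::{t2_space,second_countable_topology}, 'b::{t2_space,second_countable_topology}) family_data"
    and W :: "'c set" and \<eta> :: "'c \<Rightarrow> complex" and m n :: nat and \<tau> :: "'b \<Rightarrow> cvec" and c :: "'c \<Rightarrow> cvec"
    and h :: "cvec \<Rightarrow> complex" and g :: "nat \<Rightarrow> cvec \<Rightarrow> complex" and x :: "'c vfield"
    and u :: "'c \<Rightarrow> 'v" and v :: "'c \<Rightarrow> 'c loc \<Rightarrow> 'v" and w0 :: "'c \<Rightarrow> 'v"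
  assumes X: "RS_family X" and \<eta>: "fiber_coord X W \<eta>" and \<tau>: "holo_coords (base X) (proj X ` W) m \<tau>"
    and c: "c = (\<lambda>p. case_nat (\<eta> p) (\<tau> (proj X p)))"
    and h: "holo (Suc m) (c ` W) h" and g: "\<And>j. j < m \<Longrightarrow> holo m (\<tau> ` proj X ` W) (g j)"
    and x: "x = (\<lambda>f p. h (c p) * coord_deriv W c 0 f p
      + (\<Sum>j<m. g j (\<tau> (proj X p)) * coord_deriv W c (Suc j) f p))"
    and v: "v \<in> voa_sections V X n W" and u: "u \<in> gr_le_O V (tot X) n W"
    and vu: "equals_in_coord v W \<eta> u"
    and w0: "w0 = (\<lambda>p. scl V (h (c p)) (coord_vderiv V W c 0 u p)
      + (\<Sum>j<m. scl V (g j (\<tau> (proj X p))) (coord_vderiv V W c (Suc j) u p))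
      - Sum_any (\<lambda>k. if k \<ge> 1
          then scl V (1 / fact k * (pd 0 ^^ k) h (c p)) (vir V (int k - 1) (u p)) else 0))"
begin

lemma atlas: "complex_atlas (tot X)"
  by (rule RS_familyD(1)[OF X])

lemma coords: "holo_coords (tot X) W (Suc m) c"
  by (rule total_coords[OF X \<eta> \<tau> c])

lemma open_W: "open W"
  by (rule fiber_coordD(1)[OF \<eta>])

lemma open_coords_image: "openin (top_of_set (Cn (Suc m))) (c ` W)"
  by (rule is_chartD(2)[OF holo_coordsD(1)[OF coords]])

lemma u_mem: "p \<in> W \<Longrightarrow> u p \<in> gr_le V n"
  and u_holo: "dual V \<alpha> \<Longrightarrow> holo_fun (tot X) W (\<lambda>p. \<alpha> (u p))"
  using u unfolding gr_le_O_iff[OF atlas open_W] by simp_all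

lemma coord_deriv_fiber_coord:
  assumes "q \<in> W" "i < Suc m"
  shows "coord_deriv W c i \<eta> q = (if i = 0 then 1 else 0)"
proof -
  have "coord_deriv W c i \<eta> q = pd i (\<lambda>y. y 0) (c q)"
    unfolding coord_deriv_def
  proof (rule pd_cong[OF open_coords_image _ assms(2)])
    fix y assume "y \<in> c ` W"
    then show "(\<eta> \<circ> inv_into W c) y = y 0"
      using is_chartD(6)[OF holo_coordsD(1)[OF coords]] by (auto simp: c)
  qed (use assms(1) in simp)
  then show ?thesis by (cases "i = 0") (simp_all add: pd_def)
qed

lemma x_fiber_coord: "q \<in> W \<Longrightarrow> x \<eta> q = h (c q)"
  unfolding x by (simp add: coord_deriv_fiber_coord)

lemma coord_vderiv_weak:
  assumes "p \<in> W" "i < Suc m"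
  shows "coord_vderiv V W c i u p \<in> gr_le V n"
    "dual V \<alpha> \<Longrightarrow> \<alpha> (coord_vderiv V W c i u p) = coord_deriv W c i (\<lambda>p. \<alpha> (u p)) p"
proof -
  have f1: "(u \<circ> inv_into W c) y \<in> gr_le V n" if "y \<in> c ` W" for y
    using u_mem inv_into_into[OF that] by simp
  have f2: "holo (Suc m) (c ` W) (\<lambda>y. \<alpha> ((u \<circ> inv_into W c) y))" if "dual V \<alpha>" for \<alpha>
    using holo_in_coords[OF atlas coords open_W subset_refl u_holo[OF that]] by simp
  have cp: "c p \<in> c ` W" using assms(1) by simp
  show "coord_vderiv V W c i u p \<in> gr_le V n"
    unfolding coord_vderiv_def by (rule vpd_weak(1)[where f = "u \<circ> inv_into W c", OF open_coords_image f1 f2 cp assms(2)])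
  show "\<alpha> (coord_vderiv V W c i u p) = coord_deriv W c i (\<lambda>p. \<alpha> (u p)) p" if \<alpha>: "dual V \<alpha>"
    using vpd_weak(2)[where f = "u \<circ> inv_into W c", OF open_coords_image f1 f2 cp assms(2) \<alpha>] unfolding coord_vderiv_def coord_deriv_def by (simp add: o_def)
qed

definition "directional p = scl V (h (c p)) (coord_vderiv V W c 0 u p)
      + (\<Sum>j<m. scl V (g j (\<tau> (proj X p))) (coord_vderiv V W c (Suc j) u p))"

lemma directional_mem: "p \<in> W \<Longrightarrow> directional p \<in> gr_le V n"
  unfolding directional_def by (rule gr_le_closed(2), rule gr_le_closed(4), erule coord_vderiv_weak, simp, rule gr_le_closed(5), rule gr_le_closed(4), erule coord_vderiv_weak, simp)

lemma dual_directional: "p \<in> W \<Longrightarrow> dual V \<alpha> \<Longrightarrow> \<alpha> (directional p) = x (\<lambda>p. \<alpha> (u p)) p"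
  unfolding directional_def x by (simp add: dualD coord_vderiv_weak(2))

text \<open>The operators \<open>L\<^sub>k\<^sub>-\<^sub>1\<close> with \<open>k > n + 1\<close> vanish on \<open>gr_le V n\<close>.\<close>
lemma w0_eq:
  assumes "p \<in> W"
  shows "w0 p = directional p - (\<Sum>k=1..Suc n. scl V (1 / fact k * (pd 0 ^^ k) h (c p)) (vir V (int k - 1) (u p)))"
proof -
  have zero: "scl V (1 / fact k * (pd 0 ^^ k) h (c p)) (vir V (int k - 1) (u p)) = 0" if k: "k > Suc n" for k
  proof -
    obtain j where j: "k = Suc j" using k by (cases k) auto
    have "vir V (int j) (u p) = 0" by (rule vir_gr_le(2)[OF u_mem[OF assms]]) (use k j in simp)
    then show ?thesis unfolding j by simp
  qed
  have "Sum_any (\<lambda>k. if k \<ge> 1 then scl V (1 / fact k * (pd 0 ^^ k) h (c p)) (vir V (int k - 1) (u p)) else 0)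
    = (\<Sum>k=1..Suc n. if k \<ge> 1 then scl V (1 / fact k * (pd 0 ^^ k) h (c p)) (vir V (int k - 1) (u p)) else 0)"
  proof (intro Sum_any.expand_superset subsetI)
    fix k assume k: "k \<in> {k. (if k \<ge> 1 then scl V (1 / fact k * (pd 0 ^^ k) h (c p)) (vir V (int k - 1) (u p)) else 0) \<noteq> 0}"
    then have "k \<ge> 1" by (simp split: if_splits)
    moreover have "\<not> k > Suc n" using k zero[of k] by (auto simp del: vs.scale_eq_0_iff split: if_splits)
    ultimately show "k \<in> {1..Suc n}" by simp
  qed simp
  also have "\<dots> = (\<Sum>k=1..Suc n. scl V (1 / fact k * (pd 0 ^^ k) h (c p)) (vir V (int k - 1) (u p)))"
    by (rule sum.cong) auto
  finally have S: "Sum_any (\<lambda>k. if k \<ge> 1 then scl V (1 / fact k * (pd 0 ^^ k) h (c p)) (vir V (int k - 1) (u p)) else 0)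
    = (\<Sum>k=1..Suc n. scl V (1 / fact k * (pd 0 ^^ k) h (c p)) (vir V (int k - 1) (u p)))" .
  show ?thesis unfolding w0 directional_def S ..
qed

lemma w0_mem: assumes "p \<in> W" shows "w0 p \<in> gr_le V n"
proof -
  have "vir V (int k - 1) (u p) \<in> gr_le V n" if "k \<in> {1..Suc n}" for k
    using vir_gr_le_mem[OF u_mem[OF assms], of "k - 1"] that by (cases k) simp_all
  then show ?thesis unfolding w0_eq[OF assms]
    by (intro gr_le_closed(3) directional_mem[OF assms] gr_le_closed(5) gr_le_closed(4))
qed

lemma holo_fun_of_c:
  assumes "holo (Suc m) (c ` W) f"
  shows "holo_fun (tot X) W (\<lambda>p. f (c p))"
  by (rule holo_fun_compose_Cn[where F = c and g = f, OF atlas open_W _ _ open_coords_image assms]) (use holo_fun_coordinate[OF atlas coords] in auto)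

lemma w0_holo: assumes \<alpha>: "dual V \<alpha>" shows "holo_fun (tot X) W (\<lambda>p. \<alpha> (w0 p))"
proof -
  define f where "f = (\<lambda>p. \<alpha> (u p))"
  have d: "holo_fun (tot X) W (\<lambda>p. coord_deriv W c i f p)" if "i < Suc m" for i
  proof -
    have "holo (Suc m) (c ` W) (\<lambda>y. f (inv_into W c y))"
      by (rule holo_in_coords[OF atlas coords open_W subset_refl]) (simp add: f_def u_holo[OF \<alpha>])
    then show ?thesis unfolding coord_deriv_def o_def
      by (intro holo_fun_of_c holo_pd[OF open_coords_image _ that])
  qed
  have g': "holo_fun (tot X) W (\<lambda>p. g j (\<tau> (proj X p)))" if "j < m" for j
  proof (rule holo_fun_compose_Cn[where F = "\<lambda>p. \<tau> (proj X p)" and g = "g j", OF atlas open_W _ _ is_chartD(2)[OF holo_coordsD(1)[OF \<tau>]] g[OF that]])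
    show "holo_fun (tot X) W (\<lambda>p. \<tau> (proj X p) k)" if "k < m" for k
      by (rule holo_fun_subset[OF atlas holo_fun_base_coords[OF X \<tau> that] _
          open_proj_preimage[OF X is_chartD(1)[OF holo_coordsD(1)[OF \<tau>]]] open_W]) auto
  qed blast
  have vir': "holo_fun (tot X) W (\<lambda>p. \<alpha> (vir V k (u p)))" for k
    by (rule u_holo[OF dual_lin[OF \<alpha> lin_vir]])
  have k': "holo_fun (tot X) W (\<lambda>p. - (1 / fact k) * (pd 0 ^^ k) h (c p) * \<alpha> (vir V (int k - 1) (u p)))" for k
    by (rule holo_fun_mult[OF atlas open_W holo_fun_mult[OF atlas open_W holo_fun_const[OF atlas] holo_fun_of_c[OF holo_pd_funpow[OF open_coords_image h]]] vir']) simp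
  have hd: "holo_fun (tot X) W (\<lambda>p. h (c p) * coord_deriv W c 0 f p)"
    by (rule holo_fun_mult[OF atlas open_W holo_fun_of_c[OF h] d]) simp
  have gd: "holo_fun (tot X) W (\<lambda>p. \<Sum>j<m. g j (\<tau> (proj X p)) * coord_deriv W c (Suc j) f p)"
    by (rule holo_fun_sum[OF atlas open_W], rule holo_fun_mult[OF atlas open_W g' d]) simp_all
  have kd: "holo_fun (tot X) W (\<lambda>p. \<Sum>k=1..Suc n. - (1 / fact k) * (pd 0 ^^ k) h (c p) * \<alpha> (vir V (int k - 1) (u p)))"
    by (rule holo_fun_sum[OF atlas open_W k'])
  have eq: "h (c p) * coord_deriv W c 0 f p + (\<Sum>j<m. g j (\<tau> (proj X p)) * coord_deriv W c (Suc j) f p)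
      + (\<Sum>k=1..Suc n. - (1 / fact k) * (pd 0 ^^ k) h (c p) * \<alpha> (vir V (int k - 1) (u p))) = \<alpha> (w0 p)" if p: "p \<in> W" for p
  proof -
    have "\<alpha> (w0 p) = x f p - (\<Sum>k=1..Suc n. 1 / fact k * (pd 0 ^^ k) h (c p) * \<alpha> (vir V (int k - 1) (u p)))"
      unfolding w0_eq[OF p] dualD(5)[OF \<alpha>] dual_directional[OF p \<alpha>] dualD(6)[OF \<alpha>] dualD(2)[OF \<alpha>] f_def ..
    then show ?thesis unfolding x by (simp only: minus_mult_left[symmetric] sum_negf diff_conv_add_uminus)
  qed
  show ?thesis
    by (rule holo_fun_cong[OF atlas eq holo_fun_add[OF atlas open_W holo_fun_add[OF atlas open_W hd gd] kd] open_W])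
qed

lemma v_fiber: "p \<in> W \<Longrightarrow> v p \<in> voa_fiber V X n p"
  using v by (simp add: voa_sections_def)

lemma loc_W: "p \<in> W \<Longrightarrow> (W, \<eta>) \<in> loc_coords X p"
  using \<eta> by (simp add: loc_coords_def)

text \<open>
  The only candidate: the value in the coordinate \<open>\<eta>\<close> determines the values in all others. That these are compatible with each other is
  proved in \<open>lie_section_fiber\<close> by recognizing them as limits of compatible families.
\<close>
definition "lie_section p = restrict (\<lambda>(N, \<mu>). coord_op V (coord_change X (N \<inter> W) \<mu> \<eta> p) (w0 p)) (loc_coords X p)"

lemma lie_section_eta: assumes "p \<in> W" shows "lie_section p (W, \<eta>) = w0 p"
proof -
  have "lie_section p (W, \<eta>) = coord_op V (coord_change X W \<eta> \<eta> p) (w0 p)"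
    using loc_W[OF assms] by (simp add: lie_section_def)
  then show ?thesis by (simp add: coord_op_id[OF coord_change_self[OF X \<eta> assms]])
qed

context
  fixes U :: "'c set" and T :: "complex set" and \<phi> :: "complex \<Rightarrow> 'c \<Rightarrow> 'c" and p :: 'c
  assumes flow: "local_flow X W x U T \<phi>" and U: "open U" "U \<subseteq> W" and p: "p \<in> U"
begin

definition "quot l \<zeta> = scl V (1 / \<zeta>) (transport_inv V X n U (\<phi> \<zeta>) v p l - v p l)"

lemma flow_v: "\<zeta> \<in> T \<Longrightarrow> v (\<phi> \<zeta> p) \<in> voa_fiber V X n (\<phi> \<zeta> p)"
  by (rule v_fiber, rule subsetD[OF local_flowD(4)[OF flow] imageI[OF p]])

text \<open>The product rule at \<open>\<zeta> = 0\<close> for the transported value \<open>\<U>(\<rho>\<^sub>\<zeta>) u(\<phi> \<zeta> p)\<close>.\<close>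
lemma quot_eta: "vtendsto V (\<lambda>\<zeta>. quot (W, \<eta>) \<zeta>) (w0 p) (at 0)"
proof -
  have pW: "p \<in> W" using p U by blast
  define \<rho> where "\<rho> \<zeta> = coord_change X U \<eta> (\<eta> \<circ> \<phi> \<zeta>) p" for \<zeta>
  define c' where "c' k = - (pd 0 ^^ Suc k) h (c p) / fact (Suc k)" for k
  define F where "F \<zeta> = u (\<phi> \<zeta> p)" for \<zeta>
  have \<phi>W: "\<phi> \<zeta> p \<in> W" if "\<zeta> \<in> T" for \<zeta> by (rule subsetD[OF local_flowD(4)[OF flow that] imageI[OF p]])
  have evT: "eventually (\<lambda>\<zeta>. \<zeta> \<in> T) (nhds 0)" using eventually_nhds_in_open[OF local_flowD(1,2)[OF flow]] .
  have F0: "F 0 = u p" by (simp add: F_def local_flowD(6)[OF flow p])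
  have F1: "eventually (\<lambda>\<zeta>. F \<zeta> \<in> gr_le V n) (nhds 0)"
    using evT by eventually_elim (simp add: F_def u_mem \<phi>W)
  have F2: "weak_deriv F (directional p)"
  proof (rule weak_derivI)
    fix \<alpha> assume \<alpha>: "dual V \<alpha>"
    show "((\<lambda>\<zeta>. \<alpha> (F \<zeta>)) has_field_derivative \<alpha> (directional p)) (at 0)"
      unfolding dual_directional[OF pW \<alpha>] F_def by (rule local_flowD(7)[OF flow p open_W pW u_holo[OF \<alpha>]])
  qed
  note G = flow_germ_deriv[OF X \<eta> \<tau> c flow U p h x_fiber_coord]
  have 1: "weak_deriv (\<lambda>\<zeta>. coord_op V (\<rho> \<zeta>) (F \<zeta>))
      (directional p + scl V (- pd 0 h (c p)) (vir V 0 (F 0)) + vir_comb n c' (F 0))"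
  proof (rule weak_deriv_coord_op[OF _ _ _ _ F1 F2 directional_mem[OF pW]])
    show "((\<lambda>\<zeta>. deriv (\<rho> \<zeta>) 0) has_field_derivative - pd 0 h (c p)) (at 0)" unfolding \<rho>_def by (rule G(1))
    show "deriv (\<rho> 0) 0 = 1" unfolding \<rho>_def by (rule G(2))
    show "((\<lambda>\<zeta>. germ_coeffs (\<rho> \<zeta>) k) has_field_derivative c' k) (at 0)" if "k \<ge> 1" for k
      unfolding \<rho>_def c'_def by (rule G(3)[OF _ that])
    show "germ_coeffs (\<rho> 0) k = 0" if "k \<ge> 1" for k unfolding \<rho>_def by (rule G(4)[OF _ that])
  qed
  have 2: "directional p + scl V (- pd 0 h (c p)) (vir V 0 (F 0)) + vir_comb n c' (F 0) = w0 p"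
  proof -
    have "(\<Sum>k=1..Suc n. scl V (1 / fact k * (pd 0 ^^ k) h (c p)) (vir V (int k - 1) (u p)))
      = scl V (pd 0 h (c p)) (vir V 0 (u p))
        + (\<Sum>k=1..n. scl V (1 / fact (Suc k) * (pd 0 ^^ Suc k) h (c p)) (vir V (int (Suc k) - 1) (u p)))"
      \<comment> \<open>the term \<open>k = 1\<close> comes from \<open>a\<^bsup>L_0\<^esup>\<close>, the others from the exponential\<close>
      unfolding sum.atLeast_Suc_atMost[of 1 "Suc n", OF le_add1[of 1 n, unfolded plus_1_eq_Suc]] sum.shift_bounds_cl_Suc_ivl by simp
    also have "(\<Sum>k=1..n. scl V (1 / fact (Suc k) * (pd 0 ^^ Suc k) h (c p)) (vir V (int (Suc k) - 1) (u p)))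
      = - vir_comb n c' (u p)"
      unfolding vir_comb_def sum_negf[symmetric]
      by (rule sum.cong) (simp_all add: c'_def vs.scale_minus_left[symmetric] del: vs.scale_minus_left funpow.simps)
    finally show ?thesis unfolding w0_eq[OF pW] F0 by (simp add: vs.scale_minus_left)
  qed
  define G where "G \<zeta> = transport_inv V X n U (\<phi> \<zeta>) v p (W, \<eta>)" for \<zeta>
  have Gv: "G \<zeta> = coord_op V (\<rho> \<zeta>) (F \<zeta>)" if \<zeta>: "\<zeta> \<in> T" for \<zeta>
  proof -
    have "v (\<phi> \<zeta> p) (W, \<eta>) = F \<zeta>" using vu \<phi>W[OF \<zeta>] by (simp add: equals_in_coord_def F_def)
    then show ?thesis unfolding G_def \<rho>_def
      using transport_inv_value[where s = v, OF X local_flowD(5)[OF flow \<zeta>] p flow_v[OF \<zeta>] \<eta> U(2) local_flowD(4)[OF flow \<zeta>]] by simp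
  qed
  have "eventually (\<lambda>\<zeta>. G \<zeta> = coord_op V (\<rho> \<zeta>) (F \<zeta>)) (nhds 0)"
    using evT by eventually_elim (rule Gv)
  then have "weak_deriv G (w0 p)" by (rule weak_deriv_cong_ev) (rule 1[unfolded 2])
  from weak_deriv_vtendsto[OF this]
  have "vtendsto V (\<lambda>\<zeta>. scl V (1 / \<zeta>) (G \<zeta> - G 0)) (w0 p) (at 0)" .
  moreover have "G 0 = v p (W, \<eta>)"
  proof -
    have "G 0 = F 0" unfolding Gv[OF local_flowD(2)[OF flow]] \<rho>_def
      by (rule coord_op_id[OF flow_germ_0(2)[OF X \<eta> \<tau> c flow U p h x_fiber_coord]])
    then show ?thesis using vu pW by (simp add: equals_in_coord_def F0)
  qed
  ultimately show ?thesis unfolding quot_def G_def by simp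
qed

text \<open>Both \<open>v p\<close> and the transported value lie in the fiber at \<open>p\<close>, and \<open>coord_op\<close> is
  linear.\<close>
lemma quot_change:
  assumes \<zeta>: "\<zeta> \<in> T" and l: "(N, \<mu>) \<in> loc_coords X p" "(N', \<mu>') \<in> loc_coords X p"
  shows "quot (N, \<mu>) \<zeta> = coord_op V (coord_change X (N \<inter> N') \<mu> \<mu>' p) (quot (N', \<mu>') \<zeta>)"
proof -
  have pW: "p \<in> W" using p U by blast
  note L = linD[OF lin_coord_op]
  show ?thesis unfolding quot_def L(2) L(4)
    using voa_fiberD(2)[OF transport_inv_mem(1)[where s = v, OF X local_flowD(5)[OF flow \<zeta>] p flow_v[OF \<zeta>]] l]
      voa_fiberD(2)[OF v_fiber[OF pW] l] by simp
qed

lemma eventually_T: "eventually (\<lambda>\<zeta>. \<zeta> \<in> T) (at 0)"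
  using eventually_nhds_in_open[OF local_flowD(1,2)[OF flow]] by (rule filter_leD[OF at_within_le_nhds])

lemma quot_change_limit:
  assumes l: "(N, \<mu>) \<in> loc_coords X p" "(N', \<mu>') \<in> loc_coords X p" and lim: "vtendsto V (\<lambda>\<zeta>. quot (N', \<mu>') \<zeta>) a (at 0)"
  shows "vtendsto V (\<lambda>\<zeta>. quot (N, \<mu>) \<zeta>) (coord_op V (coord_change X (N \<inter> N') \<mu> \<mu>' p) a) (at 0)"
proof (rule vtendsto_cong[OF _ vtendsto_lin[OF lim lin_coord_op]])
  show "\<forall>\<^sub>F \<zeta> in at 0. coord_op V (coord_change X (N \<inter> N') \<mu> \<mu>' p) (quot (N', \<mu>') \<zeta>) = quot (N, \<mu>) \<zeta>"
    using eventually_T by eventually_elim (rule quot_change[OF _ l, symmetric])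
qed

lemma quot_limit:
  assumes l: "l \<in> loc_coords X p"
  shows "vtendsto V (\<lambda>\<zeta>. quot l \<zeta>) (lie_section p l) (at 0)"
proof -
  obtain N \<mu> where N: "l = (N, \<mu>)" by (cases l)
  have pW: "p \<in> W" using p U by blast
  have "lie_section p l = coord_op V (coord_change X (N \<inter> W) \<mu> \<eta> p) (w0 p)" using l by (simp add: lie_section_def N)
  then show ?thesis using quot_change_limit[OF l[unfolded N] loc_W[OF pW] quot_eta] by (simp add: N)
qed

text \<open>The difference quotients satisfy the compatibility condition for all small \<open>\<zeta>\<close>, and limits are unique.\<close>
lemma lie_section_fiber: "lie_section p \<in> voa_fiber V X n p"
proof (rule voa_fiberI)
  have pW: "p \<in> W" using p U by blast
  fix l
  show "lie_section p l \<in> gr_le V n" if "l \<in> loc_coords X p"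
    using that coord_op_mem[OF w0_mem[OF pW]] by (cases l) (simp add: lie_section_def)
  show "lie_section p l = undefined" if "l \<notin> loc_coords X p" using that by (simp add: lie_section_def)
next
  fix N \<mu> N' \<mu>' assume l: "(N, \<mu>) \<in> loc_coords X p" "(N', \<mu>') \<in> loc_coords X p"
  show "lie_section p (N, \<mu>) = coord_op V (coord_change X (N \<inter> N') \<mu> \<mu>' p) (lie_section p (N', \<mu>'))"
    by (rule vtendsto_unique[OF quot_limit[OF l(1)] quot_change_limit[OF l quot_limit[OF l(2)]]]) simp
qed

end

lemma flow_exists:
  assumes "open U" "compact (closure U)" "closure U \<subseteq> W"
  shows "\<exists>T \<phi>. local_flow X W x U T \<phi>"
  unfolding x by (rule local_flow_exists[OF X \<eta> \<tau> c h g assms])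

lemma lie_section_fiber_W:
  assumes "p \<in> W"
  shows "lie_section p \<in> voa_fiber V X n p"
proof -
  obtain U where U: "open U" "p \<in> U" "compact (closure U)" "closure U \<subseteq> W"
    by (rule chart_compact_neighborhood[OF holo_coordsD(1)[OF coords] assms], rule that)
  obtain T \<phi> where flow: "local_flow X W x U T \<phi>"
    using flow_exists[OF U(1,3,4)] by (elim exE) (rule that)
  have "U \<subseteq> W" using U(4) closure_subset by blast
  then show ?thesis by (rule lie_section_fiber[OF flow U(1) _ U(2)])
qed

text \<open>The Taylor coefficients of the change of coordinates are partial derivatives in the coordinates
  \<open>c\<close>, hence holomorphic in \<open>p\<close>, and \<open>coord_op\<close> depends on them algebraically.\<close>
lemma lie_section_holo:
  assumes \<mu>: "fiber_coord X N \<mu>"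
  shows "(\<lambda>p. lie_section p (N, \<mu>)) \<in> gr_le_O V (tot X) n (W \<inter> N)"
proof -
  define K where "K = N \<inter> W"
  have \<mu>K: "fiber_coord X K \<mu>" unfolding K_def by (rule fiber_coord_Int(1)[OF X \<mu> open_W])
  have \<eta>K: "fiber_coord X K \<eta>" unfolding K_def by (rule fiber_coord_Int(2)[OF X \<eta> fiber_coordD(1)[OF \<mu>]])
  have oK: "open K" by (rule fiber_coordD(1)[OF \<mu>K])
  have KW: "K \<subseteq> W" by (simp add: K_def)
  have KB: "K = K \<inter> proj X -` (proj X ` W)" using KW by blast
  have hcK: "holo_coords (tot X) K (Suc m) c"
    using fiber_chart[OF X \<eta>K \<tau>] unfolding KB[symmetric] c .
  have oK': "openin (top_of_set (Cn (Suc m))) (c ` K)"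
    by (rule is_chartD(2)[OF holo_coordsD(1)[OF hcK]])
  define \<rho> where "\<rho> p = coord_change X K \<mu> \<eta> p" for p
  define f where "f y = \<mu> (inv_into K c y)" for y
  have hf: "holo (Suc m) (c ` K) f" unfolding f_def
    by (rule holo_in_coords[OF atlas hcK oK subset_refl fiber_coordD(2)[OF \<mu>K]])
  have tay: "(deriv ^^ k) (\<rho> p) 0 = (pd 0 ^^ k) f (c p)" if p: "p \<in> K" and k: "k \<ge> 1" for p k
  proof -
    have "\<rho> p = (\<lambda>z. \<mu> (fiber_curve X K \<eta> p z) - \<mu> p)"
      unfolding \<rho>_def by (rule ext) (rule coord_change_fiber_curve)
    then have "(deriv ^^ k) (\<rho> p) 0 = (deriv ^^ k) (\<lambda>z. \<mu> (fiber_curve X K \<eta> p z)) 0"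
      by (simp only: higher_deriv_diff_const[OF k])
    also have "\<dots> = (pd 0 ^^ k) f (c p)"
      unfolding f_def by (rule fiber_curve_taylor[OF X \<eta>K \<tau> p _ KB c]) (use p KW in blast)
    finally show ?thesis .
  qed
  have \<rho>0: "\<rho> p 0 = 0" and \<rho>1: "deriv (\<rho> p) 0 \<noteq> 0" if "p \<in> K" for p
    unfolding \<rho>_def using coord_change_holo(2,3)[OF X \<eta>K \<mu>K that] by simp_all
  have ck: "holo_fun (tot X) K (\<lambda>p. (deriv ^^ k) (\<rho> p) 0)" for k
  proof (cases "k \<ge> 1")
    case True
    have "holo_fun (tot X) K (\<lambda>p. (pd 0 ^^ k) f (c p))"
      by (rule holo_fun_compose_Cn[where F = c, OF atlas oK _ _ oK' holo_pd_funpow[OF oK' hf]])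
         (use holo_fun_coordinate[OF atlas hcK] in auto)
    then show ?thesis by (rule holo_fun_cong[OF atlas _ _ oK, rotated]) (rule tay[OF _ True, symmetric])
  next
    case False
    show ?thesis by (rule holo_fun_cong[OF atlas _ holo_fun_const[OF atlas, of _ 0] oK]) (use False \<rho>0 in \<open>simp add: not_le\<close>)
  qed
  have fa: "function_algebra K {f. holo_fun (tot X) K f}" by (rule holo_fun_algebra[OF atlas oK])
  have d1: "(\<lambda>p. deriv (\<rho> p) 0) \<in> {f. holo_fun (tot X) K f}" using ck[of 1] by simp
  have gc: "(\<lambda>p. germ_coeffs (\<rho> p) k) \<in> {f. holo_fun (tot X) K f}" if "k \<ge> 1" for k
  proof (rule fa_germ_coeffs[OF fa \<rho>0 \<rho>1 _ that])
    show "(\<lambda>p. (deriv ^^ i) (\<rho> p) 0 / deriv (\<rho> p) 0) \<in> {f. holo_fun (tot X) K f}" for i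
      using holo_fun_divide[OF atlas oK ck d1[unfolded mem_Collect_eq] \<rho>1] by simp
  qed
  have w0K: "(\<lambda>p. \<alpha> (w0 p)) \<in> {f. holo_fun (tot X) K f}" if "dual V \<alpha>" for \<alpha>
    using holo_fun_subset[OF atlas w0_holo[OF that] KW open_W oK] by simp
  have val: "lie_section p (N, \<mu>) = coord_op V (\<rho> p) (w0 p)" if "p \<in> K" for p
    using that \<mu> by (simp add: lie_section_def loc_coords_def \<rho>_def K_def)
  have "(\<lambda>p. lie_section p (N, \<mu>)) \<in> gr_le_O V (tot X) n K"
    unfolding gr_le_O_iff[OF atlas oK]
  proof (intro conjI ballI allI impI)
    show "lie_section p (N, \<mu>) \<in> gr_le V n" if "p \<in> K" for p
      unfolding val[OF that] by (rule coord_op_mem[OF w0_mem]) (use that KW in blast)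
    fix \<alpha> assume \<alpha>: "dual V \<alpha>"
    have "(\<lambda>p. \<alpha> (coord_op V (\<rho> p) (w0 p))) \<in> {f. holo_fun (tot X) K f}"
      by (rule weak_coord_op[where F = w0, OF fa d1 gc w0_mem w0K \<alpha>]) (use KW in auto)
    then have "holo_fun (tot X) K (\<lambda>p. \<alpha> (coord_op V (\<rho> p) (w0 p)))" by simp
    then show "holo_fun (tot X) K (\<lambda>p. \<alpha> (lie_section p (N, \<mu>)))"
      by (rule holo_fun_cong[OF atlas _ _ oK, rotated]) (simp add: val)
  qed
  then show ?thesis by (simp add: K_def Int_commute)
qed

theorem lie_derivative_formula: "\<exists>w. has_lie_derivative V X n W x v w \<and> equals_in_coord w W \<eta> w0"
proof (intro exI conjI)
  show "equals_in_coord lie_section W \<eta> w0" by (simp add: equals_in_coord_def lie_section_eta)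
  show "has_lie_derivative V X n W x v lie_section"
    unfolding has_lie_derivative_def
  proof (intro conjI allI impI ballI)
    show "lie_section \<in> voa_sections V X n W"
      unfolding voa_sections_def using lie_section_fiber_W lie_section_holo by simp
    fix U assume U: "open U \<and> compact (closure U) \<and> closure U \<subseteq> W"
    then show "\<exists>T \<phi>. local_flow X W x U T \<phi>" using flow_exists by simp
    fix T \<phi> p l assume flow: "local_flow X W x U T \<phi>" and p: "p \<in> U" and l: "l \<in> loc_coords X p"
    have UW: "U \<subseteq> W" using U closure_subset by blast
    show "vtendsto V (\<lambda>\<zeta>. scl V (1 / \<zeta>) (transport_inv V X n U (\<phi> \<zeta>) v p l - v p l)) (lie_section p l) (at 0)"
      using quot_limit[OF flow conjunct1[OF U] UW p l] unfolding quot_def[OF flow conjunct1[OF U] UW p] .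
  qed
qed

end

end

theorem theorem2p6p2:
  fixes V :: "'v::ab_group_add voa_data"
    and X :: "('c::{t2_space,second_countable_topology},
               'b::{t2_space,second_countable_topology}) family_data"
    and W :: "'c set" and \<eta> :: "'c \<Rightarrow> complex"
    and m n :: nat and \<tau> :: "'b \<Rightarrow> cvec"
    and h :: "cvec \<Rightarrow> complex" and g :: "nat \<Rightarrow> cvec \<Rightarrow> complex"
    and u :: "'c \<Rightarrow> 'v" and v :: "'c \<Rightarrow> 'c loc \<Rightarrow> 'v"
  defines "\<eta>\<tau> \<equiv> \<lambda>p. case_nat (\<eta> p) (\<tau> (proj X p))"
  defines "x \<equiv> \<lambda>f p. h (\<eta>\<tau> p) * coord_deriv W \<eta>\<tau> 0 f p
      + (\<Sum>j<m. g j (\<tau> (proj X p)) * coord_deriv W \<eta>\<tau> (Suc j) f p)"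
  assumes "voa V" and "RS_family X" and "open W"
    and "fiber_coord X W \<eta>"
    and "holo_coords (base X) (proj X ` W) m \<tau>"
    and "holo (Suc m) (\<eta>\<tau> ` W) h"
    and "\<And>j. j < m \<Longrightarrow> holo m (\<tau> ` proj X ` W) (g j)"
    and "v \<in> voa_sections V X n W"
    and "u \<in> gr_le_O V (tot X) n W"
    and "equals_in_coord v W \<eta> u"
  shows "\<exists>w. has_lie_derivative V X n W x v w \<and>
    equals_in_coord w W \<eta> (\<lambda>p.
      scl V (h (\<eta>\<tau> p)) (coord_vderiv V W \<eta>\<tau> 0 u p)
      + (\<Sum>j<m. scl V (g j (\<tau> (proj X p))) (coord_vderiv V W \<eta>\<tau> (Suc j) u p))
      - Sum_any (\<lambda>k. if k \<ge> 1
          then scl V (1 / fact k * (pd 0 ^^ k) h (\<eta>\<tau> p)) (vir V (int k - 1) (u p))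
          else 0))"
proof -
  have c: "\<eta>\<tau> = (\<lambda>p. case_nat (\<eta> p) (\<tau> (proj X p)))" by (rule \<eta>\<tau>_def[THEN meta_eq_to_obj_eq])
  have x: "x = (\<lambda>f p. h (\<eta>\<tau> p) * coord_deriv W \<eta>\<tau> 0 f p
      + (\<Sum>j<m. g j (\<tau> (proj X p)) * coord_deriv W \<eta>\<tau> (Suc j) f p))" by (rule x_def[THEN meta_eq_to_obj_eq])
  show ?thesis
    by (rule voa.lie_derivative_formula[OF assms(3,4,6,7) c assms(8,9) x assms(10-12) refl])
qed

end
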